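(* Let $d\ge 1$ be an integer and let $A : \mathbb{R} \to \mathrm{Herm}(d)$ be a curve of $d \times d$ Hermitian matrices of class $DC \cap W^{2,1}_{\mathrm{loc}}$ on $\mathbb{R}$. \begin{enumerate} \item[(1)] Any differentiable system $\lambda=(\lambda_1,\ldots,\lambda_d)$ of the eigenvalues of $A$ is actually of class \[ \lambda \in C^1(\mathbb{R},\mathbb{R}^d) \cap DC(\mathbb{R},\mathbb{R}^d)\cap W^{2,1}_{\mathrm{loc}}(\mathbb{R},\mathbb{R}^d). \] \item[(2)] If $A$ additionally is of class $C^1$, then there exists a differentiable (thus $C^1$) system $\lambda=(\lambda_1,\ldots,\lambda_d)$ of the eigenvalues of $A$. \item[(3)] The result is uniform in the following sense. Let $I \subseteq \mathbb{R}$ be a bounded open interval, let $k\ge 1$ be an integer, and let $U$ be an open neighborhood of the closure of $I^{1+k}$ in $\mathbb{R}^{1+k}$. Suppose that $A : U \to \mathrm{Herm}(d)$ (now a map on $U$, replacing the curve above) is such that \begin{itemize} \item $A$ is locally $DC$ on $U$, \item $A( \cdot,r)$ is of class $C^1 \cap W^{2,1}$ on $\overline I$ for all $r \in \overline I^k$. \end{itemize} Assume that, for each $r \in \overline I^k$, a $C^1$-system $\lambda(\cdot,r)$ of the eigenvalues of $A(\cdot,r)$ is fixed. Then the family $\lambda(\cdot,r)$, $r \in \overline I^k$, is bounded in $C^1(\overline I, \mathbb{R}^d)$, and there is a non-negative $L^1$-function $m : I^k \to \mathbb{R}_{\ge 0}$ such that \[ \|\lambda(\cdot, r)\|_{W^{2,1}(I,\mathbb{R}^d)}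 \le m(r) \quad \text{for a.e. } r \in I^k. \] \end{enumerate}
   Context: $\mathrm{Herm}(d)$ is the real vector space of complex $d\times d$ Hermitian matrices. Given a curve $A:J\to\mathrm{Herm}(d)$ on an interval $J\subseteq\mathbb{R}$ (e.g. $J=\mathbb{R}$ or $J=\overline I$), a system of the eigenvalues of $A$ is a mapping $\lambda=(\lambda_1,\ldots,\lambda_d):J\to\mathbb{R}^d$ such that for every $t\in J$ the unordered $d$-tuple $\lambda_1(t),\ldots,\lambda_d(t)$ consists of the eigenvalues of $A(t)$ counted with multiplicity. It is a differentiable (resp. $C^1$-) system if $\lambda$ is differentiable (resp. $C^1$). A real function on a convex set is difference-convex ($DC$) if it is the difference of two continuous convex functions on that set; a function is locally $DC$ if every point of its domain has a convex neighborhood on which it is $DC$. A map into a finite-dimensional real vector space is (locally) $DC$ if each of its components (real coordinates) is. $DC(\mathbb{R},\mathbb{R}^d)$ is the set of $DC$ maps $\mathbb{R}\to\mathbb{R}^d$. $W^{2,1}$ denotes the Sobolev space of integrable functions with integrable weak derivatives up to order $2$, and $W^{2,1}_{\mathrm{loc}}$ its local version. *)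

theory Defs
  imports "HOL-Analysis.Analysis" "HOL-Computational_Algebra.Polynomial"
begin

section \<open>Hermitian matrices and systems of eigenvalues\<close>

definition Herm :: "(complex ^ 'n ^ 'n) set" where
  "Herm = {M. \<forall>i j. M $ i $ j = cnj (M $ j $ i)}"

definition charpoly :: "complex ^ 'n ^ 'n \<Rightarrow> complex poly" where
  "charpoly M = det (mat [:0, 1:] - (\<chi> i j. [:M $ i $ j:]))"

text \<open>Unordered tuples are multisets; the eigenvalues counted with multiplicity are the roots
  of the characteristic polynomial. Only the values on \<open>J\<close> matter.\<close>

definition eigenvalue_system_on ::
    "real set \<Rightarrow> (real \<Rightarrow> complex ^ 'n ^ 'n) \<Rightarrow> (real \<Rightarrow> real ^ 'n) \<Rightarrow> bool" where
  "eigenvalue_system_on J A lam \<longleftrightarrow>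
     (\<forall>t\<in>J. image_mset (\<lambda>i. complex_of_real (lam t $ i)) (mset_set UNIV) = proots (charpoly (A t)))"


section \<open>Difference-convex maps\<close>

text \<open>In the library, \<^term>\<open>convex_on S g\<close> includes the convexity of the set \<open>S\<close>.\<close>

definition dc_fun_on :: "'a::real_normed_vector set \<Rightarrow> ('a \<Rightarrow> real) \<Rightarrow> bool" where
  "dc_fun_on S f \<longleftrightarrow>
     (\<exists>g h. continuous_on S g \<and> convex_on S g \<and> continuous_on S h \<and> convex_on S h \<and>
            (\<forall>x\<in>S. f x = g x - h x))"

definition locally_dc_fun_on :: "'a::real_normed_vector set \<Rightarrow> ('a \<Rightarrow> real) \<Rightarrow> bool" where
  "locally_dc_fun_on S f \<longleftrightarrow>
     (\<forall>x\<in>S. \<exists>V T. V \<subseteq> S \<and> convex V \<and> open T \<and> x \<in> T \<and> T \<inter> S \<subseteq> V \<and> dc_fun_on V f)"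

text \<open>For complex matrices the real coordinates with respect to \<^const>\<open>Basis\<close> are the real and
  imaginary parts of the entries.\<close>

definition DC_on :: "'a::real_normed_vector set \<Rightarrow> ('a \<Rightarrow> 'b::euclidean_space) \<Rightarrow> bool" where
  "DC_on S f \<longleftrightarrow> (\<forall>b\<in>Basis. dc_fun_on S (\<lambda>x. f x \<bullet> b))"

definition locally_DC_on :: "'a::real_normed_vector set \<Rightarrow> ('a \<Rightarrow> 'b::euclidean_space) \<Rightarrow> bool" where
  "locally_DC_on S f \<longleftrightarrow> (\<forall>b\<in>Basis. locally_dc_fun_on S (\<lambda>x. f x \<bullet> b))"


section \<open>Continuously differentiable curves\<close>

text \<open>The derivative is taken within \<open>J\<close>, so that it is one-sided at the endpoints of a closed
  interval (unlike in \<^const>\<open>C1_differentiable_on\<close>).\<close>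

definition C1_on :: "real set \<Rightarrow> (real \<Rightarrow> 'b::real_normed_vector) \<Rightarrow> bool" where
  "C1_on J f \<longleftrightarrow>
     (\<exists>f'. (\<forall>t\<in>J. (f has_vector_derivative f' t) (at t within J)) \<and> continuous_on J f')"

definition bounded_in_C1 :: "real set \<Rightarrow> (real \<Rightarrow> 'b::real_normed_vector) set \<Rightarrow> bool" where
  "bounded_in_C1 J F \<longleftrightarrow>
     (\<forall>f\<in>F. C1_on J f) \<and>
     (\<exists>C. \<forall>f\<in>F. \<forall>t\<in>J. norm (f t) \<le> C \<and> norm (vector_derivative f (at t within J)) \<le> C)"


section \<open>Sobolev spaces on open subsets of the real line\<close>

definition test_function :: "real set \<Rightarrow> (real \<Rightarrow> real) \<Rightarrow> bool" where
  "test_function V \<phi> \<longleftrightarrow>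
     (\<forall>n. (deriv ^^ n) \<phi> differentiable_on UNIV) \<and>
     compact (closure {x. \<phi> x \<noteq> 0}) \<and> closure {x. \<phi> x \<noteq> 0} \<subseteq> V"

definition locally_integrable_on :: "real set \<Rightarrow> (real \<Rightarrow> 'b::euclidean_space) \<Rightarrow> bool" where
  "locally_integrable_on V f \<longleftrightarrow> (\<forall>K. compact K \<and> K \<subseteq> V \<longrightarrow> f absolutely_integrable_on K)"

definition has_weak_derivative ::
    "nat \<Rightarrow> real set \<Rightarrow> (real \<Rightarrow> 'b::euclidean_space) \<Rightarrow> (real \<Rightarrow> 'b) \<Rightarrow> bool" where
  "has_weak_derivative j V f g \<longleftrightarrow>
     locally_integrable_on V f \<and> locally_integrable_on V g \<and>
     (\<forall>\<phi>. test_function V \<phi> \<longrightarrow>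
        (LINT x:V|lebesgue. (deriv ^^ j) \<phi> x *\<^sub>R f x) =
        (- 1) ^ j *\<^sub>R (LINT x:V|lebesgue. \<phi> x *\<^sub>R g x))"

definition W21 :: "real set \<Rightarrow> (real \<Rightarrow> 'b::euclidean_space) \<Rightarrow> bool" where
  "W21 V f \<longleftrightarrow>
     f absolutely_integrable_on V \<and>
     (\<forall>j\<in>{1, 2}. \<exists>g. g absolutely_integrable_on V \<and> has_weak_derivative j V f g)"

definition W21_loc :: "real set \<Rightarrow> (real \<Rightarrow> 'b::euclidean_space) \<Rightarrow> bool" where
  "W21_loc V f \<longleftrightarrow> (\<forall>V'. open V' \<and> compact (closure V') \<and> closure V' \<subseteq> V \<longrightarrow> W21 V' f)"

text \<open>Weak derivatives are unique up to null sets, so the following norm does not depend on the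
  choice. It is meaningful only for functions satisfying \<^term>\<open>W21 V\<close>.\<close>

definition weak_derivative ::
    "nat \<Rightarrow> real set \<Rightarrow> (real \<Rightarrow> 'b::euclidean_space) \<Rightarrow> real \<Rightarrow> 'b" where
  "weak_derivative j V f = (SOME g. has_weak_derivative j V f g)"

definition W21_norm :: "real set \<Rightarrow> (real \<Rightarrow> 'b::euclidean_space) \<Rightarrow> real" where
  "W21_norm V f =
     (LINT x:V|lebesgue. norm (f x)) +
     (LINT x:V|lebesgue. norm (weak_derivative 1 V f x)) +
     (LINT x:V|lebesgue. norm (weak_derivative 2 V f x))"


section \<open>Cubes\<close>

definition cube :: "real set \<Rightarrow> (real ^ 'k) set" where
  "cube J = {r. \<forall>i. r $ i \<in> J}"

end

theory Submission
  imports Defs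
begin

text \<open>On a compact interval let \<open>A'\<close> be absolutely continuous with density \<open>B\<close>, and let \<open>P\<^sub>k(t)\<close> be a
  projection of rank \<open>k\<close> maximizing \<open>A(t) \<bullet> P\<close> (Ky Fan). The function \<open>G\<^sub>k = A' \<bullet> P\<^sub>k + n \<integral>|B|\<close> is monotone, being
  a subgradient of a convex function, and it is locally absolutely continuous where the \<open>k\<close>-th and the
  \<open>k+1\<close>-st largest eigenvalues are separated by a gap, because \<open>P\<^sub>k\<close> is Lipschitz there. Two eigenvalues
  that meet with different derivatives do so at countably many times only. At all other times
  \<open>\<lambda>\<^sub>j'\<close> is by Hellmann--Feynman the mean of the derivatives of its cluster of equal eigenvalues, that is
  \<open>(G\<^sub>k\<^sub>' - G\<^sub>k) / (k' - k)\<close> with gaps at both \<open>k\<close> and \<open>k'\<close>. Since \<open>\<lambda>\<^sub>j'\<close> is a derivative, it has the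
  Darboux property, so its increment over an interval is at most the outer measure of the image of this interval,
  and this is bounded by the absolutely continuous parts of the Stieltjes measures of the \<open>G\<^sub>k\<close>. Hence
  \<open>\<lambda>\<^sub>j'\<close> has a density whose \<open>L\<^sup>1\<close> norm is bounded in terms of \<open>sup |A'| + \<integral>|B|\<close> only.

  In the uniform version this quantity is bounded by the suprema of the convex functions of which \<open>A\<close> is
  locally the difference, so that \<open>m\<close> can be taken constant. A differentiable system exists because the
  eigenvalues have, near each single point, an arrangement differentiable at this point (first order perturbation theory);
  these are glued by induction on the number of eigenvalues, which splits near every point where they do not
  all coincide.\<close>

section \<open>Spectral resolutions of Hermitian matrices\<close>

text \<open>A single ordered eigenvalue is in general neither convex nor concave in the matrix; only
  the sums of the \<open>k\<close> largest ones are convex, which is why the maximizers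
  \<open>P k\<close> and the functions \<open>G k\<close> carry the proof. Two kinds of information
  about \<open>G k\<close> are kept apart. The Lipschitz constant of \<open>P k\<close> is of the
  order of 1 over the gap and cannot give a uniform bound; it serves only to show that the Stieltjes
  measure of \<open>G k\<close>, restricted to the open set of times with a gap at \<open>k\<close>,
  vanishes on Lebesgue null sets. The size of this measure is bounded by the total increment of
  \<open>G k\<close>, in which no gap occurs. Where the gap closes the measure may have a singular
  part, which the restriction cuts off; nothing is lost, because the ranks at which a cluster of
  equal eigenvalues begins and ends always have gaps. The factor
  \<open>CARD('n set \<times> 'n set)\<close> counts the pairs of index sets that may lie strictly
  above and weakly above a given eigenvalue. Continuity of the derivatives is part of the
  conclusion, so the estimate of their increments has to rest on the Darboux property and on the
  measure of images.\<close>

definition adj :: "complex ^ 'n ^ 'n \<Rightarrow> complex ^ 'n ^ 'n" where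
  "adj M = (\<chi> i j. cnj (M $ j $ i))"

lemma adj_nth [simp]: "adj M $ i $ j = cnj (M $ j $ i)"
  by (simp add: adj_def)

lemma Herm_iff_adj: "M \<in> Herm \<longleftrightarrow> adj M = M"
  unfolding Herm_def vec_eq_iff mem_Collect_eq adj_nth by (metis (no_types))

lemma adj_mult: "adj (M ** N) = adj N ** adj M"
  by (simp add: vec_eq_iff matrix_matrix_mult_def mult.commute)

lemma adj_mat_1 [simp]: "adj (mat 1) = mat 1"
  by (simp add: vec_eq_iff mat_def)

lemma adj_add: "adj (M + N) = adj M + adj N"
  and adj_diff: "adj (M - N) = adj M - adj N"
  and adj_0 [simp]: "adj 0 = 0"
  by (simp_all add: vec_eq_iff)

lemma adj_sum: "adj (\<Sum>i\<in>I. f i) = (\<Sum>i\<in>I. adj (f i))"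
  by (induction I rule: infinite_finite_induct) (auto simp: adj_add)

lemma mult_scaleR_left: "(c *\<^sub>R M) ** N = c *\<^sub>R (M ** N)"
  and mult_scaleR_right: "M ** (c *\<^sub>R N) = c *\<^sub>R (M ** N)"
  for M N :: "complex ^ 'n ^ 'n"
  by (simp_all add: vec_eq_iff matrix_matrix_mult_def scaleR_right.sum)

lemma mult_add_left: "(M + M') ** N = M ** N + M' ** N"
  for M M' N :: "complex ^ 'n ^ 'n"
  by (simp add: vec_eq_iff matrix_matrix_mult_def sum.distrib algebra_simps)

lemma mult_sum_left: "(\<Sum>i\<in>I. f i) ** N = (\<Sum>i\<in>I. f i ** N)"
  and mult_sum_right: "N ** (\<Sum>i\<in>I. f i) = (\<Sum>i\<in>I. N ** f i)"
  for N :: "complex ^ 'n ^ 'n"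
  by (induction I rule: infinite_finite_induct)
     (auto simp: matrix_add_ldistrib mult_add_left)

lemma mult_diff_left: "(M - M') ** N = M ** N - M' ** N"
  and mult_diff_right: "N ** (M - M') = N ** M - N ** M'"
  for M M' N :: "complex ^ 'n ^ 'n"
  by (simp_all add: vec_eq_iff matrix_matrix_mult_def sum_subtractf algebra_simps)

lemma trace_sum: "trace (\<Sum>i\<in>I. f i) = (\<Sum>i\<in>I. trace (f i))"
  for f :: "'a \<Rightarrow> complex ^ 'n ^ 'n"
  proof (induction I rule: infinite_finite_induct)
  case (insert x F)
  then show ?case by (simp add: trace_add)
qed (simp_all add: trace_def)

lemma trace_scaleR: "trace (c *\<^sub>R M) = c *\<^sub>R trace M" for M :: "complex ^ 'n ^ 'n"
  by (simp add: trace_def scaleR_right.sum)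

lemma inner_eq_Re_trace: "M \<bullet> N = Re (trace (M ** adj N))"
  by (simp add: inner_vec_def trace_def matrix_matrix_mult_def inner_complex_def)

text \<open>The eigenprojections of an orthonormal basis, with trace 1 encoding rank one. Unlike
  eigenvectors they carry no phases, and the conditions are equations between continuous functions
  of matrices of norm 1, so they pass to limits of subsequences.\<close>

definition resolution :: "('n \<Rightarrow> complex ^ 'n ^ 'n) \<Rightarrow> bool" where
  "resolution E \<longleftrightarrow>
     (\<forall>i. adj (E i) = E i) \<and> (\<forall>i j. E i ** E j = (if i = j then E i else 0)) \<and>
     (\<Sum>i\<in>UNIV. E i) = mat 1 \<and> (\<forall>i. trace (E i) = 1)"

definition diagonalizes ::
  "('n \<Rightarrow> complex ^ 'n ^ 'n) \<Rightarrow> real ^ 'n \<Rightarrow> complex ^ 'n ^ 'n \<Rightarrow> bool" where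
  "diagonalizes E l M \<longleftrightarrow> resolution E \<and> M = (\<Sum>i\<in>UNIV. l $ i *\<^sub>R E i)"

section \<open>Spectral theorem for Hermitian matrices\<close>

definition cip :: "complex ^ 'n \<Rightarrow> complex ^ 'n \<Rightarrow> complex" where
  "cip x y = (\<Sum>i\<in>UNIV. cnj (x $ i) * y $ i)"

text \<open>Complex orthogonality to \<open>x\<close> is real orthogonality to the two vectors
  \<open>x\<close> and \<open>\<i> *s x\<close>, so that real subspaces and real dimension counts
  suffice for the complex spectral theorem.\<close>

lemma cip_eq: "cip x y = Complex (x \<bullet> y) ((\<i> *s x) \<bullet> y)"
  by (simp add: cip_def inner_vec_def inner_complex_def complex_eq_iff algebra_simps sum_subtractf)

lemma cip_self: "cip x x = complex_of_real (x \<bullet> x)"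
  by (simp add: cip_eq complex_eq_iff) (simp add: inner_vec_def inner_complex_def)

lemma cip_self_adjoint:
  assumes "adj M = M"
  shows "cip x (M *v y) = cip (M *v x) y"
proof -
  have c: "cnj (M $ i $ j) = M $ j $ i" for i j
    using assms by (metis adj_nth)
  have "cip x (M *v y) = (\<Sum>i\<in>UNIV. \<Sum>j\<in>UNIV. cnj (x $ i) * (M $ i $ j * y $ j))"
    by (simp add: cip_def matrix_vector_mult_def sum_distrib_left)
  also have "\<dots> = (\<Sum>j\<in>UNIV. \<Sum>i\<in>UNIV. cnj (x $ i) * (M $ i $ j * y $ j))"
    by (rule sum.swap)
  also have "\<dots> = cip (M *v x) y"
    by (simp add: cip_def matrix_vector_mult_def sum_distrib_left sum_distrib_right c mult_ac)
  finally show ?thesis .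
qed

lemma cip_scaleR_left: "cip (c *\<^sub>R x) y = c *\<^sub>R cip x y"
  by (simp add: cip_def scaleR_right.sum)

lemma cip_commute: "cip x y = cnj (cip y x)"
  by (simp add: cip_def mult.commute)

text \<open>A maximizer \<open>x\<close> of the quadratic form on the unit sphere of
  \<open>W\<close> is an eigenvector: the residual \<open>y = M *v x - m *\<^sub>R x\<close> lies in
  \<open>W\<close> by invariance, so it is an admissible direction, and the first variation in this
  direction is \<open>2 * (y \<bullet> y)\<close>.\<close>

lemma rayleigh_maximizer_eigenvector:
  fixes M :: "complex ^ 'n ^ 'n" and W :: "(complex ^ 'n) set"
  assumes M: "adj M = M" and W: "subspace W" and inv: "\<And>x. x \<in> W \<Longrightarrow> M *v x \<in> W"
    and z: "z \<in> W" "z \<noteq> 0"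
  shows "\<exists>x\<in>W. \<exists>m::real. norm x = 1 \<and> M *v x = m *\<^sub>R x"
proof -
  have lin: "linear ((*v) M)"
    unfolding matrix_vector_mult_def
    by (intro linearI) (simp_all add: vec_eq_iff sum.distrib algebra_simps scaleR_right.sum)
  have sym: "x \<bullet> (M *v y) = (M *v x) \<bullet> y" for x y
    using arg_cong[OF cip_self_adjoint[OF M, of x y], of Re] by (simp add: cip_eq)
  let ?S = "sphere 0 1 \<inter> W"
  have "compact ?S"
    by (intro compact_Int_closed compact_sphere closed_subspace W)
  moreover have "(1 / norm z) *\<^sub>R z \<in> ?S"
    using z W by (auto intro: subspace_scale)
  moreover have "continuous_on ?S (\<lambda>x. x \<bullet> (M *v x))"
    using lin by (intro continuous_intros linear_continuous_on linear_conv_bounded_linear[THEN iffD1])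
  ultimately obtain x where x: "x \<in> ?S" and max: "\<And>y. y \<in> ?S \<Longrightarrow> y \<bullet> (M *v y) \<le> x \<bullet> (M *v x)"
    using continuous_attains_sup[of ?S "\<lambda>x. x \<bullet> (M *v x)"] by blast
  define m where "m = x \<bullet> (M *v x)"
  have nx: "x \<bullet> x = 1" "x \<in> W" "norm x = 1"
    using x by (auto simp: norm_eq_1)
  have le: "y \<bullet> (M *v y) \<le> m * (y \<bullet> y)" if "y \<in> W" for y
  proof (cases "y = 0")
    case False
    have "(1 / norm y) *\<^sub>R y \<in> ?S"
      using False that W by (auto intro: subspace_scale)
    from max[OF this] have "(1 / norm y)\<^sup>2 * (y \<bullet> (M *v y)) \<le> m"
      by (simp add: m_def linear_scale[OF lin] power2_eq_square)
    then show ?thesis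
      using False by (simp add: divide_simps power2_norm_eq_inner mult.commute split: if_splits)
  qed simp
  define y where "y = M *v x - m *\<^sub>R x"
  have yW: "y \<in> W"
    unfolding y_def using nx W inv by (intro subspace_diff subspace_scale) auto
  \<comment> \<open>The inequality \<open>le\<close> at \<open>x + s *\<^sub>R y\<close>, expanded
    in powers of \<open>s\<close>.\<close>
  have key: "2 * s * (y \<bullet> y) + s\<^sup>2 * (y \<bullet> (M *v y) - m * (y \<bullet> y)) \<le> 0" for s
  proof -
    have "x + s *\<^sub>R y \<in> W"
      using yW nx W by (intro subspace_add subspace_scale)
    from le[OF this]
    have "(x + s *\<^sub>R y) \<bullet> (M *v x + s *\<^sub>R (M *v y)) \<le> m * ((x + s *\<^sub>R y) \<bullet> (x + s *\<^sub>R y))"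
      by (simp add: linear_add[OF lin] linear_scale[OF lin])
    moreover have "(x + s *\<^sub>R y) \<bullet> (M *v x + s *\<^sub>R (M *v y)) =
        m + 2 * s * (y \<bullet> (M *v x)) + s\<^sup>2 * (y \<bullet> (M *v y))"
      using sym[of x y] by (simp add: inner_add m_def power2_eq_square inner_commute algebra_simps)
    moreover have "(x + s *\<^sub>R y) \<bullet> (x + s *\<^sub>R y) = 1 + 2 * s * (y \<bullet> x) + s\<^sup>2 * (y \<bullet> y)"
      by (simp add: inner_add nx power2_eq_square inner_commute algebra_simps)
    moreover have "y \<bullet> y = y \<bullet> (M *v x) - m * (y \<bullet> x)"
      by (subst (2) y_def) (simp add: inner_diff)
    ultimately have le1: "m + 2 * s * (y \<bullet> (M *v x)) + s\<^sup>2 * (y \<bullet> (M *v y)) \<le>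
        m * (1 + 2 * s * (y \<bullet> x) + s\<^sup>2 * (y \<bullet> y))"
      and e: "y \<bullet> y = y \<bullet> (M *v x) - m * (y \<bullet> x)"
      by simp_all
    have "2 * s * (y \<bullet> y) = 2 * s * (y \<bullet> (M *v x)) - 2 * s * m * (y \<bullet> x)"
      unfolding e by (simp add: algebra_simps)
    with le1 show ?thesis
      by (simp add: algebra_simps)
  qed
  have "y \<bullet> y = 0"
  proof (rule ccontr)
    assume "y \<bullet> y \<noteq> 0"
    then have p: "y \<bullet> y > 0"
      by (simp add: less_le)
    \<comment> \<open>\<open>- c\<close> bounds the second order coefficient from below; with
      \<open>s = (y \<bullet> y) / c\<close> the left side of \<open>key\<close> is at least
      \<open>s * (y \<bullet> y)\<close>, which is positive.\<close>
    define c where "c = \<bar>y \<bullet> (M *v y) - m * (y \<bullet> y)\<bar> + 1"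
    have c: "c > 0" "- c \<le> y \<bullet> (M *v y) - m * (y \<bullet> y)"
      unfolding c_def by auto
    define s where "s = (y \<bullet> y) / c"
    have s: "s > 0" "s * c = y \<bullet> y" using p c by (auto simp: s_def)
    have "0 < 2 * s * (y \<bullet> y) - s * (s * c)"
      using s p by simp
    also have "\<dots> \<le> 2 * s * (y \<bullet> y) + s\<^sup>2 * (y \<bullet> (M *v y) - m * (y \<bullet> y))"
      using mult_left_mono[OF c(2), of "s\<^sup>2"] by (simp add: power2_eq_square algebra_simps)
    finally show False using key[of s] by simp
  qed
  then show ?thesis
    using nx unfolding y_def by auto
qed

text \<open>Induction on the index set: the orthogonal complement \<open>W\<close> of the vectors
  found so far is invariant because \<open>M\<close> is self-adjoint, and it contains a nonzero
  vector as long as fewer than \<open>CARD('n)\<close> vectors have been found.\<close>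

lemma orthonormal_eigenvectors_exist:
  fixes M :: "complex ^ 'n ^ 'n" and I :: "'n set"
  assumes M: "adj M = M"
  shows "\<exists>(v :: 'n \<Rightarrow> complex ^ 'n) d. (\<forall>i\<in>I. M *v v i = (d i :: real) *\<^sub>R v i) \<and>
           (\<forall>i\<in>I. \<forall>j\<in>I. cip (v i) (v j) = (if i = j then 1 else 0))"
proof -
  have "finite I" by simp
  then show ?thesis
  proof (induction I rule: finite_induct)
    case (insert i I)
    then obtain v :: "'n \<Rightarrow> complex ^ 'n" and d
      where v: "\<forall>i\<in>I. M *v v i = (d i :: real) *\<^sub>R v i"
        "\<forall>i\<in>I. \<forall>j\<in>I. cip (v i) (v j) = (if i = j then 1 else 0)"
      by blast
    define W where "W = {x. \<forall>j\<in>I. cip (v j) x = 0}"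
    have W: "subspace W"
      by (auto simp: subspace_def W_def cip_eq inner_add complex_eq_iff)
    have inv: "M *v x \<in> W" if "x \<in> W" for x
      using that v(1) by (auto simp: W_def cip_self_adjoint[OF M] cip_scaleR_left)
    \<comment> \<open>Real dimensions: the vectors and their multiples by \<open>\<i>\<close> span
      at most \<open>2 * card I\<close> of the \<open>2 * CARD('n)\<close> dimensions.\<close>
    let ?B = "v ` I \<union> (\<lambda>j. \<i> *s v j) ` I"
    have "dim ?B \<le> card ?B"
      by (rule dim_le_card) (auto simp: span_superset)
    also have "\<dots> \<le> card I + card I"
      by (intro order_trans[OF card_Un_le] add_mono card_image_le) auto
    also have "\<dots> < 2 * CARD('n)"
    proof -
      have "card I < card (insert i I)" using insert by simp
      also have "\<dots> \<le> CARD('n)" by (intro card_mono) auto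
      finally show ?thesis by simp
    qed
    finally have "dim ?B < DIM(complex ^ 'n)" by simp
    from orthogonal_to_subspace_exists[OF this] obtain z
      where z: "z \<noteq> 0" "\<And>y. y \<in> span ?B \<Longrightarrow> orthogonal z y" by blast
    have "z \<in> W"
      unfolding W_def
    proof (safe)
      fix j assume "j \<in> I"
      then have "orthogonal z (v j)" "orthogonal z (\<i> *s v j)"
        by (auto intro!: z(2) span_base)
      then show "cip (v j) z = 0"
        by (simp add: cip_eq orthogonal_def complex_eq_iff inner_commute)
    qed
    from rayleigh_maximizer_eigenvector[OF M W inv this z(1)] obtain x m
      where x: "x \<in> W" "norm x = 1" "M *v x = (m::real) *\<^sub>R x" by blast
    have xx: "cip x x = 1" "\<And>j. j \<in> I \<Longrightarrow> cip (v j) x = 0" "\<And>j. j \<in> I \<Longrightarrow> cip x (v j) = 0"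
      using x by (auto simp: cip_self norm_eq_1 W_def cip_commute[of x])
    show ?case
      by (rule exI[of _ "v(i := x)"], rule exI[of _ "d(i := m)"])
         (use v x xx insert in \<open>auto simp: fun_upd_def\<close>)
  qed auto
qed

lemma mat_mult_commute: "mat k ** A = A ** mat k" for A :: "'a::comm_ring_1 ^ 'n ^ 'n"
proof -
  have "(mat k ** A) $ i $ j = k * A $ i $ j" "(A ** mat k) $ i $ j = A $ i $ j * k" for i j
    by (simp_all add: matrix_matrix_mult_def mat_def if_distrib[of "\<lambda>q. q * _"]
          if_distrib[of "\<lambda>q. _ * q"] cong: if_cong)
  then show ?thesis by (simp add: vec_eq_iff mult.commute)
qed

text \<open>Similarity invariance over the polynomial ring: \<open>c\<close> embeds matrices as
  constant polynomial matrices and is multiplicative, and the scalar matrix \<open>X\<close>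
  commutes with everything, so conjugation by \<open>U\<close> leaves the determinant of
  \<open>X - c D\<close>.\<close>

lemma charpoly_unitary_diagonal:
  fixes U :: "complex ^ 'n ^ 'n"
  assumes U: "U ** adj U = mat 1"
    and M: "M = U ** (\<chi> i j. if i = j then complex_of_real (d i) else 0) ** adj U"
  shows "charpoly M = (\<Prod>i\<in>UNIV. [:- complex_of_real (d i), 1:])"
proof -
  define c :: "complex ^ 'n ^ 'n \<Rightarrow> complex poly ^ 'n ^ 'n" where "c N = (\<chi> i j. [:N $ i $ j:])" for N
  define X :: "complex poly ^ 'n ^ 'n" where "X = mat [:0, 1:]"
  define D :: "complex ^ 'n ^ 'n" where "D = (\<chi> i j. if i = j then complex_of_real (d i) else 0)"
  have cs: "[:\<Sum>i\<in>I. f i:] = (\<Sum>i\<in>I. [:f i:])" for I :: "'n set" and f :: "'n \<Rightarrow> complex"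
  proof (induction I rule: infinite_finite_induct)
    case (insert x F)
    have "[:f x + sum f F:] = [:f x:] + [:sum f F:]" by simp
    then show ?case using insert by simp
  qed auto
  have cm: "c (A ** B) = c A ** c B" for A B
    by (simp add: c_def vec_eq_iff matrix_matrix_mult_def cs mult.commute)
  have c1: "c (mat 1) = mat 1"
    by (auto simp: c_def vec_eq_iff mat_def one_pCons[symmetric])
  have X: "X ** A = A ** X" for A
    unfolding X_def by (rule mat_mult_commute)
  have dl: "A ** (B - C) = A ** B - A ** C" "(B - C) ** A = B ** A - C ** A"
    for A B C :: "complex poly ^ 'n ^ 'n"
    by (simp_all add: vec_eq_iff matrix_matrix_mult_def sum_subtractf algebra_simps)
  have UU: "c U ** c (adj U) = mat 1"
    using cm[of U "adj U"] U c1 by simp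
  have "c U ** (X - c D) ** c (adj U) = c U ** X ** c (adj U) - c (U ** D ** adj U)"
    by (simp only: dl cm)
  also have "c U ** X ** c (adj U) = X ** (c U ** c (adj U))"
    by (simp only: X[of "c U", symmetric] matrix_mul_assoc)
  also have "X ** (c U ** c (adj U)) - c (U ** D ** adj U) = X - c (U ** D ** adj U)"
    by (simp only: UU matrix_mul_rid)
  also have "\<dots> = X - c M"
    by (simp only: M D_def)
  finally have "X - c M = c U ** (X - c D) ** c (adj U)" ..
  then have "charpoly M = det (c U ** (X - c D) ** c (adj U))"
    by (simp add: charpoly_def X_def c_def)
  also have "\<dots> = det (X - c D) * det (c U ** c (adj U))"
    by (simp only: det_mul mult_ac)
  also have "\<dots> = det (X - c D)"
    by (simp only: UU det_I mult_1_right)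
  also have "\<dots> = (\<Prod>i\<in>UNIV. (X - c D) $ i $ i)"
    by (rule det_diagonal) (simp add: X_def c_def D_def mat_def)
  also have "\<dots> = (\<Prod>i\<in>UNIV. [:- complex_of_real (d i), 1:])"
    by (simp add: X_def c_def D_def mat_def)
  finally show ?thesis .
qed

theorem Herm_diagonalizes:
  fixes M :: "complex ^ 'n ^ 'n"
  assumes "M \<in> Herm"
  shows "\<exists>l E. diagonalizes E l M \<and>
    image_mset (\<lambda>i. complex_of_real (l $ i)) (mset_set UNIV) = proots (charpoly M)"
proof -
  have M: "adj M = M" using assms by (simp add: Herm_iff_adj)
  from orthonormal_eigenvectors_exist[OF M, of UNIV] obtain v :: "'n \<Rightarrow> complex ^ 'n" and d
    where v: "\<And>i. M *v v i = (d i :: real) *\<^sub>R v i"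
      "\<And>i j. cip (v i) (v j) = (if i = j then 1 else 0)" by auto
  define U :: "complex ^ 'n ^ 'n" where "U = (\<chi> a i. v i $ a)"
  define D :: "complex ^ 'n ^ 'n" where "D = (\<chi> i j. if i = j then complex_of_real (d i) else 0)"
  have "adj U ** U = mat 1"
    using v(2) by (simp add: vec_eq_iff matrix_matrix_mult_def U_def mat_def cip_def)
  then have UU: "U ** adj U = mat 1"
    using matrix_left_right_inverse by blast
  have sd: "(\<Sum>k\<in>UNIV. f k * (if k = i then g k else 0)) = f i * g i"
    for i :: 'n and f g :: "'n \<Rightarrow> complex"
    by (simp add: if_distrib[of "\<lambda>q. _ * q"] cong: if_cong)
  have "M ** U = U ** D"
  proof -
    have "(M ** U) $ a $ i = (M *v v i) $ a" for a i
      by (simp add: matrix_matrix_mult_def matrix_vector_mult_def U_def)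
    then show ?thesis
      by (simp add: vec_eq_iff v(1), simp add: matrix_matrix_mult_def U_def D_def sd scaleR_conv_of_real mult.commute)
  qed
  then have M_eq: "M = U ** D ** adj U"
    using UU by (metis matrix_mul_assoc matrix_mul_rid)
  \<comment> \<open>The rank-one projection onto the line of \<open>v i\<close>. The
    \<open>v i\<close> are the columns of \<open>U\<close>, so \<open>U ** adj U = mat 1\<close>
    says that these projections sum to the identity.\<close>
  define E :: "'n \<Rightarrow> complex ^ 'n ^ 'n" where "E i = (\<chi> a b. v i $ a * cnj (v i $ b))" for i
  have E_sum: "(\<Sum>i\<in>UNIV. E i) = mat 1"
    using UU by (simp add: vec_eq_iff E_def matrix_matrix_mult_def U_def)
  have EE: "E i ** E j = (if i = j then E i else 0)" for i j
  proof -
    have "(E i ** E j) $ a $ b = v i $ a * cip (v i) (v j) * cnj (v j $ b)" for a b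
      by (simp add: E_def matrix_matrix_mult_def cip_def sum_distrib_left sum_distrib_right mult_ac)
    then show ?thesis
      by (simp add: vec_eq_iff v(2)) (simp add: E_def)
  qed
  have tr: "trace (E i) = 1" for i
    using v(2)[of i i] by (simp add: trace_def E_def cip_def mult.commute)
  have res: "resolution E"
    unfolding resolution_def using EE E_sum tr by (auto simp: E_def vec_eq_iff)
  have "M ** E i = d i *\<^sub>R E i" for i
  proof -
    have "(M ** E i) $ a $ b = (M *v v i) $ a * cnj (v i $ b)" for a b
      by (simp add: matrix_matrix_mult_def matrix_vector_mult_def E_def sum_distrib_left sum_distrib_right mult_ac)
    then show ?thesis
      by (simp add: vec_eq_iff v(1), simp add: E_def)
  qed
  then have "M = (\<Sum>i\<in>UNIV. d i *\<^sub>R E i)"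
    using mult_sum_right[of M E UNIV] by (simp add: E_sum)
  then have dg: "diagonalizes E (\<chi> i. d i) M"
    unfolding diagonalizes_def using res by simp
  have pr: "proots (\<Prod>i\<in>I. [:- complex_of_real (d i), 1:]) =
      image_mset (\<lambda>i. complex_of_real (d i)) (mset_set I)" for I :: "'n set"
  proof -
    have "finite I" by simp
    then show ?thesis
      by (induction I rule: finite_induct) (auto simp: proots_mult simp del: mult_pCons_left)
  qed
  show ?thesis
    using dg pr[of UNIV] charpoly_unitary_diagonal[OF UU M_eq[unfolded D_def]]
    by (intro exI[of _ "\<chi> i. d i"] exI[of _ E]) simp
qed

text \<open>The labelling of the eigenvalues is prescribed here, so the projections of some
  diagonalization are permuted to match it.\<close>

lemma eigenvalues_diagonalizes:
  fixes M :: "complex ^ 'n ^ 'n"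
  assumes "M \<in> Herm"
    and l: "image_mset (\<lambda>i. complex_of_real (l $ i)) (mset_set UNIV) = proots (charpoly M)"
  shows "\<exists>E. diagonalizes E l M"
proof -
  from Herm_diagonalizes[OF assms(1)] obtain d E where E: "diagonalizes E d M"
    and d: "image_mset (\<lambda>i. complex_of_real (d $ i)) (mset_set UNIV) = proots (charpoly M)"
    by blast
  from image_mset_eq_implies_permutes[OF finite trans[OF l d[symmetric]]] obtain p
    where p: "p permutes UNIV" "\<And>i. l $ i = d $ p i" by auto
  have bij: "bij p" using p(1) by (rule permutes_bij)
  have inj: "p i = p j \<longleftrightarrow> i = j" for i j
    using bij by (metis bij_pointE)
  have s: "(\<Sum>i\<in>UNIV. f (p i)) = (\<Sum>i\<in>UNIV. f i)" for f :: "'n \<Rightarrow> complex ^ 'n ^ 'n"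
    by (rule sum.reindex_bij_betw[OF bij])
  have "diagonalizes (\<lambda>i. E (p i)) l M"
    using E unfolding diagonalizes_def resolution_def
    by (simp add: p(2) inj s[of E] s[of "\<lambda>i. d $ i *\<^sub>R E i"])
  then show ?thesis by blast
qed

section \<open>The Ky Fan maximum principle\<close>

definition projs :: "nat \<Rightarrow> (complex ^ 'n ^ 'n) set" where
  "projs k = {P. adj P = P \<and> P ** P = P \<and> trace P = of_nat k}"

lemma resolutionD:
  assumes "resolution E"
  shows "adj (E i) = E i" "E i ** E j = (if i = j then E i else 0)"
    "(\<Sum>i\<in>UNIV. E i) = mat 1" "trace (E i) = 1"
  using assms by (auto simp: resolution_def)

text \<open>Cyclicity of the trace turns the overlap of two orthogonal projections into a square;
  its use is that overlaps are nonnegative.\<close>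

lemma inner_projections:
  assumes "adj E = E" "E ** E = E" "adj P = P" "P ** P = P"
  shows "E \<bullet> P = (norm (E ** P))\<^sup>2"
proof -
  have "(norm (E ** P))\<^sup>2 = Re (trace (E ** P ** (P ** E)))"
    by (simp add: power2_norm_eq_inner inner_eq_Re_trace adj_mult assms)
  also have "E ** P ** (P ** E) = E ** P ** E"
    using assms by (metis matrix_mul_assoc)
  also have "trace (E ** P ** E) = trace (E ** (E ** P))"
    by (rule trace_mul_sym)
  also have "E ** (E ** P) = E ** P"
    using assms by (metis matrix_mul_assoc)
  finally show ?thesis
    by (simp add: inner_eq_Re_trace assms)
qed

text \<open>The weights \<open>E i \<bullet> P\<close> tell how the rank \<open>k\<close> is
  distributed over the eigenlines. Nonnegativity of overlaps, applied to the complementary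
  projection \<open>mat 1 - P\<close>, gives the upper bound 1.\<close>

lemma resolution_weights:
  fixes E :: "'n \<Rightarrow> complex ^ 'n ^ 'n"
  assumes E: "resolution E" and P: "P \<in> projs k"
  shows "0 \<le> E i \<bullet> P" "E i \<bullet> P \<le> 1" "(\<Sum>i\<in>UNIV. E i \<bullet> P) = real k"
proof -
  note E = resolutionD[OF E]
  have P: "adj P = P" "P ** P = P" "trace P = of_nat k"
    using P by (auto simp: projs_def)
  have EE: "E i ** E i = E i" using E(2) by simp
  show "0 \<le> E i \<bullet> P"
    using inner_projections[OF E(1) EE P(1,2)] by simp
  have Q: "adj (mat 1 - P) = mat 1 - P" "(mat 1 - P) ** (mat 1 - P) = mat 1 - P"
    by (simp_all add: adj_diff P mult_diff_left mult_diff_right)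
  have "0 \<le> E i \<bullet> (mat 1 - P)"
    using inner_projections[OF E(1) EE Q] by simp
  also have "E i \<bullet> (mat 1 - P) = 1 - E i \<bullet> P"
    by (simp add: inner_diff_right) (simp add: inner_eq_Re_trace E(4))
  finally show "E i \<bullet> P \<le> 1" by simp
  have "(\<Sum>i\<in>UNIV. E i \<bullet> P) = mat 1 \<bullet> P"
    by (simp add: E(3)[symmetric] inner_sum_left)
  also have "\<dots> = real k"
    by (simp add: inner_eq_Re_trace P)
  finally show "(\<Sum>i\<in>UNIV. E i \<bullet> P) = real k" .
qed

lemma norm_projs: "P \<in> projs k \<Longrightarrow> (norm P)\<^sup>2 = real k"
  by (simp add: power2_norm_eq_inner inner_eq_Re_trace projs_def)

lemma resolution_inner:
  assumes "resolution E"
  shows "E i \<bullet> E j = (if i = j then 1 else 0)"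
  by (simp add: inner_eq_Re_trace resolutionD[OF assms] trace_def[of 0])

lemma resolution_norm: "resolution E \<Longrightarrow> norm (E i) = 1"
  by (simp add: norm_eq_1 resolution_inner)

lemma diagonalizes_inner:
  assumes "diagonalizes E l M"
  shows "M \<bullet> E i = l $ i"
  using assms unfolding diagonalizes_def
  by (simp add: inner_sum_left resolution_inner if_distrib cong: if_cong)

lemma diagonalizes_mult:
  assumes "diagonalizes E l M"
  shows "M ** E i = l $ i *\<^sub>R E i" "E i ** M = l $ i *\<^sub>R E i"
  using assms resolutionD[of E] unfolding diagonalizes_def
  by (simp_all add: mult_sum_left mult_sum_right mult_scaleR_left mult_scaleR_right
      if_distrib[of "\<lambda>x. _ *\<^sub>R x"] cong: if_cong)

lemma sum_resolution_in_projs: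
  assumes E: "resolution E"
  shows "(\<Sum>i\<in>K. E i) \<in> projs (card K)"
  using resolutionD[OF E]
  by (auto simp: projs_def adj_sum trace_sum mult_sum_left mult_sum_right cong: if_cong sum.cong)

text \<open>Ky Fan's principle with a quadratic deficit. The weight missing on \<open>K\<close>
  equals the weight placed outside \<open>K\<close>, moving one unit of it costs at least
  \<open>c' - c''\<close>, and the squared distance of the projections is twice the missing
  weight.\<close>

lemma ky_fan_gap:
  fixes M :: "complex ^ 'n ^ 'n"
  assumes dg: "diagonalizes E l M"
    and hi: "\<And>i. i \<in> K \<Longrightarrow> c' \<le> l $ i" and lo: "\<And>i. i \<notin> K \<Longrightarrow> l $ i \<le> c''"
    and P: "P \<in> projs (card K)"
  shows "(c' - c'') / 2 * (norm ((\<Sum>i\<in>K. E i) - P))\<^sup>2 \<le> M \<bullet> (\<Sum>i\<in>K. E i) - M \<bullet> P"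
proof -
  have E: "resolution E" and M: "M = (\<Sum>i\<in>UNIV. l $ i *\<^sub>R E i)"
    using dg by (auto simp: diagonalizes_def)
  define q where "q i = E i \<bullet> P" for i
  have q: "0 \<le> q i" "q i \<le> 1" "(\<Sum>i\<in>UNIV. q i) = real (card K)" for i
    using resolution_weights[OF E P] by (auto simp: q_def)
  let ?PK = "\<Sum>i\<in>K. E i"
  have "(\<Sum>i\<in>UNIV. q i) = (\<Sum>i\<in>K. q i) + (\<Sum>i\<in>-K. q i)"
    using sum.union_disjoint[of K "-K" q] by simp
  then have qc: "(\<Sum>i\<in>-K. q i) = (\<Sum>i\<in>K. 1 - q i)"
    using q(3) by (simp add: sum_subtractf)
  have nn: "(norm (?PK - P))\<^sup>2 = 2 * (\<Sum>i\<in>K. 1 - q i)"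
  proof -
    have "(norm (?PK - P))\<^sup>2 = (norm ?PK)\<^sup>2 + (norm P)\<^sup>2 - 2 * (?PK \<bullet> P)"
      by (simp add: power2_norm_eq_inner inner_diff inner_commute)
    also have "?PK \<bullet> P = (\<Sum>i\<in>K. q i)"
      by (simp add: inner_sum_left q_def)
    finally show ?thesis
      by (simp add: norm_projs[OF P] norm_projs[OF sum_resolution_in_projs[OF E]] sum_subtractf)
  qed
  have "M \<bullet> ?PK = (\<Sum>i\<in>K. l $ i)"
    by (simp add: inner_sum_right diagonalizes_inner[OF dg])
  moreover have "M \<bullet> P = (\<Sum>i\<in>K. l $ i * q i) + (\<Sum>i\<in>-K. l $ i * q i)"
    using sum.union_disjoint[of K "-K" "\<lambda>i. l $ i * q i"]
    by (simp add: M inner_sum_left q_def)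
  moreover have "(\<Sum>i\<in>K. c' * (1 - q i)) \<le> (\<Sum>i\<in>K. l $ i * (1 - q i))"
    using hi q by (intro sum_mono mult_right_mono) auto
  moreover have "(\<Sum>i\<in>-K. l $ i * q i) \<le> (\<Sum>i\<in>-K. c'' * q i)"
    using lo q by (intro sum_mono mult_right_mono) auto
  moreover have "(\<Sum>i\<in>K. l $ i * (1 - q i)) = (\<Sum>i\<in>K. l $ i) - (\<Sum>i\<in>K. l $ i * q i)"
    by (simp add: sum_subtractf algebra_simps)
  moreover have "(\<Sum>i\<in>-K. c'' * q i) = c'' * (\<Sum>i\<in>K. 1 - q i)"
    by (simp only: qc sum_distrib_left[symmetric])
  ultimately have "c' * (\<Sum>i\<in>K. 1 - q i) - c'' * (\<Sum>i\<in>K. 1 - q i) \<le> M \<bullet> ?PK - M \<bullet> P"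
    by (simp add: sum_distrib_left)
  then show ?thesis
    unfolding nn by (simp add: left_diff_distrib)
qed

text \<open>Without a gap at rank \<open>k\<close> there are several maximizers and the choice among
  them is arbitrary; at such matrices only maximality is used.\<close>

definition max_proj :: "nat \<Rightarrow> complex ^ 'n ^ 'n \<Rightarrow> complex ^ 'n ^ 'n" where
  "max_proj k M = (SOME P. P \<in> projs k \<and> (\<forall>Q\<in>projs k. M \<bullet> Q \<le> M \<bullet> P))"

lemma compact_projs: "compact (projs k :: (complex ^ 'n ^ 'n) set)"
proof -
  have "bounded (projs k :: (complex ^ 'n ^ 'n) set)"
  proof (rule boundedI)
    fix P :: "complex ^ 'n ^ 'n" assume "P \<in> projs k"
    then show "norm P \<le> sqrt (real k)"
      using norm_projs real_le_rsqrt by fastforce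
  qed
  moreover have "projs k = {P :: complex ^ 'n ^ 'n. adj P = P} \<inter> {P. P ** P = P} \<inter> {P. trace P = of_nat k}"
    by (auto simp: projs_def)
  moreover have "closed {P :: complex ^ 'n ^ 'n. adj P = P}"
    unfolding adj_def by (intro closed_Collect_eq continuous_intros)
  moreover have "closed {P :: complex ^ 'n ^ 'n. P ** P = P}"
    unfolding matrix_matrix_mult_def by (intro closed_Collect_eq continuous_intros)
  moreover have "closed {P :: complex ^ 'n ^ 'n. trace P = of_nat k}"
    unfolding trace_def by (intro closed_Collect_eq continuous_intros)
  ultimately show ?thesis
    by (simp add: compact_eq_bounded_closed closed_Int)
qed

lemma resolution_exists: "\<exists>E :: 'n \<Rightarrow> complex ^ 'n ^ 'n. resolution E"
proof -
  have "(mat 1 :: complex ^ 'n ^ 'n) \<in> Herm" by (simp add: Herm_iff_adj)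
  from Herm_diagonalizes[OF this] show ?thesis by (auto simp: diagonalizes_def)
qed

lemma max_proj:
  assumes "k \<le> CARD('n)"
  shows "max_proj k (M :: complex ^ 'n ^ 'n) \<in> projs k"
    and "Q \<in> projs k \<Longrightarrow> M \<bullet> Q \<le> M \<bullet> max_proj k M"
proof -
  obtain E :: "'n \<Rightarrow> complex ^ 'n ^ 'n" where E: "resolution E"
    using resolution_exists by blast
  obtain K :: "'n set" where "card K = k"
    using obtain_subset_with_card_n[OF assms] by blast
  then have "projs k \<noteq> ({} :: (complex ^ 'n ^ 'n) set)"
    using sum_resolution_in_projs[OF E, of K] by auto
  from continuous_attains_sup[OF compact_projs this, of "\<lambda>P. M \<bullet> P"]
  have "\<exists>P. P \<in> projs k \<and> (\<forall>Q\<in>projs k. M \<bullet> Q \<le> M \<bullet> P)"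
    using continuous_on_inner[OF continuous_on_const continuous_on_id] by blast
  from someI_ex[OF this] show "max_proj k M \<in> projs k"
    and "Q \<in> projs k \<Longrightarrow> M \<bullet> Q \<le> M \<bullet> max_proj k M"
    unfolding max_proj_def by auto
qed

text \<open>The deficit of the maximizer for \<open>N\<close>, measured by \<open>M\<close>, is
  bounded below by the quadratic term of \<open>ky_fan_gap\<close> and above by
  \<open>(M - N) \<bullet> (?P - ?Q)\<close>, since this maximizer wins for \<open>N\<close>.
  Dividing by the distance gives a Lipschitz estimate, with a gap required at \<open>M\<close>
  only.\<close>

lemma max_proj_gap:
  fixes M N :: "complex ^ 'n ^ 'n"
  assumes dg: "diagonalizes E l M" and g: "g > 0"
    and gap: "\<And>i j. i \<in> K \<Longrightarrow> j \<notin> K \<Longrightarrow> l $ j + g \<le> l $ i"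
  shows "norm ((\<Sum>i\<in>K. E i) - max_proj (card K) N) \<le> 2 / g * norm (M - N)"
proof -
  let ?P = "\<Sum>i\<in>K. E i" and ?Q = "max_proj (card K) N"
  have cK: "card K \<le> CARD('n)" by (intro card_mono) auto
  have E: "resolution E" using dg by (simp add: diagonalizes_def)
  \<comment> \<open>A threshold at least \<open>g\<close> below all eigenvalues in \<open>K\<close>
    and above all the others; for \<open>K = UNIV\<close> there are no others and the smallest
    eigenvalue minus \<open>g\<close> serves.\<close>
  obtain c where c: "\<And>i. i \<in> K \<Longrightarrow> c + g \<le> l $ i" "\<And>i. i \<notin> K \<Longrightarrow> l $ i \<le> c"
  proof (cases "K = UNIV")
    case True
    define c where "c = Min (range (($) l)) - g"
    have "c + g \<le> l $ i" for i unfolding c_def by simp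
    with True show ?thesis by (intro that[of c]) auto
  next
    case False
    define c where "c = Max ((($) l) ` (-K))"
    have 1: "l $ i \<le> c" if "i \<notin> K" for i
      unfolding c_def using that by (intro Max_ge) auto
    have "c \<in> (($) l) ` (-K)"
      unfolding c_def using False by (intro Max_in) auto
    then obtain j where "j \<notin> K" "c = l $ j" by auto
    with gap 1 show ?thesis by (intro that[of c]) auto
  qed
  have "g / 2 * (norm (?P - ?Q))\<^sup>2 \<le> M \<bullet> ?P - M \<bullet> ?Q"
    using ky_fan_gap[OF dg c(1,2), where P = ?Q] max_proj(1)[OF cK] by simp
  also have "N \<bullet> ?P \<le> N \<bullet> ?Q"
    by (intro max_proj(2) cK sum_resolution_in_projs E)
  then have "M \<bullet> ?P - M \<bullet> ?Q \<le> (M - N) \<bullet> (?P - ?Q)"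
    by (simp add: inner_diff)
  also have "\<dots> \<le> norm (M - N) * norm (?P - ?Q)"
    by (rule norm_cauchy_schwarz)
  finally have le: "(g / 2 * norm (?P - ?Q)) * norm (?P - ?Q) \<le> norm (M - N) * norm (?P - ?Q)"
    by (simp only: power2_eq_square mult.assoc)
  have "g / 2 * norm (?P - ?Q) \<le> norm (M - N)"
  proof (cases "norm (?P - ?Q) = 0")
    case False
    then have "0 < norm (?P - ?Q)" by simp
    from mult_right_le_imp_le[OF le this] show ?thesis .
  qed (simp only: mult_zero_right norm_ge_zero)
  then show ?thesis using g by (simp add: field_simps)
qed

lemma max_proj_eq:
  assumes "diagonalizes E l M" "g > 0"
    and "\<And>i j. i \<in> K \<Longrightarrow> j \<notin> K \<Longrightarrow> l $ j + g \<le> l $ i"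
  shows "max_proj (card K) M = (\<Sum>i\<in>K. E i)"
  using max_proj_gap[OF assms, where N = M] by simp

section \<open>First order perturbation of eigenvalues\<close>

lemma tendsto_matrix_mult [tendsto_intros]:
  fixes f g :: "'a \<Rightarrow> complex ^ 'n ^ 'n"
  assumes "(f \<longlongrightarrow> a) F" "(g \<longlongrightarrow> b) F"
  shows "((\<lambda>x. f x ** g x) \<longlongrightarrow> a ** b) F"
  unfolding matrix_matrix_mult_def by (intro tendsto_intros assms)

lemma tendsto_adj [tendsto_intros]:
  assumes "(f \<longlongrightarrow> a) F"
  shows "((\<lambda>x. adj (f x)) \<longlongrightarrow> adj a) F"
  unfolding adj_def by (intro tendsto_intros assms)

lemma tendsto_trace [tendsto_intros]:
  fixes f :: "'a \<Rightarrow> complex ^ 'n ^ 'n"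
  assumes "(f \<longlongrightarrow> a) F"
  shows "((\<lambda>x. trace (f x)) \<longlongrightarrow> trace a) F"
  unfolding trace_def by (intro tendsto_intros assms)

lemma resolution_limit:
  fixes E :: "nat \<Rightarrow> 'n \<Rightarrow> complex ^ 'n ^ 'n"
  assumes E: "\<And>m. resolution (E m)" and lim: "\<And>i. (\<lambda>m. E m i) \<longlonglongrightarrow> E0 i"
  shows "resolution E0"
  unfolding resolution_def
proof (intro conjI allI)
  note R = resolutionD[OF E]
  show "adj (E0 i) = E0 i" for i
    by (rule LIMSEQ_unique[of "\<lambda>m. E m i"]) (use tendsto_adj[OF lim[of i]] lim R in auto)
  show "E0 i ** E0 j = (if i = j then E0 i else 0)" for i j
    by (rule LIMSEQ_unique[OF tendsto_matrix_mult[OF lim[of i] lim[of j]]]) (use lim R in auto)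
  show "(\<Sum>i\<in>UNIV. E0 i) = mat 1"
    by (rule LIMSEQ_unique[OF tendsto_sum[OF lim]]) (use R in auto)
  show "trace (E0 i) = 1" for i
    by (rule LIMSEQ_unique[OF tendsto_trace[OF lim[of i]]]) (use R in auto)
qed

text \<open>Eigenvalues and rank-one eigenprojections along \<open>M\<^sub>0 + h\<^sub>m B + o(h\<^sub>m)\<close>, \<open>h\<^sub>m \<rightarrow> 0\<close>: the
  identity \<open>E\<^sub>m i (M\<^sub>m - M\<^sub>0) E\<^sub>0 j = (\<lambda>\<^sub>m i - a j) E\<^sub>m i E\<^sub>0 j\<close>, divided by \<open>h\<^sub>m\<close>, shows that limit
  eigenprojections diagonalize the compressions of \<open>B\<close> to the eigenspaces of \<open>M\<^sub>0\<close>.\<close>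

definition first_order_data where
  "first_order_data E a b M B \<longleftrightarrow> diagonalizes E a M \<and>
     (\<forall>i j. a $ i = a $ j \<longrightarrow> E i ** B ** E j = (if i = j then b $ i *\<^sub>R E i else 0))"

lemma perturbation_subsequence:
  fixes M :: "nat \<Rightarrow> complex ^ 'n ^ 'n"
  assumes dg: "\<And>m. diagonalizes (E m) (l m) (M m)"
    and h: "\<And>m. h m \<noteq> 0" "h \<longlonglongrightarrow> 0"
    and M: "(\<lambda>m. (1 / h m) *\<^sub>R (M m - M0)) \<longlonglongrightarrow> B"
  shows "\<exists>r E0 a b. strict_mono r \<and> first_order_data E0 a b M0 B \<and> (l \<circ> r) \<longlonglongrightarrow> a \<and>
     (\<lambda>m. (1 / h (r m)) *\<^sub>R (l (r m) - a)) \<longlonglongrightarrow> b"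
proof -
  have "(\<lambda>m. h m *\<^sub>R ((1 / h m) *\<^sub>R (M m - M0)) + M0) \<longlonglongrightarrow> 0 *\<^sub>R B + M0"
    by (intro tendsto_intros M h)
  then have M_lim: "M \<longlonglongrightarrow> M0" using h(1) by simp
  then obtain C where C: "\<And>m. norm (M m) \<le> C"
    using convergent_imp_Bseq[of M] convergentI BseqD by metis
  have E: "resolution (E m)" for m using dg by (simp add: diagonalizes_def)
  have lC: "\<bar>l m $ i\<bar> \<le> C" for m i
  proof -
    have "\<bar>l m $ i\<bar> = \<bar>M m \<bullet> E m i\<bar>" by (simp add: diagonalizes_inner[OF dg])
    also have "\<dots> \<le> norm (M m) * norm (E m i)" by (rule Cauchy_Schwarz_ineq2)
    also have "\<dots> \<le> C" using C by (simp add: resolution_norm[OF E])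
    finally show ?thesis .
  qed
  \<comment> \<open>One vector holding all projections and eigenvalues, so that a single compactness
    argument yields a common subsequence.\<close>
  define X :: "nat \<Rightarrow> ((complex ^ 'n ^ 'n) ^ 'n) \<times> (real ^ 'n)" where
    "X m = (\<chi> i. E m i, l m)" for m
  have "bounded (range X)"
  proof (rule boundedI)
    fix x assume "x \<in> range X"
    then obtain m where x: "x = X m" by blast
    have "norm x \<le> norm (\<chi> i. E m i) + norm (l m)"
      unfolding x X_def by (rule norm_Pair_le)
    also have "norm (\<chi> i. E m i) \<le> (\<Sum>i\<in>UNIV. norm (E m i))"
      using norm_le_l1_cart[of "\<chi> i. norm (E m i)"] by (simp add: norm_vec_def)
    also have "\<dots> = real CARD('n)" by (simp add: resolution_norm[OF E])
    also have "norm (l m) \<le> (\<Sum>i\<in>UNIV. \<bar>l m $ i\<bar>)" by (rule norm_le_l1_cart)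
    also have "\<dots> \<le> real CARD('n) * C"
      using sum_bounded_above[of UNIV "\<lambda>i. \<bar>l m $ i\<bar>" C] lC by simp
    finally show "norm x \<le> real CARD('n) + real CARD('n) * C" by simp
  qed
  from bounded_imp_convergent_subsequence[OF this] obtain L r
    where r: "strict_mono r" and L: "(X \<circ> r) \<longlonglongrightarrow> L" by blast
  define E0 where "E0 i = fst L $ i" for i
  define a where "a = snd L"
  have E_lim: "(\<lambda>m. E (r m) i) \<longlonglongrightarrow> E0 i" for i
    using tendsto_vec_nth[OF tendsto_fst[OF L], of i] by (simp add: X_def E0_def o_def)
  have l_lim: "(\<lambda>m. l (r m)) \<longlonglongrightarrow> a"
    using tendsto_snd[OF L] by (simp add: X_def a_def o_def)
  have Mr: "(\<lambda>m. M (r m)) \<longlonglongrightarrow> M0"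
    using LIMSEQ_subseq_LIMSEQ[OF M_lim r] by (simp add: o_def)
  have quot: "(\<lambda>m. (1 / h (r m)) *\<^sub>R (M (r m) - M0)) \<longlonglongrightarrow> B"
    using LIMSEQ_subseq_LIMSEQ[OF M r] by (simp add: o_def)
  have E0: "resolution E0"
    by (rule resolution_limit[of "\<lambda>m. E (r m)"]) (use E E_lim in auto)
  have "M0 = (\<Sum>i\<in>UNIV. a $ i *\<^sub>R E0 i)"
  proof (rule LIMSEQ_unique[OF Mr])
    have "(\<lambda>m. \<Sum>i\<in>UNIV. l (r m) $ i *\<^sub>R E (r m) i) \<longlonglongrightarrow> (\<Sum>i\<in>UNIV. a $ i *\<^sub>R E0 i)"
      by (intro tendsto_intros l_lim E_lim)
    then show "(\<lambda>m. M (r m)) \<longlonglongrightarrow> (\<Sum>i\<in>UNIV. a $ i *\<^sub>R E0 i)"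
      using dg by (simp add: diagonalizes_def)
  qed
  with E0 have dg0: "diagonalizes E0 a M0" by (simp add: diagonalizes_def)
  define q where "q m i = (l (r m) $ i - a $ i) / h (r m)" for m i
  have key: "E (r m) i ** ((1 / h (r m)) *\<^sub>R (M (r m) - M0)) ** E0 j = q m i *\<^sub>R (E (r m) i ** E0 j)"
    if "a $ i = a $ j" for i j m
  proof -
    have "E (r m) i ** (M (r m) - M0) ** E0 j = (E (r m) i ** M (r m)) ** E0 j - E (r m) i ** (M0 ** E0 j)"
      by (simp add: mult_diff_left mult_diff_right matrix_mul_assoc)
    also have "\<dots> = (l (r m) $ i - a $ i) *\<^sub>R (E (r m) i ** E0 j)"
      by (simp add: diagonalizes_mult[OF dg] diagonalizes_mult[OF dg0] mult_scaleR_left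
          mult_scaleR_right scaleR_diff_left that)
    finally show ?thesis
      by (simp add: mult_scaleR_left mult_scaleR_right q_def)
  qed
  \<comment> \<open>The expected limit of the quotients \<open>q m i\<close>: take the trace of
    \<open>key\<close> for \<open>i = j\<close>, where the factor
    \<open>trace (E (r m) i ** E0 i)\<close> tends to 1 and can be divided out.\<close>
  define b where "b = (\<chi> i. Re (trace (E0 i ** B ** E0 i)))"
  have q_lim: "(\<lambda>m. q m i) \<longlonglongrightarrow> b $ i" for i
  proof -
    have "(\<lambda>m. E (r m) i ** E0 i) \<longlonglongrightarrow> E0 i ** E0 i" by (intro tendsto_intros E_lim)
    then have "(\<lambda>m. Re (trace (E (r m) i ** E0 i))) \<longlonglongrightarrow> Re (trace (E0 i))"
      by (intro tendsto_intros) (simp add: resolutionD(2)[OF E0])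
    then have t: "(\<lambda>m. Re (trace (E (r m) i ** E0 i))) \<longlonglongrightarrow> 1"
      by (simp add: resolutionD(4)[OF E0])
    have "(\<lambda>m. Re (trace (E (r m) i ** ((1 / h (r m)) *\<^sub>R (M (r m) - M0)) ** E0 i))) \<longlonglongrightarrow> b $ i"
      unfolding b_def by (simp, intro tendsto_intros E_lim quot)
    then have "(\<lambda>m. q m i * Re (trace (E (r m) i ** E0 i))) \<longlonglongrightarrow> b $ i"
      by (simp add: key trace_scaleR)
    from tendsto_divide[OF this t]
    have "(\<lambda>m. q m i * Re (trace (E (r m) i ** E0 i)) / Re (trace (E (r m) i ** E0 i))) \<longlonglongrightarrow> b $ i"
      by simp
    moreover have "\<forall>\<^sub>F m in sequentially. Re (trace (E (r m) i ** E0 i)) > 0"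
      using order_tendstoD(1)[OF t, of 0] by simp
    then have "\<forall>\<^sub>F m in sequentially.
        q m i * Re (trace (E (r m) i ** E0 i)) / Re (trace (E (r m) i ** E0 i)) = q m i"
      by eventually_elim simp
    ultimately show ?thesis
      by (rule Lim_transform_eventually)
  qed
  have EBE: "E0 i ** B ** E0 j = (if i = j then b $ i *\<^sub>R E0 i else 0)" if "a $ i = a $ j" for i j
  proof (rule LIMSEQ_unique)
    show "(\<lambda>m. E (r m) i ** ((1 / h (r m)) *\<^sub>R (M (r m) - M0)) ** E0 j) \<longlonglongrightarrow> E0 i ** B ** E0 j"
      by (intro tendsto_intros E_lim quot)
    have "(\<lambda>m. q m i *\<^sub>R (E (r m) i ** E0 j)) \<longlonglongrightarrow> b $ i *\<^sub>R (E0 i ** E0 j)"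
      by (intro tendsto_intros E_lim q_lim)
    then show "(\<lambda>m. E (r m) i ** ((1 / h (r m)) *\<^sub>R (M (r m) - M0)) ** E0 j)
        \<longlonglongrightarrow> (if i = j then b $ i *\<^sub>R E0 i else 0)"
      unfolding key[OF that] resolutionD(2)[OF E0] by (simp split: if_splits)
  qed
  have "(\<lambda>m. (1 / h (r m)) *\<^sub>R (l (r m) - a)) \<longlonglongrightarrow> b"
    by (rule vec_tendstoI) (use q_lim in \<open>simp add: q_def\<close>)
  with r dg0 EBE l_lim show ?thesis
    unfolding first_order_data_def o_def by blast
qed

text \<open>The overlaps \<open>E i \<bullet> F j\<close> form a doubly stochastic matrix that
  vanishes unless the labels \<open>(a $ i, b $ i)\<close> and \<open>(a' $ j, b' $ j)\<close>
  agree. Summing the overlaps over one label from both sides shows that this label occurs equally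
  often in both systems.\<close>

lemma first_order_data_unique:
  fixes M :: "complex ^ 'n ^ 'n"
  assumes E: "first_order_data E a b M B" and F: "first_order_data F a' b' M B"
  shows "\<exists>p. p permutes UNIV \<and> (\<forall>i. a' $ p i = a $ i \<and> b' $ p i = b $ i)"
proof -
  have dE: "diagonalizes E a M" and dF: "diagonalizes F a' M"
    using E F by (auto simp: first_order_data_def)
  have rE: "resolution E" and rF: "resolution F"
    using dE dF by (auto simp: diagonalizes_def)
  note E' = resolutionD[OF rE] and F' = resolutionD[OF rF]
  define w where "w i j = E i \<bullet> F j" for i j
  have Fp: "F j \<in> projs 1" for j using F' by (simp add: projs_def)
  have Ep: "E j \<in> projs 1" for j using E' by (simp add: projs_def)
  have w1: "(\<Sum>i\<in>UNIV. w i j) = 1" "(\<Sum>j\<in>UNIV. w i j) = 1" for i j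
    using resolution_weights(3)[OF rE Fp] resolution_weights(3)[OF rF Ep]
    by (simp_all add: w_def inner_commute)
  have a0: "E i ** F j = 0" if "a $ i \<noteq> a' $ j" for i j
  proof -
    have "a $ i *\<^sub>R (E i ** F j) = E i ** M ** F j"
      by (simp add: diagonalizes_mult[OF dE] mult_scaleR_left)
    also have "\<dots> = a' $ j *\<^sub>R (E i ** F j)"
      by (simp add: diagonalizes_mult[OF dF] mult_scaleR_right flip: matrix_mul_assoc)
    finally show ?thesis using that by simp
  qed
  have b0: "b $ i = b' $ j" if "E i ** F j \<noteq> 0" for i j
  proof -
    have aij: "a $ i = a' $ j" using a0 that by blast
    \<comment> \<open>\<open>E i ** B ** F j\<close> is evaluated twice, inserting the resolution
      \<open>E\<close> to the right of \<open>B\<close> and then \<open>F\<close> to its left; terms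
      belonging to other eigenvalues of \<open>M\<close> vanish by \<open>a0\<close>.\<close>
    have "E i ** B ** F j = E i ** B ** ((\<Sum>k\<in>UNIV. E k) ** F j)"
      by (simp add: E'(3))
    also have "\<dots> = (\<Sum>k\<in>UNIV. E i ** B ** E k ** F j)"
      by (simp add: mult_sum_left mult_sum_right matrix_mul_assoc)
    also have "\<dots> = (\<Sum>k\<in>UNIV. if k = i then b $ i *\<^sub>R (E i ** F j) else 0)"
    proof (rule sum.cong)
      fix k
      show "E i ** B ** E k ** F j = (if k = i then b $ i *\<^sub>R (E i ** F j) else 0)"
      proof (cases "a $ k = a' $ j")
        case True
        then show ?thesis
          using E aij by (auto simp: first_order_data_def mult_scaleR_left)
      next
        case False
        have "E i ** B ** E k ** F j = E i ** B ** (E k ** F j)"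
          by (simp add: matrix_mul_assoc)
        with False aij a0[of k j] show ?thesis by auto
      qed
    qed simp
    finally have 1: "E i ** B ** F j = b $ i *\<^sub>R (E i ** F j)" by simp
    have "E i ** B ** F j = E i ** (\<Sum>k\<in>UNIV. F k) ** B ** F j"
      by (simp add: F'(3))
    also have "\<dots> = (\<Sum>k\<in>UNIV. E i ** (F k ** B ** F j))"
      by (simp add: mult_sum_left mult_sum_right matrix_mul_assoc)
    also have "\<dots> = (\<Sum>k\<in>UNIV. if k = j then b' $ j *\<^sub>R (E i ** F j) else 0)"
    proof (rule sum.cong)
      fix k
      show "E i ** (F k ** B ** F j) = (if k = j then b' $ j *\<^sub>R (E i ** F j) else 0)"
      proof (cases "a $ i = a' $ k")
        case True
        then show ?thesis
          using F aij by (auto simp: first_order_data_def mult_scaleR_right)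
      next
        case False
        have "E i ** (F k ** B ** F j) = (E i ** F k) ** (B ** F j)"
          by (simp add: matrix_mul_assoc)
        with False aij a0[of i k] show ?thesis by auto
      qed
    qed simp
    finally have "E i ** B ** F j = b' $ j *\<^sub>R (E i ** F j)" by simp
    with 1 that show ?thesis by simp
  qed
  have w0: "w i j = 0" if "(a $ i, b $ i) \<noteq> (a' $ j, b' $ j)" for i j
  proof -
    have "E i ** F j = 0" using that a0 b0 by blast
    then show ?thesis
      by (simp add: w_def inner_eq_Re_trace F' trace_def)
  qed
  have "image_mset (\<lambda>i. (a $ i, b $ i)) (mset_set UNIV) = image_mset (\<lambda>i. (a' $ i, b' $ i)) (mset_set UNIV)"
  proof (rule multiset_eqI)
    fix p
    let ?S = "{i. (a $ i, b $ i) = p}" and ?S' = "{i. (a' $ i, b' $ i) = p}"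
    have "real (card ?S) = (\<Sum>i\<in>?S. \<Sum>j\<in>UNIV. w i j)" by (simp add: w1)
    also have "\<dots> = (\<Sum>i\<in>?S. \<Sum>j\<in>?S'. w i j)"
      by (intro sum.cong refl sum.mono_neutral_right ballI w0) auto
    also have "\<dots> = (\<Sum>j\<in>?S'. \<Sum>i\<in>?S. w i j)" by (rule sum.swap)
    also have "\<dots> = (\<Sum>j\<in>?S'. \<Sum>i\<in>UNIV. w i j)"
      by (intro sum.cong refl sum.mono_neutral_left ballI w0) auto
    also have "\<dots> = real (card ?S')" by (simp add: w1)
    finally have "card ?S = card ?S'" by simp
    then show "count (image_mset (\<lambda>i. (a $ i, b $ i)) (mset_set UNIV)) p =
        count (image_mset (\<lambda>i. (a' $ i, b' $ i)) (mset_set UNIV)) p"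
      by (simp add: count_image_mset_eq_card_vimage)
  qed
  from image_mset_eq_implies_permutes[OF finite this] obtain p
    where "p permutes UNIV" "\<And>i. (a $ i, b $ i) = (a' $ p i, b' $ p i)" by auto
  then show ?thesis by (metis prod.inject)
qed

section \<open>Derivatives of eigenvalues along a curve\<close>

lemma eigenvalue_system_on_diagonalizes:
  assumes "eigenvalue_system_on J A lam" "t \<in> J" "A t \<in> Herm"
  shows "\<exists>E. diagonalizes E (lam t) (A t)"
  using assms eigenvalues_diagonalizes[of "A t" "lam t"] by (auto simp: eigenvalue_system_on_def)

lemma has_vector_derivative_iff_quotient:
  "(f has_vector_derivative f') (at t within S) \<longleftrightarrow>
     ((\<lambda>s. (1 / (s - t)) *\<^sub>R (f s - f t)) \<longlongrightarrow> f') (at t within S)"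
proof -
  have e: "norm ((1 / norm (s - t)) *\<^sub>R (f s - (f t + (s - t) *\<^sub>R f'))) =
      norm ((1 / (s - t)) *\<^sub>R (f s - f t) - f')" if "s \<noteq> t" for s
  proof -
    have "(1 / (s - t)) *\<^sub>R (f s - (f t + (s - t) *\<^sub>R f')) =
        (1 / (s - t)) *\<^sub>R (f s - f t) - ((1 / (s - t)) * (s - t)) *\<^sub>R f'"
      by (simp only: scaleR_diff_right scaleR_add_right scaleR_scaleR diff_diff_eq)
    then have "(1 / (s - t)) *\<^sub>R (f s - f t) - f' = (1 / (s - t)) *\<^sub>R (f s - (f t + (s - t) *\<^sub>R f'))"
      using that by simp
    then show ?thesis by simp
  qed
  have "(f has_vector_derivative f') (at t within S) \<longleftrightarrow>
     ((\<lambda>s. norm ((1 / norm (s - t)) *\<^sub>R (f s - (f t + (s - t) *\<^sub>R f')))) \<longlongrightarrow> 0) (at t within S)"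
    by (simp only: has_vector_derivative_def has_derivative_within bounded_linear_scaleR_left simp_thms
        tendsto_norm_zero_iff)
  also have "\<dots> \<longleftrightarrow> ((\<lambda>s. norm ((1 / (s - t)) *\<^sub>R (f s - f t) - f')) \<longlongrightarrow> 0) (at t within S)"
    by (rule Lim_cong_within[OF refl refl refl]) (rule e)
  also have "\<dots> \<longleftrightarrow> ((\<lambda>s. (1 / (s - t)) *\<^sub>R (f s - f t)) \<longlongrightarrow> f') (at t within S)"
    by (simp only: tendsto_norm_zero_iff LIM_zero_iff)
  finally show ?thesis .
qed

text \<open>Limit projections from \<open>perturbation_subsequence\<close> along any times tending
  to \<open>t\<close> serve: differentiability of \<open>lam\<close> in its own labelling identifies
  the limits \<open>a\<close> and \<open>b\<close> with \<open>lam t\<close> and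
  \<open>lam'\<close>, and the traces of the diagonal blocks are the products
  \<open>B \<bullet> E i\<close>.\<close>

lemma hellmann_feynman:
  fixes A :: "real \<Rightarrow> complex ^ 'n ^ 'n"
  assumes dg: "\<And>s. s \<in> J \<Longrightarrow> \<exists>E. diagonalizes E (lam s) (A s)"
    and A: "(A has_vector_derivative B) (at t within J)"
    and lam: "(lam has_vector_derivative lam') (at t within J)"
    and t: "t islimpt J"
  shows "\<exists>E. diagonalizes E (lam t) (A t) \<and> (\<forall>i. lam' $ i = B \<bullet> E i)"
proof -
  from t obtain s where s: "\<And>m. s m \<in> J - {t}" "s \<longlonglongrightarrow> t"
    unfolding islimpt_sequential by blast
  have sub: "filterlim s (at t within J) sequentially"
    using s by (auto simp: filterlim_at)
  have quot: "(\<lambda>m. (1 / (s m - t)) *\<^sub>R (f (s m) - f t)) \<longlonglongrightarrow> f'"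
    if "(f has_vector_derivative f') (at t within J)" for f :: "real \<Rightarrow> 'b::real_normed_vector" and f'
    using filterlim_compose[OF that[unfolded has_vector_derivative_iff_quotient] sub] .
  have "\<exists>E. \<forall>m. diagonalizes (E m) (lam (s m)) (A (s m))"
    using dg s by (intro choice) blast
  then obtain E where E: "\<And>m. diagonalizes (E m) (lam (s m)) (A (s m))" by blast
  have h: "s m - t \<noteq> 0" "(\<lambda>m. s m - t) \<longlonglongrightarrow> 0" for m
    using s by (auto simp: LIM_zero)
  from perturbation_subsequence[OF E h quot[OF A]] obtain r E0 a b where
    r: "strict_mono r" and E0: "first_order_data E0 a b (A t) B"
    and a: "(\<lambda>m. lam (s (r m))) \<longlonglongrightarrow> a"
    and b: "(\<lambda>m. (1 / (s (r m) - t)) *\<^sub>R (lam (s (r m)) - a)) \<longlonglongrightarrow> b"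
    by (auto simp: o_def)
  have "(lam \<longlongrightarrow> lam t) (at t within J)"
    using has_vector_derivative_continuous[OF lam] by (simp add: continuous_within)
  from filterlim_compose[OF this sub] have "(\<lambda>m. lam (s m)) \<longlonglongrightarrow> lam t" .
  from LIMSEQ_subseq_LIMSEQ[OF this r] a have at: "a = lam t"
    using LIMSEQ_unique by (auto simp: o_def)
  have bl: "b = lam'"
    using LIMSEQ_subseq_LIMSEQ[OF quot[OF lam] r] b LIMSEQ_unique by (auto simp: o_def at)
  have dg0: "diagonalizes E0 a (A t)"
    and EB: "\<And>i. E0 i ** B ** E0 i = b $ i *\<^sub>R E0 i"
    using E0 by (auto simp: first_order_data_def)
  have rE: "resolution E0" using dg0 by (simp add: diagonalizes_def)
  note R = resolutionD[OF rE]
  have "b $ i = B \<bullet> E0 i" for i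
  proof -
    have "b $ i = Re (trace (E0 i ** B ** E0 i))"
      by (simp add: EB trace_scaleR R(4))
    also have "trace (E0 i ** B ** E0 i) = trace (B ** (E0 i ** E0 i))"
      by (metis matrix_mul_assoc trace_mul_sym)
    finally show ?thesis by (simp add: R inner_eq_Re_trace)
  qed
  then show ?thesis using dg0 at bl by auto
qed


text \<open>At each \<open>s\<close> the eigenvalues are matched as well as possible with the
  prediction \<open>a + (s - t) *\<^sub>R b\<close>. If the error were not of smaller order than
  \<open>s - t\<close>, a bad sequence of times would produce first order data again; these are a
  permutation of \<open>a\<close> and \<open>b\<close>, which yields a better matching.\<close>

lemma pointwise_differentiable_rearrangement:
  fixes A :: "real \<Rightarrow> complex ^ 'n ^ 'n" and lam :: "real \<Rightarrow> real ^ 'n"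
  assumes dg: "\<And>s. \<exists>E. diagonalizes E (lam s) (A s)"
    and A: "(A has_vector_derivative B) (at t)"
  shows "\<exists>p nu'. (\<forall>s. p s permutes UNIV) \<and>
           ((\<lambda>s. \<chi> i. lam s $ p s i) has_vector_derivative nu') (at t)"
proof -
  have quot: "(\<lambda>m. (1 / (s m - t)) *\<^sub>R (A (s m) - A t)) \<longlonglongrightarrow> B"
    if "\<And>m. s m \<noteq> t" "s \<longlonglongrightarrow> t" for s :: "nat \<Rightarrow> real"
    using filterlim_compose[OF A[unfolded has_vector_derivative_iff_quotient], of s sequentially] that
    by (simp add: filterlim_at)
  obtain E where E: "\<And>s. diagonalizes (E s) (lam s) (A s)"
    using dg by metis
  have sub: "\<exists>r E0 a b. strict_mono r \<and> first_order_data E0 a b (A t) B \<and>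
      (\<lambda>m. (1 / (s (r m) - t)) *\<^sub>R (lam (s (r m)) - a)) \<longlonglongrightarrow> b"
    if s: "\<And>m. s m \<noteq> t" "s \<longlonglongrightarrow> t" for s :: "nat \<Rightarrow> real"
    using perturbation_subsequence[of "\<lambda>m. E (s m)" "\<lambda>m. lam (s m)" "\<lambda>m. A (s m)" "\<lambda>m. s m - t" "A t" B,
        OF E _ _ quot[OF s]] s by (auto simp: LIM_zero)
  have "(\<lambda>m. t + 1 / real (Suc m)) \<longlonglongrightarrow> t + 0"
    by (intro tendsto_intros LIMSEQ_Suc lim_1_over_n)
  from sub[OF _ this[simplified]] obtain E0 a b where E0: "first_order_data E0 a b (A t) B"
    by auto
  define cost where "cost p s = (\<Sum>i\<in>UNIV. \<bar>lam s $ p i - a $ i - (s - t) * b $ i\<bar>)" for p s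
  let ?P = "{p :: 'n \<Rightarrow> 'n. p permutes UNIV}"
  have fin: "finite ?P" by (intro finite_permutations) auto
  have ne: "?P \<noteq> {}" using permutes_id by blast
  define p where "p s = arg_min_on (\<lambda>p. cost p s) ?P" for s
  have p: "p s permutes UNIV" "q permutes UNIV \<Longrightarrow> cost (p s) s \<le> cost q s" for s q
  proof -
    show "p s permutes UNIV"
      using arg_min_if_finite(1)[OF fin ne, of "\<lambda>p. cost p s"] unfolding p_def mem_Collect_eq .
    show "cost (p s) s \<le> cost q s" if "q permutes UNIV"
      unfolding p_def by (rule arg_min_least[OF fin ne]) (use that in simp)
  qed
  \<comment> \<open>With zero derivative the uniqueness lemma compares the eigenvalues of
    \<open>A t\<close> alone; hence the optimal matching at \<open>s = t\<close> has cost 0.\<close>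
  have "first_order_data E0 a 0 (A t) 0" "first_order_data (E t) (lam t) 0 (A t) 0"
    using E0 E by (simp_all add: first_order_data_def)
  from first_order_data_unique[OF this] obtain q where "q permutes UNIV" "\<And>i. lam t $ q i = a $ i"
    by auto
  then have "cost (p t) t \<le> 0"
    using p(2)[of q t] by (simp add: cost_def)
  then have "cost (p t) t = 0"
    by (intro antisym) (auto simp: cost_def intro: sum_nonneg)
  then have pt: "lam t $ p t i = a $ i" for i
    by (simp add: cost_def sum_nonneg_eq_0_iff)
  have cost_lim: "((\<lambda>s. cost (p s) s / \<bar>s - t\<bar>) \<longlongrightarrow> 0) (at t)"
  proof (rule tendstoI, rule ccontr)
    fix e :: real assume e: "e > 0"
    assume "\<not> (\<forall>\<^sub>F s in at t. dist (cost (p s) s / \<bar>s - t\<bar>) 0 < e)"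
    then have ne: "\<exists>s. s \<noteq> t \<and> dist s t < d \<and> \<not> dist (cost (p s) s / \<bar>s - t\<bar>) 0 < e" if "d > 0" for d
      unfolding eventually_at using that by blast
    have c0: "0 \<le> cost (p s) s" for s
      unfolding cost_def by (intro sum_nonneg) simp
    have "\<exists>s. s \<noteq> t \<and> \<bar>s - t\<bar> < 1 / real (Suc m) \<and> cost (p s) s / \<bar>s - t\<bar> \<ge> e" for m
      using ne[of "1 / real (Suc m)"] c0 by (fastforce simp: dist_real_def not_less)
    then obtain s where s: "\<And>m. s m \<noteq> t" "\<And>m. \<bar>s m - t\<bar> < 1 / real (Suc m)"
        "\<And>m. cost (p (s m)) (s m) / \<bar>s m - t\<bar> \<ge> e"
      by metis
    have "s \<longlonglongrightarrow> t"
    proof (rule LIM_zero_cancel, rule Lim_null_comparison)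
      show "\<forall>\<^sub>F m in sequentially. norm (s m - t) \<le> 1 / real (Suc m)"
        using s(2) by (intro always_eventually allI) (simp add: less_imp_le)
      show "(\<lambda>m. 1 / real (Suc m)) \<longlonglongrightarrow> 0"
        by (rule LIMSEQ_Suc[OF lim_1_over_n])
    qed
    from sub[OF s(1) this] obtain r E1 a' b' where r: "strict_mono r"
      and E1: "first_order_data E1 a' b' (A t) B"
      and lim: "(\<lambda>m. (1 / (s (r m) - t)) *\<^sub>R (lam (s (r m)) - a')) \<longlonglongrightarrow> b'"
      by blast
    from first_order_data_unique[OF E0 E1] obtain q
      where q: "q permutes UNIV" "\<And>i. a' $ q i = a $ i" "\<And>i. b' $ q i = b $ i" by blast
    have "cost q (s (r m)) / \<bar>s (r m) - t\<bar> =
        (\<Sum>i\<in>UNIV. \<bar>((1 / (s (r m) - t)) *\<^sub>R (lam (s (r m)) - a')) $ q i - b' $ q i\<bar>)" for m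
      unfolding cost_def sum_divide_distrib
      by (intro sum.cong refl)
         (use s(1)[of "r m"] in \<open>simp add: q abs_divide[symmetric] diff_divide_distrib\<close>)
    moreover have "(\<lambda>m. \<Sum>i\<in>UNIV. \<bar>((1 / (s (r m) - t)) *\<^sub>R (lam (s (r m)) - a')) $ q i - b' $ q i\<bar>)
        \<longlonglongrightarrow> (\<Sum>i\<in>UNIV. \<bar>b' $ q i - b' $ q i\<bar>)"
      by (intro tendsto_intros lim)
    ultimately have "(\<lambda>m. cost q (s (r m)) / \<bar>s (r m) - t\<bar>) \<longlonglongrightarrow> 0" by simp
    from order_tendstoD(2)[OF this e] obtain m where m: "cost q (s (r m)) / \<bar>s (r m) - t\<bar> < e"
      by (auto simp: eventually_sequentially)
    have "e \<le> cost (p (s (r m))) (s (r m)) / \<bar>s (r m) - t\<bar>" by (rule s)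
    also have "\<dots> \<le> cost q (s (r m)) / \<bar>s (r m) - t\<bar>"
      by (intro divide_right_mono p(2) q) auto
    finally show False using m by simp
  qed
  have "((\<lambda>s. (1 / (s - t)) *\<^sub>R ((\<chi> i. lam s $ p s i) - (\<chi> i. lam t $ p t i)) - b) \<longlongrightarrow> 0) (at t)"
  proof (rule Lim_null_comparison[OF _ cost_lim], rule eventually_at_filter[THEN iffD2], rule always_eventually, intro allI impI)
    fix s assume s: "s \<noteq> t"
    let ?v = "(1 / (s - t)) *\<^sub>R ((\<chi> i. lam s $ p s i) - (\<chi> i. lam t $ p t i)) - b"
    have "norm ?v \<le> (\<Sum>i\<in>UNIV. \<bar>?v $ i\<bar>)" by (rule norm_le_l1_cart)
    also have "\<dots> = cost (p s) s / \<bar>s - t\<bar>"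
      unfolding cost_def sum_divide_distrib
      by (intro sum.cong refl) (use s in \<open>simp add: pt abs_divide[symmetric] diff_divide_distrib\<close>)
    finally show "norm ?v \<le> cost (p s) s / \<bar>s - t\<bar>" .
  qed
  then have "((\<lambda>s. \<chi> i. lam s $ p s i) has_vector_derivative b) (at t)"
    unfolding has_vector_derivative_iff_quotient by (rule LIM_zero_cancel)
  with p(1) show ?thesis by blast
qed

section \<open>Images under derivatives and Stieltjes measures\<close>

lemma outer_measure_of_subadditive:
  assumes "\<And>n. A n \<subseteq> space M"
  shows "outer_measure_of M (\<Union>n::nat. A n) \<le> (\<Sum>n. outer_measure_of M (A n))"
proof -
  have "\<forall>n. \<exists>E\<in>sets M. A n \<subseteq> E \<and> outer_measure_of M (A n) = emeasure M E"
    using outer_measure_of_attain[OF assms] by blast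
  then obtain E where E: "\<And>n. E n \<in> sets M" "\<And>n. A n \<subseteq> E n"
      "\<And>n. outer_measure_of M (A n) = emeasure M (E n)"
    by metis
  have "outer_measure_of M (\<Union>n. A n) \<le> outer_measure_of M (\<Union>n. E n)"
    using E(2) by (intro outer_measure_of_mono) blast
  also have "\<dots> = emeasure M (\<Union>n. E n)" using E(1) by (intro outer_measure_of_eq) auto
  also have "\<dots> \<le> (\<Sum>n. emeasure M (E n))"
    using E(1) by (intro emeasure_subadditive_countably) auto
  finally show ?thesis by (simp add: E)
qed

lemma open_real_disjoint_intervals:
  fixes W :: "real set"
  assumes "open W"
  obtains C :: "nat \<Rightarrow> real set" where "\<And>n. open (C n)" "\<And>n. connected (C n)"
    "disjoint_family C" "(\<Union>n. C n) = W"
proof -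
  let ?D = "components W"
  have op: "open C" if "C \<in> ?D" for C using open_components[OF assms that] .
  have disj: "disjoint ?D"
    using components_nonoverlap unfolding disjoint_def by blast
  have cnt: "countable ?D"
    by (rule countable_disjoint_open_subsets) (use op disj in \<open>auto simp: pairwise_def disjnt_def disjoint_def\<close>)
  define C where "C n = (if n \<in> to_nat_on ?D ` ?D then from_nat_into ?D n else {})" for n
  have C: "C n \<in> ?D \<or> C n = {}" for n
    using cnt by (auto simp: C_def)
  show thesis
  proof
    show "open (C n)" "connected (C n)" for n
      using C[of n] op in_components_connected[of "C n" W] by auto
    show "disjoint_family C"
      unfolding disjoint_family_on_def
    proof (intro ballI impI)
      fix m n :: nat assume "m \<noteq> n"
      show "C m \<inter> C n = {}"
      proof (cases "m \<in> to_nat_on ?D ` ?D \<and> n \<in> to_nat_on ?D ` ?D")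
        case True
        then obtain X Y where X: "X \<in> ?D" "m = to_nat_on ?D X" and Y: "Y \<in> ?D" "n = to_nat_on ?D Y"
          by blast
        with \<open>m \<noteq> n\<close> have "X \<noteq> Y" by auto
        then show ?thesis
          using X Y cnt disj by (auto simp: C_def disjoint_def)
      qed (auto simp: C_def)
    qed
    have "(\<Union>n. C n) = \<Union>?D"
    proof safe
      fix x X assume "x \<in> X" "X \<in> ?D"
      then show "x \<in> (\<Union>n. C n)"
        using cnt by (intro UN_I[of "to_nat_on ?D X"]) (auto simp: C_def)
    qed (use C in blast)
    then show "(\<Union>n. C n) = W" by simp
  qed
qed

text \<open>By outer regularity it suffices to bound open sets, and these are countable disjoint
  unions of open intervals. \<open>\<rho>\<close> is a mere set function because it will stand both
  for the outer measure of an image and for the outer measure of a Stieltjes measure.\<close>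

lemma outer_measure_le_measure:
  fixes \<rho> :: "real set \<Rightarrow> ennreal"
  assumes mono: "\<And>A B. A \<subseteq> B \<Longrightarrow> \<rho> A \<le> \<rho> B"
    and sub: "\<And>A. \<rho> (\<Union>n::nat. A n) \<le> (\<Sum>n. \<rho> (A n))"
    and M: "sets M = sets borel" "emeasure M UNIV \<noteq> \<infinity>"
    and Q: "open Q" and le: "\<And>C. open C \<Longrightarrow> connected C \<Longrightarrow> C \<subseteq> Q \<Longrightarrow> \<rho> C \<le> emeasure M C"
    and E: "E \<in> sets borel" "E \<subseteq> Q"
  shows "\<rho> E \<le> emeasure M E"
proof -
  have sp: "space M = UNIV" using sets_eq_imp_space_eq[OF M(1)] by simp
  have "\<rho> E \<le> emeasure M U" if U: "E \<subseteq> U" "open U" for U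
  proof -
    have UQ: "open (U \<inter> Q)" using U Q by auto
    obtain C where C: "\<And>n. open (C n)" "\<And>n. connected (C n)" "disjoint_family C"
        "(\<Union>n::nat. C n) = U \<inter> Q"
      using open_real_disjoint_intervals[OF UQ] by metis
    have "\<rho> E \<le> \<rho> (\<Union>n. C n)" using U E by (intro mono) (auto simp: C)
    also have "\<dots> \<le> (\<Sum>n. \<rho> (C n))" by (rule sub)
    also have "\<dots> \<le> (\<Sum>n. emeasure M (C n))"
      using C by (intro suminf_le le) auto
    also have "\<dots> = emeasure M (\<Union>n. C n)"
      using C by (intro suminf_emeasure) (auto simp: M)
    also have "\<dots> \<le> emeasure M U"
      unfolding C(4) using U by (intro emeasure_mono) (auto simp: M)
    finally show ?thesis .
  qed
  note le_open = this
  have "emeasure M (space M) \<noteq> \<infinity>" using M(2) by (simp only: sp not_False_eq_True)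
  note reg = outer_regular[OF M(1) this E(1)]
  have "\<rho> E \<le> (INF U \<in> {U. E \<subseteq> U \<and> open U}. emeasure M U)"
  proof (rule INF_greatest)
    fix U assume "U \<in> {U. E \<subseteq> U \<and> open U}"
    then have "E \<subseteq> U" "open U" by auto
    then show "\<rho> E \<le> emeasure M U" by (rule le_open)
  qed
  then show ?thesis by (rule ord_le_eq_trans[OF _ reg[symmetric]])
qed

text \<open>The mass of an open interval under the Stieltjes measure of a monotone function is the
  supremum of the increments in it; this form is insensitive to the normalization at jumps.\<close>

lemma stieltjes_measure_exists:
  fixes G :: "real \<Rightarrow> real"
  assumes mono: "mono G" and lo: "\<And>t. t \<le> a \<Longrightarrow> G t = G a" and hi: "\<And>t. b \<le> t \<Longrightarrow> G t = G b"
  obtains m where "sets m = sets borel" "emeasure m UNIV \<le> ennreal (G b - G a)"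
    "\<And>C p q. open C \<Longrightarrow> connected C \<Longrightarrow> p \<in> C \<Longrightarrow> q \<in> C \<Longrightarrow> p \<le> q \<Longrightarrow> ennreal (G q - G p) \<le> emeasure m C"
    "\<And>C c. open C \<Longrightarrow> connected C \<Longrightarrow>
        (\<And>p q. p \<in> C \<Longrightarrow> q \<in> C \<Longrightarrow> p \<le> q \<Longrightarrow> ennreal (G q - G p) \<le> c) \<Longrightarrow> emeasure m C \<le> c"
proof -
  \<comment> \<open>The right-continuous version of \<open>G\<close>, as required for
    \<open>interval_measure\<close>; \<open>GF\<close> and \<open>FG\<close> sandwich it between
    values of \<open>G\<close>.\<close>
  define F where "F t = Inf (G ` {t<..})" for t
  have Gm: "G s \<le> G t" if "s \<le> t" for s t using mono that by (rule monoD)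
  have bdd: "bdd_below (G ` {t<..})" for t
    by (intro bdd_belowI[of _ "G t"]) (auto intro: Gm)
  have ne: "G ` {t<..} \<noteq> {}" for t by (auto simp: gt_ex)
  have GF: "G t \<le> F t" for t
    unfolding F_def using ne by (intro cInf_greatest) (auto intro: Gm)
  have FG: "F s \<le> G t" if "s < t" for s t
    unfolding F_def using that by (intro cInf_lower bdd) auto
  have Fm: "F s \<le> F t" if "s \<le> t" for s t
    unfolding F_def using that by (intro cInf_superset_mono ne bdd) auto
  have rc: "continuous (at_right t) F" for t
    unfolding continuous_within
  proof (rule order_tendstoI)
    fix l assume "l < F t"
    then show "\<forall>\<^sub>F s in at_right t. l < F s"
      unfolding eventually_at_right_field by (meson Fm gt_ex less_imp_le order_less_le_trans)
  next
    fix u assume "F t < u"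
    then obtain s where s: "t < s" "G s < u"
      unfolding F_def using cInf_less_iff[OF ne bdd] by auto
    then have "F x < u" if "t < x" "x < s" for x
      using FG[of x s] that by auto
    with s show "\<forall>\<^sub>F s in at_right t. F s < u"
      unfolding eventually_at_right_field by blast
  qed
  define m where "m = interval_measure F"
  have m: "sets m = sets borel" by (simp add: m_def)
  have mI: "emeasure m {p<..q} = ennreal (F q - F p)" if "p \<le> q" for p q
    unfolding m_def using that Fm rc by (intro emeasure_interval_measure_Ioc)
  have fin: "emeasure m UNIV \<le> ennreal (G b - G a)"
  proof -
    have U: "(UNIV :: real set) = (\<Union>n::nat. {- real n<..real n})"
    proof (intro equalityI subsetI)
      fix x :: real
      obtain n :: nat where "\<bar>x\<bar> < real n" using reals_Archimedean2 by blast
      then show "x \<in> (\<Union>n::nat. {- real n<..real n})" by (intro UN_I[of n]) auto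
    qed auto
    have "emeasure m UNIV = (SUP n::nat. emeasure m {- real n<..real n})"
      unfolding U by (intro SUP_emeasure_incseq[symmetric]) (auto simp: incseq_def m)
    also have "\<dots> \<le> ennreal (G b - G a)"
    proof (rule SUP_least)
      fix n :: nat
      have "F (real n) \<le> G (max (real n) b + 1)" by (rule FG) simp
      also have "\<dots> = G b" by (rule hi) simp
      finally have 1: "F (real n) \<le> G b" .
      have "G a = G (min a (- real n))" by (rule lo[symmetric]) simp
      also have "\<dots> \<le> G (- real n)" by (intro Gm) simp
      also have "\<dots> \<le> F (- real n)" by (rule GF)
      finally show "emeasure m {- real n<..real n} \<le> ennreal (G b - G a)"
        using 1 by (subst mI) (auto intro!: ennreal_leI)
    qed
    finally show ?thesis .
  qed
  have low: "ennreal (G q - G p) \<le> emeasure m C"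
    if C: "open C" "connected C" "p \<in> C" "q \<in> C" "p \<le> q" for C p q
  proof -
    obtain e where e: "e > 0" "ball p e \<subseteq> C" using C openE by blast
    \<comment> \<open>Starting to the left of \<open>p\<close>, at a point still in
      \<open>C\<close>, includes the mass of a jump at \<open>p\<close>, which the interval
      \<open>{p<..q}\<close> would miss.\<close>
    define x where "x = p - e / 2"
    have x: "x < p" "x \<in> C" using e by (auto simp: x_def dist_real_def intro!: subsetD[OF e(2)])
    have "{x<..q} \<subseteq> C"
      using connected_contains_Icc[OF C(2) x(2) C(4)] by auto
    have "G q - G p \<le> F q - F x" using GF[of q] FG[OF x(1)] by simp
    then have "ennreal (G q - G p) \<le> emeasure m {x<..q}"
      using x C by (subst mI) (auto intro: ennreal_leI)
    also have "\<dots> \<le> emeasure m C"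
      using \<open>{x<..q} \<subseteq> C\<close> C(1) by (intro emeasure_mono) (auto simp: m)
    finally show ?thesis .
  qed
  have up: "emeasure m C \<le> c"
    if C: "open C" "connected C" and c: "\<And>p q. p \<in> C \<Longrightarrow> q \<in> C \<Longrightarrow> p \<le> q \<Longrightarrow> ennreal (G q - G p) \<le> c" for C c
  proof -
    \<comment> \<open>Inner regularity: a compact part of \<open>C\<close> has room on both sides
      inside \<open>C\<close>, so its mass is at most an increment of \<open>G\<close> between two
      points of \<open>C\<close>.\<close>
    have "emeasure m K \<le> c" if K: "K \<subseteq> C" "compact K" for K
    proof (cases "K = {}")
      case False
      obtain p' where p': "p' \<in> K" "\<And>x. x \<in> K \<Longrightarrow> p' \<le> x"
        using compact_attains_inf[OF K(2) False] by blast
      obtain q' where q': "q' \<in> K" "\<And>x. x \<in> K \<Longrightarrow> x \<le> q'"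
        using compact_attains_sup[OF K(2) False] by blast
      obtain e where e: "e > 0" "ball p' e \<subseteq> C" using C openE p' K by blast
      obtain d where d: "d > 0" "ball q' d \<subseteq> C" using C openE q' K by blast
      have pC: "p' - e / 2 \<in> C" using e by (auto simp: dist_real_def intro!: subsetD[OF e(2)])
      have qC: "q' + d / 2 \<in> C" using d by (auto simp: dist_real_def intro!: subsetD[OF d(2)])
      have pq: "p' \<le> q'" using p' q' by auto
      have "K \<subseteq> {p' - e / 2<..q'}" using p' q' e by fastforce
      then have "emeasure m K \<le> emeasure m {p' - e / 2<..q'}" by (intro emeasure_mono) (auto simp: m)
      also have "\<dots> = ennreal (F q' - F (p' - e / 2))" using pq e by (intro mI) auto
      also have "\<dots> \<le> ennreal (G (q' + d / 2) - G (p' - e / 2))"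
        using FG[of q' "q' + d / 2"] GF[of "p' - e / 2"] d by (intro ennreal_leI) auto
      also have "\<dots> \<le> c" using pC qC pq d e by (intro c) auto
      finally show ?thesis .
    qed simp
    moreover have "emeasure m C = (SUP K \<in> {K. K \<subseteq> C \<and> compact K}. emeasure m K)"
      by (rule inner_regular) (use fin C in \<open>auto simp: m m_def top_unique\<close>)
    ultimately show ?thesis by (auto intro: SUP_least)
  qed
  show thesis by (rule that[OF m fin low up])
qed

lemma outer_measure_le_diameter:
  fixes S :: "real set"
  assumes "\<And>x y. x \<in> S \<Longrightarrow> y \<in> S \<Longrightarrow> x \<le> y \<Longrightarrow> ennreal (y - x) \<le> c"
  shows "outer_measure_of lborel S \<le> c"
proof (cases "S = {} \<or> c = \<infinity>")
  case False
  then obtain r where r: "c = ennreal r" "0 \<le> r" by (cases c) auto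
  obtain x0 where x0: "x0 \<in> S" using False by auto
  have d: "y - x \<le> r" if "x \<in> S" "y \<in> S" for x y
    using assms[OF that] r by (cases "x \<le> y") auto
  have bdd: "bdd_below S" "bdd_above S"
    using d[OF _ x0] d[OF x0] by (auto intro!: bdd_belowI[of _ "x0 - r"] bdd_aboveI[of _ "x0 + r"] simp: algebra_simps)
  have "Sup S \<le> Inf S + r"
  proof (rule cSup_least)
    fix y assume y: "y \<in> S"
    have "y - r \<le> Inf S" using x0 d[OF _ y] by (intro cInf_greatest) (auto simp: algebra_simps)
    then show "y \<le> Inf S + r" by simp
  qed (use x0 in auto)
  have "S \<subseteq> {Inf S..Sup S}" using bdd by (auto intro: cInf_lower cSup_upper)
  then have "outer_measure_of lborel S \<le> outer_measure_of lborel {Inf S..Sup S}"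
    by (rule outer_measure_of_mono)
  also have "\<dots> \<le> c"
    using \<open>Sup S \<le> Inf S + r\<close> r by (auto simp: outer_measure_of_eq emeasure_lborel_Icc_eq intro: ennreal_leI)
  finally show ?thesis .
qed auto

text \<open>The image of an open interval has diameter at most the mass of this interval;
  \<open>outer_measure_le_measure\<close> carries the comparison over to Borel sets.\<close>

lemma outer_measure_image_le:
  fixes \<phi> :: "real \<Rightarrow> real"
  assumes M: "sets M = sets borel" "emeasure M UNIV \<noteq> \<infinity>"
    and le: "\<And>C p q. open C \<Longrightarrow> connected C \<Longrightarrow> p \<in> C \<Longrightarrow> q \<in> C \<Longrightarrow> p \<le> q \<Longrightarrow> ennreal \<bar>\<phi> q - \<phi> p\<bar> \<le> emeasure M C"
    and E: "E \<in> sets borel"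
  shows "outer_measure_of lborel (\<phi> ` E) \<le> emeasure M E"
proof (rule outer_measure_le_measure[of "\<lambda>X. outer_measure_of lborel (\<phi> ` X)", OF _ _ M open_UNIV _ E subset_UNIV])
  show "outer_measure_of lborel (\<phi> ` A) \<le> outer_measure_of lborel (\<phi> ` B)" if "A \<subseteq> B" for A B
    using that by (intro outer_measure_of_mono) auto
  show "outer_measure_of lborel (\<phi> ` (\<Union>n. A n)) \<le> (\<Sum>n. outer_measure_of lborel (\<phi> ` A n))" for A :: "nat \<Rightarrow> real set"
    unfolding image_UN by (intro outer_measure_of_subadditive) simp
  fix C :: "real set" assume C: "open C" "connected C"
  show "outer_measure_of lborel (\<phi> ` C) \<le> emeasure M C"
  proof (rule outer_measure_le_diameter)
    fix x y assume "x \<in> \<phi> ` C" "y \<in> \<phi> ` C" "x \<le> y"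
    then obtain p q where pq: "p \<in> C" "q \<in> C" "x = \<phi> p" "y = \<phi> q" by auto
    have "ennreal (y - x) \<le> ennreal \<bar>\<phi> q - \<phi> p\<bar>" using pq by (intro ennreal_leI) auto
    also have "\<dots> \<le> emeasure M C"
      using le[OF C pq(1,2)] le[OF C pq(2,1)] by (cases "p \<le> q") (auto simp: abs_minus_commute)
    finally show "ennreal (y - x) \<le> emeasure M C" .
  qed
qed

text \<open>Subtracting the slope \<open>c\<close> leaves a function with negative derivative at
  \<open>s\<close> and positive derivative at \<open>t\<close>, so its minimum is interior, and
  there \<open>f\<close> takes the value \<open>c\<close>. The opposite order of the values follows
  by a change of sign.\<close>

lemma derivative_Darboux:
  fixes g f :: "real \<Rightarrow> real"
  assumes der: "\<And>x. x \<in> {s..t} \<Longrightarrow> (g has_vector_derivative f x) (at x within {s..t})" and "s \<le> t"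
  shows "closed_segment (f s) (f t) \<subseteq> f ` {s..t}"
proof -
  have main: "c \<in> f ` {s..t}"
    if der: "\<And>x. x \<in> {s..t} \<Longrightarrow> (g has_vector_derivative f x) (at x within {s..t})"
      and c: "f s < c" "c < f t" for g f :: "real \<Rightarrow> real" and c
  proof -
    have st: "s < t" using c \<open>s \<le> t\<close> by (cases "s = t") auto
    define h where "h x = g x - c * x" for x
    have dh: "(h has_real_derivative f x - c) (at x within {s..t})" if "x \<in> {s..t}" for x
      unfolding h_def using der[OF that]
      by (auto intro!: derivative_eq_intros simp: has_real_derivative_iff_has_vector_derivative)
    have "continuous_on {s..t} h"
      unfolding continuous_on_eq_continuous_within using DERIV_continuous[OF dh] by blast
    then obtain x where x: "x \<in> {s..t}" and min: "\<And>y. y \<in> {s..t} \<Longrightarrow> h x \<le> h y"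
      using continuous_attains_inf[of "{s..t}" h] st by auto
    have "x \<noteq> s"
    proof
      assume "x = s"
      from has_real_derivative_neg_dec_right[OF dh[of s]] c st
      obtain d where d: "d > 0" "\<And>k. k > 0 \<Longrightarrow> s + k \<in> {s..t} \<Longrightarrow> k < d \<Longrightarrow> h s > h (s + k)" by auto
      define k where "k = min (d / 2) (t - s)"
      have "k > 0" "k < d" "s + k \<in> {s..t}" using d st by (auto simp: k_def)
      with d(2)[of k] min[of "s + k"] \<open>x = s\<close> show False by auto
    qed
    moreover have "x \<noteq> t"
    proof
      assume "x = t"
      from has_real_derivative_pos_inc_left[OF dh[of t]] c st
      obtain d where d: "d > 0" "\<And>k. k > 0 \<Longrightarrow> t - k \<in> {s..t} \<Longrightarrow> k < d \<Longrightarrow> h t > h (t - k)" by auto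
      define k where "k = min (d / 2) (t - s)"
      have "k > 0" "k < d" "t - k \<in> {s..t}" using d st by (auto simp: k_def)
      with d(2)[of k] min[of "t - k"] \<open>x = t\<close> show False by auto
    qed
    ultimately have xi: "x \<in> {s<..<t}" using x by auto
    have "(h has_real_derivative f x - c) (at x)"
      using dh[OF x] xi at_within_interior[of x "{s..t}"] by simp
    then have "f x - c = 0"
      by (rule DERIV_local_min[where d = "min (x - s) (t - x)"]) (use xi min in \<open>auto simp: abs_if split: if_splits\<close>)
    then show ?thesis using x by force
  qed
  show ?thesis
  proof
    fix c assume c: "c \<in> closed_segment (f s) (f t)"
    consider "c = f s" | "c = f t" | "f s < c" "c < f t" | "f t < c" "c < f s"
      using c by (fastforce simp: closed_segment_eq_real_ivl split: if_splits)
    then show "c \<in> f ` {s..t}"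
    proof cases
      case 3
      then show ?thesis using main[OF der] by blast
    next
      case 4
      have "- c \<in> (\<lambda>x. - f x) ` {s..t}"
        by (rule main[of "\<lambda>x. - g x"]) (use 4 der in \<open>auto intro!: derivative_intros\<close>)
      then show ?thesis by force
    qed (use \<open>s \<le> t\<close> in auto)
  qed
qed

text \<open>The values between \<open>f s\<close> and \<open>f t\<close> are covered by the image of
  the countable set \<open>T\<close>, which is null, and the images of the pieces \<open>E i\<close>
  under \<open>\<phi> i\<close>. Each piece contributes at most the mass of \<open>{s..t}\<close>,
  hence the factor \<open>card I\<close>. The Darboux property takes the place of continuity of
  \<open>f\<close>, which is not known at this stage.\<close>

lemma countable_selection_bound:
  fixes f :: "real \<Rightarrow> real"
  assumes darboux: "closed_segment (f s) (f t) \<subseteq> f ` {s..t}"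
    and T: "countable T" and I: "finite I" and cover: "{s..t} \<subseteq> T \<union> (\<Union>i\<in>I. E i)"
    and E: "\<And>i. i \<in> I \<Longrightarrow> E i \<in> sets borel" and f: "\<And>i x. i \<in> I \<Longrightarrow> x \<in> E i \<Longrightarrow> f x = \<phi> i x"
    and N: "sets N = sets borel"
    and le: "\<And>i X. i \<in> I \<Longrightarrow> X \<in> sets borel \<Longrightarrow> X \<subseteq> E i \<Longrightarrow> outer_measure_of lborel (\<phi> i ` X) \<le> emeasure N X"
  shows "ennreal \<bar>f t - f s\<bar> \<le> of_nat (card I) * emeasure N {s..t}"
proof -
  let ?\<mu> = "outer_measure_of (lborel :: real measure)"
  have fin_sub: "?\<mu> (\<Union>i\<in>I. A i) \<le> (\<Sum>i\<in>I. ?\<mu> (A i))" for A :: "'a \<Rightarrow> real set"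
    using I
  proof (induction I rule: finite_induct)
    case (insert i I)
    \<comment> \<open>A binary union, padded with empty sets to a sequence.\<close>
    let ?B = "\<lambda>n::nat. if n = 0 then A i else if n = 1 then (\<Union>i\<in>I. A i) else {}"
    have "(\<Union>i\<in>insert i I. A i) = (\<Union>n. ?B n)"
      by (auto split: if_splits intro: exI[of _ 0] exI[of _ 1])
    then have "?\<mu> (\<Union>i\<in>insert i I. A i) \<le> (\<Sum>n. ?\<mu> (?B n))"
      using outer_measure_of_subadditive[of ?B lborel] by simp
    also have "\<dots> = (\<Sum>n\<in>{0,1}. ?\<mu> (?B n))"
      by (rule suminf_finite) auto
    also have "\<dots> = ?\<mu> (A i) + ?\<mu> (\<Union>i\<in>I. A i)" by simp
    also have "\<dots> \<le> ?\<mu> (A i) + (\<Sum>i\<in>I. ?\<mu> (A i))"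
      by (intro add_left_mono insert.IH)
    finally show ?case using insert by simp
  qed simp
  have T0: "?\<mu> (f ` T) = 0"
  proof -
    have "f ` T \<in> null_sets lborel" using T by (intro countable_imp_null_set_lborel countable_image)
    then show ?thesis using outer_measure_of_eq[of "f ` T" lborel] by (auto simp: null_sets_def)
  qed
  let ?J = "insert None (Some ` I)"
  let ?X = "\<lambda>j. case j of None \<Rightarrow> f ` T | Some i \<Rightarrow> \<phi> i ` (E i \<inter> {s..t})"
  have "ennreal \<bar>f t - f s\<bar> = emeasure lborel (closed_segment (f s) (f t))"
    by (auto simp: closed_segment_eq_real_ivl emeasure_lborel_Icc_eq)
  also have "\<dots> = ?\<mu> (closed_segment (f s) (f t))"
    by (rule outer_measure_of_eq[symmetric]) (simp add: closed_segment_eq_real_ivl)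
  also have "\<dots> \<le> ?\<mu> (f ` T \<union> (\<Union>i\<in>I. \<phi> i ` (E i \<inter> {s..t})))"
  proof (rule outer_measure_of_mono)
    show "closed_segment (f s) (f t) \<subseteq> f ` T \<union> (\<Union>i\<in>I. \<phi> i ` (E i \<inter> {s..t}))"
    proof
      fix c assume "c \<in> closed_segment (f s) (f t)"
      then obtain x where x: "x \<in> {s..t}" "c = f x" using darboux by blast
      with cover consider "x \<in> T" | i where "i \<in> I" "x \<in> E i" by blast
      then show "c \<in> f ` T \<union> (\<Union>i\<in>I. \<phi> i ` (E i \<inter> {s..t}))"
      proof cases
        case 2
        then have "c = \<phi> i x" using f x by simp
        with 2 x show ?thesis by blast
      qed (use x in auto)
    qed
  qed
  also have "\<dots> \<le> ?\<mu> (f ` T) + ?\<mu> (\<Union>i\<in>I. \<phi> i ` (E i \<inter> {s..t}))"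
  proof -
    let ?B = "\<lambda>n::nat. if n = 0 then f ` T else if n = 1 then (\<Union>i\<in>I. \<phi> i ` (E i \<inter> {s..t})) else {}"
    have "f ` T \<union> (\<Union>i\<in>I. \<phi> i ` (E i \<inter> {s..t})) = (\<Union>n. ?B n)"
      by (auto split: if_splits intro: exI[of _ 0] exI[of _ 1])
    then have "?\<mu> (f ` T \<union> (\<Union>i\<in>I. \<phi> i ` (E i \<inter> {s..t}))) \<le> (\<Sum>n. ?\<mu> (?B n))"
      using outer_measure_of_subadditive[of ?B lborel] by simp
    also have "\<dots> = (\<Sum>n\<in>{0,1}. ?\<mu> (?B n))"
      by (rule suminf_finite) auto
    finally show ?thesis by simp
  qed
  also have "\<dots> \<le> (\<Sum>i\<in>I. ?\<mu> (\<phi> i ` (E i \<inter> {s..t})))"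
    using fin_sub[of "\<lambda>i. \<phi> i ` (E i \<inter> {s..t})"] by (simp add: T0)
  also have "\<dots> \<le> (\<Sum>i\<in>I. emeasure N {s..t})"
  proof (rule sum_mono)
    fix i assume i: "i \<in> I"
    have "?\<mu> (\<phi> i ` (E i \<inter> {s..t})) \<le> emeasure N (E i \<inter> {s..t})"
      using E[OF i] by (intro le[OF i]) auto
    also have "\<dots> \<le> emeasure N {s..t}" by (intro emeasure_mono) (auto simp: N)
    finally show "?\<mu> (\<phi> i ` (E i \<inter> {s..t})) \<le> emeasure N {s..t}" .
  qed
  also have "\<dots> = of_nat (card I) * emeasure N {s..t}" by simp
  finally show ?thesis .
qed

section \<open>Densities of absolutely continuous measures and functions\<close>

lemma finite_ac_measure_density:
  assumes N: "sets N = sets borel" "emeasure N UNIV \<noteq> \<infinity>" "null_sets lborel \<subseteq> null_sets N"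
  obtains h :: "real \<Rightarrow> real" where "\<And>x. 0 \<le> h x" "h absolutely_integrable_on UNIV"
    "\<And>X. X \<in> sets borel \<Longrightarrow> integral X h = measure N X"
proof -
  have "absolutely_continuous lborel N" using N by (simp add: absolutely_continuous_def)
  from sigma_finite_measure.Radon_Nikodym[OF sigma_finite_lborel this] obtain h0 where h0: "h0 \<in> borel_measurable borel" "density lborel h0 = N"
    using N by auto
  have Nh: "emeasure N X = (\<integral>\<^sup>+x. h0 x * indicator X x \<partial>lborel)" if "X \<in> sets borel" for X
    using that h0 by (subst h0(2)[symmetric], subst emeasure_density) auto
  have fin: "(\<integral>\<^sup>+x. h0 x \<partial>lborel) \<noteq> \<infinity>"
    using Nh[of UNIV] N by simp
  have ae: "AE x in lborel. h0 x \<noteq> \<infinity>"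
    by (rule nn_integral_PInf_AE) (use h0 fin in auto)
  define h where "h x = enn2real (h0 x)" for x
  have hm [measurable]: "h \<in> borel_measurable borel" unfolding h_def using h0(1) by measurable
  have h_eq: "(\<integral>\<^sup>+x. ennreal (indicator X x * h x) \<partial>lborel) = emeasure N X" if "X \<in> sets borel" for X
    unfolding Nh[OF that]
    by (rule nn_integral_cong_AE) (use ae in eventually_elim, auto simp: h_def indicator_def less_top)
  have h0': "0 \<le> h x" for x by (simp add: h_def)
  have int: "set_integrable lborel X h" if "X \<in> sets borel" for X
    unfolding set_integrable_def
  proof (rule integrableI_nonneg)
    have "(\<integral>\<^sup>+x. ennreal (indicat_real X x *\<^sub>R h x) \<partial>lborel) = emeasure N X" using h_eq[OF that] by simp
    also have "\<dots> \<le> emeasure N UNIV" by (rule emeasure_mono) (auto simp: N)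
    also have "\<dots> < \<infinity>" using N(2) by (simp add: less_top)
    finally show "(\<integral>\<^sup>+x. ennreal (indicat_real X x *\<^sub>R h x) \<partial>lborel) < \<infinity>" .
  qed (use that h0' in auto)
  have hX: "integral X h = measure N X" if X: "X \<in> sets borel" for X
  proof -
    have "integral X h = (LINT x:X|lborel. h x)"
      using set_borel_integral_eq_integral(2)[OF int[OF X]] by simp
    also have "\<dots> = enn2real (\<integral>\<^sup>+x. ennreal (indicat_real X x *\<^sub>R h x) \<partial>lborel)"
      unfolding set_lebesgue_integral_def
      by (rule integral_eq_nn_integral) (use X h0' in auto)
    also have "\<dots> = measure N X" using h_eq[OF X] by (simp add: measure_def)
    finally show ?thesis .
  qed
  have "h absolutely_integrable_on UNIV"
    using int[of UNIV] by (simp add: set_integrable_def integrable_completion)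
  with h0' hX show thesis by (intro that) auto
qed

text \<open>The passage from densities back to measures. The function \<open>w\<close> is only
  Lebesgue measurable, so the density is taken over \<open>lebesgue\<close> and the result is pushed
  to the Borel sets by the identity map.\<close>

lemma absolutely_integrable_measure:
  fixes w :: "real \<Rightarrow> real"
  assumes w: "w absolutely_integrable_on {a..b}" "\<And>x. 0 \<le> w x"
  obtains W where "sets W = sets borel" "emeasure W UNIV \<noteq> \<infinity>" "null_sets lborel \<subseteq> null_sets W"
    "\<And>p q. a \<le> p \<Longrightarrow> p \<le> q \<Longrightarrow> q \<le> b \<Longrightarrow> emeasure W {p..q} = ennreal (integral {p..q} w)"
proof -
  define g where "g x = indicat_real {a..b} x * w x" for x
  have gi: "integrable lebesgue g" using w by (simp add: set_integrable_def g_def[abs_def])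
  have gm [measurable]: "g \<in> borel_measurable lebesgue" using gi by auto
  define D where "D = density lebesgue (\<lambda>x. ennreal (g x))"
  define W where "W = distr D borel (\<lambda>x. x)"
  have idm: "(\<lambda>x. x) \<in> D \<rightarrow>\<^sub>M borel" unfolding D_def by (auto simp: measurable_def)
  have W: "emeasure W X = (\<integral>\<^sup>+x. ennreal (g x) * indicator X x \<partial>lebesgue)" if "X \<in> sets borel" for X
  proof -
    have "emeasure W X = emeasure D X"
      unfolding W_def using that idm by (subst emeasure_distr) (auto simp: D_def)
    also have "\<dots> = (\<integral>\<^sup>+x. ennreal (g x) * indicator X x \<partial>lebesgue)"
      unfolding D_def using that by (subst emeasure_density) auto
    finally show ?thesis .
  qed
  have sW: "sets W = sets borel" by (simp add: W_def)
  have pq: "emeasure W {p..q} = ennreal (integral {p..q} w)" if "a \<le> p" "p \<le> q" "q \<le> b" for p q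
  proof -
    have i: "set_integrable lebesgue {p..q} w"
      using w(1) that by (intro set_integrable_subset[OF w(1)]) auto
    have "emeasure W {p..q} = (\<integral>\<^sup>+x. ennreal (indicat_real {p..q} x *\<^sub>R w x) \<partial>lebesgue)"
      unfolding W[of "{p..q}", simplified]
      by (intro nn_integral_cong) (use that in \<open>auto simp: g_def indicator_def\<close>)
    also have "\<dots> = ennreal (LINT x:{p..q}|lebesgue. w x)"
      unfolding set_lebesgue_integral_def
      by (rule nn_integral_eq_integral) (use i w(2) in \<open>auto simp: set_integrable_def\<close>)
    also have "(LINT x:{p..q}|lebesgue. w x) = integral {p..q} w"
      by (rule set_lebesgue_integral_eq_integral(2)[OF i])
    finally show ?thesis .
  qed
  have "emeasure W UNIV = (\<integral>\<^sup>+x. ennreal (g x) \<partial>lebesgue)" using W[of UNIV] by simp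
  also have "\<dots> = ennreal (LINT x|lebesgue. g x)"
    by (rule nn_integral_eq_integral[OF gi]) (use w(2) in \<open>simp add: g_def\<close>)
  finally have fin: "emeasure W UNIV \<noteq> \<infinity>" by simp
  have "null_sets lborel \<subseteq> null_sets W"
  proof
    fix X :: "real set" assume X: "X \<in> null_sets lborel"
    then have Xb: "X \<in> sets borel" by (auto simp: null_sets_def)
    have ae: "AE x in lebesgue. x \<notin> X"
      using X by (intro AE_not_in null_sets_completionI)
    have "(\<integral>\<^sup>+x. ennreal (g x) * indicator X x \<partial>lebesgue) = (\<integral>\<^sup>+x. 0 \<partial>(lebesgue :: real measure))"
    proof (rule nn_integral_cong_AE)
      show "AE x in lebesgue. ennreal (g x) * indicator X x = 0"
        using ae by eventually_elim simp
    qed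
    then show "X \<in> null_sets W" using W[OF Xb] Xb by (simp add: null_sets_def sW)
  qed
  with sW fin pq show thesis by (intro that) auto
qed

text \<open>By Henstock's lemma, on a fine tagged division \<open>u x\<close> times the length of a
  piece is close to the integral of \<open>u\<close> over the piece, with total error below
  \<open>e / 2\<close>; the norms of these integrals are bounded by increments of
  \<open>\<Phi>\<close>, which telescope.\<close>

lemma integral_norm_le_variation:
  fixes u :: "real \<Rightarrow> 'b::euclidean_space"
  assumes u: "u absolutely_integrable_on {a..b}" and ab: "a \<le> b"
    and le: "\<And>s t. a \<le> s \<Longrightarrow> s \<le> t \<Longrightarrow> t \<le> b \<Longrightarrow> norm (integral {s..t} u) \<le> \<Phi> t - \<Phi> s"
  shows "integral {a..b} (\<lambda>x. norm (u x)) \<le> \<Phi> b - \<Phi> a"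
proof (rule field_le_epsilon)
  fix e :: real assume e: "e > 0"
  have ui: "u integrable_on cbox a b" and ni: "(\<lambda>x. norm (u x)) integrable_on cbox a b"
    using u by (auto simp: absolutely_integrable_on_def cbox_interval)
  from Henstock_lemma[OF ui, of "e / 2"] e obtain g1 where g1: "gauge g1"
    "\<And>p. p tagged_partial_division_of cbox a b \<Longrightarrow> g1 fine p \<Longrightarrow>
       (\<Sum>(x,k)\<in>p. norm (measure lborel k *\<^sub>R u x - integral k u)) < e / 2" by auto
  from integrable_integral[OF ni, unfolded has_integral, rule_format, of "e / 2"] e
  obtain g2 where g2: "gauge g2"
    "\<And>p. p tagged_division_of cbox a b \<Longrightarrow> g2 fine p \<Longrightarrow>
       norm ((\<Sum>(x,k)\<in>p. measure lborel k *\<^sub>R norm (u x)) - integral (cbox a b) (\<lambda>x. norm (u x))) < e / 2" by auto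
  from fine_division_exists[OF gauge_Int[OF g1(1) g2(1)], of a b] obtain p
    where "p tagged_division_of cbox a b" "(\<lambda>x. g1 x \<inter> g2 x) fine p" by blast
  then have p: "p tagged_division_of cbox a b" "g1 fine p" "g2 fine p" by (auto simp: fine_Int)
  have 1: "(\<Sum>(x,k)\<in>p. norm (measure lborel k *\<^sub>R u x - integral k u)) < e / 2"
    using g1(2) p tagged_division_of_def by blast
  have "integral {a..b} (\<lambda>x. norm (u x)) \<le> (\<Sum>(x,k)\<in>p. measure lborel k *\<^sub>R norm (u x)) + e / 2"
    using g2(2)[OF p(1,3)] unfolding real_norm_def abs_less_iff cbox_interval by linarith
  also have "(\<Sum>(x,k)\<in>p. measure lborel k *\<^sub>R norm (u x)) \<le>
      (\<Sum>(x,k)\<in>p. norm (measure lborel k *\<^sub>R u x - integral k u) + (\<Phi> (Sup k) - \<Phi> (Inf k)))"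
  proof (rule sum_mono, clarify)
    fix x k assume xk: "(x, k) \<in> p"
    from tagged_division_ofD(4)[OF p(1) xk] obtain s t where st: "k = {s..t}" by (auto simp: cbox_interval)
    have "x \<in> k" "k \<subseteq> {a..b}"
      using tagged_division_ofD(2,3)[OF p(1) xk] by (auto simp: cbox_interval)
    with st have st': "a \<le> s" "s \<le> t" "t \<le> b" by auto
    have "measure lborel k *\<^sub>R norm (u x) = norm (measure lborel k *\<^sub>R u x)" by simp
    also have "\<dots> \<le> norm (measure lborel k *\<^sub>R u x - integral k u) + norm (integral k u)"
      using norm_triangle_ineq[of "measure lborel k *\<^sub>R u x - integral k u" "integral k u"] by simp
    also have "norm (integral k u) \<le> \<Phi> (Sup k) - \<Phi> (Inf k)"
      using le[OF st'] st' st by simp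
    finally show "measure lborel k *\<^sub>R norm (u x) \<le>
        norm (measure lborel k *\<^sub>R u x - integral k u) + (\<Phi> (Sup k) - \<Phi> (Inf k))" by simp
  qed
  also have "\<dots> = (\<Sum>(x,k)\<in>p. norm (measure lborel k *\<^sub>R u x - integral k u)) + (\<Sum>(x,k)\<in>p. \<Phi> (Sup k) - \<Phi> (Inf k))"
    by (simp add: split_def sum.distrib)
  also have "(\<Sum>(x,k)\<in>p. \<Phi> (Sup k) - \<Phi> (Inf k)) = \<Phi> b - \<Phi> a"
    using additive_tagged_division_1[OF ab, of p \<Phi>] p(1) by (simp add: cbox_interval)
  finally show "integral {a..b} (\<lambda>x. norm (u x)) \<le> \<Phi> b - \<Phi> a + e" using 1 by simp
qed

text \<open>The sum of \<open>f\<close> and the distribution function of \<open>N\<close> is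
  monotone, with a Stieltjes measure of at most twice \<open>N\<close>; so this measure has a
  density, and subtracting the density of \<open>N\<close> leaves one for \<open>f\<close>. The norm
  is estimated separately by the variation, so that the factor 2 does not enter the bound.\<close>

lemma absolutely_continuous_density:
  fixes f :: "real \<Rightarrow> real"
  assumes N: "sets N = sets borel" "emeasure N UNIV \<noteq> \<infinity>" "null_sets lborel \<subseteq> null_sets N"
    and ab: "a \<le> b"
    and le: "\<And>s t. a \<le> s \<Longrightarrow> s \<le> t \<Longrightarrow> t \<le> b \<Longrightarrow> ennreal \<bar>f t - f s\<bar> \<le> emeasure N {s..t}"
  obtains u where "u absolutely_integrable_on {a..b}"
    "\<And>s t. a \<le> s \<Longrightarrow> s \<le> t \<Longrightarrow> t \<le> b \<Longrightarrow> integral {s..t} u = f t - f s"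
    "integral {a..b} (\<lambda>x. \<bar>u x\<bar>) \<le> measure N UNIV"
proof -
  have spN: "space N = UNIV" using sets_eq_imp_space_eq[OF N(1)] by simp
  interpret N: finite_measure N by standard (use N spN in simp)
  have le': "\<bar>f t - f s\<bar> \<le> measure N {s..t}" if "a \<le> s" "s \<le> t" "t \<le> b" for s t
    using le[OF that] by (simp add: N.emeasure_eq_measure)
  have pt: "measure N {s} = 0" for s
  proof -
    have "{s} \<in> null_sets lborel" by (intro countable_imp_null_set_lborel) simp
    with N(3) have "{s} \<in> null_sets N" by blast
    then show ?thesis by (simp add: null_sets_def measure_def)
  qed
  have split: "measure N {a..t} - measure N {a..s} = measure N {s..t}" if "a \<le> s" "s \<le> t" for s t
  proof -
    have "{a..t} = {a..s} \<union> {s<..t}" "{s..t} = {s} \<union> {s<..t}" using that by auto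
    moreover have "{a..s} \<inter> {s<..t} = {}" "{s} \<inter> {s<..t} = {}" by auto
    ultimately show ?thesis
      using N.finite_measure_Union[of "{a..s}" "{s<..t}"] N.finite_measure_Union[of "{s}" "{s<..t}"]
      by (simp add: N pt del: Un_insert_left)
  qed
  define cl where "cl t = max a (min b t)" for t
  have cl: "a \<le> cl t" "cl t \<le> b" "s \<le> t \<Longrightarrow> cl s \<le> cl t" "t \<in> {a..b} \<Longrightarrow> cl t = t" for s t
    using ab by (auto simp: cl_def)
  \<comment> \<open>Monotone because the increments of \<open>N\<close> dominate those of
    \<open>f\<close>; clamping makes it constant outside \<open>{a..b}\<close>.\<close>
  define H where "H t = f (cl t) + measure N {a..cl t}" for t
  have H: "0 \<le> H t - H s \<and> H t - H s \<le> 2 * measure N {cl s..cl t}" if "s \<le> t" for s t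
    using le'[OF cl(1) cl(3)[OF that] cl(2)] split[OF cl(1) cl(3)[OF that]] by (auto simp: H_def)
  have cls: "measure N {cl s..cl t} \<le> measure N {s..t}" if "s \<le> t" for s t
  proof (cases "cl s = cl t")
    case True
    then show ?thesis by (simp add: pt)
  next
    case False
    then have "{cl s..cl t} \<subseteq> {s..t}" using that ab by (auto simp: cl_def max_def min_def split: if_splits)
    then show ?thesis by (intro N.finite_measure_mono) (auto simp: N)
  qed
  have H1: "mono H" using H by (intro monoI) fastforce
  have H2: "H t = H a" if "t \<le> a" for t using that ab by (simp add: H_def cl_def)
  have H3: "H t = H b" if "b \<le> t" for t using that ab by (simp add: H_def cl_def)
  obtain m where m: "sets m = sets borel" "emeasure m UNIV \<le> ennreal (H b - H a)"
    and lo: "\<And>C p q. open C \<Longrightarrow> connected C \<Longrightarrow> p \<in> C \<Longrightarrow> q \<in> C \<Longrightarrow> p \<le> q \<Longrightarrow> ennreal (H q - H p) \<le> emeasure m C"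
    and up: "\<And>C c. open C \<Longrightarrow> connected C \<Longrightarrow>
        (\<And>p q. p \<in> C \<Longrightarrow> q \<in> C \<Longrightarrow> p \<le> q \<Longrightarrow> ennreal (H q - H p) \<le> c) \<Longrightarrow> emeasure m C \<le> c"
    by (rule stieltjes_measure_exists[OF H1], erule H2, erule H3, (rule that; blast))
  have spm: "space m = UNIV" using sets_eq_imp_space_eq[OF m(1)] by simp
  have mfin: "emeasure m UNIV \<noteq> \<infinity>" using m(2) by (auto simp: top_unique)
  interpret m: finite_measure m by standard (use mfin spm in simp)
  \<comment> \<open>The increments of \<open>f\<close> and of the distribution function are each at
    most those of \<open>N\<close>, whence the factor 2.\<close>
  define N2 where "N2 = scale_measure 2 N"
  have mle: "emeasure m E \<le> emeasure N2 E" if E: "E \<in> sets borel" for E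
  proof -
    have "outer_measure_of m E \<le> emeasure N2 E"
    proof (rule outer_measure_le_measure[OF _ _ _ _ open_UNIV _ E subset_UNIV])
      show "outer_measure_of m A \<le> outer_measure_of m B" if "A \<subseteq> B" for A B
        using that by (rule outer_measure_of_mono)
      show "outer_measure_of m (\<Union>n. A n) \<le> (\<Sum>n. outer_measure_of m (A n))" for A :: "nat \<Rightarrow> real set"
        by (rule outer_measure_of_subadditive) (simp add: spm)
      show "sets N2 = sets borel" by (simp add: N2_def N)
      show "emeasure N2 UNIV \<noteq> \<infinity>"
        using N(2) by (simp add: N2_def ennreal_mult_eq_top_iff)
      fix C :: "real set" assume C: "open C" "connected C"
      have "emeasure m C \<le> emeasure N2 C"
      proof (rule up[OF C])
        fix p q assume pq: "p \<in> C" "q \<in> C" "p \<le> q"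
        have "H q - H p \<le> 2 * measure N C"
        proof -
          have "measure N {p..q} \<le> measure N C"
            using connected_contains_Icc[OF C(2) pq(1,2)] C(1) by (intro N.finite_measure_mono) (auto simp: N)
          then show ?thesis using H[OF pq(3)] cls[OF pq(3)] by linarith
        qed
        then have "ennreal (H q - H p) \<le> ennreal (2 * measure N C)" by (rule ennreal_leI)
        also have "\<dots> = emeasure N2 C"
          by (simp add: N2_def N.emeasure_eq_measure ennreal_mult)
        finally show "ennreal (H q - H p) \<le> emeasure N2 C" .
      qed
      then show "outer_measure_of m C \<le> emeasure N2 C"
        using C m(1) by (simp add: outer_measure_of_eq)
    qed
    then show ?thesis using E m(1) by (simp add: outer_measure_of_eq)
  qed
  have mnull: "null_sets lborel \<subseteq> null_sets m"
  proof
    fix X :: "real set" assume X: "X \<in> null_sets lborel"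
    then have "X \<in> null_sets N" "X \<in> sets borel" using N(3) by (auto simp: null_sets_def)
    then show "X \<in> null_sets m" using mle[of X] by (auto simp: null_sets_def m N2_def)
  qed
  have mI: "measure m {s..t} = H t - H s" if st: "s \<le> t" for s t
  proof (rule antisym)
    have "measure m {s..t} = measure m {s<..<t}"
    proof -
      have "{s..t} = insert s (insert t {s<..<t})" using st by auto
      moreover have "{s} \<in> null_sets m" "{t} \<in> null_sets m"
        by (intro subsetD[OF mnull] countable_imp_null_set_lborel; simp)+
      ultimately show ?thesis
        by (metis (no_types, opaque_lifting) emeasure_Un_null_set insert_is_Un m(1) measure_Un_null_set sets.Un borel_open open_greaterThanLessThan sup_commute null_setsD2)
    qed
    also have "ennreal \<dots> \<le> ennreal (H t - H s)"
      unfolding m.emeasure_eq_measure[symmetric]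
    proof (rule up)
      fix p q assume "p \<in> {s<..<t}" "q \<in> {s<..<t}" "p \<le> q"
      then show "ennreal (H q - H p) \<le> ennreal (H t - H s)"
        using H[of s p] H[of q t] by (intro ennreal_leI) auto
    qed auto
    finally show "measure m {s..t} \<le> H t - H s" using H[OF st] by simp
    have "ennreal (H t - H s) \<le> emeasure m {s..t}"
    proof -
      have reg: "emeasure m {s..t} = (INF U\<in>{U. {s..t} \<subseteq> U \<and> open U}. emeasure m U)"
        by (rule outer_regular) (use m mfin spm in auto)
      have "ennreal (H t - H s) \<le> (INF U\<in>{U. {s..t} \<subseteq> U \<and> open U}. emeasure m U)"
      proof (rule INF_greatest)
        fix U assume "U \<in> {U. {s..t} \<subseteq> U \<and> open U}"
        then have U: "{s..t} \<subseteq> U" "open U" by auto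
        \<comment> \<open>The lower bound \<open>lo\<close> is available for open intervals only;
          the component of \<open>s\<close> in \<open>U\<close> is one, and it still contains all of
          \<open>{s..t}\<close>.\<close>
        let ?C = "connected_component_set U s"
        have C: "open ?C" "connected ?C" using U by (auto simp: open_connected_component)
        have "{s..t} \<subseteq> ?C" using U st by (intro connected_component_maximal) auto
        then have "s \<in> ?C" "t \<in> ?C" using st by auto
        from lo[OF C this st] have "ennreal (H t - H s) \<le> emeasure m ?C" .
        also have "\<dots> \<le> emeasure m U"
          using U connected_component_subset by (intro emeasure_mono) (auto simp: m)
        finally show "ennreal (H t - H s) \<le> emeasure m U" .
      qed
      then show ?thesis using reg by simp
    qed
    then show "H t - H s \<le> measure m {s..t}" by (simp add: m.emeasure_eq_measure)
  qed
  obtain v where v: "\<And>x. 0 \<le> v x" "v absolutely_integrable_on UNIV"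
    "\<And>X. X \<in> sets borel \<Longrightarrow> integral X v = measure m X"
    using finite_ac_measure_density[OF m(1) mfin mnull] by blast
  obtain h where h: "\<And>x. 0 \<le> h x" "h absolutely_integrable_on UNIV"
    "\<And>X. X \<in> sets borel \<Longrightarrow> integral X h = measure N X"
    using finite_ac_measure_density[OF N] by blast
  have vi: "v absolutely_integrable_on {s..t}" and hi: "h absolutely_integrable_on {s..t}" for s t
    using set_integrable_subset[OF v(2), of "{s..t}"] set_integrable_subset[OF h(2), of "{s..t}"] by auto
  define u where "u x = v x - h x" for x
  have ui: "u absolutely_integrable_on {s..t}" for s t
    unfolding u_def by (intro set_integral_diff vi hi)
  have uI: "integral {s..t} u = f t - f s" if st: "a \<le> s" "s \<le> t" "t \<le> b" for s t
  proof -
    have "integral {s..t} u = integral {s..t} v - integral {s..t} h"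
      unfolding u_def by (intro Henstock_Kurzweil_Integration.integral_diff set_lebesgue_integral_eq_integral(1) vi hi)
    also have "\<dots> = (H t - H s) - measure N {s..t}"
      by (simp add: v h mI st)
    also have "\<dots> = f t - f s"
      using split[OF st(1,2)] st by (simp add: H_def cl(4))
    finally show ?thesis .
  qed
  have "integral {a..b} (\<lambda>x. norm (u x)) \<le> measure N {a..b} - measure N {a..a}"
  proof (rule integral_norm_le_variation[OF ui ab])
    fix s t assume st: "a \<le> s" "s \<le> t" "t \<le> b"
    then show "norm (integral {s..t} u) \<le> measure N {a..t} - measure N {a..s}"
      using uI[OF st] le'[OF st] split[OF st(1,2)] by simp
  qed
  also have "\<dots> \<le> measure N UNIV"
    by (simp add: pt N.bounded_measure[of "{a..b}", unfolded spN])
  finally show thesis using ui uI by (intro that) auto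
qed

section \<open>Absolute continuity of the derivatives of eigenvalues\<close>

text \<open>A zero with nonzero derivative is isolated among the zeros, so a rational interval
  around it meets \<open>S\<close> in this point alone and determines it.\<close>

lemma countable_transversal_zeros:
  fixes D :: "real \<Rightarrow> real"
  assumes "\<And>t. t \<in> S \<Longrightarrow> D t = 0" and "S \<subseteq> J"
    and der: "\<And>t. t \<in> S \<Longrightarrow> (D has_vector_derivative D' t) (at t within J)" "\<And>t. t \<in> S \<Longrightarrow> D' t \<noteq> 0"
  shows "countable S"
proof -
  have iso: "\<exists>p\<in>\<rat>. \<exists>q\<in>\<rat>. p < t \<and> t < q \<and> S \<inter> {p<..<q} = {t}" if t: "t \<in> S" for t
  proof -
    have "((\<lambda>s. (1 / (s - t)) *\<^sub>R (D s - D t)) \<longlongrightarrow> D' t) (at t within J)"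
      using der(1)[OF t] by (simp only: has_vector_derivative_iff_quotient)
    then have "\<forall>\<^sub>F s in at t within J. (1 / (s - t)) *\<^sub>R (D s - D t) \<noteq> 0"
      using der(2)[OF t] by (rule tendsto_imp_eventually_ne)
    then obtain d where d: "d > 0" "\<And>s. s \<in> J \<Longrightarrow> s \<noteq> t \<Longrightarrow> dist s t < d \<Longrightarrow> D s \<noteq> 0"
      unfolding eventually_at using assms(1)[OF t] by auto
    obtain p q where pq: "p \<in> \<rat>" "t - d < p" "p < t" "q \<in> \<rat>" "t < q" "q < t + d"
      using Rats_dense_in_real[of "t - d" t] Rats_dense_in_real[of t "t + d"] d(1) by auto
    have only: "s = t" if "s \<in> S" "p < s" "s < q" for s
    proof (rule ccontr)
      assume "s \<noteq> t"
      moreover have "dist s t < d" using that pq by (auto simp: dist_real_def)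
      ultimately show False using d(2)[of s] assms(1,2) that by blast
    qed
    have "S \<inter> {p<..<q} = {t}"
    proof (intro equalityI subsetI)
      fix s assume "s \<in> S \<inter> {p<..<q}"
      then show "s \<in> {t}" using only[of s] by simp
    qed (use pq(3,5) t in simp)
    then show ?thesis using pq(1,3,4,5) by blast
  qed
  have "\<forall>t\<in>S. \<exists>r. r \<in> \<rat> \<times> \<rat> \<and> S \<inter> {fst r<..<snd r} = {t}"
  proof
    fix t assume "t \<in> S"
    from iso[OF this] obtain p q where "p \<in> \<rat>" "q \<in> \<rat>" "S \<inter> {p<..<q} = {t}" by blast
    then show "\<exists>r. r \<in> \<rat> \<times> \<rat> \<and> S \<inter> {fst r<..<snd r} = {t}"
      by (intro exI[of _ "(p, q)"]) simp
  qed
  from bchoice[OF this] obtain r where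
    "\<forall>t\<in>S. r t \<in> \<rat> \<times> \<rat> \<and> S \<inter> {fst (r t)<..<snd (r t)} = {t}" ..
  then have r: "r t \<in> \<rat> \<times> \<rat>" "S \<inter> {fst (r t)<..<snd (r t)} = {t}" if "t \<in> S" for t
    using that by blast+
  have "inj_on r S"
  proof (rule inj_onI)
    fix x y assume xy: "x \<in> S" "y \<in> S" "r x = r y"
    have "{x} = S \<inter> {fst (r x)<..<snd (r x)}" by (rule r(2)[OF xy(1), symmetric])
    also have "\<dots> = {y}" unfolding xy(3) by (rule r(2)[OF xy(2)])
    finally show "x = y" by simp
  qed
  moreover have "countable (r ` S)"
    by (rule countable_subset[OF _ countable_SIGMA[OF countable_rat countable_rat]]) (use r(1) in blast)
  ultimately show ?thesis using countable_image_inj_on by blast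
qed

lemma sum_of_measures_exists:
  fixes M :: "'i \<Rightarrow> real measure"
  assumes M: "\<And>i. i \<in> I \<Longrightarrow> sets (M i) = sets borel"
  obtains N where "sets N = sets borel" "\<And>X. X \<in> sets borel \<Longrightarrow> emeasure N X = (\<Sum>i\<in>I. emeasure (M i) X)"
proof -
  define N where "N = measure_of UNIV (sets borel) (\<lambda>X. \<Sum>i\<in>I. emeasure (M i) X)"
  have sN: "sets N = sets borel"
    unfolding N_def using sets.sigma_sets_eq[of "borel :: real measure"] by simp
  have "emeasure N X = (\<Sum>i\<in>I. emeasure (M i) X)" if X: "X \<in> sets borel" for X
  proof (rule emeasure_measure_of[OF N_def])
    show "positive (sets N) (\<lambda>X. \<Sum>i\<in>I. emeasure (M i) X)" by (simp add: positive_def)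
    show "countably_additive (sets N) (\<lambda>X. \<Sum>i\<in>I. emeasure (M i) X)"
    proof (rule countably_additiveI)
      fix A :: "nat \<Rightarrow> real set" assume A: "range A \<subseteq> sets N" "disjoint_family A" "(\<Union>n. A n) \<in> sets N"
      have "(\<Sum>n. \<Sum>i\<in>I. emeasure (M i) (A n)) = (\<Sum>i\<in>I. \<Sum>n. emeasure (M i) (A n))"
        by (rule suminf_sum) simp
      also have "\<dots> = (\<Sum>i\<in>I. emeasure (M i) (\<Union>n. A n))"
        using A M by (intro sum.cong refl suminf_emeasure) (auto simp: sN)
      finally show "(\<Sum>n. \<Sum>i\<in>I. emeasure (M i) (A n)) = (\<Sum>i\<in>I. emeasure (M i) (\<Union>n. A n))" .
    qed
  qed (use X sN in auto)
  with sN show thesis by (rule that)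
qed

lemma max_proj_eq_strict:
  fixes M :: "complex ^ 'n ^ 'n"
  assumes dg: "diagonalizes E l M" and gap: "\<And>i j. i \<in> K \<Longrightarrow> j \<notin> K \<Longrightarrow> l $ j < l $ i"
  shows "max_proj (card K) M = (\<Sum>i\<in>K. E i)"
proof -
  \<comment> \<open>The element 1 keeps the set nonempty when \<open>K\<close> is empty or
    everything.\<close>
  define D where "D = insert 1 ((\<lambda>(i, j). l $ i - l $ j) ` (K \<times> -K))"
  have D: "finite D" "D \<noteq> {}" by (auto simp: D_def)
  show ?thesis
  proof (rule max_proj_eq[OF dg])
    show "0 < Min D" using D gap by (auto simp: D_def)
    fix i j assume ij: "i \<in> K" "j \<notin> K"
    then have "Min D \<le> l $ i - l $ j"
      using D by (intro Min_le) (force simp: D_def)+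
    then show "l $ j + Min D \<le> l $ i" by simp
  qed
qed

lemma norm_projs_le:
  fixes P :: "complex ^ 'n ^ 'n"
  assumes "P \<in> projs k" "k \<le> CARD('n)"
  shows "norm P \<le> real CARD('n)"
proof -
  have "(norm P)\<^sup>2 \<le> real CARD('n)" using norm_projs[OF assms(1)] assms(2) by simp
  also have "\<dots> \<le> (real CARD('n))\<^sup>2"
    by (simp add: power2_eq_square Suc_leI)
  finally show ?thesis by (rule power2_le_imp_le) simp
qed

lemma norm_integral_le_integral_norm:
  fixes B :: "real \<Rightarrow> 'b::euclidean_space"
  assumes "B absolutely_integrable_on {a..b}" "a \<le> s" "t \<le> b"
  shows "norm (integral {s..t} B) \<le> integral {s..t} (\<lambda>x. norm (B x))"
proof (rule integral_norm_bound_integral)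
  have "B absolutely_integrable_on {s..t}"
    using assms by (intro set_integrable_subset[OF assms(1)]) auto
  then show "B integrable_on {s..t}" "(\<lambda>x. norm (B x)) integrable_on {s..t}"
    by (auto simp: absolutely_integrable_on_def)
qed auto

section \<open>Monotone Ky Fan functionals along a curve\<close>

locale hermitian_curve =
  fixes A A' B :: "real \<Rightarrow> complex ^ 'n ^ 'n" and a b L :: real
  assumes ab: "a < b"
    and A: "\<And>t. t \<in> {a..b} \<Longrightarrow> (A has_vector_derivative A' t) (at t within {a..b})"
    and B: "B absolutely_integrable_on {a..b}"
    and A'B: "\<And>s t. a \<le> s \<Longrightarrow> s \<le> t \<Longrightarrow> t \<le> b \<Longrightarrow> integral {s..t} B = A' t - A' s"
    and L: "\<And>t. t \<in> {a..b} \<Longrightarrow> norm (A' t) \<le> L"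
begin

definition V where "V t = integral {a..t} (\<lambda>x. norm (B x))"

lemma Bn: "(\<lambda>x. norm (B x)) integrable_on {s..t}" if "a \<le> s" "t \<le> b"
proof -
  have "B absolutely_integrable_on {s..t}"
    using that by (intro set_integrable_subset[OF B]) auto
  then show ?thesis by (auto simp: absolutely_integrable_on_def)
qed

lemma V_diff: "V t - V s = integral {s..t} (\<lambda>x. norm (B x))" if "a \<le> s" "s \<le> t" "t \<le> b"
  using Henstock_Kurzweil_Integration.integral_combine[OF that(1,2) Bn] that by (simp add: V_def)

lemma V_mono: "V s \<le> V t" if "a \<le> s" "s \<le> t" "t \<le> b"
  using V_diff[OF that] integral_nonneg[OF Bn[of s t]] that by simp

lemma A'_diff: "norm (A' t - A' s) \<le> V t - V s" if "a \<le> s" "s \<le> t" "t \<le> b"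
  using norm_integral_le_integral_norm[OF B that(1,3)] A'B[OF that] V_diff[OF that] by simp

lemma L0: "0 \<le> L"
  using L[of a] ab norm_ge_zero[of "A' a"] by (simp del: norm_ge_zero)

lemma A_lipschitz: "norm (A q - A p) \<le> L * (q - p)" if "a \<le> p" "p \<le> q" "q \<le> b"
proof -
  have "norm (A q - A p) \<le> L * norm (q - p)"
  proof (rule differentiable_bound[of "{a..b}" A "\<lambda>x h. h *\<^sub>R A' x"])
    fix x assume x: "x \<in> {a..b}"
    show "(A has_derivative (\<lambda>h. h *\<^sub>R A' x)) (at x within {a..b})"
      using A[OF x] by (simp add: has_vector_derivative_def)
    show "onorm (\<lambda>h. h *\<^sub>R A' x) \<le> L"
      by (rule onorm_le) (use mult_right_mono[OF L[OF x] abs_ge_zero] in \<open>simp add: mult.commute\<close>)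
  qed (use that in auto)
  then show ?thesis using that by simp
qed

definition P where "P k t = max_proj k (A t)"
definition G where "G k t = A' t \<bullet> P k t + real CARD('n) * V t"

lemma P: "P k t \<in> projs k" "Q \<in> projs k \<Longrightarrow> A t \<bullet> Q \<le> A t \<bullet> P k t" "norm (P k t) \<le> real CARD('n)"
  if "k \<le> CARD('n)"
  unfolding P_def using max_proj[OF that] norm_projs_le[OF _ that] by auto

lemma inner_P_le: "\<bar>X \<bullet> P k t\<bar> \<le> real CARD('n) * c" if "k \<le> CARD('n)" "norm X \<le> c"
proof -
  have "\<bar>X \<bullet> P k t\<bar> \<le> norm X * norm (P k t)" by (rule Cauchy_Schwarz_ineq2)
  also have "\<dots> \<le> c * real CARD('n)"
    using that P(3)[OF that(1), of t] order_trans[OF norm_ge_zero[of X] that(2)] by (intro mult_mono) auto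
  finally show ?thesis by (simp add: mult.commute)
qed

text \<open>\<open>G k\<close> is a subgradient of the convex function \<open>t \<mapsto> (sup over Q of A t \<bullet> Q) + CARD('n) \<integral>\<integral> |B|\<close>,
  \<open>Q\<close> ranging over the projections of rank \<open>k\<close>; hence it is monotone.\<close>

lemma G_mono:
  assumes k: "k \<le> CARD('n)" and st: "a \<le> s" "s \<le> t" "t \<le> b"
  shows "G k s \<le> G k t"
proof (cases "s = t")
  case False
  let ?D = "P k t - P k s"
  \<comment> \<open>Maximality at both ends makes \<open>(A t - A s) \<bullet> ?D\<close>
    nonnegative, so by the mean value theorem \<open>A' x \<bullet> ?D\<close> is nonnegative for
    some \<open>x\<close> in between.\<close>
  have "\<exists>x\<in>{s<..<t}. A t \<bullet> ?D - A s \<bullet> ?D = (t - s) *\<^sub>R (A' x \<bullet> ?D)"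
  proof (rule mvt_simple[of s t "\<lambda>x. A x \<bullet> ?D" "\<lambda>x h. h *\<^sub>R (A' x \<bullet> ?D)"])
    fix x assume x: "s \<le> x" "x \<le> t"
    have "(A has_vector_derivative A' x) (at x within {s..t})"
      by (rule has_vector_derivative_within_subset[OF A]) (use x st in auto)
    then show "((\<lambda>x. A x \<bullet> ?D) has_derivative (\<lambda>h. h *\<^sub>R (A' x \<bullet> ?D))) (at x within {s..t})"
      unfolding has_vector_derivative_def by (auto intro!: derivative_eq_intros)
  qed (use False st in auto)
  then obtain x where x: "s < x" "x < t" "A t \<bullet> ?D - A s \<bullet> ?D = (t - s) * (A' x \<bullet> ?D)" by auto
  have "0 \<le> A t \<bullet> ?D - A s \<bullet> ?D"
    using P(2)[OF k P(1)[OF k], of t s] P(2)[OF k P(1)[OF k], of s t] by (simp add: inner_diff)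
  then have D0: "0 \<le> A' x \<bullet> ?D" using x by (simp add: zero_le_mult_iff)
  have 1: "\<bar>(A' t - A' x) \<bullet> P k t\<bar> \<le> real CARD('n) * (V t - V x)"
    using A'_diff[of x t] x st by (intro inner_P_le[OF k]) auto
  have 2: "\<bar>(A' x - A' s) \<bullet> P k s\<bar> \<le> real CARD('n) * (V x - V s)"
    using A'_diff[of s x] x st by (intro inner_P_le[OF k]) auto
  \<comment> \<open>Replacing \<open>A' t\<close> and \<open>A' s\<close> by the intermediate
    \<open>A' x\<close> costs at most \<open>CARD('n)\<close> times the variation of
    \<open>A'\<close>, and the increments of the \<open>V\<close> term pay for it.\<close>
  have "G k t - G k s = (A' t - A' x) \<bullet> P k t + (A' x - A' s) \<bullet> P k s + A' x \<bullet> ?D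
      + (real CARD('n) * (V t - V x) + real CARD('n) * (V x - V s))"
    by (simp add: G_def inner_diff algebra_simps)
  then show ?thesis using 1 2 D0 by linarith
qed simp

text \<open>The quantitative input of the whole estimate: it involves the sizes of \<open>A'\<close>
  and \<open>B\<close> only and no gap. The product \<open>A' \<bullet> P k\<close> contributes
  \<open>2 * CARD('n) * L\<close>, and the \<open>V\<close> term contributes \<open>CARD('n)\<close>
  times the integral, rounded up to the common factor.\<close>

lemma G_total: "G k b - G k a \<le> 2 * real CARD('n) * (L + integral {a..b} (\<lambda>x. norm (B x)))"
  if k: "k \<le> CARD('n)"
proof -
  have "\<bar>A' t \<bullet> P k t\<bar> \<le> real CARD('n) * L" if "t \<in> {a..b}" for t
    by (intro inner_P_le[OF k] L[OF that])
  from this[of a] this[of b] have "A' b \<bullet> P k b - A' a \<bullet> P k a \<le> 2 * (real CARD('n) * L)"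
    using ab by simp
  moreover have Vb: "V b = integral {a..b} (\<lambda>x. norm (B x))" and Va: "V a = 0"
    by (auto simp: V_def)
  moreover have "0 \<le> real CARD('n) * V b"
    using V_mono[of a b] ab Va by simp
  moreover have "2 * real CARD('n) * (L + V b) = 2 * (real CARD('n) * L) + real CARD('n) * V b + real CARD('n) * V b"
    by (simp add: algebra_simps)
  ultimately show ?thesis
    unfolding G_def Vb[symmetric] Va mult_zero_right by linarith
qed

text \<open>The increment splits into the change of \<open>A'\<close>, the Lipschitz change of the
  projection, and the \<open>V\<close> term. The first and the last each contribute
  \<open>CARD('n)\<close> times the integral of the norm of \<open>B\<close>, which explains the
  factor 2. The weight degenerates as \<open>g\<close> tends to 0, which is harmless for statements
  about null sets.\<close>

lemma G_local:
  assumes dg: "diagonalizes E l (A p)" and g: "g > 0"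
    and gap: "\<And>i j. i \<in> K \<Longrightarrow> j \<notin> K \<Longrightarrow> l $ j + g \<le> l $ i" and pq: "a \<le> p" "p \<le> q" "q \<le> b"
  shows "G (card K) q - G (card K) p \<le> integral {p..q} (\<lambda>x. 2 * real CARD('n) * norm (B x) + 2 / g * L\<^sup>2)"
proof -
  have k: "card K \<le> CARD('n)" by (intro card_mono) auto
  have "norm (P (card K) p - P (card K) q) \<le> 2 / g * norm (A p - A q)"
    unfolding P_def using max_proj_gap[OF dg g gap, where N = "A q"] max_proj_eq[OF dg g gap] by simp
  also have "\<dots> \<le> 2 / g * (L * (q - p))"
    using A_lipschitz[OF pq] g by (intro mult_left_mono) (auto simp: norm_minus_commute)
  finally have n: "norm (P (card K) q - P (card K) p) \<le> 2 / g * (L * (q - p))"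
    by (simp add: norm_minus_commute)
  have 1: "\<bar>(A' q - A' p) \<bullet> P (card K) q\<bar> \<le> real CARD('n) * (V q - V p)"
    by (intro inner_P_le[OF k] A'_diff[OF pq])
  have "A' p \<bullet> (P (card K) q - P (card K) p) \<le> norm (A' p) * norm (P (card K) q - P (card K) p)"
    by (rule norm_cauchy_schwarz)
  also have "\<dots> \<le> L * (2 / g * (L * (q - p)))"
    using n L[of p] pq L0 by (intro mult_mono) auto
  finally have 2: "A' p \<bullet> (P (card K) q - P (card K) p) \<le> 2 / g * L\<^sup>2 * (q - p)"
    by (simp add: power2_eq_square mult_ac)
  have "G (card K) q - G (card K) p = (A' q - A' p) \<bullet> P (card K) q + A' p \<bullet> (P (card K) q - P (card K) p)
      + real CARD('n) * (V q - V p)"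
    by (simp add: G_def inner_diff algebra_simps)
  also have "\<dots> \<le> 2 * real CARD('n) * (V q - V p) + 2 / g * L\<^sup>2 * (q - p)"
    using 1 2 by linarith
  also have "\<dots> = integral {p..q} (\<lambda>x. 2 * real CARD('n) * norm (B x) + 2 / g * L\<^sup>2)"
  proof -
    have i: "(\<lambda>x. 2 * real CARD('n) * norm (B x)) integrable_on {p..q}"
      using integrable_on_cmult_left[OF Bn[of p q], of "2 * real CARD('n)"] pq by simp
    have "integral {p..q} (\<lambda>x. 2 * real CARD('n) * norm (B x) + 2 / g * L\<^sup>2) =
       integral {p..q} (\<lambda>x. 2 * real CARD('n) * norm (B x)) + integral {p..q} (\<lambda>x. 2 / g * L\<^sup>2)"
      by (rule Henstock_Kurzweil_Integration.integral_add[OF i integrable_const_ivl])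
    also have "integral {p..q} (\<lambda>x. 2 * real CARD('n) * norm (B x)) = 2 * real CARD('n) * integral {p..q} (\<lambda>x. norm (B x))"
      by (rule integral_mult_right)
    finally show ?thesis using V_diff[OF pq] pq by simp
  qed
  finally show ?thesis .
qed
end

text \<open>The properties from \<open>stieltjes_measure_exists\<close> as a predicate, so that a
  measure can be chosen for every rank. The two inequalities together say that the mass of an open
  interval is the supremum of the increments of \<open>F\<close> in it.\<close>

definition is_stieltjes :: "(real \<Rightarrow> real) \<Rightarrow> real measure \<Rightarrow> bool" where
  "is_stieltjes F m \<longleftrightarrow> sets m = sets borel \<and>
     (\<forall>C p q. open C \<longrightarrow> connected C \<longrightarrow> p \<in> C \<longrightarrow> q \<in> C \<longrightarrow> p \<le> q \<longrightarrow> ennreal (F q - F p) \<le> emeasure m C) \<and>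
     (\<forall>C c. open C \<longrightarrow> connected C \<longrightarrow>
        (\<forall>p\<in>C. \<forall>q\<in>C. p \<le> q \<longrightarrow> ennreal (F q - F p) \<le> c) \<longrightarrow> emeasure m C \<le> c)"

lemma is_stieltjes_exists:
  assumes "mono F" "\<And>t. t \<le> a \<Longrightarrow> F t = F a" "\<And>t. b \<le> t \<Longrightarrow> F t = F b"
  shows "\<exists>m. is_stieltjes F m"
  by (rule stieltjes_measure_exists[OF assms(1)], erule assms(2), erule assms(3))
     (auto simp: is_stieltjes_def)

text \<open>Local absolute continuity: domination of the increments inside \<open>Q\<close> by an
  absolutely continuous measure \<open>W\<close> transfers from intervals to all Borel subsets of
  \<open>Q\<close>.\<close>

lemma is_stieltjes_null:
  assumes m: "is_stieltjes F m" and Q: "open Q"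
    and W: "sets W = sets borel" "emeasure W UNIV \<noteq> \<infinity>" "null_sets lborel \<subseteq> null_sets W"
    and le: "\<And>p q. p \<in> Q \<Longrightarrow> q \<in> Q \<Longrightarrow> p \<le> q \<Longrightarrow> ennreal (F q - F p) \<le> emeasure W {p..q}"
    and X: "X \<in> null_sets lborel" "X \<subseteq> Q"
  shows "emeasure m X = 0"
proof -
  have sm: "sets m = sets borel" using m by (simp add: is_stieltjes_def)
  have spm: "space m = UNIV" using sets_eq_imp_space_eq[OF sm] by simp
  have Xb: "X \<in> sets borel" using X by (auto simp: null_sets_def)
  have "outer_measure_of m X \<le> emeasure W X"
  proof (rule outer_measure_le_measure[OF _ _ W(1,2) Q _ Xb X(2)])
    show "outer_measure_of m A \<le> outer_measure_of m B" if "A \<subseteq> B" for A B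
      using that by (rule outer_measure_of_mono)
    show "outer_measure_of m (\<Union>n. A n) \<le> (\<Sum>n. outer_measure_of m (A n))" for A :: "nat \<Rightarrow> real set"
      by (rule outer_measure_of_subadditive) (simp add: spm)
    fix C assume C: "open C" "connected C" "C \<subseteq> Q"
    have "emeasure m C \<le> emeasure W C"
    proof -
      have "ennreal (F q - F p) \<le> emeasure W C" if "p \<in> C" "q \<in> C" "p \<le> q" for p q
      proof -
        have "ennreal (F q - F p) \<le> emeasure W {p..q}" using that C by (intro le) auto
        also have "\<dots> \<le> emeasure W C"
          using connected_contains_Icc[OF C(2) that(1,2)] C(1) by (intro emeasure_mono) (auto simp: W)
        finally show ?thesis .
      qed
      then show ?thesis using m C unfolding is_stieltjes_def by blast
    qed
    then show "outer_measure_of m C \<le> emeasure W C" using C(1) sm by (simp add: outer_measure_of_eq)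
  qed
  moreover have "emeasure W X = 0" using W(3) X(1) by (auto simp: null_sets_def)
  ultimately show ?thesis using Xb sm by (simp add: outer_measure_of_eq)
qed

lemma finite_strict_gap:
  fixes l :: "real ^ 'n"
  assumes "\<And>i j. i \<in> K \<Longrightarrow> j \<notin> K \<Longrightarrow> l $ j < l $ i"
  shows "\<exists>r. \<forall>i\<in>K. \<forall>j\<in>-K. l $ j + 1 / real (Suc r) < l $ i"
proof -
  define D where "D = insert 1 ((\<lambda>(i, j). l $ i - l $ j) ` (K \<times> -K))"
  have D: "finite D" "D \<noteq> {}" by (auto simp: D_def)
  have "0 < Min D" using D assms by (auto simp: D_def)
  then obtain r where r: "1 / real (Suc r) < Min D"
    using reals_Archimedean[of "Min D"] by (auto simp: inverse_eq_divide)
  have "l $ j + 1 / real (Suc r) < l $ i" if "i \<in> K" "j \<notin> K" for i j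
  proof -
    have "Min D \<le> l $ i - l $ j" using that D by (intro Min_le) (force simp: D_def)+
    with r show ?thesis by linarith
  qed
  then show ?thesis by auto
qed

section \<open>Stieltjes measures on the times with a spectral gap\<close>

locale eigenvalue_curve = hermitian_curve A A' B a b L
  for A A' B :: "real \<Rightarrow> complex ^ 'n ^ 'n" and a b L +
  fixes lam lam' :: "real \<Rightarrow> real ^ 'n"
  assumes dg: "\<And>t. t \<in> {a..b} \<Longrightarrow> \<exists>E. diagonalizes E (lam t) (A t)"
    and lam: "\<And>t. t \<in> {a..b} \<Longrightarrow> (lam has_vector_derivative lam' t) (at t within {a..b})"
begin

definition clamp where "clamp t = max a (min b t)"

lemma clamp: "a \<le> clamp t" "clamp t \<le> b" "s \<le> t \<Longrightarrow> clamp s \<le> clamp t" "t \<in> {a..b} \<Longrightarrow> clamp t = t"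
  using ab by (auto simp: clamp_def)

text \<open>Clamping extends \<open>G k\<close> by constants beyond the ends, so that it is monotone
  on the whole line and its measure is finite.\<close>

definition stj where "stj k = (SOME m. is_stieltjes (\<lambda>t. G k (clamp t)) m)"

lemma G_clamp_mono: "s \<le> t \<Longrightarrow> k \<le> CARD('n) \<Longrightarrow> G k (clamp s) \<le> G k (clamp t)"
  by (intro G_mono clamp) auto

lemma stj: "is_stieltjes (\<lambda>t. G k (clamp t)) (stj k)" if "k \<le> CARD('n)"
  unfolding stj_def
proof (rule someI_ex, rule is_stieltjes_exists[where a = a and b = b])
  show "mono (\<lambda>t. G k (clamp t))" using that by (intro monoI G_clamp_mono)
qed (use ab in \<open>auto simp: clamp_def max_def min_def\<close>)

lemma sets_stj: "k \<le> CARD('n) \<Longrightarrow> sets (stj k) = sets borel"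
  using stj by (simp add: is_stieltjes_def)

lemma stj_UNIV: "emeasure (stj k) UNIV \<le> ennreal (G k b - G k a)" if k: "k \<le> CARD('n)"
proof -
  have "\<forall>p\<in>UNIV. \<forall>q\<in>UNIV. p \<le> q \<longrightarrow> ennreal (G k (clamp q) - G k (clamp p)) \<le> ennreal (G k b - G k a)"
  proof (intro ballI impI ennreal_leI)
    fix p q :: real assume "p \<le> q"
    have "G k (clamp q) \<le> G k b" "G k a \<le> G k (clamp p)"
      using ab by (intro G_mono[OF k] clamp order_refl; simp add: clamp)+
    then show "G k (clamp q) - G k (clamp p) \<le> G k b - G k a" by simp
  qed
  then show ?thesis
    using stj[OF k] unfolding is_stieltjes_def by (blast intro: open_UNIV connected_UNIV)
qed

text \<open>The margin \<open>g\<close> is uniform, so that \<open>G_local\<close> applies with one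
  weight on the whole set; the inequality is strict, so that the set is open.\<close>

definition gap where "gap K g = {t \<in> {a<..<b}. \<forall>i\<in>K. \<forall>j\<in>-K. lam t $ j + g < lam t $ i}"

lemma continuous_lam: "continuous_on {a<..<b} (\<lambda>t. lam t $ i)"
proof -
  have "continuous_on {a..b} lam"
    unfolding continuous_on_eq_continuous_within by (intro ballI has_vector_derivative_continuous[OF lam])
  then have "continuous_on {a<..<b} lam" by (rule continuous_on_subset) auto
  then show ?thesis by (intro continuous_intros)
qed

lemma open_lam_less: "open {t \<in> {a<..<b}. lam t $ j + g < lam t $ i}"
proof -
  have "\<exists>U. open U \<and> U \<inter> {a<..<b} = {t \<in> {a<..<b}. lam t $ j + g < lam t $ i}"
    by (intro open_Collect_less_Int continuous_intros continuous_lam)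
  then show ?thesis by (metis open_Int open_greaterThanLessThan)
qed

lemma open_gap: "open (gap K g)"
proof -
  have "gap K g = {a<..<b} \<inter> (\<Inter>i\<in>K. \<Inter>j\<in>-K. {t \<in> {a<..<b}. lam t $ j + g < lam t $ i})"
    by (auto simp: gap_def)
  also have "open \<dots>"
    by (intro open_Int open_INT ballI open_lam_less open_greaterThanLessThan finite)
  finally show ?thesis .
qed

text \<open>\<open>G_local\<close> dominates the increments between any two times of the set by the
  integral of one weight. The weight depends on \<open>g\<close>; only the vanishing on null sets is
  kept from it.\<close>

lemma stj_gap_null:
  assumes X: "X \<in> null_sets lborel" "X \<subseteq> gap K g" and g: "g > 0"
  shows "emeasure (stj (card K)) X = 0"
proof -
  have k: "card K \<le> CARD('n)" by (intro card_mono) auto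
  let ?w = "\<lambda>x. 2 * real CARD('n) * norm (B x) + 2 / g * L\<^sup>2"
  have "?w absolutely_integrable_on {a..b}"
    using absolutely_integrable_norm[OF B]
    by (intro set_integral_add set_integrable_mult_right absolutely_integrable_on_const) (auto simp: o_def)
  moreover have "0 \<le> ?w x" for x using g by simp
  ultimately obtain W where W: "sets W = sets borel" "emeasure W UNIV \<noteq> \<infinity>" "null_sets lborel \<subseteq> null_sets W"
    and Wpq: "\<And>p q. a \<le> p \<Longrightarrow> p \<le> q \<Longrightarrow> q \<le> b \<Longrightarrow> emeasure W {p..q} = ennreal (integral {p..q} ?w)"
    using absolutely_integrable_measure[where w = ?w and a = a and b = b] by blast
  show ?thesis
  proof (rule is_stieltjes_null[OF stj[OF k] open_gap W _ X])
    fix p q assume pq: "p \<in> gap K g" "q \<in> gap K g" "p \<le> q"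
    then have i: "a \<le> p" "q \<le> b" "p \<in> {a..b}" "q \<in> {a..b}" by (auto simp: gap_def)
    obtain E where E: "diagonalizes E (lam p) (A p)" using dg[OF i(3)] by blast
    have "G (card K) q - G (card K) p \<le> integral {p..q} ?w"
      by (rule G_local[OF E g _ i(1) pq(3) i(2)]) (use pq in \<open>force simp: gap_def\<close>)
    then show "ennreal (G (card K) (clamp q) - G (card K) (clamp p)) \<le> emeasure W {p..q}"
      unfolding clamp(4)[OF i(3)] clamp(4)[OF i(4)] Wpq[OF i(1) pq(3) i(2)] by (rule ennreal_leI)
  qed
qed

text \<open>All times with a gap at rank \<open>k\<close>, as a countable union of sets with fixed
  margin. Different index sets \<open>K\<close> of size \<open>k\<close> may occur at different
  times, because \<open>G k\<close> and its measure depend on the rank alone.\<close>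

definition gaps where "gaps k = (\<Union>K\<in>{K. card K = k}. \<Union>r. gap K (1 / real (Suc r)))"

lemma open_gaps: "open (gaps k)"
  unfolding gaps_def by (intro open_UN ballI open_gap)

lemma stj_gaps_null:
  assumes X: "X \<in> null_sets lborel" and k: "k \<le> CARD('n)"
  shows "emeasure (stj k) (gaps k \<inter> X) = 0"
proof -
  have Xb: "X \<in> sets borel" using X by (auto simp: null_sets_def)
  have "emeasure (stj (card K)) (gap K (1 / real (Suc r)) \<inter> X) = 0" for K r
    by (rule stj_gap_null) (use X open_gap in \<open>auto intro: null_set_Int1\<close>)
  then have nul: "gap K (1 / real (Suc r)) \<inter> X \<in> null_sets (stj k)" if "card K = k" for K r
    using that open_gap Xb sets_stj[OF k] by (auto simp: null_sets_def)
  have "(\<Union>K\<in>{K. card K = k}. \<Union>r. gap K (1 / real (Suc r)) \<inter> X) \<in> null_sets (stj k)"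
    by (intro null_sets_UN' null_sets_UN nul countable_finite) auto
  also have "(\<Union>K\<in>{K. card K = k}. \<Union>r. gap K (1 / real (Suc r)) \<inter> X) = gaps k \<inter> X"
    by (auto simp: gaps_def)
  finally show ?thesis by auto
qed

text \<open>The sum over all \<open>Suc CARD('n)\<close> ranks of the Stieltjes measures, each
  restricted to its own gap set. The restriction makes the sum absolutely continuous, and the mass
  does not exceed that of the full measures, which \<open>G_total\<close> bounds.\<close>

lemma dominating_measure:
  obtains N where "sets N = sets borel" "null_sets lborel \<subseteq> null_sets N"
    "emeasure N UNIV \<le> ennreal (real (Suc CARD('n)) * (2 * real CARD('n) * (L + integral {a..b} (\<lambda>x. norm (B x)))))"
    "\<And>k k' X. k < k' \<Longrightarrow> k' \<le> CARD('n) \<Longrightarrow> X \<in> sets borel \<Longrightarrow> X \<subseteq> gaps k \<inter> gaps k' \<Longrightarrow>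
       emeasure (stj k) X + emeasure (stj k') X \<le> emeasure N X"
proof -
  let ?M = "\<lambda>k. density (stj k) (indicator (gaps k))"
  have "sets (?M k) = sets borel" if "k \<in> {..CARD('n)}" for k
    using sets_stj that by simp
  from sum_of_measures_exists[of "{..CARD('n)}" ?M, OF this] obtain N where
    N: "sets N = sets borel" and N': "\<And>X. X \<in> sets borel \<Longrightarrow> emeasure N X = (\<Sum>k\<le>CARD('n). emeasure (?M k) X)"
    by blast
  have Mk: "emeasure (?M k) X = emeasure (stj k) (gaps k \<inter> X)" if "k \<le> CARD('n)" "X \<in> sets borel" for k X
    using that open_gaps sets_stj by (intro emeasure_restricted) auto
  show thesis
  proof
    show "sets N = sets borel" by (rule N)
    show "null_sets lborel \<subseteq> null_sets N"
    proof
      fix X :: "real set" assume X: "X \<in> null_sets lborel"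
      then have Xb: "X \<in> sets borel" by (auto simp: null_sets_def)
      have "emeasure N X = 0"
        unfolding N'[OF Xb] using Mk[OF _ Xb] stj_gaps_null[OF X] by simp
      then show "X \<in> null_sets N" using N Xb by (simp add: null_sets_def)
    qed
    have "emeasure N UNIV = (\<Sum>k\<le>CARD('n). emeasure (?M k) UNIV)" by (rule N') simp
    also have "\<dots> \<le> (\<Sum>k\<le>CARD('n). ennreal (2 * real CARD('n) * (L + integral {a..b} (\<lambda>x. norm (B x)))))"
    proof (rule sum_mono)
      fix k assume "k \<in> {..CARD('n)}"
      then have k: "k \<le> CARD('n)" by simp
      have "emeasure (?M k) UNIV = emeasure (stj k) (gaps k \<inter> UNIV)" using Mk[OF k] by simp
      also have "\<dots> \<le> emeasure (stj k) UNIV" by (rule emeasure_mono) (auto simp: sets_stj[OF k])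
      also have "\<dots> \<le> ennreal (G k b - G k a)" by (rule stj_UNIV[OF k])
      also have "\<dots> \<le> ennreal (2 * real CARD('n) * (L + integral {a..b} (\<lambda>x. norm (B x))))"
        by (intro ennreal_leI G_total k)
      finally show "emeasure (?M k) UNIV \<le> ennreal (2 * real CARD('n) * (L + integral {a..b} (\<lambda>x. norm (B x))))" .
    qed
    also have "\<dots> = ennreal (real (Suc CARD('n)) * (2 * real CARD('n) * (L + integral {a..b} (\<lambda>x. norm (B x)))))"
      using L0 integral_nonneg[OF Bn[of a b]]
      by (subst ennreal_mult) (auto simp: ennreal_of_nat_eq_real_of_nat)
    finally show "emeasure N UNIV \<le> \<dots>" .
    fix k k' :: nat and X assume k: "k < k'" "k' \<le> CARD('n)" and X: "X \<in> sets borel" "X \<subseteq> gaps k \<inter> gaps k'"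
    then have e: "gaps k \<inter> X = X" "gaps k' \<inter> X = X" by auto
    have "emeasure (stj k) X + emeasure (stj k') X = emeasure (?M k) X + emeasure (?M k') X"
      using Mk[of k X] Mk[of k' X] k X(1) e by simp
    also have "\<dots> = (\<Sum>i\<in>{k, k'}. emeasure (?M i) X)" using k by simp
    also have "\<dots> \<le> (\<Sum>i\<le>CARD('n). emeasure (?M i) X)"
      using k by (intro sum_mono2) auto
    finally show "emeasure (stj k) X + emeasure (stj k') X \<le> emeasure N X" by (simp add: N'[OF X(1)])
  qed
qed

section \<open>Clusters of equal eigenvalues\<close>

definition crossings where
  "crossings = {a, b} \<union> (\<Union>i. \<Union>j. {t \<in> {a..b}. lam t $ i = lam t $ j \<and> lam' t $ i \<noteq> lam' t $ j})"

lemma countable_crossings: "countable crossings"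
proof -
  have "countable {t \<in> {a..b}. lam t $ i = lam t $ j \<and> lam' t $ i \<noteq> lam' t $ j}" (is "countable ?S") for i j
  proof (rule countable_transversal_zeros[where D = "\<lambda>t. lam t $ i - lam t $ j" and D' = "\<lambda>t. lam' t $ i - lam' t $ j" and J = "{a..b}"])
    fix t assume "t \<in> ?S"
    then have "(lam has_vector_derivative lam' t) (at t within {a..b})" by (intro lam) auto
    then show "((\<lambda>t. lam t $ i - lam t $ j) has_vector_derivative lam' t $ i - lam' t $ j) (at t within {a..b})"
      by (auto intro!: derivative_intros bounded_linear.has_vector_derivative[OF bounded_linear_vec_nth])
  qed auto
  then show ?thesis unfolding crossings_def by (intro countable_Un countable_UN) auto
qed

text \<open>On this set the cluster of eigenvalues equal to \<open>lam t $ j\<close> is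
  \<open>K' - K\<close>; its two ends are the ranks \<open>card K\<close> and
  \<open>card K'\<close>.\<close>

definition block where
  "block j K K' = {t \<in> {a<..<b} - crossings. {i. lam t $ i > lam t $ j} = K \<and> {i. lam t $ i \<ge> lam t $ j} = K'}"

text \<open>The mean derivative over a cluster; the \<open>V\<close> terms cancel in the difference.
  It is a function on the whole line that depends on \<open>K\<close> and \<open>K'\<close> only, so
  its increments can be estimated without reference to the block.\<close>

definition block_slope where
  "block_slope K K' t = (G (card K') (clamp t) - G (card K) (clamp t)) / (real (card K') - real (card K))"

lemma block_card: "card K < card K'" "card K' \<le> CARD('n)" if "t \<in> block j K K'"
proof -
  have "j \<in> K' - K" "K \<subseteq> K'" using that by (auto simp: block_def)
  then have "K \<subset> K'" by auto
  then show "card K < card K'" by (intro psubset_card_mono) auto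
  show "card K' \<le> CARD('n)" by (intro card_mono) auto
qed

text \<open>Both ranks have gaps at \<open>t\<close>, so the maximizers are the spectral projections
  of \<open>K\<close> and \<open>K'\<close> whatever choice was made, and the Hellmann-Feynman
  formula gives the sum of the derivatives over the cluster; outside \<open>crossings\<close> these
  are all equal.\<close>

lemma block_slope: "lam' t $ j = block_slope K K' t" if t: "t \<in> block j K K'"
proof -
  have tab: "t \<in> {a..b}" "t \<notin> crossings" using t by (auto simp: block_def)
  have K: "K = {i. lam t $ i > lam t $ j}" "K' = {i. lam t $ i \<ge> lam t $ j}" using t by (auto simp: block_def)
  have "t islimpt {a..b}" using ab tab by simp
  from hellmann_feynman[OF dg A[OF tab(1)] lam[OF tab(1)] this] obtain E
    where E: "diagonalizes E (lam t) (A t)" "\<And>i. lam' t $ i = A' t \<bullet> E i" by blast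
  have P1: "P (card K) t = (\<Sum>i\<in>K. E i)" "P (card K') t = (\<Sum>i\<in>K'. E i)"
    unfolding P_def by (rule max_proj_eq_strict[OF E(1)]; auto simp: K)+
  have sub: "K \<subseteq> K'" "finite K'" by (auto simp: K)
  have same: "lam' t $ i = lam' t $ j" if "i \<in> K' - K" for i
  proof -
    have "lam t $ i = lam t $ j" using that by (auto simp: K)
    show ?thesis
    proof (rule ccontr)
      assume "lam' t $ i \<noteq> lam' t $ j"
      then have "t \<in> crossings" unfolding crossings_def using \<open>lam t $ i = lam t $ j\<close> tab(1) by blast
      then show False using tab(2) by simp
    qed
  qed
  have "G (card K') t - G (card K) t = A' t \<bullet> (\<Sum>i\<in>K' - K. E i)"
    using sum_diff[OF sub(2,1), of E] by (simp add: G_def P1 inner_diff_right)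
  also have "\<dots> = (\<Sum>i\<in>K' - K. lam' t $ i)" by (simp add: inner_sum_right E(2))
  also have "\<dots> = (\<Sum>i\<in>K' - K. lam' t $ j)" using same by (intro sum.cong) auto
  also have "\<dots> = (real (card K') - real (card K)) * lam' t $ j"
    using sub card_mono[OF sub(2,1)] by (simp add: card_Diff_subset of_nat_diff)
  finally show ?thesis
    using block_card[OF t] by (simp add: block_slope_def clamp(4)[OF tab(1)])
qed

lemma block_measurable: "block j K K' \<in> sets borel"
proof -
  define U where "U i i' = {t \<in> {a<..<b}. lam t $ i < lam t $ i'}" for i i'
  have U: "U i i' \<in> sets borel" for i i'
    unfolding U_def using open_lam_less[of i 0 i'] by (simp add: borel_open)
  have tU: "t \<in> U i i' \<longleftrightarrow> lam t $ i < lam t $ i'" if "t \<in> {a<..<b}" for t i i'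
    using that by (simp add: U_def)
  have c: "crossings \<in> sets borel"
    by (rule sets.countable[OF _ countable_crossings]) simp
  have "block j K K' = ({a<..<b} - crossings) \<inter> (\<Inter>i\<in>K. U j i) \<inter> (\<Inter>i\<in>-K. - U j i) \<inter>
      (\<Inter>i\<in>K'. - U i j) \<inter> (\<Inter>i\<in>-K'. U i j)" (is "?L = ?R")
  proof (rule set_eqI)
    fix t
    show "t \<in> ?L \<longleftrightarrow> t \<in> ?R"
    proof (cases "t \<in> {a<..<b} - crossings")
      case True
      then have t: "t \<in> {a<..<b}" by blast
      have "t \<in> ?L \<longleftrightarrow> (\<forall>i. lam t $ j < lam t $ i \<longleftrightarrow> i \<in> K) \<and> (\<forall>i. lam t $ j \<le> lam t $ i \<longleftrightarrow> i \<in> K')"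
        using True by (simp add: block_def set_eq_iff)
      also have "\<dots> \<longleftrightarrow> (\<forall>i. t \<in> U j i \<longleftrightarrow> i \<in> K) \<and> (\<forall>i. t \<notin> U i j \<longleftrightarrow> i \<in> K')"
        by (simp only: tU[OF t] not_less)
      also have "\<dots> \<longleftrightarrow> t \<in> ?R"
        unfolding Int_iff INT_iff Ball_def Compl_iff by (simp only: True simp_thms) blast
      finally show ?thesis .
    next
      case False
      then have "t \<notin> ?L" unfolding block_def mem_Collect_eq by simp
      moreover have "t \<notin> ?R" unfolding Int_iff using False by simp
      ultimately show ?thesis by simp
    qed
  qed
  also have "\<dots> \<in> sets borel"
    by (intro sets.Int sets.Diff sets.countable_INT'' borel_comp U c countable_finite finite) auto
  finally show ?thesis .
qed

lemma block_subset_gaps: "block j K K' \<subseteq> gaps (card K) \<inter> gaps (card K')"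
proof
  fix t assume t: "t \<in> block j K K'"
  have K: "K = {i. lam t $ i > lam t $ j}" "K' = {i. lam t $ i \<ge> lam t $ j}" using t by (auto simp: block_def)
  have tab: "t \<in> {a<..<b}" using t by (auto simp: block_def)
  have 1: "\<exists>r. \<forall>i\<in>K. \<forall>j\<in>-K. lam t $ j + 1 / real (Suc r) < lam t $ i"
    by (rule finite_strict_gap) (auto simp: K)
  have 2: "\<exists>r. \<forall>i\<in>K'. \<forall>j\<in>-K'. lam t $ j + 1 / real (Suc r) < lam t $ i"
    by (rule finite_strict_gap) (auto simp: K)
  show "t \<in> gaps (card K) \<inter> gaps (card K')"
    using 1 2 tab unfolding gaps_def gap_def by blast
qed

text \<open>The rank difference in the denominator is at least 1, and both increments of
  \<open>G\<close> are nonnegative, so the absolute value of their difference is at most their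
  sum.\<close>

lemma block_slope_increment:
  assumes "card K < card K'" "card K' \<le> CARD('n)" "p \<le> q"
  shows "\<bar>block_slope K K' q - block_slope K K' p\<bar> \<le>
    (G (card K) (clamp q) - G (card K) (clamp p)) + (G (card K') (clamp q) - G (card K') (clamp p))"
proof -
  have g: "0 \<le> G (card K) (clamp q) - G (card K) (clamp p)" "0 \<le> G (card K') (clamp q) - G (card K') (clamp p)"
    using G_clamp_mono[OF assms(3)] assms by auto
  have c: "1 \<le> real (card K') - real (card K)" using assms(1) by linarith
  have "\<bar>block_slope K K' q - block_slope K K' p\<bar> =
     \<bar>(G (card K') (clamp q) - G (card K') (clamp p)) - (G (card K) (clamp q) - G (card K) (clamp p))\<bar> / (real (card K') - real (card K))"
    using c by (simp add: block_slope_def diff_divide_distrib[symmetric] abs_divide)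
  also have "\<dots> \<le> \<bar>(G (card K') (clamp q) - G (card K') (clamp p)) - (G (card K) (clamp q) - G (card K) (clamp p))\<bar> / 1"
    using c by (intro divide_left_mono) auto
  also have "\<dots> \<le> (G (card K) (clamp q) - G (card K) (clamp p)) + (G (card K') (clamp q) - G (card K') (clamp p))"
    unfolding div_by_1 using g by linarith
  finally show ?thesis .
qed
end

lemma absolutely_integrable_vec:
  fixes u :: "'n::finite \<Rightarrow> real \<Rightarrow> real"
  assumes "\<And>j. u j absolutely_integrable_on S"
  shows "(\<lambda>x. \<chi> j. u j x) absolutely_integrable_on S"
proof (subst absolutely_integrable_componentwise_iff, intro ballI)
  fix e :: "real ^ 'n" assume "e \<in> Basis"
  then obtain j where "e = axis j 1" by (auto simp: Basis_vec_def)
  then show "(\<lambda>x. (\<chi> j. u j x) \<bullet> e) absolutely_integrable_on S"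
    using assms[of j] by (simp add: inner_axis)
qed

context eigenvalue_curve
begin

text \<open>The endpoints were put into \<open>crossings\<close> because blocks live in the open
  interval; a time outside \<open>crossings\<close> lies in the block of its own index sets
  \<open>K\<close> and \<open>K'\<close>.\<close>

lemma crossing_cover:
  assumes "{s..t} \<subseteq> {a..b}"
  shows "{s..t} \<subseteq> crossings \<union> (\<Union>i\<in>UNIV. block j (fst i) (snd i))"
proof
  fix x assume "x \<in> {s..t}"
  then have x: "x \<in> {a..b}" using assms by blast
  show "x \<in> crossings \<union> (\<Union>i\<in>UNIV. block j (fst i) (snd i))"
  proof (cases "x \<in> crossings")
    case False
    then have "x \<noteq> a" "x \<noteq> b" by (auto simp: crossings_def)
    with x False have "x \<in> block j {i. lam x $ i > lam x $ j} {i. lam x $ i \<ge> lam x $ j}"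
      by (simp add: block_def)
    then show ?thesis by (intro UnI2 UN_I[of "({i. lam x $ i > lam x $ j}, {i. lam x $ i \<ge> lam x $ j})"]) simp_all
  qed simp
qed

text \<open>The pieces are indexed by all pairs of index sets, which is the origin of the factor
  \<open>CARD('n set \<times> 'n set)\<close>. On one piece the images are measured by the Stieltjes
  measures of two ranks, and these are dominated by \<open>N\<close> because blocks lie in the gap
  sets.\<close>

lemma eigenvalue_derivative_bound:
  assumes N: "sets N = sets borel"
    and dom: "\<And>k k' X. k < k' \<Longrightarrow> k' \<le> CARD('n) \<Longrightarrow> X \<in> sets borel \<Longrightarrow> X \<subseteq> gaps k \<inter> gaps k' \<Longrightarrow>
       emeasure (stj k) X + emeasure (stj k') X \<le> emeasure N X"
    and st: "a \<le> s" "s \<le> t" "t \<le> b"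
  shows "ennreal \<bar>lam' t $ j - lam' s $ j\<bar> \<le> of_nat CARD('n set \<times> 'n set) * emeasure N {s..t}"
proof (rule countable_selection_bound[where T = crossings and E = "\<lambda>i. block j (fst i) (snd i)"
      and \<phi> = "\<lambda>i. block_slope (fst i) (snd i)" and f = "\<lambda>x. lam' x $ j"])
  show "closed_segment (lam' s $ j) (lam' t $ j) \<subseteq> (\<lambda>x. lam' x $ j) ` {s..t}"
  proof (rule derivative_Darboux[OF _ st(2)])
    fix x assume x: "x \<in> {s..t}"
    have "(lam has_vector_derivative lam' x) (at x within {s..t})"
      by (rule has_vector_derivative_within_subset[OF lam]) (use x st in auto)
    then show "((\<lambda>x. lam x $ j) has_vector_derivative lam' x $ j) (at x within {s..t})"
      by (rule bounded_linear.has_vector_derivative[OF bounded_linear_vec_nth])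
  qed
  show "{s..t} \<subseteq> crossings \<union> (\<Union>i\<in>UNIV. block j (fst i) (snd i))"
    using st by (intro crossing_cover) auto
  fix i :: "'n set \<times> 'n set" and X :: "real set"
  assume X: "X \<in> sets borel" "X \<subseteq> block j (fst i) (snd i)"
  let ?K = "fst i" and ?K' = "snd i"
  show "outer_measure_of lborel (block_slope ?K ?K' ` X) \<le> emeasure N X"
  \<comment> \<open>Only a point of the block shows that \<open>card ?K < card ?K'\<close>; an empty
    \<open>X\<close> has empty image.\<close>
  proof (cases "X = {}")
    case False
    then have c: "card ?K < card ?K'" "card ?K' \<le> CARD('n)" "card ?K \<le> CARD('n)"
      using block_card X(2) by (blast, blast, meson block_card X(2) ex_in_conv less_imp_le order_less_le_trans subsetD)
    have "sets (stj k) = sets borel" if "k \<in> {card ?K, card ?K'}" for k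
      using that c by (auto simp: sets_stj)
    from sum_of_measures_exists[of "{card ?K, card ?K'}" stj, OF this] obtain M where
      M: "sets M = sets borel" "\<And>X. X \<in> sets borel \<Longrightarrow> emeasure M X = (\<Sum>k\<in>{card ?K, card ?K'}. emeasure (stj k) X)"
      by blast
    have MX: "emeasure M X = emeasure (stj (card ?K)) X + emeasure (stj (card ?K')) X" if "X \<in> sets borel" for X
      using M(2)[OF that] c(1) by simp
    have "outer_measure_of lborel (block_slope ?K ?K' ` X) \<le> emeasure M X"
    proof (rule outer_measure_image_le[OF M(1) _ _ X(1)])
      show "emeasure M UNIV \<noteq> \<infinity>"
        using stj_UNIV[OF c(2)] stj_UNIV[OF c(3)] by (auto simp: MX top_unique)
      fix C :: "real set" and p q assume C: "open C" "connected C" "p \<in> C" "q \<in> C" "p \<le> q"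
      have g: "ennreal (G k (clamp q) - G k (clamp p)) \<le> emeasure (stj k) C" if "k \<le> CARD('n)" for k
        using stj[OF that] C unfolding is_stieltjes_def by blast
      have "ennreal \<bar>block_slope ?K ?K' q - block_slope ?K ?K' p\<bar> \<le>
        ennreal ((G (card ?K) (clamp q) - G (card ?K) (clamp p)) + (G (card ?K') (clamp q) - G (card ?K') (clamp p)))"
        by (intro ennreal_leI block_slope_increment c C)
      also have "\<dots> = ennreal (G (card ?K) (clamp q) - G (card ?K) (clamp p)) + ennreal (G (card ?K') (clamp q) - G (card ?K') (clamp p))"
        using G_clamp_mono[OF C(5) c(2)] G_clamp_mono[OF C(5) c(3)] by (intro ennreal_plus) auto
      also have "\<dots> \<le> emeasure M C"
        using MX[OF borel_open[OF C(1)]] g[OF c(2)] g[OF c(3)] by (simp add: add_mono)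
      finally show "ennreal \<bar>block_slope ?K ?K' q - block_slope ?K ?K' p\<bar> \<le> emeasure M C" .
    qed
    also have "\<dots> \<le> emeasure N X"
      unfolding MX[OF X(1)] by (intro dom c X(1) order_trans[OF X(2) block_subset_gaps])
    finally show ?thesis .
  qed simp
qed (use countable_crossings block_measurable block_slope N in auto)

text \<open>The constant is a product: \<open>CARD('n)\<close> for the sum over the components, the
  number of pairs of index sets, the number of ranks, and the bound of
  \<open>G_total\<close>.\<close>

lemma eigenvalue_derivative_density:
  obtains u where "u absolutely_integrable_on {a..b}"
    "\<And>s t. a \<le> s \<Longrightarrow> s \<le> t \<Longrightarrow> t \<le> b \<Longrightarrow> integral {s..t} u = lam' t - lam' s"
    "integral {a..b} (\<lambda>x. norm (u x)) \<le> real CARD('n) * (real CARD('n set \<times> 'n set) *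
       (real (Suc CARD('n)) * (2 * real CARD('n) * (L + integral {a..b} (\<lambda>x. norm (B x))))))"
proof -
  let ?c = "real CARD('n set \<times> 'n set)" and ?D = "real (Suc CARD('n)) * (2 * real CARD('n) * (L + integral {a..b} (\<lambda>x. norm (B x))))"
  have D0: "0 \<le> ?D" using L0 integral_nonneg[OF Bn[of a b]] by simp
  obtain N where N: "sets N = sets borel" "null_sets lborel \<subseteq> null_sets N" "emeasure N UNIV \<le> ennreal ?D"
    and dom: "\<And>k k' X. k < k' \<Longrightarrow> k' \<le> CARD('n) \<Longrightarrow> X \<in> sets borel \<Longrightarrow> X \<subseteq> gaps k \<inter> gaps k' \<Longrightarrow>
       emeasure (stj k) X + emeasure (stj k') X \<le> emeasure N X"
    using dominating_measure by metis
  define N1 where "N1 = scale_measure (of_nat CARD('n set \<times> 'n set)) N"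
  have N1: "emeasure N1 X = of_nat CARD('n set \<times> 'n set) * emeasure N X" for X
    by (simp add: N1_def)
  have sN1: "sets N1 = sets borel" by (simp add: N1_def N)
  have "emeasure N1 UNIV \<le> of_nat CARD('n set \<times> 'n set) * ennreal ?D"
    unfolding N1 using N(3) by (rule mult_left_mono) simp
  also have "\<dots> = ennreal (?c * ?D)"
    using D0 by (subst ennreal_mult) (auto simp: ennreal_of_nat_eq_real_of_nat)
  finally have N1U: "emeasure N1 UNIV \<le> ennreal (?c * ?D)" .
  then have fin: "emeasure N1 UNIV \<noteq> \<infinity>" by (auto simp: top_unique)
  have mN1: "measure N1 UNIV \<le> ?c * ?D"
    unfolding measure_def using N1U D0 by (intro enn2real_leI) auto
  have nul: "null_sets lborel \<subseteq> null_sets N1"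
    using N(2) by (auto simp: null_sets_def N1 sN1 N(1))
  have "\<exists>u. u absolutely_integrable_on {a..b} \<and>
      (\<forall>s t. a \<le> s \<longrightarrow> s \<le> t \<longrightarrow> t \<le> b \<longrightarrow> integral {s..t} u = lam' t $ j - lam' s $ j) \<and>
      integral {a..b} (\<lambda>x. \<bar>u x\<bar>) \<le> ?c * ?D" for j
  proof -
    have "ennreal \<bar>lam' t $ j - lam' s $ j\<bar> \<le> emeasure N1 {s..t}" if "a \<le> s" "s \<le> t" "t \<le> b" for s t
      unfolding N1 using eigenvalue_derivative_bound[OF N(1) dom that] by blast
    from absolutely_continuous_density[OF sN1 fin nul _ this, of a b] ab obtain u where
      "u absolutely_integrable_on {a..b}"
      "\<And>s t. a \<le> s \<Longrightarrow> s \<le> t \<Longrightarrow> t \<le> b \<Longrightarrow> integral {s..t} u = lam' t $ j - lam' s $ j"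
      "integral {a..b} (\<lambda>x. \<bar>u x\<bar>) \<le> measure N1 UNIV" by auto
    then show ?thesis using mN1 by (intro exI[of _ u]) auto
  qed
  then obtain u where u: "\<And>j. u j absolutely_integrable_on {a..b}"
      "\<And>j s t. a \<le> s \<Longrightarrow> s \<le> t \<Longrightarrow> t \<le> b \<Longrightarrow> integral {s..t} (u j) = lam' t $ j - lam' s $ j"
      "\<And>j. integral {a..b} (\<lambda>x. \<bar>u j x\<bar>) \<le> ?c * ?D"
    by metis
  define w :: "real \<Rightarrow> real ^ 'n" where "w x = (\<chi> j. u j x)" for x
  have w: "w absolutely_integrable_on {a..b}"
    unfolding w_def by (rule absolutely_integrable_vec) (rule u)
  have wi: "w integrable_on {s..t}" if "a \<le> s" "t \<le> b" for s t
    using set_integrable_subset[OF w, of "{s..t}"] that by (auto simp: absolutely_integrable_on_def)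
  have "integral {s..t} w = lam' t - lam' s" if st: "a \<le> s" "s \<le> t" "t \<le> b" for s t
  proof -
    have "integral {s..t} w $ j = lam' t $ j - lam' s $ j" for j
      using integral_component_eq_cart[OF wi[OF st(1,3)], of j] u(2)[OF st] by (simp add: w_def)
    then show ?thesis by (simp add: vec_eq_iff)
  qed
  moreover have "integral {a..b} (\<lambda>x. norm (w x)) \<le> integral {a..b} (\<lambda>x. \<Sum>j\<in>UNIV. \<bar>u j x\<bar>)"
  proof (rule integral_le)
    show "(\<lambda>x. norm (w x)) integrable_on {a..b}" using w by (simp add: absolutely_integrable_on_def)
    show "(\<lambda>x. \<Sum>j\<in>UNIV. \<bar>u j x\<bar>) integrable_on {a..b}"
      using u(1) by (intro integrable_sum) (auto simp: absolutely_integrable_on_def)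
    show "norm (w x) \<le> (\<Sum>j\<in>UNIV. \<bar>u j x\<bar>)" for x
      using norm_le_l1_cart[of "w x"] by (simp add: w_def)
  qed
  moreover have "integral {a..b} (\<lambda>x. \<Sum>j\<in>UNIV. \<bar>u j x\<bar>) = (\<Sum>j\<in>UNIV. integral {a..b} (\<lambda>x. \<bar>u j x\<bar>))"
    using u(1) by (intro Henstock_Kurzweil_Integration.integral_sum) (auto simp: absolutely_integrable_on_def)
  moreover have "\<dots> \<le> real CARD('n) * (?c * ?D)"
    using sum_bounded_above[of UNIV "\<lambda>j. integral {a..b} (\<lambda>x. \<bar>u j x\<bar>)", OF u(3)] by simp
  ultimately show thesis using w by (intro that) auto
qed

lemma eigenvalue_derivative_le: "t \<in> {a..b} \<Longrightarrow> \<bar>lam' t $ i\<bar> \<le> L"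
proof -
  assume t: "t \<in> {a..b}"
  then have "t islimpt {a..b}" using ab by simp
  from hellmann_feynman[OF dg A[OF t] lam[OF t] this] obtain E
    where E: "diagonalizes E (lam t) (A t)" "lam' t $ i = A' t \<bullet> E i" by blast
  have "\<bar>A' t \<bullet> E i\<bar> \<le> norm (A' t) * norm (E i)" by (rule Cauchy_Schwarz_ineq2)
  also have "\<dots> \<le> L" using E L[OF t] by (simp add: diagonalizes_def resolution_norm)
  finally show ?thesis using E by simp
qed

end

section \<open>Weak derivatives of second order\<close>

primrec cdiff :: "nat \<Rightarrow> (real \<Rightarrow> real) \<Rightarrow> bool" where
  "cdiff 0 f \<longleftrightarrow> f differentiable_on UNIV"
| "cdiff (Suc n) f \<longleftrightarrow> f differentiable_on UNIV \<and> cdiff n (deriv f)"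

definition smooth :: "(real \<Rightarrow> real) \<Rightarrow> bool" where
  "smooth f \<longleftrightarrow> (\<forall>n. cdiff n f)"

lemma differentiable_on_UNIV_DERIV:
  fixes f :: "real \<Rightarrow> real"
  assumes "f differentiable_on UNIV"
  shows "(f has_real_derivative deriv f x) (at x)"
  using assms unfolding differentiable_on_def
  by (metis DERIV_imp_deriv UNIV_I real_differentiableE)

text \<open>\<open>cdiff\<close> strips the innermost derivative first, which suits inductions over
  sums, products and compositions with the function generalized; here it is linked to the iterates
  that occur in \<open>test_function\<close>.\<close>

lemma smooth_iff: "smooth f \<longleftrightarrow> (\<forall>n. (deriv ^^ n) f differentiable_on UNIV)"
proof
  assume "smooth f"
  have "cdiff n f \<Longrightarrow> (deriv ^^ n) f differentiable_on UNIV" for n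
    by (induction n arbitrary: f) (auto simp: funpow_swap1)
  with \<open>smooth f\<close> show "\<forall>n. (deriv ^^ n) f differentiable_on UNIV" by (simp add: smooth_def)
next
  assume a: "\<forall>n. (deriv ^^ n) f differentiable_on UNIV"
  have "(\<And>n. (deriv ^^ n) f differentiable_on UNIV) \<Longrightarrow> cdiff n f" for n
  proof (induction n arbitrary: f)
    case 0
    from 0[of 0] show ?case by simp
  next
    case (Suc n)
    have "(deriv ^^ m) (deriv f) differentiable_on UNIV" for m
      using Suc.prems[of "Suc m"] by (simp add: funpow_swap1)
    with Suc.IH[of "deriv f"] Suc.prems[of 0] show ?case by simp
  qed
  with a show "smooth f" by (simp add: smooth_def)
qed

lemma smoothI:
  assumes "\<And>x. (f has_real_derivative f' x) (at x)" "smooth f'"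
  shows "smooth f"
proof -
  have d: "deriv f = f'" using assms(1) by (auto intro: DERIV_imp_deriv)
  have f: "f differentiable_on UNIV"
    using assms(1) by (auto simp: differentiable_on_def intro: real_differentiable_def[THEN iffD2])
  have "cdiff n f" for n
    using assms(2) f d by (cases n) (auto simp: smooth_def)
  then show ?thesis by (simp add: smooth_def)
qed

lemma smoothD:
  assumes "smooth f"
  shows "(f has_real_derivative deriv f x) (at x)" "smooth (deriv f)"
proof -
  have "cdiff (Suc n) f" for n using assms by (simp add: smooth_def)
  then show "smooth (deriv f)" "(f has_real_derivative deriv f x) (at x)"
    by (auto simp: smooth_def intro: differentiable_on_UNIV_DERIV)
qed

lemma cdiff_antimono: "cdiff (Suc n) f \<Longrightarrow> cdiff n f"
  by (induction n arbitrary: f) auto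

lemma cdiff_add:
  assumes "cdiff n f" "cdiff n g"
  shows "cdiff n (\<lambda>x. f x + g x)"
  using assms
proof (induction n arbitrary: f g)
  case (Suc n)
  have "deriv (\<lambda>x. f x + g x) = (\<lambda>x. deriv f x + deriv g x)"
    using Suc.prems by (auto intro!: DERIV_imp_deriv derivative_intros differentiable_on_UNIV_DERIV)
  with Suc show ?case by (auto intro: differentiable_on_add)
qed (auto intro: differentiable_on_add)

lemma cdiff_mult:
  assumes "cdiff n f" "cdiff n g"
  shows "cdiff n (\<lambda>x. f x * g x)"
  using assms
proof (induction n arbitrary: f g)
  case (Suc n)
  have "deriv (\<lambda>x. f x * g x) = (\<lambda>x. deriv f x * g x + f x * deriv g x)"
    using Suc.prems by (auto intro!: DERIV_imp_deriv derivative_eq_intros differentiable_on_UNIV_DERIV)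
  moreover have "cdiff n (\<lambda>x. deriv f x * g x + f x * deriv g x)"
    using Suc.prems by (intro cdiff_add Suc.IH) (auto intro: cdiff_antimono)
  ultimately show ?case using Suc.prems by (auto intro: differentiable_on_mult)
qed (auto intro: differentiable_on_mult)

lemma smooth_add: "smooth f \<Longrightarrow> smooth g \<Longrightarrow> smooth (\<lambda>x. f x + g x)"
  by (auto simp: smooth_def intro: cdiff_add)

lemma smooth_mult: "smooth f \<Longrightarrow> smooth g \<Longrightarrow> smooth (\<lambda>x. f x * g x)"
  by (auto simp: smooth_def intro: cdiff_mult)

lemma smooth_const: "smooth (\<lambda>x. c)"
proof -
  have "cdiff n (\<lambda>x. c)" for n by (induction n arbitrary: c) auto
  then show ?thesis by (simp add: smooth_def)
qed

lemma smooth_affine: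
  assumes "smooth f"
  shows "smooth (\<lambda>x. f (c * x + d))"
proof -
  have "cdiff n f \<Longrightarrow> cdiff n (\<lambda>x. f (c * x + d))" for n
  proof (induction n arbitrary: f)
    case 0
    have "((\<lambda>x. f (c * x + d)) has_real_derivative deriv f (c * x + d) * c) (at x)" for x
      by (rule DERIV_chain2[where g = "\<lambda>x. c * x + d", OF differentiable_on_UNIV_DERIV])
         (use 0 in \<open>auto intro!: derivative_eq_intros\<close>)
    then show ?case by (auto simp: differentiable_on_def intro: real_differentiable_def[THEN iffD2])
  next
    case (Suc n)
    have d: "((\<lambda>x. f (c * x + d)) has_real_derivative deriv f (c * x + d) * c) (at x)" for x
      by (rule DERIV_chain2[where g = "\<lambda>x. c * x + d", OF differentiable_on_UNIV_DERIV])
         (use Suc.prems in \<open>auto intro!: derivative_eq_intros\<close>)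
    then have "deriv (\<lambda>x. f (c * x + d)) = (\<lambda>x. deriv f (c * x + d) * c)"
      by (auto intro: DERIV_imp_deriv)
    moreover have "cdiff n (\<lambda>x. deriv f (c * x + d) * c)"
      using Suc.IH[of "deriv f"] Suc.prems smooth_const[of c] by (intro cdiff_mult) (auto simp: smooth_def)
    ultimately show ?case using d by (auto simp: differentiable_on_def intro: real_differentiable_def[THEN iffD2])
  qed
  with assms show ?thesis by (simp add: smooth_def)
qed

text \<open>The polynomial factor in \<open>1 / x\<close> makes the family closed under
  differentiation: the derivative multiplies \<open>p - pderiv p\<close> by the square of the
  variable. One derivative formula for all \<open>p\<close> therefore yields smoothness.\<close>

definition flat_exp :: "real poly \<Rightarrow> real \<Rightarrow> real" where
  "flat_exp p x = (if x > 0 then poly p (1 / x) * exp (- (1 / x)) else 0)"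

lemma poly_exp_tendsto_0: "((\<lambda>y. poly p y * exp (- y)) \<longlongrightarrow> 0) at_top" for p :: "real poly"
proof -
  have "((\<lambda>y. \<Sum>i\<le>degree p. coeff p i * (y ^ i / exp y)) \<longlongrightarrow> (\<Sum>i\<le>degree p. coeff p i * 0)) at_top"
    by (intro tendsto_intros tendsto_power_div_exp_0)
  then show ?thesis
    by (simp add: poly_altdef exp_minus sum_distrib_right divide_inverse mult.assoc)
qed

lemma flat_exp_DERIV: "(flat_exp p has_real_derivative flat_exp (monom 1 2 * (p - pderiv p)) x) (at x)"
proof -
  consider "x > 0" | "x < 0" | "x = 0" by linarith
  then show ?thesis
  proof cases
    case 1
    have "((\<lambda>x. poly p (1 / x) * exp (- (1 / x))) has_real_derivative
        flat_exp (monom 1 2 * (p - pderiv p)) x) (at x)"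
      using 1 by (auto intro!: derivative_eq_intros poly_DERIV[THEN DERIV_chain2]
          simp: flat_exp_def poly_monom power2_eq_square field_simps)
    then show ?thesis
      by (rule DERIV_cong_ev[OF refl _ refl, THEN iffD1, rotated])
         (use 1 eventually_nhds_in_open[of "{0<..}" x] in \<open>auto simp: flat_exp_def elim!: eventually_mono\<close>)
  next
    case 2
    have "((\<lambda>x. 0) has_real_derivative flat_exp (monom 1 2 * (p - pderiv p)) x) (at x)"
      using 2 by (simp add: flat_exp_def)
    then show ?thesis
      by (rule DERIV_cong_ev[OF refl _ refl, THEN iffD1, rotated])
         (use 2 eventually_nhds_in_open[of "{..<0}" x] in \<open>auto simp: flat_exp_def elim!: eventually_mono\<close>)
  next
    case 3
    \<comment> \<open>With \<open>y = 1 / h\<close> the difference quotient at 0 is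
      \<open>y * poly p y * exp (- y)\<close>.\<close>
    have "((\<lambda>y. poly (monom 1 1 * p) y * exp (- y)) \<longlongrightarrow> 0) at_top" by (rule poly_exp_tendsto_0)
    from filterlim_compose[OF this filterlim_inverse_at_top_right]
    have "((\<lambda>h. poly (monom 1 1 * p) (inverse h) * exp (- inverse h)) \<longlongrightarrow> 0) (at_right 0)" .
    then have r: "((\<lambda>h. flat_exp p h / h) \<longlongrightarrow> 0) (at_right 0)"
      by (rule Lim_transform_eventually)
         (auto simp: eventually_at_right_field flat_exp_def poly_monom field_simps intro: exI[of _ 1])
    have l: "((\<lambda>h. flat_exp p h / h) \<longlongrightarrow> 0) (at_left 0)"
      by (rule Lim_transform_eventually[OF tendsto_const])
         (auto simp: eventually_at_left_field flat_exp_def intro: exI[of _ "-1"])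
    have "((\<lambda>h. flat_exp p h / h) \<longlongrightarrow> 0) (at 0)"
      using l r by (simp add: filterlim_split_at)
    then show ?thesis
      using 3 by (simp add: DERIV_def flat_exp_def)
  qed
qed

lemma smooth_flat_exp: "smooth (flat_exp p)"
proof -
  have d: "deriv (flat_exp p) = flat_exp (monom 1 2 * (p - pderiv p))" for p
    by (rule ext) (rule DERIV_imp_deriv[OF flat_exp_DERIV])
  have "flat_exp p differentiable_on UNIV" for p
    using flat_exp_DERIV by (auto simp: differentiable_on_def intro: real_differentiable_def[THEN iffD2])
  then have "cdiff n (flat_exp p)" for n
    by (induction n arbitrary: p) (auto simp: d)
  then show ?thesis by (simp add: smooth_def)
qed

lemma antiderivative_exists:
  fixes f :: "real \<Rightarrow> real"
  assumes f: "continuous_on UNIV f" and 0: "\<And>x. x \<le> 0 \<Longrightarrow> f x = 0"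
  shows "\<exists>F. (\<forall>x. (F has_real_derivative f x) (at x)) \<and> (\<forall>x\<le>0. F x = 0)"
proof -
  define F where "F x = integral {0..x} f" for x
  have F: "F y = integral {c..y} f" if "c \<le> 0" "c \<le> y" for c y
  proof (cases "y \<le> 0")
    case True
    have "integral {c..y} f = integral {c..y} (\<lambda>x. 0)"
      by (intro integral_cong) (use True 0 in auto)
    moreover have "F y = 0"
      using True 0[of 0] by (cases "y = 0") (auto simp: F_def)
    ultimately show ?thesis by simp
  next
    case False
    have "integral {c..y} f = integral {c..0} f + integral {0..y} f"
      using False that by (intro Henstock_Kurzweil_Integration.integral_combine[symmetric] integrable_continuous_interval
          continuous_on_subset[OF f]) auto
    moreover have "integral {c..0} f = integral {c..0} (\<lambda>x. 0)"
      by (intro integral_cong) (use 0 in auto)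
    ultimately show ?thesis by (simp add: F_def)
  qed
  have "(F has_real_derivative f x) (at x)" for x
  proof -
    define c d where "c = min 0 x - 1" and "d = max 0 x + 1"
    have x: "x \<in> {c<..<d}" by (auto simp: c_def d_def)
    have "((\<lambda>y. integral {c..y} f) has_real_derivative f x) (at x within {c..d})"
      by (rule integral_has_real_derivative) (use x f continuous_on_subset in \<open>auto\<close>)
    then have "((\<lambda>y. integral {c..y} f) has_real_derivative f x) (at x)"
      using x at_within_interior[of x "{c..d}"] by simp
    then show ?thesis
      by (rule DERIV_cong_ev[OF refl _ refl, THEN iffD1, rotated])
         (use x eventually_nhds_in_open[of "{c<..<d}" x] in \<open>auto intro!: F[symmetric] simp: c_def elim!: eventually_mono\<close>)
  qed
  moreover have "F x = 0" if "x \<le> 0" for x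
    using that 0[of 0] by (cases "x = 0") (auto simp: F_def)
  ultimately show ?thesis by blast
qed

text \<open>A smooth function with second derivative a bump on \<open>{0..1}\<close>: a mollified \<open>max 0 x\<close>.\<close>

lemma smooth_ramp_exists:
  obtains R R1 \<rho> :: "real \<Rightarrow> real" and Z c where
    "smooth R" "\<And>x. (R has_real_derivative R1 x) (at x)" "\<And>x. (R1 has_real_derivative \<rho> x) (at x)"
    "continuous_on UNIV \<rho>" "\<And>x. 0 \<le> \<rho> x" "\<And>x. x \<le> 0 \<or> 1 \<le> x \<Longrightarrow> \<rho> x = 0"
    "\<And>x. x \<le> 0 \<Longrightarrow> R1 x = 0" "\<And>x. 1 \<le> x \<Longrightarrow> R1 x = Z" "Z > 0"
    "\<And>x. x \<le> 0 \<Longrightarrow> R x = 0" "\<And>x. 1 \<le> x \<Longrightarrow> R x = Z * x + c"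
proof -
  \<comment> \<open>A bump that is positive exactly on the open unit interval: the first factor
    vanishes to infinite order at 0, the second one at 1.\<close>
  define \<rho> where "\<rho> x = flat_exp 1 x * flat_exp 1 ((-1) * x + 1)" for x
  have \<rho>: "smooth \<rho>" unfolding \<rho>_def by (intro smooth_mult smooth_affine smooth_flat_exp)
  have cont: "continuous_on S f" if "\<And>x. (f has_real_derivative f' x) (at x)" for f f' :: "real \<Rightarrow> real" and S
    using that by (meson DERIV_isCont continuous_at_imp_continuous_on)
  have \<rho>c: "continuous_on UNIV \<rho>" by (rule cont) (rule smoothD(1)[OF \<rho>])
  have \<rho>0: "0 \<le> \<rho> x" and \<rho>z: "x \<le> 0 \<or> 1 \<le> x \<Longrightarrow> \<rho> x = 0" and \<rho>p: "0 < x \<Longrightarrow> x < 1 \<Longrightarrow> 0 < \<rho> x" for x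
    by (auto simp: \<rho>_def flat_exp_def)
  obtain R1 where R1: "\<And>x. (R1 has_real_derivative \<rho> x) (at x)" "\<And>x. x \<le> 0 \<Longrightarrow> R1 x = 0"
    using antiderivative_exists[OF \<rho>c] \<rho>z by metis
  obtain R where R: "\<And>x. (R has_real_derivative R1 x) (at x)" "\<And>x. x \<le> 0 \<Longrightarrow> R x = 0"
    using antiderivative_exists[OF cont[OF R1(1)]] R1(2) by metis
  define Z where "Z = R1 1"
  have Z1: "R1 x = Z" if "1 \<le> x" for x
  proof (cases "x = 1")
    case False
    with that have "1 < x" by simp
    then obtain z where "1 < z" "z < x" "R1 x - R1 1 = (x - 1) * \<rho> z"
      using MVT2[of 1 x R1 \<rho>] R1(1) that by auto
    then show ?thesis by (simp add: \<rho>z Z_def)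
  qed (simp add: Z_def)
  have "R1 0 < R1 1"
    by (rule DERIV_pos_imp_increasing_open[of 0 1 R1]) (use R1(1) \<rho>p cont[OF R1(1)] in \<open>auto intro!: exI[of _ "\<rho> _"]\<close>)
  then have "Z > 0" using R1(2)[of 0] by (simp add: Z_def)
  define c where "c = R 1 - Z"
  have "R x = Z * x + c" if "1 \<le> x" for x
  proof (cases "x = 1")
    case False
    with that have "1 < x" by simp
    then obtain z where "1 < z" "z < x" "R x - R 1 = (x - 1) * R1 z"
      using MVT2[of 1 x R R1] R(1) that by auto
    then show ?thesis by (simp add: Z1 c_def algebra_simps)
  qed (simp add: c_def)
  moreover have "smooth R" by (intro smoothI[OF R(1)] smoothI[OF R1(1)] \<rho>)
  ultimately show thesis
    using R R1 \<rho>c \<rho>0 \<rho>z Z1 \<open>Z > 0\<close> by (intro that[of R R1 \<rho> Z c]) auto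
qed

section \<open>Integration by parts for absolutely continuous functions\<close>

lemma continuous_scaleR_absolutely_integrable:
  fixes \<phi> :: "real \<Rightarrow> real" and g :: "real \<Rightarrow> 'b::euclidean_space"
  assumes "continuous_on K \<phi>" "compact K" "g absolutely_integrable_on K"
  shows "(\<lambda>x. \<phi> x *\<^sub>R g x) absolutely_integrable_on K"
proof (rule absolutely_integrable_bounded_measurable_product[where h = "\<lambda>x y. x *\<^sub>R y", OF _ _ _ _ assms(3)])
  have K: "K \<in> sets lebesgue" using assms(2) by (simp add: compact_imp_closed)
  then show "K \<in> sets lebesgue" .
  show "\<phi> \<in> borel_measurable (lebesgue_on K)"
    by (rule continuous_imp_measurable_on_sets_lebesgue[OF assms(1) K])
  show "bounded (\<phi> ` K)"
    using assms by (intro compact_imp_bounded compact_continuous_image)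
  show "bilinear (\<lambda>x y. x *\<^sub>R (y :: 'b))"
    by (auto simp: bilinear_def intro!: linearI simp: algebra_simps)
qed

text \<open>Differentiation almost everywhere is avoided. The function \<open>H\<close>, the defect
  of the formula up to time \<open>t\<close>, has increments of at most a constant times the step
  length times the variation \<open>W\<close> on the step; since \<open>W\<close> is continuous,
  \<open>H\<close> has derivative 0 at every point and is constant.\<close>

lemma ac_integration_by_parts:
  fixes F g :: "real \<Rightarrow> 'b::euclidean_space" and \<phi> \<phi>' :: "real \<Rightarrow> real"
  assumes ab: "a \<le> b" and g: "g absolutely_integrable_on {a..b}"
    and F: "\<And>s t. a \<le> s \<Longrightarrow> s \<le> t \<Longrightarrow> t \<le> b \<Longrightarrow> integral {s..t} g = F t - F s"
    and \<phi>: "\<And>x. x \<in> {a..b} \<Longrightarrow> (\<phi> has_vector_derivative \<phi>' x) (at x within {a..b})"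
    and \<phi>': "continuous_on {a..b} \<phi>'"
  shows "integral {a..b} (\<lambda>x. \<phi>' x *\<^sub>R F x) + integral {a..b} (\<lambda>x. \<phi> x *\<^sub>R g x) = \<phi> b *\<^sub>R F b - \<phi> a *\<^sub>R F a"
proof -
  have sub: "h integrable_on {s..t}" if "h absolutely_integrable_on {a..b}" "a \<le> s" "t \<le> b"
    for h :: "real \<Rightarrow> 'c::euclidean_space" and s t
    using set_integrable_subset[OF that(1), of "{s..t}"] that by (auto simp: absolutely_integrable_on_def)
  have gi: "g integrable_on {a..b}" and ni: "(\<lambda>x. norm (g x)) absolutely_integrable_on {a..b}"
    using g absolutely_integrable_norm[OF g] by (auto simp: absolutely_integrable_on_def o_def)
  have Fc: "continuous_on {a..b} F"
  proof -
    have "continuous_on {a..b} (\<lambda>t. F a + integral {a..t} g)"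
      by (intro continuous_intros indefinite_integral_continuous_1 gi)
    then show ?thesis
      by (rule continuous_on_eq) (use F in auto)
  qed
  have \<phi>c: "continuous_on {a..b} \<phi>"
    unfolding continuous_on_eq_continuous_within by (intro ballI has_vector_derivative_continuous[OF \<phi>])
  have i1: "(\<lambda>x. \<phi>' x *\<^sub>R F x) absolutely_integrable_on {a..b}"
    by (intro absolutely_integrable_continuous_real continuous_intros \<phi>' Fc)
  have i2: "(\<lambda>x. \<phi> x *\<^sub>R g x) absolutely_integrable_on {a..b}"
    by (rule continuous_scaleR_absolutely_integrable[OF \<phi>c compact_Icc g])
  obtain M where M: "\<And>x. x \<in> {a..b} \<Longrightarrow> \<bar>\<phi>' x\<bar> \<le> M" "M > 0"
  proof -
    have "bounded (\<phi>' ` {a..b})" by (intro compact_imp_bounded compact_continuous_image \<phi>' compact_Icc)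
    from bounded_pos[THEN iffD1, OF this] obtain M where "M > 0" "\<forall>x\<in>\<phi>' ` {a..b}. norm x \<le> M" by blast
    then show ?thesis by (intro that[of M]) auto
  qed
  define W where "W t = integral {a..t} (\<lambda>x. norm (g x))" for t
  have Wc: "continuous_on {a..b} W"
    unfolding W_def by (rule indefinite_integral_continuous_1[OF sub[OF ni]]) auto
  have W: "W t - W s = integral {s..t} (\<lambda>x. norm (g x))" if "a \<le> s" "s \<le> t" "t \<le> b" for s t
    using Henstock_Kurzweil_Integration.integral_combine[OF that(1,2) sub[OF ni order_refl that(3)]] by (simp add: W_def)
  have Wm: "W s \<le> W t" if "a \<le> s" "s \<le> t" "t \<le> b" for s t
    using W[OF that] integral_nonneg[OF sub[OF ni, of s t]] that by simp
  have FW: "norm (F t - F s) \<le> W t - W s" if "a \<le> s" "s \<le> t" "t \<le> b" for s t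
    unfolding W[OF that] F[OF that, symmetric]
    by (rule integral_norm_bound_integral) (use sub[OF g] sub[OF ni] that in auto)
  define H where "H t = \<phi> t *\<^sub>R F t - integral {a..t} (\<lambda>x. \<phi>' x *\<^sub>R F x) - integral {a..t} (\<lambda>x. \<phi> x *\<^sub>R g x)" for t
  have bound: "norm (H t - H s) \<le> 2 * M * (t - s) * (W t - W s)" if st: "a \<le> s" "s \<le> t" "t \<le> b" for s t
  proof -
    have p: "integral {s..y} \<phi>' = \<phi> y - \<phi> s" if "s \<le> y" "y \<le> t" for y
    proof (rule integral_unique, rule fundamental_theorem_of_calculus)
      fix x assume "x \<in> {s..y}"
      then show "(\<phi> has_vector_derivative \<phi>' x) (at x within {s..y})"
        using st that by (intro has_vector_derivative_within_subset[OF \<phi>]) auto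
    qed (use that in auto)
    have \<phi>L: "\<bar>\<phi> t - \<phi> x\<bar> \<le> M * (t - s)" if x: "x \<in> {s..t}" for x
    proof -
      have "norm (\<phi> t - \<phi> x) \<le> M * norm (t - x)"
      proof (rule differentiable_bound[of "{a..b}" \<phi> "\<lambda>x h. h *\<^sub>R \<phi>' x"])
        fix x assume x: "x \<in> {a..b}"
        show "(\<phi> has_derivative (\<lambda>h. h *\<^sub>R \<phi>' x)) (at x within {a..b})"
          using \<phi>[OF x] by (simp only: has_vector_derivative_def)
        show "onorm (\<lambda>h. h *\<^sub>R \<phi>' x) \<le> M"
          by (rule onorm_le) (use mult_right_mono[OF M(1)[OF x] abs_ge_zero] in \<open>simp add: abs_mult mult.commute\<close>)
      qed (use st x in auto)
      also have "M * norm (t - x) \<le> M * (t - s)" using x M(2) by (intro mult_left_mono) auto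
      finally show ?thesis by simp
    qed
    have c: "integral {a..t} h - integral {a..s} h = integral {s..t} h" if "h absolutely_integrable_on {a..b}"
      for h :: "real \<Rightarrow> 'b"
      using Henstock_Kurzweil_Integration.integral_combine[OF st(1,2) sub[OF that order_refl st(3)]] by (metis add_diff_cancel_left')
    have \<phi>'i: "\<phi>' integrable_on {s..t}"
      by (rule integrable_continuous_interval, rule continuous_on_subset[OF \<phi>']) (use st in auto)
    \<comment> \<open>Each product is frozen at one end, \<open>\<phi>\<close> at \<open>t\<close>
      against \<open>g\<close> and \<open>F\<close> at \<open>s\<close> against
      \<open>\<phi>'\<close>. What remains are two integrals of differences, each with one factor
      that varies little on the step.\<close>
    have "\<phi> t *\<^sub>R F t - \<phi> s *\<^sub>R F s = \<phi> t *\<^sub>R (F t - F s) + (\<phi> t - \<phi> s) *\<^sub>R F s"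
      by (simp add: algebra_simps)
    also have "\<phi> t *\<^sub>R (F t - F s) = integral {s..t} (\<lambda>x. \<phi> t *\<^sub>R g x)"
      by (simp only: F[OF st, symmetric] integral_cmul)
    also have "(\<phi> t - \<phi> s) *\<^sub>R F s = integral {s..t} (\<lambda>x. \<phi>' x *\<^sub>R F s)"
      using has_integral_scaleR_left[OF integrable_integral[OF \<phi>'i], of "F s"] p[OF st(2) order_refl]
      by (simp add: integral_unique)
    finally have "H t - H s = (integral {s..t} (\<lambda>x. \<phi> t *\<^sub>R g x) - integral {s..t} (\<lambda>x. \<phi> x *\<^sub>R g x)) +
        (integral {s..t} (\<lambda>x. \<phi>' x *\<^sub>R F s) - integral {s..t} (\<lambda>x. \<phi>' x *\<^sub>R F x))"
      unfolding H_def using c[OF i1] c[OF i2] by (simp add: algebra_simps)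
    also have "integral {s..t} (\<lambda>x. \<phi> t *\<^sub>R g x) - integral {s..t} (\<lambda>x. \<phi> x *\<^sub>R g x) =
        integral {s..t} (\<lambda>x. \<phi> t *\<^sub>R g x - \<phi> x *\<^sub>R g x)"
      by (rule Henstock_Kurzweil_Integration.integral_diff[symmetric])
         (use sub[OF g] sub[OF i2] st in \<open>auto intro: integrable_cmul\<close>)
    also have "integral {s..t} (\<lambda>x. \<phi>' x *\<^sub>R F s) - integral {s..t} (\<lambda>x. \<phi>' x *\<^sub>R F x) =
        integral {s..t} (\<lambda>x. \<phi>' x *\<^sub>R F s - \<phi>' x *\<^sub>R F x)"
      by (rule Henstock_Kurzweil_Integration.integral_diff[symmetric])
         (use sub[OF i1] st has_integral_scaleR_left[OF integrable_integral[OF \<phi>'i]] in \<open>auto intro: has_integral_integrable\<close>)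
    finally have H: "H t - H s = integral {s..t} (\<lambda>x. \<phi> t *\<^sub>R g x - \<phi> x *\<^sub>R g x) +
        integral {s..t} (\<lambda>x. \<phi>' x *\<^sub>R F s - \<phi>' x *\<^sub>R F x)" .
    have "norm (integral {s..t} (\<lambda>x. \<phi> t *\<^sub>R g x - \<phi> x *\<^sub>R g x)) \<le> integral {s..t} (\<lambda>x. M * (t - s) * norm (g x))"
    proof (rule integral_norm_bound_integral)
      show "(\<lambda>x. \<phi> t *\<^sub>R g x - \<phi> x *\<^sub>R g x) integrable_on {s..t}"
        using sub[OF g] sub[OF i2] st by (intro integrable_diff integrable_cmul) auto
      show "(\<lambda>x. M * (t - s) * norm (g x)) integrable_on {s..t}"
        using integrable_on_cmult_left[OF sub[OF ni st(1,3)]] by simp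
      fix x assume "x \<in> {s..t}"
      from mult_right_mono[OF \<phi>L[OF this] norm_ge_zero[of "g x"]]
      show "norm (\<phi> t *\<^sub>R g x - \<phi> x *\<^sub>R g x) \<le> M * (t - s) * norm (g x)"
        by (simp add: scaleR_diff_left[symmetric])
    qed
    also have "\<dots> = M * (t - s) * (W t - W s)"
      unfolding W[OF st] by (rule integral_mult_right)
    finally have 1: "norm (integral {s..t} (\<lambda>x. \<phi> t *\<^sub>R g x - \<phi> x *\<^sub>R g x)) \<le> M * (t - s) * (W t - W s)" .
    have "norm (integral {s..t} (\<lambda>x. \<phi>' x *\<^sub>R F s - \<phi>' x *\<^sub>R F x)) \<le> integral {s..t} (\<lambda>x. M * (W t - W s))"
    proof (rule integral_norm_bound_integral)
      show "(\<lambda>x. \<phi>' x *\<^sub>R F s - \<phi>' x *\<^sub>R F x) integrable_on {s..t}"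
        by (rule integrable_diff[OF has_integral_integrable[OF has_integral_scaleR_left[OF integrable_integral[OF \<phi>'i]]]
              sub[OF i1 st(1,3)]])
      fix x assume x: "x \<in> {s..t}"
      have "norm (\<phi>' x *\<^sub>R F s - \<phi>' x *\<^sub>R F x) = \<bar>\<phi>' x\<bar> * norm (F x - F s)"
        by (simp add: scaleR_diff_right[symmetric] norm_minus_commute)
      also have "\<dots> \<le> M * (W t - W s)"
        using M(1)[of x] FW[of s x] Wm[of x t] x st M(2) by (intro mult_mono) auto
      finally show "norm (\<phi>' x *\<^sub>R F s - \<phi>' x *\<^sub>R F x) \<le> M * (W t - W s)" .
    qed (rule integrable_const_ivl)
    also have "\<dots> = M * (t - s) * (W t - W s)" using st by simp
    finally have 2: "norm (integral {s..t} (\<lambda>x. \<phi>' x *\<^sub>R F s - \<phi>' x *\<^sub>R F x)) \<le> M * (t - s) * (W t - W s)" .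
    have "norm (H t - H s) \<le> M * (t - s) * (W t - W s) + M * (t - s) * (W t - W s)"
      unfolding H by (rule norm_triangle_le[OF add_mono[OF 1 2]])
    then show ?thesis by (simp add: mult.assoc)
  qed
  have "(H has_vector_derivative 0) (at t within {a..b})" if t: "t \<in> {a..b}" for t
    unfolding has_vector_derivative_iff_quotient
  proof (rule Lim_null_comparison)
    have "((\<lambda>s. 2 * M * \<bar>W s - W t\<bar>) \<longlongrightarrow> 2 * M * \<bar>W t - W t\<bar>) (at t within {a..b})"
      by (intro tendsto_intros) (use Wc t in \<open>simp add: continuous_on\<close>)
    then show "((\<lambda>s. 2 * M * \<bar>W s - W t\<bar>) \<longlongrightarrow> 0) (at t within {a..b})" by simp
    have "norm ((1 / (s - t)) *\<^sub>R (H s - H t)) \<le> 2 * M * \<bar>W s - W t\<bar>" if s: "s \<in> {a..b}" "s \<noteq> t" for s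
    proof -
      have "norm (H s - H t) \<le> \<bar>s - t\<bar> * (2 * M * \<bar>W s - W t\<bar>)"
      proof (cases "s \<le> t")
        case True
        then have "\<bar>s - t\<bar> = t - s" "\<bar>W s - W t\<bar> = W t - W s" using Wm[of s t] s t by auto
        then have e: "2 * M * (t - s) * (W t - W s) = \<bar>s - t\<bar> * (2 * M * \<bar>W s - W t\<bar>)" by simp
        have "norm (H s - H t) \<le> 2 * M * (t - s) * (W t - W s)"
          using bound[of s t] True s t by (simp add: norm_minus_commute)
        then show ?thesis unfolding e .
      next
        case False
        then have "\<bar>s - t\<bar> = s - t" "\<bar>W s - W t\<bar> = W s - W t" using Wm[of t s] s t by auto
        then have e: "2 * M * (s - t) * (W s - W t) = \<bar>s - t\<bar> * (2 * M * \<bar>W s - W t\<bar>)" by simp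
        have "norm (H s - H t) \<le> 2 * M * (s - t) * (W s - W t)"
          using bound[of t s] False s t by simp
        then show ?thesis unfolding e .
      qed
      then show ?thesis using s by (simp add: divide_simps mult.commute split: if_splits)
    qed
    then show "\<forall>\<^sub>F s in at t within {a..b}. norm ((1 / (s - t)) *\<^sub>R (H s - H t)) \<le> 2 * M * \<bar>W s - W t\<bar>"
      unfolding eventually_at_filter by (intro always_eventually) blast
  qed
  from has_vector_derivative_zero_constant[OF convex_real_interval(5) this]
  obtain c where c: "\<And>x. x \<in> {a..b} \<Longrightarrow> H x = c" by blast
  have "H b = H a" using c[of a] c[of b] ab by simp
  then show ?thesis by (simp add: H_def algebra_simps)
qed

section \<open>Test functions and weak derivatives\<close>

lemma test_function_smooth: "test_function V \<phi> \<Longrightarrow> smooth \<phi>"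
  by (simp add: test_function_def smooth_iff)

lemma test_function_zero: "test_function V \<phi> \<Longrightarrow> x \<notin> V \<Longrightarrow> \<phi> x = 0"
  using closure_subset[of "{x. \<phi> x \<noteq> 0}"] unfolding test_function_def by blast

lemma test_function_deriv:
  assumes "test_function V \<phi>"
  shows "test_function V (deriv \<phi>)"
proof -
  let ?K = "closure {x. \<phi> x \<noteq> 0}"
  have "deriv \<phi> x = 0" if "x \<notin> ?K" for x
  proof -
    have "open (- ?K)" by auto
    then have "((\<lambda>x. 0) has_real_derivative 0) (at x) \<longleftrightarrow> (\<phi> has_real_derivative 0) (at x)"
      using that closure_subset[of "{x. \<phi> x \<noteq> 0}"]
      by (intro DERIV_cong_ev[OF refl _ refl]) (auto elim!: eventually_mono dest: eventually_nhds_in_open[of "- ?K" x])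
    then show ?thesis by (auto intro: DERIV_imp_deriv)
  qed
  then have "{x. deriv \<phi> x \<noteq> 0} \<subseteq> ?K" by blast
  then have sub: "closure {x. deriv \<phi> x \<noteq> 0} \<subseteq> ?K" by (rule closure_minimal) auto
  have "compact (closure {x. deriv \<phi> x \<noteq> 0})"
    using compact_Int_closed[of ?K "closure {x. deriv \<phi> x \<noteq> 0}"] sub assms
    by (auto simp: test_function_def inf.absorb2)
  moreover have "(deriv ^^ n) (deriv \<phi>) differentiable_on UNIV" for n
    using assms unfolding test_function_def by (metis funpow_Suc_right o_apply)
  ultimately show ?thesis using sub assms by (auto simp: test_function_def)
qed

lemma test_function_deriv_pow: "test_function V \<phi> \<Longrightarrow> test_function V ((deriv ^^ j) \<phi>)"
  by (induction j) (auto intro: test_function_deriv)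

lemma test_function_subset: "test_function V \<phi> \<Longrightarrow> V \<subseteq> V' \<Longrightarrow> test_function V' \<phi>"
  by (auto simp: test_function_def)

lemma continuous_smooth: "smooth \<phi> \<Longrightarrow> continuous_on S \<phi>"
  using smoothD(1) by (meson DERIV_isCont continuous_at_imp_continuous_on)

lemma set_integrable_zero_outside:
  assumes "set_integrable M K h" "\<And>x. x \<in> V \<Longrightarrow> x \<notin> K \<Longrightarrow> h x = 0" "\<And>x. x \<in> K \<Longrightarrow> x \<notin> V \<Longrightarrow> h x = 0"
  shows "set_integrable M V h" "(LINT x:V|M. h x) = (LINT x:K|M. h x)"
proof -
  have "(\<lambda>x. indicat_real V x *\<^sub>R h x) = (\<lambda>x. indicat_real K x *\<^sub>R h x)"
    using assms(2,3) by (auto simp: indicator_def fun_eq_iff)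
  with assms(1) show "set_integrable M V h" "(LINT x:V|M. h x) = (LINT x:K|M. h x)"
    by (simp_all add: set_integrable_def set_lebesgue_integral_def)
qed

lemma test_function_integrable:
  fixes h :: "real \<Rightarrow> 'b::euclidean_space"
  assumes \<phi>: "test_function V \<phi>" and h: "locally_integrable_on V h"
  shows "set_integrable lebesgue V (\<lambda>x. \<phi> x *\<^sub>R h x)"
proof (rule set_integrable_zero_outside)
  let ?K = "closure {x. \<phi> x \<noteq> 0}"
  have K: "compact ?K" "?K \<subseteq> V" using \<phi> by (auto simp: test_function_def)
  show "set_integrable lebesgue ?K (\<lambda>x. \<phi> x *\<^sub>R h x)"
  proof (rule continuous_scaleR_absolutely_integrable[OF continuous_smooth[OF test_function_smooth[OF \<phi>]] K(1)])
    show "h absolutely_integrable_on ?K" using h K unfolding locally_integrable_on_def by blast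
  qed
  show "\<phi> x *\<^sub>R h x = 0" if "x \<notin> ?K" for x
    using that closure_subset[of "{x. \<phi> x \<noteq> 0}"] by auto
qed (use \<phi> test_function_zero[OF \<phi>] in auto)

lemma test_function_integral:
  fixes h :: "real \<Rightarrow> 'b::euclidean_space"
  assumes \<phi>: "test_function V \<phi>" and h: "h absolutely_integrable_on {a..b}" and V: "V \<subseteq> {a..b}"
  shows "(LINT x:V|lebesgue. \<phi> x *\<^sub>R h x) = integral {a..b} (\<lambda>x. \<phi> x *\<^sub>R h x)"
proof -
  have i: "(\<lambda>x. \<phi> x *\<^sub>R h x) absolutely_integrable_on {a..b}"
    by (rule continuous_scaleR_absolutely_integrable[OF continuous_smooth[OF test_function_smooth[OF \<phi>]] compact_Icc h])
  have "(LINT x:V|lebesgue. \<phi> x *\<^sub>R h x) = (LINT x:{a..b}|lebesgue. \<phi> x *\<^sub>R h x)"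
    by (rule set_integrable_zero_outside(2)[OF i]) (use V test_function_zero[OF \<phi>] in auto)
  also have "\<dots> = integral {a..b} (\<lambda>x. \<phi> x *\<^sub>R h x)"
    by (rule set_lebesgue_integral_eq_integral(2)[OF i])
  finally show ?thesis .
qed

lemma absolutely_integrable_imp_locally_integrable:
  assumes "h absolutely_integrable_on S" "V \<subseteq> S"
  shows "locally_integrable_on V h"
  unfolding locally_integrable_on_def using assms
  by (auto intro!: set_integrable_subset[OF assms(1)] dest: compact_imp_closed)

lemma ac_imp_weak_derivative:
  fixes F g :: "real \<Rightarrow> 'b::euclidean_space"
  assumes ab: "a \<le> b" and g: "g absolutely_integrable_on {a..b}"
    and F: "\<And>s t. a \<le> s \<Longrightarrow> s \<le> t \<Longrightarrow> t \<le> b \<Longrightarrow> integral {s..t} g = F t - F s"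
    and Fi: "F absolutely_integrable_on {a..b}"
    and V: "V \<subseteq> {a<..<b}" and \<phi>: "test_function V \<phi>"
  shows "(LINT x:V|lebesgue. deriv \<phi> x *\<^sub>R F x) = - (LINT x:V|lebesgue. \<phi> x *\<^sub>R g x)"
proof -
  have Vab: "V \<subseteq> {a..b}" using V by auto
  note sm = test_function_smooth[OF \<phi>]
  have d: "(\<phi> has_vector_derivative deriv \<phi> x) (at x within {a..b})" for x
    by (rule has_vector_derivative_at_within[OF smoothD(1)[OF sm, unfolded has_real_derivative_iff_has_vector_derivative]])
  have "\<phi> a = 0" by (rule test_function_zero[OF \<phi>]) (use V in auto)
  moreover have "\<phi> b = 0" by (rule test_function_zero[OF \<phi>]) (use V in auto)
  ultimately have "integral {a..b} (\<lambda>x. deriv \<phi> x *\<^sub>R F x) + integral {a..b} (\<lambda>x. \<phi> x *\<^sub>R g x) = 0"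
    using ac_integration_by_parts[OF ab g F d continuous_smooth[OF smoothD(2)[OF sm]]] by simp
  then show ?thesis
    unfolding test_function_integral[OF test_function_deriv[OF \<phi>] Fi Vab] test_function_integral[OF \<phi> g Vab]
    by (simp add: add_eq_0_iff2)
qed

text \<open>The second order formula is the first order formula for \<open>f\<close>, tested with
  \<open>deriv \<phi>\<close>, followed by the one for \<open>f'\<close>, tested with
  \<open>\<phi>\<close>.\<close>

lemma classical_imp_weak:
  fixes f f' g :: "real \<Rightarrow> 'b::euclidean_space"
  assumes ab: "a \<le> b" and g: "g absolutely_integrable_on {a..b}"
    and f': "\<And>s t. a \<le> s \<Longrightarrow> s \<le> t \<Longrightarrow> t \<le> b \<Longrightarrow> integral {s..t} g = f' t - f' s"
    and f: "\<And>t. t \<in> {a..b} \<Longrightarrow> (f has_vector_derivative f' t) (at t within {a..b})"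
    and V: "V \<subseteq> {a<..<b}"
  shows "has_weak_derivative 1 V f f'" "has_weak_derivative 2 V f g"
    and "f absolutely_integrable_on {a..b}" "f' absolutely_integrable_on {a..b}"
proof -
  have fc: "continuous_on {a..b} f"
    unfolding continuous_on_eq_continuous_within by (intro ballI has_vector_derivative_continuous[OF f])
  have "continuous_on {a..b} (\<lambda>t. f' a + integral {a..t} g)"
    by (intro continuous_on_add continuous_on_const indefinite_integral_continuous_1 set_lebesgue_integral_eq_integral(1)[OF g])
  then have f'c: "continuous_on {a..b} f'"
    by (rule continuous_on_eq) (simp add: f')
  show fi: "f absolutely_integrable_on {a..b}" and f'i: "f' absolutely_integrable_on {a..b}"
    by (intro absolutely_integrable_continuous_real fc f'c)+
  have F: "integral {s..t} f' = f t - f s" if "a \<le> s" "s \<le> t" "t \<le> b" for s t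
  proof (rule integral_unique, rule fundamental_theorem_of_calculus[OF that(2)])
    fix x assume "x \<in> {s..t}"
    then show "(f has_vector_derivative f' x) (at x within {s..t})"
      using that by (intro has_vector_derivative_within_subset[OF f]) auto
  qed
  have Vab: "V \<subseteq> {a..b}" using V by auto
  have loc: "locally_integrable_on V f" "locally_integrable_on V f'" "locally_integrable_on V g"
    by (rule absolutely_integrable_imp_locally_integrable[OF _ Vab], rule fi f'i g)+
  have 1: "(LINT x:V|lebesgue. deriv \<phi> x *\<^sub>R f x) = - (LINT x:V|lebesgue. \<phi> x *\<^sub>R f' x)" if "test_function V \<phi>" for \<phi>
    by (rule ac_imp_weak_derivative[OF ab f'i F fi V that])
  have 2: "(LINT x:V|lebesgue. deriv \<phi> x *\<^sub>R f' x) = - (LINT x:V|lebesgue. \<phi> x *\<^sub>R g x)" if "test_function V \<phi>" for \<phi>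
    by (rule ac_imp_weak_derivative[OF ab g f' f'i V that])
  show "has_weak_derivative 1 V f f'"
    using 1 loc by (simp add: has_weak_derivative_def)
  show "has_weak_derivative 2 V f g"
    using 1[OF test_function_deriv] 2 loc by (simp add: has_weak_derivative_def numeral_2_eq_2)
qed

section \<open>Continuous functions with vanishing weak second derivative\<close>

lemma kernel_limit:
  fixes \<rho> R1 e :: "real \<Rightarrow> real"
  assumes R1: "\<And>x. (R1 has_real_derivative \<rho> x) (at x)" and \<rho>: "continuous_on UNIV \<rho>" "\<And>x. 0 \<le> \<rho> x"
    "\<And>x. x \<le> 0 \<or> 1 \<le> x \<Longrightarrow> \<rho> x = 0" "\<And>x. x \<le> 0 \<Longrightarrow> R1 x = 0" "\<And>x. 1 \<le> x \<Longrightarrow> R1 x = Z"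
    and e: "continuous_on {u..v} e" and x0: "u \<le> x0" "x0 < v"
  shows "(\<lambda>n. integral {u..v} (\<lambda>x. (real n * \<rho> (real n * (x - x0))) * e x)) \<longlonglongrightarrow> Z * e x0"
proof (rule LIMSEQ_I)
  fix r :: real assume r: "r > 0"
  have Z0: "0 \<le> Z"
  proof -
    have "R1 0 \<le> R1 1" by (rule DERIV_nonneg_imp_nondecreasing[of 0 1]) (use R1 \<rho>(2) in \<open>auto intro!: exI[of _ "\<rho> _"]\<close>)
    then show ?thesis using \<rho>(4)[of 0] \<rho>(5)[of 1] by simp
  qed
  \<comment> \<open>A tolerance for \<open>e\<close> that a kernel of mass \<open>Z\<close> turns
    into an error of at most \<open>r / 2\<close>; the summand 1 covers
    \<open>Z = 0\<close>.\<close>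
  define d where "d = r / (2 * (Z + 1))"
  have d: "d > 0" using r Z0 by (simp add: d_def)
  obtain \<delta> where \<delta>: "\<delta> > 0" "\<And>x. x \<in> {u..v} \<Longrightarrow> dist x x0 < \<delta> \<Longrightarrow> dist (e x) (e x0) < d"
    using e[unfolded continuous_on_iff, rule_format, of x0 d] x0 d by auto
  obtain N :: nat where N: "1 / min \<delta> (v - x0) < real N"
    using reals_Archimedean2 by blast
  have m: "0 < min \<delta> (v - x0)" using \<delta> x0 by simp
  show "\<exists>N. \<forall>n\<ge>N. norm (integral {u..v} (\<lambda>x. (real n * \<rho> (real n * (x - x0))) * e x) - Z * e x0) < r"
  proof (intro exI allI impI)
    fix n assume "n \<ge> N"
    then have n: "1 / min \<delta> (v - x0) < real n" using N by simp
    have n0: "real n > 0" using n m by (meson divide_pos_pos less_trans zero_less_one)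
    have n1: "1 < real n * min \<delta> (v - x0)" using n m by (simp add: divide_simps mult.commute split: if_splits)
    have nv: "1 \<le> real n * (v - x0)" and n\<delta>: "1 < real n * \<delta>"
      using n1 n0 by (smt (verit) mult_left_mono min.cobounded1 min.cobounded2)+
    let ?k = "\<lambda>x. real n * \<rho> (real n * (x - x0))"
    have kc: "continuous_on {u..v} ?k"
      by (intro continuous_intros continuous_on_compose2[OF \<rho>(1)]) auto
    \<comment> \<open>The kernel sits between \<open>x0\<close> and \<open>x0 + 1 / real n\<close>,
      to the right of \<open>x0\<close> and to the left of \<open>v\<close>; hence it has full mass
      \<open>Z\<close> even for \<open>x0 = u\<close>.\<close>
    have "(?k has_integral (R1 (real n * (v - x0)) - R1 (real n * (u - x0)))) {u..v}"
    proof (rule fundamental_theorem_of_calculus)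
      fix x assume "x \<in> {u..v}"
      have "((\<lambda>x. R1 (real n * (x - x0))) has_real_derivative \<rho> (real n * (x - x0)) * real n) (at x within {u..v})"
        by (rule DERIV_chain2[where g = "\<lambda>x. real n * (x - x0)", OF R1]) (auto intro!: derivative_eq_intros)
      then show "((\<lambda>x. R1 (real n * (x - x0))) has_vector_derivative ?k x) (at x within {u..v})"
        by (simp add: has_real_derivative_iff_has_vector_derivative mult.commute)
    qed (use x0 in simp)
    moreover have "R1 (real n * (u - x0)) = 0"
      using x0 by (intro \<rho>(4)) (simp add: mult_nonneg_nonpos)
    ultimately have k: "(?k has_integral Z) {u..v}" using \<rho>(5)[OF nv] by simp
    have i1: "(\<lambda>x. ?k x * e x) integrable_on {u..v}"
      by (intro integrable_continuous_interval continuous_on_mult kc e)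
    have i2: "((\<lambda>x. ?k x * e x0) has_integral Z * e x0) {u..v}"
      by (rule has_integral_mult_left[OF k])
    have "integral {u..v} (\<lambda>x. ?k x * e x) - Z * e x0 = integral {u..v} (\<lambda>x. ?k x * e x - ?k x * e x0)"
      by (simp only: Henstock_Kurzweil_Integration.integral_diff[OF i1 has_integral_integrable[OF i2]] integral_unique[OF i2])
    also have "norm \<dots> \<le> integral {u..v} (\<lambda>x. ?k x * d)"
    proof (rule integral_norm_bound_integral)
      show "(\<lambda>x. ?k x * e x - ?k x * e x0) integrable_on {u..v}"
        by (rule integrable_diff[OF i1 has_integral_integrable[OF i2]])
      show "(\<lambda>x. ?k x * d) integrable_on {u..v}"
        by (rule has_integral_integrable[OF has_integral_mult_left[OF k]])
      fix x assume x: "x \<in> {u..v}"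
      have k0: "0 \<le> ?k x" using \<rho>(2) by simp
      show "norm (?k x * e x - ?k x * e x0) \<le> ?k x * d"
      proof (cases "?k x = 0")
        case False
        then have "0 < real n * (x - x0)" "real n * (x - x0) < 1"
          using \<rho>(3)[of "real n * (x - x0)"] by (metis mult_zero_right not_le)+
        then have "0 < x - x0" "x - x0 < \<delta>"
          using n0 n\<delta> zero_less_mult_pos[of "real n" "x - x0"] mult_less_cancel_left_pos[OF n0, of "x - x0" \<delta>]
          by linarith+
        then have "dist x x0 < \<delta>" by (simp add: dist_real_def)
        from \<delta>(2)[OF x this] have "\<bar>e x - e x0\<bar> \<le> d" by (simp add: dist_real_def)
        from mult_left_mono[OF this k0] show ?thesis
          by (simp only: right_diff_distrib[symmetric] real_norm_def abs_mult[of "?k x"] abs_of_nonneg[OF k0])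
      next
        case True
        show ?thesis unfolding True by simp
      qed
    qed
    also have "\<dots> = Z * d" by (rule integral_unique[OF has_integral_mult_left[OF k]])
    also have "\<dots> \<le> (Z + 1) * d" using d by (simp add: algebra_simps)
    also have "(Z + 1) * d = r / 2" using Z0 by (simp add: d_def field_simps)
    also have "r / 2 < r" using r by simp
    finally show "norm (integral {u..v} (\<lambda>x. ?k x * e x) - Z * e x0) < r" .
  qed
qed

text \<open>Ramps starting at \<open>x1\<close>, \<open>x2\<close> and \<open>x3\<close>, with
  weights whose sum and first moment vanish, add up to a compactly supported function. Its second
  derivative consists of three approximate point masses, and in the limit the equation says that the
  second divided difference of \<open>e\<close> at the three points is 0.\<close>

lemma weak_second_derivative_zero_three_points:
  fixes e :: "real \<Rightarrow> real"
  assumes e: "continuous_on {p<..<q} e"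
    and zero: "\<And>\<phi>. test_function {p<..<q} \<phi> \<Longrightarrow> (LINT x:{p<..<q}|lebesgue. (deriv ^^ 2) \<phi> x *\<^sub>R e x) = 0"
    and x: "p < x1" "x1 < x2" "x2 < x3" "x3 < q"
  shows "(x3 - x2) * e x1 - (x3 - x1) * e x2 + (x2 - x1) * e x3 = 0"
proof -
  obtain R R1 \<rho> :: "real \<Rightarrow> real" and Z c where R: "smooth R"
    and dR: "\<And>x. (R has_real_derivative R1 x) (at x)" and dR1: "\<And>x. (R1 has_real_derivative \<rho> x) (at x)"
    and \<rho>: "continuous_on UNIV \<rho>" "\<And>x. 0 \<le> \<rho> x" "\<And>x. x \<le> 0 \<or> 1 \<le> x \<Longrightarrow> \<rho> x = 0"
      "\<And>x. x \<le> 0 \<Longrightarrow> R1 x = 0" "\<And>x. 1 \<le> x \<Longrightarrow> R1 x = Z" "Z > 0"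
    and R0: "\<And>x. x \<le> 0 \<Longrightarrow> R x = 0" "\<And>x. 1 \<le> x \<Longrightarrow> R x = Z * x + c"
    by (rule smooth_ramp_exists) blast
  \<comment> \<open>A point between \<open>x3\<close> and \<open>q\<close>: for large
    \<open>n\<close> the three kernels end before \<open>v\<close>, and the test function vanishes
    from there on.\<close>
  define v where "v = (x3 + q) / 2"
  have v: "x3 < v" "v < q" "x1 < v" "x2 < v" using x by (auto simp: v_def)
  \<comment> \<open>The coefficients of the divided difference; they annihilate affine functions,
    which removes the tails of the ramps.\<close>
  define a1 a2 a3 where "a1 = x3 - x2" and "a2 = x1 - x3" and "a3 = x2 - x1"
  have a: "a1 + a2 + a3 = 0" "a1 * x1 + a2 * x2 + a3 * x3 = 0"
    by (auto simp: a1_def a2_def a3_def algebra_simps)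
  have ec: "continuous_on {x1..v} e"
    by (rule continuous_on_subset[OF e]) (use x v in auto)
  define I where "I n y = integral {x1..v} (\<lambda>x. (real n * \<rho> (real n * (x - y))) * e x)" for n y
  have lim: "(\<lambda>n. I n y) \<longlonglongrightarrow> Z * e y" if "x1 \<le> y" "y < v" for y
    unfolding I_def by (rule kernel_limit[OF dR1 \<rho>(1-5) ec that])
  have "(\<lambda>n. a1 * I n x1 + a2 * I n x2 + a3 * I n x3) \<longlonglongrightarrow> a1 * (Z * e x1) + a2 * (Z * e x2) + a3 * (Z * e x3)"
    by (intro tendsto_intros lim) (use x v in auto)
  moreover have "\<forall>\<^sub>F n in sequentially. a1 * I n x1 + a2 * I n x2 + a3 * I n x3 = 0"
  proof -
    obtain N :: nat where N: "1 / (v - x3) < real N" using reals_Archimedean2 by blast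
    have "a1 * I n x1 + a2 * I n x2 + a3 * I n x3 = 0" if "n \<ge> N" for n
    proof -
      have n: "1 / (v - x3) < real n" using N that by simp
      have n0: "0 < real n" using n v by (meson diff_gt_0_iff_gt divide_pos_pos less_trans zero_less_one)
      have nv: "1 < real n * (v - x3)" using n v by (simp add: divide_simps mult.commute split: if_splits)
      define T where "T y x = R (real n * x + - (real n * y))" for y x
      \<comment> \<open>Dividing by \<open>real n\<close> compensates one of the two inner
        derivatives, so that the second derivative consists of the kernels of
        \<open>kernel_limit\<close>.\<close>
      define \<phi> where "\<phi> x = (a1 / real n) * T x1 x + (a2 / real n) * T x2 x + (a3 / real n) * T x3 x" for x
      have sT: "smooth (T y)" for y unfolding T_def by (rule smooth_affine[OF R])
      have sm: "smooth \<phi>"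
        unfolding \<phi>_def by (intro smooth_add smooth_mult smooth_const sT)
      have dT: "(T y has_real_derivative real n * R1 (real n * (x - y))) (at x)" for x y
      proof -
        have "(T y has_real_derivative R1 (real n * x + - (real n * y)) * real n) (at x)"
          unfolding T_def by (rule DERIV_chain2[where g = "\<lambda>x. real n * x + - (real n * y)", OF dR]) (auto intro!: derivative_eq_intros)
        then show ?thesis by (simp add: algebra_simps)
      qed
      have dd: "((\<lambda>x. R1 (real n * (x - y))) has_real_derivative real n * \<rho> (real n * (x - y))) (at x)" for x y
      proof -
        have "((\<lambda>x. R1 (real n * (x - y))) has_real_derivative \<rho> (real n * (x - y)) * real n) (at x)"
          by (rule DERIV_chain2[where g = "\<lambda>x. real n * (x - y)", OF dR1]) (auto intro!: derivative_eq_intros)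
        then show ?thesis by (simp add: mult.commute)
      qed
      have d1: "deriv \<phi> = (\<lambda>x. a1 * R1 (real n * (x - x1)) + a2 * R1 (real n * (x - x2)) + a3 * R1 (real n * (x - x3)))"
      proof
        fix x
        have "(\<phi> has_real_derivative (a1 / real n) * (real n * R1 (real n * (x - x1))) +
           (a2 / real n) * (real n * R1 (real n * (x - x2))) + (a3 / real n) * (real n * R1 (real n * (x - x3)))) (at x)"
          unfolding \<phi>_def by (intro DERIV_add DERIV_cmult dT)
        then show "deriv \<phi> x = a1 * R1 (real n * (x - x1)) + a2 * R1 (real n * (x - x2)) + a3 * R1 (real n * (x - x3))"
          using n0 by (intro DERIV_imp_deriv) simp
      qed
      have d2: "(deriv ^^ 2) \<phi> = (\<lambda>x. a1 * (real n * \<rho> (real n * (x - x1))) + a2 * (real n * \<rho> (real n * (x - x2))) + a3 * (real n * \<rho> (real n * (x - x3))))"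
      proof
        fix x
        have "(deriv \<phi> has_real_derivative a1 * (real n * \<rho> (real n * (x - x1))) + a2 * (real n * \<rho> (real n * (x - x2))) + a3 * (real n * \<rho> (real n * (x - x3)))) (at x)"
          unfolding d1 by (intro DERIV_add DERIV_cmult dd)
        then show "(deriv ^^ 2) \<phi> x = a1 * (real n * \<rho> (real n * (x - x1))) + a2 * (real n * \<rho> (real n * (x - x2))) + a3 * (real n * \<rho> (real n * (x - x3)))"
          by (simp add: numeral_2_eq_2 DERIV_imp_deriv)
      qed
      have lo: "\<phi> x = 0" if "x \<le> x1" for x
      proof -
        have "real n * x + - (real n * y) \<le> 0" if "x1 \<le> y" for y
          using \<open>x \<le> x1\<close> that n0 by (simp add: mult_left_mono)
        then show ?thesis unfolding \<phi>_def T_def using x by (simp add: R0(1))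
      qed
      have hi: "\<phi> y = 0" if "v \<le> y" for y
      proof -
        have "1 \<le> real n * y + - (real n * z)" if "z \<le> x3" for z
        proof -
          have "real n * (v - x3) \<le> real n * (y - z)"
            using \<open>v \<le> y\<close> that n0 by (intro mult_left_mono) auto
          then show ?thesis using nv by (simp add: algebra_simps)
        qed
        then have T: "T z y = Z * (real n * y + - (real n * z)) + c" if "z \<le> x3" for z
          unfolding T_def using that by (intro R0(2)) blast
        have "\<phi> y = ((a1 + a2 + a3) * (Z * real n * y + c) - Z * real n * (a1 * x1 + a2 * x2 + a3 * x3)) / real n"
          unfolding \<phi>_def using x n0 by (simp add: T field_simps)
        then show ?thesis by (simp add: a)
      qed
      have supp: "closure {x. \<phi> x \<noteq> 0} \<subseteq> {x1..v}"
      proof (rule closure_minimal)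
        show "{x. \<phi> x \<noteq> 0} \<subseteq> {x1..v}" 
        proof
          fix x assume "x \<in> {x. \<phi> x \<noteq> 0}"
          then have "\<not> x \<le> x1" "\<not> v \<le> x" using lo[of x] hi[of x] by blast+
          then show "x \<in> {x1..v}" by simp
        qed
      qed simp
      have tf: "test_function {p<..<q} \<phi>"
        unfolding test_function_def
      proof (intro conjI)
        show "\<forall>n. (deriv ^^ n) \<phi> differentiable_on UNIV" using sm by (simp add: smooth_iff)
        have "compact ({x1..v} \<inter> closure {x. \<phi> x \<noteq> 0})" by (intro compact_Int_closed) auto
        then show "compact (closure {x. \<phi> x \<noteq> 0})" using supp by (simp add: inf.absorb2)
        show "closure {x. \<phi> x \<noteq> 0} \<subseteq> {p<..<q}" using supp x v by (auto intro: less_le_trans le_less_trans)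
      qed
      let ?k = "\<lambda>y x. (real n * \<rho> (real n * (x - y))) * e x"
      have kc: "continuous_on {x1..v} (?k y)" for y
        by (intro continuous_on_mult ec continuous_on_const continuous_on_compose2[OF \<rho>(1)] continuous_intros) auto
      have hz: "(deriv ^^ 2) \<phi> x = 0" if "x \<notin> {x1..v}" for x
      proof -
        have "\<rho> (real n * (x - y)) = 0" if y: "x1 \<le> y" "y \<le> x3" for y
        proof (rule \<rho>(3))
          from \<open>x \<notin> {x1..v}\<close> consider "x < x1" | "v < x" by force
          then show "real n * (x - y) \<le> 0 \<or> 1 \<le> real n * (x - y)"
          proof cases
            case 1
            then show ?thesis using y n0 by (simp add: mult_nonneg_nonpos)
          next
            case 2
            then have "real n * (v - x3) \<le> real n * (x - y)"
              using y n0 by (intro mult_left_mono) auto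
            then show ?thesis using nv by simp
          qed
        qed
        then show ?thesis unfolding d2 using x by simp
      qed
      have hc: "continuous_on {x1..v} (\<lambda>x. (deriv ^^ 2) \<phi> x *\<^sub>R e x)"
        by (intro continuous_on_scaleR ec continuous_smooth test_function_smooth[OF test_function_deriv_pow[OF tf]])
      have hi: "(\<lambda>x. (deriv ^^ 2) \<phi> x *\<^sub>R e x) absolutely_integrable_on {x1..v}"
        by (rule absolutely_integrable_continuous_real[OF hc])
      have "0 = (LINT x:{p<..<q}|lebesgue. (deriv ^^ 2) \<phi> x *\<^sub>R e x)" using zero[OF tf] by simp
      also have "\<dots> = (LINT x:{x1..v}|lebesgue. (deriv ^^ 2) \<phi> x *\<^sub>R e x)"
        by (rule set_integrable_zero_outside(2)[OF hi]) (use hz x v in auto)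
      also have "\<dots> = integral {x1..v} (\<lambda>x. (deriv ^^ 2) \<phi> x *\<^sub>R e x)"
        by (rule set_lebesgue_integral_eq_integral(2)[OF hi])
      also have "\<dots> = integral {x1..v} (\<lambda>x. a1 * ?k x1 x + a2 * ?k x2 x + a3 * ?k x3 x)"
        by (rule integral_cong) (simp add: d2 algebra_simps)
      also have "\<dots> = a1 * I n x1 + a2 * I n x2 + a3 * I n x3"
      proof (rule integral_unique)
        have "(?k y has_integral I n y) {x1..v}" for y
          unfolding I_def by (rule integrable_integral[OF integrable_continuous_interval[OF kc]])
        then show "((\<lambda>x. a1 * ?k x1 x + a2 * ?k x2 x + a3 * ?k x3 x) has_integral a1 * I n x1 + a2 * I n x2 + a3 * I n x3) {x1..v}"
          by (intro has_integral_add has_integral_mult_right)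
      qed
      finally show ?thesis by simp
    qed
    then show ?thesis by (auto simp: eventually_sequentially)
  qed
  ultimately have "(\<lambda>n. 0) \<longlonglongrightarrow> a1 * (Z * e x1) + a2 * (Z * e x2) + a3 * (Z * e x3)"
    by (rule Lim_transform_eventually)
  then have "Z * (a1 * e x1 + a2 * e x2 + a3 * e x3) = 0"
    by (simp add: LIMSEQ_const_iff algebra_simps)
  then have "a1 * e x1 + a2 * e x2 + a3 * e x3 = 0" using \<rho>(6) by simp
  then show ?thesis by (simp add: a1_def a2_def a3_def algebra_simps)
qed

text \<open>Two reference points at the thirds of the interval determine the line, and the three
  point identity places every other point of the graph on it.\<close>

lemma weak_second_derivative_zero_affine:
  fixes e :: "real \<Rightarrow> real"
  assumes "continuous_on {p<..<q} e"
    and "\<And>\<phi>. test_function {p<..<q} \<phi> \<Longrightarrow> (LINT x:{p<..<q}|lebesgue. (deriv ^^ 2) \<phi> x *\<^sub>R e x) = 0"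
    and pq: "p < q"
  shows "\<exists>c d. \<forall>x\<in>{p<..<q}. e x = c + x * d"
proof -
  note tp = weak_second_derivative_zero_three_points[OF assms(1,2)]
  define u v where "u = p + (q - p) / 3" and "v = p + 2 * (q - p) / 3"
  have uv: "p < u" "u < v" "v < q" using pq by (auto simp: u_def v_def field_simps)
  define d where "d = (e v - e u) / (v - u)"
  have dv: "d * (v - u) = e v - e u" using uv by (simp add: d_def)
  have "e x = (e u - u * d) + x * d" if x: "x \<in> {p<..<q}" for x
  proof -
    have "(v - u) * (e x - e u) = (x - u) * (e v - e u)"
    proof -
      consider "x < u" | "x = u" | "u < x" "x < v" | "x = v" | "v < x" by linarith
      then show ?thesis
      proof cases
        case 1
        then show ?thesis using tp[of x u v] x uv by (simp add: algebra_simps)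
      next
        case 3
        then show ?thesis using tp[of u x v] x uv by (simp add: algebra_simps)
      next
        case 5
        then show ?thesis using tp[of u v x] x uv by (simp add: algebra_simps)
      qed (auto simp: algebra_simps)
    qed
    then have "(v - u) * (e x - e u) = (v - u) * ((x - u) * d)"
      unfolding dv[symmetric] by (simp add: algebra_simps)
    then have "e x - e u = (x - u) * d" using uv by simp
    then show ?thesis by (simp add: algebra_simps)
  qed
  then show ?thesis by blast
qed

section \<open>From weak to classical derivatives\<close>

lemma set_integral_inner_left:
  fixes h :: "'a \<Rightarrow> 'b::euclidean_space"
  assumes "set_integrable M V h"
  shows "(LINT x:V|M. h x \<bullet> b) = (LINT x:V|M. h x) \<bullet> b"
  using integral_inner_left[of b M "\<lambda>x. indicat_real V x *\<^sub>R h x"] assms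
  by (simp add: set_lebesgue_integral_def set_integrable_def)

text \<open>Subtract the double primitive \<open>F\<close> of \<open>g\<close>: the difference is
  continuous with vanishing weak second derivative, hence affine in every component, and adding
  \<open>F\<close> back gives the classical derivative.\<close>

lemma weak_imp_classical:
  fixes f g :: "real \<Rightarrow> 'b::euclidean_space"
  assumes pq: "p < q" and f: "continuous_on {p<..<q} f"
    and wd: "has_weak_derivative 2 {p<..<q} f g" and g: "g absolutely_integrable_on {p..q}"
  shows "\<exists>c. \<forall>t\<in>{p<..<q}. (f has_vector_derivative (c + integral {p..t} g)) (at t)"
proof -
  let ?V = "{p<..<q}"
  define G where "G t = integral {p..t} g" for t
  define F where "F t = integral {p..t} G" for t
  have gi: "g integrable_on {p..q}" using g by (rule set_lebesgue_integral_eq_integral(1))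
  have Gc: "continuous_on {p..q} G"
    unfolding G_def by (rule indefinite_integral_continuous_1[OF gi])
  have dF: "(F has_vector_derivative G t) (at t within {p..q})" if "t \<in> {p..q}" for t
    unfolding F_def by (rule integral_has_vector_derivative[OF Gc that])
  have Ginc: "integral {s..t} g = G t - G s" if "p \<le> s" "s \<le> t" "t \<le> q" for s t
  proof -
    have "g integrable_on {p..t}" using integrable_subinterval_real[OF gi, of p t] that by auto
    from Henstock_Kurzweil_Integration.integral_combine[OF that(1,2) this] show ?thesis
      unfolding G_def by (metis add_diff_cancel_left')
  qed
  have wF: "has_weak_derivative 2 ?V F g"
    by (rule classical_imp_weak(2)[OF less_imp_le[OF pq] g Ginc dF order_refl])
  have Fc: "continuous_on ?V F"
  proof (rule continuous_on_subset)
    show "continuous_on {p..q} F"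
      unfolding continuous_on_eq_continuous_within by (intro ballI has_vector_derivative_continuous[OF dF])
  qed auto
  have "\<exists>c d. \<forall>x\<in>?V. (f x - F x) \<bullet> b = c + x * d" for b
  proof (rule weak_second_derivative_zero_affine[OF _ _ pq])
    show "continuous_on ?V (\<lambda>x. (f x - F x) \<bullet> b)" by (intro continuous_intros f Fc)
    fix \<phi> assume \<phi>: "test_function ?V \<phi>"
    let ?p = "(deriv ^^ 2) \<phi>"
    have i: "set_integrable lebesgue ?V (\<lambda>x. ?p x *\<^sub>R f x)" "set_integrable lebesgue ?V (\<lambda>x. ?p x *\<^sub>R F x)"
      using wd wF by (auto simp: has_weak_derivative_def intro!: test_function_integrable test_function_deriv_pow \<phi>)
    have "(LINT x:?V|lebesgue. ?p x *\<^sub>R ((f x - F x) \<bullet> b)) = (LINT x:?V|lebesgue. (?p x *\<^sub>R f x - ?p x *\<^sub>R F x) \<bullet> b)"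
      by (simp add: inner_diff_left algebra_simps)
    also have "\<dots> = (LINT x:?V|lebesgue. ?p x *\<^sub>R f x - ?p x *\<^sub>R F x) \<bullet> b"
      by (rule set_integral_inner_left[OF set_integral_diff(1)[OF i]])
    also have "(LINT x:?V|lebesgue. ?p x *\<^sub>R f x - ?p x *\<^sub>R F x) = 0"
      using set_integral_diff(2)[OF i] wd wF \<phi> by (simp add: has_weak_derivative_def)
    finally show "(LINT x:?V|lebesgue. ?p x *\<^sub>R ((f x - F x) \<bullet> b)) = 0" by simp
  qed
  then obtain c d where cd: "\<And>b x. x \<in> ?V \<Longrightarrow> (f x - F x) \<bullet> b = c b + x * d b" by metis
  define C where "C = (\<Sum>b\<in>Basis. c b *\<^sub>R b)"
  define D where "D = (\<Sum>b\<in>Basis. d b *\<^sub>R b)"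
  have fx: "F x + (C + x *\<^sub>R D) = f x" if "x \<in> ?V" for x
  proof -
    have "f x - F x = (\<Sum>b\<in>Basis. (c b + x * d b) *\<^sub>R b)"
      by (subst euclidean_representation[symmetric]) (simp only: cd[OF that])
    also have "\<dots> = C + x *\<^sub>R D"
      by (simp add: C_def D_def scaleR_add_left sum.distrib scaleR_sum_right)
    finally show ?thesis by (simp add: algebra_simps)
  qed
  have "(f has_vector_derivative (D + integral {p..t} g)) (at t)" if t: "t \<in> ?V" for t
  proof (rule has_vector_derivative_transform_within_open[OF _ _ t fx])
    have "(F has_vector_derivative G t) (at t)"
      using dF[of t] t at_within_interior[of t "{p..q}"] by simp
    then show "((\<lambda>x. F x + (C + x *\<^sub>R D)) has_vector_derivative (D + integral {p..t} g)) (at t)"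
      unfolding G_def by (auto intro!: derivative_eq_intros)
  qed auto
  then show ?thesis by blast
qed

lemma has_weak_derivative_subset:
  assumes "has_weak_derivative j V f g" "V' \<subseteq> V"
  shows "has_weak_derivative j V' f g"
  unfolding has_weak_derivative_def
proof (intro conjI allI impI)
  show loc: "locally_integrable_on V' f" "locally_integrable_on V' g"
    using assms by (auto simp: has_weak_derivative_def locally_integrable_on_def)
  fix \<phi> assume \<phi>: "test_function V' \<phi>"
  have \<phi>V: "test_function V \<phi>" by (rule test_function_subset[OF \<phi> assms(2)])
  have eq: "(LINT x:V|lebesgue. \<psi> x *\<^sub>R h x) = (LINT x:V'|lebesgue. \<psi> x *\<^sub>R h x)"
    if "test_function V' \<psi>" "locally_integrable_on V' h" for \<psi> and h :: "real \<Rightarrow> 'a"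
    by (rule set_integrable_zero_outside(2)[OF test_function_integrable[OF that]])
       (use assms(2) test_function_zero[OF that(1)] in auto)
  show "(LINT x:V'|lebesgue. (deriv ^^ j) \<phi> x *\<^sub>R f x) = (- 1) ^ j *\<^sub>R (LINT x:V'|lebesgue. \<phi> x *\<^sub>R g x)"
    unfolding eq[OF test_function_deriv_pow[OF \<phi>, of j] loc(1), symmetric] eq[OF \<phi> loc(2), symmetric]
    using assms(1) \<phi>V unfolding has_weak_derivative_def by blast
qed

text \<open>This applies to any weak second derivative, in particular to the one picked by
  \<open>weak_derivative\<close>. Such a \<open>g\<close> is only known to be integrable on compact
  parts, so the argument runs on an interval \<open>{p<..<q}\<close> halfway between the given one
  and the full one.\<close>

lemma weak_second_derivative_increment:
  fixes F f g :: "real \<Rightarrow> 'b::euclidean_space"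
  assumes wd: "has_weak_derivative 2 {a<..<b} F g"
    and F: "\<And>t. t \<in> {a<..<b} \<Longrightarrow> (F has_vector_derivative f t) (at t)"
    and st: "a < s" "s \<le> t" "t < b"
  shows "g absolutely_integrable_on {s..t}" "integral {s..t} g = f t - f s"
proof -
  have "locally_integrable_on {a<..<b} g" using wd by (simp add: has_weak_derivative_def)
  have loc: "g absolutely_integrable_on {u..v}" if "a < u" "v < b" for u v
  proof -
    have "compact {u..v}" "{u..v} \<subseteq> {a<..<b}" using that by auto
    then show ?thesis using \<open>locally_integrable_on {a<..<b} g\<close> unfolding locally_integrable_on_def by blast
  qed
  show "g absolutely_integrable_on {s..t}" using loc st by auto
  define p q where "p = (a + s) / 2" and "q = (t + b) / 2"
  have pq: "a < p" "p < s" "t < q" "q < b" "p < q" using st by (auto simp: p_def q_def)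
  have gi: "g absolutely_integrable_on {p..q}" using loc pq by auto
  have Fc: "continuous_on {p<..<q} F"
  proof (intro continuous_at_imp_continuous_on ballI)
    fix x assume "x \<in> {p<..<q}"
    then have "x \<in> {a<..<b}" using pq by auto
    from has_vector_derivative_continuous[OF F[OF this]] show "isCont F x" .
  qed
  have sub: "{p<..<q} \<subseteq> {a<..<b}" using pq by auto
  from weak_imp_classical[OF pq(5) Fc has_weak_derivative_subset[OF wd sub] gi]
  obtain c where c: "\<And>x. x \<in> {p<..<q} \<Longrightarrow> (F has_vector_derivative (c + integral {p..x} g)) (at x)" by blast
  have f: "f x = c + integral {p..x} g" if "x \<in> {p<..<q}" for x
    using vector_derivative_unique_at[OF F c[OF that]] that pq by auto
  have "g integrable_on {p..t}"
    using set_lebesgue_integral_eq_integral(1)[OF gi] pq st by (auto intro: integrable_subinterval_real)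
  from Henstock_Kurzweil_Integration.integral_combine[OF _ st(2) this] pq
  show "integral {s..t} g = f t - f s" using f[of s] f[of t] pq st by (simp add: algebra_simps)
qed

text \<open>Equal increments replace uniqueness almost everywhere: on compact parts the integral of
  the norm is bounded by the variation of the primitive, and compact parts exhaust the
  interval.\<close>

lemma set_integral_norm_le_of_increments:
  fixes h k :: "real \<Rightarrow> 'b::euclidean_space"
  assumes ab: "a < b" and k: "k absolutely_integrable_on {a..b}"
    and h: "\<And>s t. a < s \<Longrightarrow> s \<le> t \<Longrightarrow> t < b \<Longrightarrow> h absolutely_integrable_on {s..t}"
      "\<And>s t. a < s \<Longrightarrow> s \<le> t \<Longrightarrow> t < b \<Longrightarrow> integral {s..t} h = integral {s..t} k"
  shows "(LINT x:{a<..<b}|lebesgue. norm (h x)) \<le> integral {a..b} (\<lambda>x. norm (k x))"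
proof -
  have kn: "(\<lambda>x. norm (k x)) integrable_on {a..b}" using k by (simp add: absolutely_integrable_on_def)
  have ksub: "k absolutely_integrable_on {s..t}" if "a \<le> s" "t \<le> b" for s t
    using that by (intro set_integrable_subset[OF k]) auto
  have le: "integral {s..t} (\<lambda>x. norm (h x)) \<le> integral {a..b} (\<lambda>x. norm (k x))" if st: "a < s" "s \<le> t" "t < b" for s t
  proof -
    define W where "W x = integral {s..x} (\<lambda>x. norm (k x))" for x
    have "integral {s..t} (\<lambda>x. norm (h x)) \<le> W t - W s"
    proof (rule integral_norm_le_variation[OF h(1)[OF st] st(2)])
      fix u v assume uv: "s \<le> u" "u \<le> v" "v \<le> t"
      have "k absolutely_integrable_on {s..v}" using ksub st uv by auto
      then have ni: "(\<lambda>x. norm (k x)) integrable_on {s..v}" by (simp add: absolutely_integrable_on_def)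
      have "norm (integral {u..v} h) = norm (integral {u..v} k)" using h(2)[of u v] uv st by simp
      also have "\<dots> \<le> integral {u..v} (\<lambda>x. norm (k x))"
        using ksub[of u v] uv st by (intro integral_norm_bound_integral) (auto simp: absolutely_integrable_on_def)
      also have "\<dots> = W v - W u"
        using Henstock_Kurzweil_Integration.integral_combine[OF uv(1,2) ni] by (simp add: W_def)
      finally show "norm (integral {u..v} h) \<le> W v - W u" .
    qed
    also have "\<dots> = integral {s..t} (\<lambda>x. norm (k x))" by (simp add: W_def)
    also have "\<dots> \<le> integral {a..b} (\<lambda>x. norm (k x))"
      using ksub[of s t] st kn by (intro integral_subset_le) (auto simp: absolutely_integrable_on_def)
    finally show ?thesis .
  qed
  show ?thesis
  proof (cases "set_integrable lebesgue {a<..<b} (\<lambda>x. norm (h x))")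
    case False
    \<comment> \<open>The Lebesgue integral of a function that is not integrable is 0 by convention,
      and then the estimate is trivial.\<close>
    then have "(LINT x:{a<..<b}|lebesgue. norm (h x)) = 0"
      unfolding set_lebesgue_integral_def set_integrable_def by (rule not_integrable_integral_eq)
    also have "0 \<le> integral {a..b} (\<lambda>x. norm (k x))" by (rule integral_nonneg[OF kn]) simp
    finally show ?thesis .
  next
    case True
    have hI: "(\<lambda>x. norm (h x)) integrable_on {a..b}"
      using set_lebesgue_integral_eq_integral(1)[OF True] by (simp add: integrable_on_Icc_iff_Ioo)
    define I where "I t = integral {a..t} (\<lambda>x. norm (h x))" for t
    have Ic: "continuous_on {a..b} I" unfolding I_def by (rule indefinite_integral_continuous_1[OF hI])
    \<comment> \<open>Margins of at most half the length, so that \<open>{a + e n..b - e n}\<close>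
      is never empty.\<close>
    define e where "e n = (b - a) / (real n + 2)" for n :: nat
    have e: "0 < e n" "e n \<le> (b - a) / 2" for n
    proof -
      show "0 < e n" using ab by (simp add: e_def)
      show "e n \<le> (b - a) / 2" unfolding e_def by (rule divide_left_mono) (use ab in auto)
    qed
    have "(\<lambda>n. (b - a) * (1 / real (n + 2))) \<longlonglongrightarrow> (b - a) * 0"
      by (intro tendsto_intros LIMSEQ_ignore_initial_segment lim_1_over_n)
    then have e0: "e \<longlonglongrightarrow> 0" by (simp add: e_def[abs_def] add.commute)
    have "(\<lambda>n. I (b - e n) - I (a + e n)) \<longlonglongrightarrow> I b - I a"
    proof (intro tendsto_diff continuous_on_tendsto_compose[OF Ic])
      show "(\<lambda>n. b - e n) \<longlonglongrightarrow> b" "(\<lambda>n. a + e n) \<longlonglongrightarrow> a"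
        using tendsto_diff[OF tendsto_const e0, of b] tendsto_add[OF tendsto_const e0, of a] by auto
      show "\<forall>\<^sub>F n in sequentially. b - e n \<in> {a..b}" "\<forall>\<^sub>F n in sequentially. a + e n \<in> {a..b}"
        using e ab by (auto intro!: always_eventually simp: algebra_simps) (smt (verit) field_sum_of_halves)+
    qed (use ab in auto)
    moreover have "I (b - e n) - I (a + e n) \<le> integral {a..b} (\<lambda>x. norm (k x))" for n
    proof -
      have st: "a < a + e n" "a + e n \<le> b - e n" "b - e n < b" using e[of n] by (auto simp: field_simps)
      have "(\<lambda>x. norm (h x)) integrable_on {a..b - e n}"
        using integrable_subinterval_real[OF hI, of a "b - e n"] e[of n] by auto
      from Henstock_Kurzweil_Integration.integral_combine[OF less_imp_le[OF st(1)] st(2) this]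
      show ?thesis using le[OF st] by (simp add: I_def)
    qed
    ultimately have "I b - I a \<le> integral {a..b} (\<lambda>x. norm (k x))"
      by (intro LIMSEQ_le_const2) auto
    moreover have "(LINT x:{a<..<b}|lebesgue. norm (h x)) = I b"
      using set_lebesgue_integral_eq_integral(2)[OF True] by (simp add: I_def integral_open_interval_real)
    ultimately show ?thesis by (simp add: I_def)
  qed
qed

lemma W21_classical:
  fixes f f' g :: "real \<Rightarrow> 'b::euclidean_space"
  assumes ab: "a \<le> b" and g: "g absolutely_integrable_on {a..b}"
    and f': "\<And>s t. a \<le> s \<Longrightarrow> s \<le> t \<Longrightarrow> t \<le> b \<Longrightarrow> integral {s..t} g = f' t - f' s"
    and f: "\<And>t. t \<in> {a..b} \<Longrightarrow> (f has_vector_derivative f' t) (at t within {a..b})"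
    and V: "open V" "V \<subseteq> {a<..<b}"
  shows "W21 V f"
proof -
  note c = classical_imp_weak[OF ab g f' f V(2)]
  have sub: "h absolutely_integrable_on V" if "h absolutely_integrable_on {a..b}" for h :: "real \<Rightarrow> 'b"
    using V by (intro set_integrable_subset[OF that]) auto
  show ?thesis
    unfolding W21_def using c sub g by blast
qed

text \<open>The weak derivatives in \<open>W21_norm\<close> are arbitrary choices; their increments
  identify them with \<open>f'\<close> and \<open>g\<close>. The first order one is handled as a
  second weak derivative, namely that of a primitive \<open>G\<close> of \<open>f\<close>.\<close>

lemma W21_norm_le:
  fixes f f' g :: "real \<Rightarrow> 'b::euclidean_space"
  assumes ab: "a < b" and g: "g absolutely_integrable_on {a..b}"
    and f': "\<And>s t. a \<le> s \<Longrightarrow> s \<le> t \<Longrightarrow> t \<le> b \<Longrightarrow> integral {s..t} g = f' t - f' s"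
    and f: "\<And>t. t \<in> {a..b} \<Longrightarrow> (f has_vector_derivative f' t) (at t within {a..b})"
  shows "W21_norm {a<..<b} f \<le> integral {a..b} (\<lambda>x. norm (f x)) + integral {a..b} (\<lambda>x. norm (f' x)) +
           integral {a..b} (\<lambda>x. norm (g x))"
proof -
  let ?V = "{a<..<b}"
  note c = classical_imp_weak[OF less_imp_le[OF ab] g f' f order_refl]
  have w1: "has_weak_derivative 1 ?V f (weak_derivative 1 ?V f)"
    unfolding weak_derivative_def by (rule someI[of "has_weak_derivative 1 ?V f", OF c(1)])
  have w2: "has_weak_derivative 2 ?V f (weak_derivative 2 ?V f)"
    unfolding weak_derivative_def by (rule someI[of "has_weak_derivative 2 ?V f", OF c(2)])
  have fi: "f' absolutely_integrable_on {a..b}" "f absolutely_integrable_on {a..b}" using c(3,4) by auto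
  have F: "integral {s..t} f' = f t - f s" if "a \<le> s" "s \<le> t" "t \<le> b" for s t
  proof (rule integral_unique, rule fundamental_theorem_of_calculus[OF that(2)])
    fix x assume "x \<in> {s..t}"
    then show "(f has_vector_derivative f' x) (at x within {s..t})"
      using that by (intro has_vector_derivative_within_subset[OF f]) auto
  qed
  have inner: "(h has_vector_derivative d) (at t)" if "t \<in> ?V" "(h has_vector_derivative d) (at t within {a..b})"
    for t h and d :: 'b
    using that at_within_interior[of t "{a..b}"] by simp
  have "(LINT x:?V|lebesgue. norm (f x)) \<le> integral {a..b} (\<lambda>x. norm (f x))"
    by (rule set_integral_norm_le_of_increments[OF ab fi(2)]) (use fi(2) in \<open>auto intro: set_integrable_subset\<close>)
  moreover have "(LINT x:?V|lebesgue. norm (weak_derivative 2 ?V f x)) \<le> integral {a..b} (\<lambda>x. norm (g x))"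
  proof (rule set_integral_norm_le_of_increments[OF ab g])
    fix s t assume st: "a < s" "s \<le> t" "t < b"
    have d: "(f has_vector_derivative f' t) (at t)" if "t \<in> ?V" for t
      using that by (intro inner f) auto
    show "weak_derivative 2 ?V f absolutely_integrable_on {s..t}"
      "integral {s..t} (weak_derivative 2 ?V f) = integral {s..t} g"
      using weak_second_derivative_increment[OF w2 d st] f'[of s t] st by auto
  qed
  moreover have "(LINT x:?V|lebesgue. norm (weak_derivative 1 ?V f x)) \<le> integral {a..b} (\<lambda>x. norm (f' x))"
  proof (rule set_integral_norm_le_of_increments[OF ab fi(1)])
    fix s t assume st: "a < s" "s \<le> t" "t < b"
    define G where "G t = integral {a..t} f" for t
    have fc: "continuous_on {a..b} f"
      unfolding continuous_on_eq_continuous_within by (intro ballI has_vector_derivative_continuous[OF f])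
    have dG: "(G has_vector_derivative f t) (at t within {a..b})" if "t \<in> {a..b}" for t
      unfolding G_def by (rule integral_has_vector_derivative[OF fc that])
    have wG: "has_weak_derivative 1 ?V G f"
      by (rule classical_imp_weak(1)[OF less_imp_le[OF ab] fi(1) F dG order_refl])
    have "has_weak_derivative 2 ?V G (weak_derivative 1 ?V f)"
      unfolding has_weak_derivative_def
    proof (intro conjI allI impI)
      show "locally_integrable_on ?V G" "locally_integrable_on ?V (weak_derivative 1 ?V f)"
        using wG w1 by (auto simp: has_weak_derivative_def)
      fix \<phi> assume \<phi>: "test_function ?V \<phi>"
      have "(LINT x:?V|lebesgue. deriv (deriv \<phi>) x *\<^sub>R G x) = - (LINT x:?V|lebesgue. deriv \<phi> x *\<^sub>R f x)"
        using wG test_function_deriv[OF \<phi>] by (simp add: has_weak_derivative_def)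
      also have "(LINT x:?V|lebesgue. deriv \<phi> x *\<^sub>R f x) = - (LINT x:?V|lebesgue. \<phi> x *\<^sub>R weak_derivative 1 ?V f x)"
        using w1 \<phi> by (simp add: has_weak_derivative_def)
      finally show "(LINT x:?V|lebesgue. (deriv ^^ 2) \<phi> x *\<^sub>R G x) =
          (- 1) ^ 2 *\<^sub>R (LINT x:?V|lebesgue. \<phi> x *\<^sub>R weak_derivative 1 ?V f x)"
        by (simp add: numeral_2_eq_2)
    qed
    moreover have d: "(G has_vector_derivative f t) (at t)" if "t \<in> ?V" for t
      using that by (intro inner dG) auto
    ultimately show "weak_derivative 1 ?V f absolutely_integrable_on {s..t}"
      "integral {s..t} (weak_derivative 1 ?V f) = integral {s..t} f'"
      using weak_second_derivative_increment[OF _ d st] F[of s t] st by auto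
  qed
  ultimately show ?thesis unfolding W21_norm_def by linarith
qed

section \<open>Differentiable rearrangements\<close>

definition rearr :: "'i set \<Rightarrow> ('i \<Rightarrow> real) \<Rightarrow> ('i \<Rightarrow> real) \<Rightarrow> bool" where
  "rearr I x y \<longleftrightarrow> image_mset x (mset_set I) = image_mset y (mset_set I)"

lemma rearr_trans: "rearr I x y \<Longrightarrow> rearr I y z \<Longrightarrow> rearr I x z"
  and rearr_sym: "rearr I x y \<Longrightarrow> rearr I y x"
  and rearr_refl [simp]: "rearr I x x"
  by (auto simp: rearr_def)

lemma rearr_cong: "(\<And>i. i \<in> I \<Longrightarrow> y i = y' i) \<Longrightarrow> finite I \<Longrightarrow> rearr I x y \<longleftrightarrow> rearr I x y'"
proof -
  assume "\<And>i. i \<in> I \<Longrightarrow> y i = y' i" "finite I"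
  then have "image_mset y (mset_set I) = image_mset y' (mset_set I)" by (intro image_mset_cong) (metis elem_mset_set)
  then show ?thesis by (simp add: rearr_def)
qed

lemma rearr_permutesE:
  assumes "rearr I x y" "finite I"
  obtains p where "p permutes I" "\<And>i. i \<in> I \<Longrightarrow> x i = y (p i)"
  by (rule image_mset_eq_implies_permutes[OF assms(2) assms(1)[unfolded rearr_def]]) (rule that, auto)

lemma permutes_rearr:
  assumes "p permutes I"
  shows "rearr I x (x \<circ> p)"
  unfolding rearr_def using assms by (simp add: multiset.map_comp[symmetric] permutes_image_mset)

lemma rearr_image:
  assumes "rearr I x y" "finite I"
  shows "x ` I = y ` I"
  using arg_cong[OF assms(1)[unfolded rearr_def], of set_mset] assms(2) by simp

text \<open>The rearrangement may depend on \<open>t\<close> and is differentiable at the single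
  point \<open>t\<close> only; this is what first order perturbation theory provides.\<close>

definition locdiff :: "'i set \<Rightarrow> (real \<Rightarrow> 'i \<Rightarrow> real) \<Rightarrow> real \<Rightarrow> bool" where
  "locdiff I \<mu> t \<longleftrightarrow> (\<exists>\<nu> d. (\<forall>\<^sub>F s in nhds t. rearr I (\<mu> s) (\<nu> s)) \<and>
     (\<forall>i\<in>I. ((\<lambda>s. \<nu> s i) has_real_derivative d i) (at t)))"

text \<open>Derivatives are taken within \<open>S\<close>, so that \<open>S\<close> may be a closed
  interval whose ends are to be glued.\<close>

definition dsys :: "'i set \<Rightarrow> (real \<Rightarrow> 'i \<Rightarrow> real) \<Rightarrow> real set \<Rightarrow> (real \<Rightarrow> 'i \<Rightarrow> real) \<Rightarrow> bool" where
  "dsys I \<mu> S \<nu> \<longleftrightarrow> (\<forall>s\<in>S. rearr I (\<mu> s) (\<nu> s) \<and>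
     (\<forall>i\<in>I. \<exists>d. ((\<lambda>s. \<nu> s i) has_real_derivative d) (at s within S)))"

lemma dsys_rearr: "dsys I \<mu> S \<nu> \<Longrightarrow> s \<in> S \<Longrightarrow> rearr I (\<mu> s) (\<nu> s)"
  and dsys_DERIV: "dsys I \<mu> S \<nu> \<Longrightarrow> s \<in> S \<Longrightarrow> i \<in> I \<Longrightarrow> \<exists>d. ((\<lambda>s. \<nu> s i) has_real_derivative d) (at s within S)"
  by (simp_all add: dsys_def)

lemma dsys_subset: "dsys I \<mu> S \<nu> \<Longrightarrow> S' \<subseteq> S \<Longrightarrow> dsys I \<mu> S' \<nu>"
  unfolding dsys_def by (meson DERIV_subset subsetD)

lemma frequently_zero_DERIV:
  fixes D :: "real \<Rightarrow> real"
  assumes D: "(D has_real_derivative d) (at t within S)" and fr: "\<exists>\<^sub>F s in at t within S. D s = 0"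
  shows "D t = 0" "d = 0"
proof -
  have lim: "(D \<longlongrightarrow> D t) (at t within S)"
    using DERIV_continuous[OF D] by (simp add: continuous_within)
  show D0: "D t = 0"
  proof (rule ccontr)
    assume "D t \<noteq> 0"
    from tendsto_imp_eventually_ne[OF lim this] fr show False by (simp add: frequently_def)
  qed
  show "d = 0"
  proof (rule ccontr)
    assume d: "d \<noteq> 0"
    have "((\<lambda>s. (D s - D t) / (s - t)) \<longlongrightarrow> d) (at t within S)"
      using D by (simp add: has_field_derivative_iff)
    from tendsto_imp_eventually_ne[OF this d] have "\<forall>\<^sub>F s in at t within S. D s \<noteq> 0"
      by eventually_elim (auto simp: D0)
    with fr show False by (simp add: frequently_def)
  qed
qed

text \<open>There are finitely many permutations, so one of them matches the two families at times
  arbitrarily close to \<open>t\<close>; the difference of matched functions then has zeros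
  accumulating at \<open>t\<close>, so values and derivatives agree there.\<close>

lemma rearr_matching:
  assumes I: "finite I" and t: "t islimpt S"
    and ev: "\<forall>\<^sub>F s in at t within S. rearr I (\<nu> s) (\<nu>' s)"
    and d: "\<And>i. i \<in> I \<Longrightarrow> ((\<lambda>s. \<nu> s i) has_real_derivative d i) (at t within S)"
    and d': "\<And>i. i \<in> I \<Longrightarrow> ((\<lambda>s. \<nu>' s i) has_real_derivative d' i) (at t within S)"
  obtains p where "p permutes I" "\<And>i. i \<in> I \<Longrightarrow> \<nu> t i = \<nu>' t (p i)" "\<And>i. i \<in> I \<Longrightarrow> d i = d' (p i)"
proof -
  let ?A = "{p. p permutes I}"
  have fin: "finite ?A" by (rule finite_permutations[OF I])
  have nt: "at t within S \<noteq> bot" using t by (simp add: trivial_limit_within)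
  have ex: "\<forall>\<^sub>F s in at t within S. \<exists>p\<in>?A. \<forall>i\<in>I. \<nu> s i = \<nu>' s (p i)"
    using ev
  proof eventually_elim
    case (elim s)
    from rearr_permutesE[OF elim I] obtain p where "p permutes I" "\<And>i. i \<in> I \<Longrightarrow> \<nu> s i = \<nu>' s (p i)" by metis
    then show ?case by blast
  qed
  have "\<exists>p\<in>?A. \<exists>\<^sub>F s in at t within S. \<forall>i\<in>I. \<nu> s i = \<nu>' s (p i)"
  proof (rule ccontr)
    assume "\<not> ?thesis"
    then have "\<forall>p\<in>?A. \<forall>\<^sub>F s in at t within S. \<not> (\<forall>i\<in>I. \<nu> s i = \<nu>' s (p i))"
      by (simp add: frequently_def)
    then have "\<forall>\<^sub>F s in at t within S. \<forall>p\<in>?A. \<not> (\<forall>i\<in>I. \<nu> s i = \<nu>' s (p i))"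
      by (rule eventually_ball_finite[OF fin])
    with ex have "\<forall>\<^sub>F s in at t within S. False" by (rule eventually_elim2) metis
    with nt show False by simp
  qed
  then obtain p where p: "p permutes I" and fr: "\<exists>\<^sub>F s in at t within S. \<forall>i\<in>I. \<nu> s i = \<nu>' s (p i)" by blast
  have "\<nu> t i = \<nu>' t (p i) \<and> d i = d' (p i)" if i: "i \<in> I" for i
  proof -
    have pi: "p i \<in> I" using p i by (simp add: permutes_in_image)
    have "((\<lambda>s. \<nu> s i - \<nu>' s (p i)) has_real_derivative d i - d' (p i)) (at t within S)"
      by (intro DERIV_diff d d' i pi)
    moreover have "\<exists>\<^sub>F s in at t within S. \<nu> s i - \<nu>' s (p i) = 0"
      using fr by (rule frequently_elim1) (use i in simp)
    ultimately show ?thesis using frequently_zero_DERIV by fastforce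
  qed
  with p that show thesis by blast
qed

text \<open>Both one-sided systems are matched with the same family \<open>\<xi>\<close>, which is
  differentiable at \<open>b\<close>; composing one matching with the inverse of the other makes the
  one-sided values and derivatives agree.\<close>

lemma dsys_matching:
  assumes I: "finite I" and loc: "locdiff I \<mu> b" and ab: "a < b" and bc: "b < c"
    and \<nu>: "dsys I \<mu> {a..b} \<nu>" and \<nu>': "dsys I \<mu> {b..c} \<nu>'"
  obtains q d where "q permutes I" "\<And>i. i \<in> I \<Longrightarrow> \<nu> b i = \<nu>' b (q i)"
    "\<And>i. i \<in> I \<Longrightarrow> ((\<lambda>s. \<nu> s i) has_real_derivative d i) (at b within {a..b})"
    "\<And>i. i \<in> I \<Longrightarrow> ((\<lambda>s. \<nu>' s (q i)) has_real_derivative d i) (at b within {b..c})"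
proof -
  obtain \<xi> e where \<xi>: "\<forall>\<^sub>F s in nhds b. rearr I (\<mu> s) (\<xi> s)"
    and e: "\<And>i. i \<in> I \<Longrightarrow> ((\<lambda>s. \<xi> s i) has_real_derivative e i) (at b)"
    using loc unfolding locdiff_def by blast
  obtain d where d: "\<And>i. i \<in> I \<Longrightarrow> ((\<lambda>s. \<nu> s i) has_real_derivative d i) (at b within {a..b})"
    using \<nu> ab unfolding dsys_def by (metis atLeastAtMost_iff less_imp_le order_refl)
  obtain d' where d': "\<And>i. i \<in> I \<Longrightarrow> ((\<lambda>s. \<nu>' s i) has_real_derivative d' i) (at b within {b..c})"
    using \<nu>' bc unfolding dsys_def by (metis atLeastAtMost_iff less_imp_le order_refl)
  have ev: "\<forall>\<^sub>F s in at b within S. rearr I (\<nu> s) (\<xi> s)" if "dsys I \<mu> S \<nu>" for S \<nu>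
  proof -
    have "\<forall>\<^sub>F s in at b within S. rearr I (\<mu> s) (\<xi> s)"
      using \<xi> by (simp add: eventually_at_filter eventually_mono)
    moreover have "\<forall>\<^sub>F s in at b within S. s \<in> S" by (simp add: eventually_at_filter)
    ultimately show ?thesis
      by eventually_elim (rule rearr_trans[OF rearr_sym[OF dsys_rearr[OF that]]])
  qed
  have l1: "b islimpt {a..b}" and l2: "b islimpt {b..c}" using ab bc by simp_all
  obtain p where p: "p permutes I" "\<And>i. i \<in> I \<Longrightarrow> \<nu> b i = \<xi> b (p i)" "\<And>i. i \<in> I \<Longrightarrow> d i = e (p i)"
    using rearr_matching[OF I l1 ev[OF \<nu>] d has_field_derivative_at_within[OF e]] by blast
  obtain p' where p': "p' permutes I" "\<And>i. i \<in> I \<Longrightarrow> \<nu>' b i = \<xi> b (p' i)" "\<And>i. i \<in> I \<Longrightarrow> d' i = e (p' i)"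
    using rearr_matching[OF I l2 ev[OF \<nu>'] d' has_field_derivative_at_within[OF e]] by blast
  define q where "q = inv p' \<circ> p"
  have q: "q permutes I" unfolding q_def by (intro permutes_compose p(1) permutes_inv p'(1))
  have qI: "q i \<in> I" if "i \<in> I" for i using permutes_in_image[OF q] that by blast
  have pq: "p' (q i) = p i" for i
    unfolding q_def using permutes_inverses(1)[OF p'(1)] by simp
  have "\<nu> b i = \<nu>' b (q i)" and "d i = d' (q i)" if "i \<in> I" for i
    using p(2,3)[OF that] p'(2,3)[OF qI[OF that]] by (simp_all add: pq)
  with q d d' qI show thesis by (intro that[of q d]) simp_all
qed

lemma dsys_glue:
  assumes I: "finite I" and ab: "a < b" and bc: "b < c"
    and \<nu>: "dsys I \<mu> {a..b} \<nu>" and \<nu>': "dsys I \<mu> {b..c} \<nu>'"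
    and eq: "\<And>i. i \<in> I \<Longrightarrow> \<nu> b i = \<nu>' b i"
    and d: "\<And>i. i \<in> I \<Longrightarrow> ((\<lambda>s. \<nu> s i) has_real_derivative d i) (at b within {a..b})"
    and d': "\<And>i. i \<in> I \<Longrightarrow> ((\<lambda>s. \<nu>' s i) has_real_derivative d i) (at b within {b..c})"
  shows "dsys I \<mu> {a..c} (\<lambda>s. if s \<le> b then \<nu> s else \<nu>' s)"
  unfolding dsys_def
proof (intro ballI conjI)
  let ?n = "\<lambda>s. if s \<le> b then \<nu> s else \<nu>' s"
  fix s assume s: "s \<in> {a..c}"
  show "rearr I (\<mu> s) (?n s)"
    using s \<nu> \<nu>' by (auto simp: dsys_def)
  fix i assume i: "i \<in> I"
  consider "s < b" | "s = b" | "b < s" by linarith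
  then show "\<exists>d. ((\<lambda>s. ?n s i) has_real_derivative d) (at s within {a..c})"
  proof cases
    case 1
    then have "s \<in> {a..b}" using s by auto
    then obtain e where e: "((\<lambda>s. \<nu> s i) has_real_derivative e) (at s within {a..b})"
      using dsys_DERIV[OF \<nu> _ i] by blast
    have f: "at s within {a..c} = at s within {a..b}"
      by (rule at_within_nhd[of s "{..<b}"]) (use 1 bc in auto)
    have "((\<lambda>s. ?n s i) has_real_derivative e) (at s within {a..b})"
      by (rule has_field_derivative_transform_within[OF e, of 1]) (use \<open>s \<in> {a..b}\<close> in auto)
    then show ?thesis unfolding f by blast
  next
    case 3
    then have "s \<in> {b..c}" using s by auto
    then obtain e where e: "((\<lambda>s. \<nu>' s i) has_real_derivative e) (at s within {b..c})"
      using dsys_DERIV[OF \<nu>' _ i] by blast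
    have f: "at s within {a..c} = at s within {b..c}"
      by (rule at_within_nhd[of s "{b<..}"]) (use 3 ab in auto)
    have "((\<lambda>s. ?n s i) has_real_derivative e) (at s within {b..c})"
      by (rule has_field_derivative_transform_within[OF e, of "s - b"])
         (use 3 \<open>s \<in> {b..c}\<close> in \<open>auto simp: dist_real_def\<close>)
    then show ?thesis unfolding f by blast
  next
    case 2
    have 1: "((\<lambda>s. ?n s i) has_real_derivative d i) (at b within {a..b})"
      by (rule has_field_derivative_transform_within[OF d[OF i], of 1]) (use ab in auto)
    have 2: "((\<lambda>s. ?n s i) has_real_derivative d i) (at b within {b..c})"
      by (rule has_field_derivative_transform_within[OF d'[OF i], of 1]) (use bc eq[OF i] in auto)
    have u: "{a..c} = {a..b} \<union> {b..c}" using ab bc by auto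
    have "((\<lambda>s. ?n s i) has_real_derivative d i) (at b within {a..c})"
      unfolding has_field_derivative_iff unfolding u at_within_union
      using 1[unfolded has_field_derivative_iff] 2[unfolded has_field_derivative_iff] by (rule filterlim_sup)
    then show ?thesis using \<open>s = b\<close> by blast
  qed
qed

lemma dsys_permute:
  assumes "dsys I \<mu> S \<nu>" "q permutes I"
  shows "dsys I \<mu> S (\<lambda>s. \<nu> s \<circ> q)"
  unfolding dsys_def
proof (intro ballI conjI)
  fix s assume s: "s \<in> S"
  show "rearr I (\<mu> s) (\<nu> s \<circ> q)"
    using assms s permutes_rearr[OF assms(2)] rearr_trans unfolding dsys_def by blast
  fix i assume "i \<in> I"
  then have "q i \<in> I" using assms(2) by (simp add: permutes_in_image)
  then show "\<exists>d. ((\<lambda>s. (\<nu> s \<circ> q) i) has_real_derivative d) (at s within S)"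
    using assms(1) s by (auto simp: dsys_def)
qed

text \<open>The new piece is permuted and the given system is left as it is; together with the
  mirror image \<open>dsys_extend_left\<close> this allows consistent extension along growing
  intervals.\<close>

lemma dsys_extend_right:
  assumes I: "finite I" and loc: "locdiff I \<mu> b" and ab: "a < b" and bc: "b < c"
    and \<nu>: "dsys I \<mu> {a..b} \<nu>" and \<nu>': "dsys I \<mu> {b..c} \<nu>'"
  obtains \<nu>'' where "dsys I \<mu> {a..c} \<nu>''" "\<And>s. s \<in> {a..b} \<Longrightarrow> \<nu>'' s = \<nu> s"
proof -
  obtain q d where q: "q permutes I" "\<And>i. i \<in> I \<Longrightarrow> \<nu> b i = \<nu>' b (q i)"
    "\<And>i. i \<in> I \<Longrightarrow> ((\<lambda>s. \<nu> s i) has_real_derivative d i) (at b within {a..b})"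
    "\<And>i. i \<in> I \<Longrightarrow> ((\<lambda>s. \<nu>' s (q i)) has_real_derivative d i) (at b within {b..c})"
    using dsys_matching[OF assms] by blast
  have "dsys I \<mu> {a..c} (\<lambda>s. if s \<le> b then \<nu> s else \<nu>' s \<circ> q)"
    by (rule dsys_glue[OF I ab bc \<nu> dsys_permute[OF \<nu>' q(1)], where d = d]) (use q in auto)
  then show thesis by (rule that) auto
qed

lemma dsys_extend_left:
  assumes I: "finite I" and loc: "locdiff I \<mu> b" and ab: "a < b" and bc: "b < c"
    and \<nu>: "dsys I \<mu> {a..b} \<nu>" and \<nu>': "dsys I \<mu> {b..c} \<nu>'"
  obtains \<nu>'' where "dsys I \<mu> {a..c} \<nu>''" "\<And>s i. s \<in> {b..c} \<Longrightarrow> i \<in> I \<Longrightarrow> \<nu>'' s i = \<nu>' s i"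
proof -
  obtain q d where q: "q permutes I" "\<And>i. i \<in> I \<Longrightarrow> \<nu> b i = \<nu>' b (q i)"
    "\<And>i. i \<in> I \<Longrightarrow> ((\<lambda>s. \<nu> s i) has_real_derivative d i) (at b within {a..b})"
    "\<And>i. i \<in> I \<Longrightarrow> ((\<lambda>s. \<nu>' s (q i)) has_real_derivative d i) (at b within {b..c})"
    using dsys_matching[OF assms] by blast
  define r where "r = inv q"
  have r: "r permutes I" unfolding r_def by (rule permutes_inv[OF q(1)])
  have rI: "r i \<in> I" if "i \<in> I" for i using permutes_in_image[OF r] that by blast
  have qr: "q (r i) = i" for i unfolding r_def by (rule permutes_inverses(1)[OF q(1)])
  have eq: "(\<nu> b \<circ> r) i = \<nu>' b i" if "i \<in> I" for i using q(2)[OF rI[OF that]] by (simp add: qr)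
  have "dsys I \<mu> {a..c} (\<lambda>s. if s \<le> b then \<nu> s \<circ> r else \<nu>' s)"
  proof (rule dsys_glue[OF I ab bc dsys_permute[OF \<nu> r] \<nu>' eq, where d = "\<lambda>i. d (r i)"])
    fix i assume i: "i \<in> I"
    show "((\<lambda>s. (\<nu> s \<circ> r) i) has_real_derivative d (r i)) (at b within {a..b})"
      using q(3)[OF rI[OF i]] by simp
    show "((\<lambda>s. \<nu>' s i) has_real_derivative d (r i)) (at b within {b..c})"
      using q(4)[OF rI[OF i]] by (simp add: qr)
  qed auto
  then show thesis by (rule that) (use eq in auto)
qed

section \<open>From local to global systems\<close>

lemma DERIV_eventually_eq:
  fixes f g :: "real \<Rightarrow> real"
  assumes "(f has_real_derivative d) (at s)" "\<forall>\<^sub>F x in nhds s. f x = g x"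
  shows "(g has_real_derivative d) (at s)"
  using assms(1) DERIV_cong_ev[OF refl assms(2) refl, of d] by simp

text \<open>Bisection: systems on adjacent intervals can be concatenated, and all sufficiently short
  intervals around a given point admit a system.\<close>

lemma dsys_compact_interval:
  assumes I: "finite I" and ab: "a < b" and loc: "\<And>t. t \<in> {a..b} \<Longrightarrow> locdiff I \<mu> t"
    and sides: "\<And>t. t \<in> {a..b} \<Longrightarrow> \<exists>e>0. (\<exists>\<nu>. dsys I \<mu> {t - e..t} \<nu>) \<and> (\<exists>\<nu>. dsys I \<mu> {t..t + e} \<nu>)"
  shows "\<exists>\<nu>. dsys I \<mu> {a..b} \<nu>"
proof -
  have cat: "\<exists>\<nu>. dsys I \<mu> {u..w} \<nu>"
    if "a \<le> u" "u < v" "v < w" "w \<le> b" "\<exists>\<nu>. dsys I \<mu> {u..v} \<nu>" "\<exists>\<nu>. dsys I \<mu> {v..w} \<nu>" for u v w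
  proof -
    have "locdiff I \<mu> v" using that by (intro loc) auto
    with that show ?thesis using dsys_extend_right[OF I] by meson
  qed
  define Q where "Q u v \<longleftrightarrow> (a \<le> u \<and> u < v \<and> v \<le> b \<longrightarrow> (\<exists>\<nu>. dsys I \<mu> {u..v} \<nu>))" for u v
  have "Q a b"
  proof (rule Bolzano[of a b Q, OF less_imp_le[OF ab]])
    fix u v w assume h: "Q u v" "Q v w" "u \<le> v" "v \<le> w"
    show "Q u w"
    proof (cases "u = v \<or> v = w")
      case False
      then show ?thesis using h cat[of u v w] unfolding Q_def by auto
    qed (use h in auto)
  next
    fix x assume x: "a \<le> x" "x \<le> b"
    then obtain e where e: "e > 0" and L: "\<exists>\<nu>. dsys I \<mu> {x - e..x} \<nu>" and R: "\<exists>\<nu>. dsys I \<mu> {x..x + e} \<nu>"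
      using sides[of x] by auto
    show "\<exists>d>0. \<forall>u v. u \<le> x \<and> x \<le> v \<and> v - u < d \<longrightarrow> Q u v"
    proof (intro exI[of _ e] conjI allI impI e)
      fix u v assume uv: "u \<le> x \<and> x \<le> v \<and> v - u < e"
      have L': "\<exists>\<nu>. dsys I \<mu> {u..x} \<nu>"
      proof -
        have "{u..x} \<subseteq> {x - e..x}" using uv by auto
        then show ?thesis using L dsys_subset by blast
      qed
      have R': "\<exists>\<nu>. dsys I \<mu> {x..v} \<nu>"
      proof -
        have "{x..v} \<subseteq> {x..x + e}" using uv by auto
        then show ?thesis using R dsys_subset by blast
      qed
      show "Q u v"
        using L' R' cat[of u x v] uv unfolding Q_def by (metis order_le_less)
    qed
  qed
  then show ?thesis using ab by (simp add: Q_def)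
qed

text \<open>The ends are the extreme values among the first points of a dense sequence in
  \<open>C\<close>, which works for bounded and unbounded intervals alike; the points
  \<open>t0 - e\<close> and \<open>t0 + e\<close> keep the intervals nondegenerate.\<close>

lemma open_interval_exhaustion:
  fixes C :: "real set"
  assumes C: "open C" "connected C" "t0 \<in> C"
  obtains p q :: "nat \<Rightarrow> real" where "\<And>n. p n < q n" "\<And>n. {p n..q n} \<subseteq> C" "decseq p" "incseq q"
    "\<And>x. x \<in> C \<Longrightarrow> \<exists>n. p n < x \<and> x < q n"
proof -
  obtain e where e: "e > 0" "cball t0 e \<subseteq> C" using C open_contains_cball by blast
  have te: "t0 - e \<in> C" "t0 + e \<in> C" using e by (auto intro!: subsetD[OF e(2)] simp: dist_real_def)
  define d where "d n = (if from_nat_into \<rat> n \<in> C then from_nat_into \<rat> n else t0)" for n :: nat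
  have dC: "d n \<in> C" for n using C by (simp add: d_def)
  have dense: "\<exists>n. d n \<in> U" if U: "open U" "U \<subseteq> C" "x \<in> U" for U x
  proof -
    obtain r where r: "r > 0" "ball x r \<subseteq> U" using U openE by blast
    obtain y where y: "y \<in> \<rat>" "x < y" "y < x + r" using Rats_dense_in_real[of x "x + r"] r by auto
    have yU: "y \<in> U" using r y by (auto simp: dist_real_def intro!: subsetD[OF r(2)])
    have "from_nat_into \<rat> (to_nat_on \<rat> y) = y" by (rule from_nat_into_to_nat_on[OF countable_rat y(1)])
    then have "d (to_nat_on \<rat> y) = y" using yU U by (auto simp: d_def)
    then show ?thesis using yU by metis
  qed
  define q where "q n = Max (insert (t0 + e) (d ` {..n}))" for n
  define p where "p n = Min (insert (t0 - e) (d ` {..n}))" for n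
  have qC: "q n \<in> C" for n
    using Max_in[of "insert (t0 + e) (d ` {..n})"] te dC by (auto simp: q_def)
  have pC: "p n \<in> C" for n
    using Min_in[of "insert (t0 - e) (d ` {..n})"] te dC by (auto simp: p_def)
  have q0: "t0 + e \<le> q n" and p0: "p n \<le> t0 - e" for n by (auto simp: q_def p_def)
  show thesis
  proof
    show "p n < q n" for n using q0[of n] p0[of n] e by linarith
    show "{p n..q n} \<subseteq> C" for n by (rule connected_contains_Icc[OF C(2) pC qC])
    show "incseq q" unfolding q_def incseq_def by (intro allI impI Max_mono) auto
    show "decseq p" unfolding p_def decseq_def by (intro allI impI Min_antimono) auto
    fix x assume x: "x \<in> C"
    obtain r where r: "r > 0" "ball x r \<subseteq> C" using C x openE by blast
    have "x + r / 2 \<in> C \<inter> {x<..}" "x - r / 2 \<in> C \<inter> {..<x}" using r by (auto simp: dist_real_def intro!: subsetD[OF r(2)])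
    then obtain n m where n: "d n \<in> C \<inter> {x<..}" and m: "d m \<in> C \<inter> {..<x}"
      using dense[of "C \<inter> {x<..}"] dense[of "C \<inter> {..<x}"] C(1) by (metis inf_le1 open_Int open_greaterThan open_lessThan)
    have "d n \<le> q (max n m)" unfolding q_def by (intro Max_ge) auto
    moreover have "p (max n m) \<le> d m" unfolding p_def by (intro Min_le) auto
    ultimately show "\<exists>n. p n < x \<and> x < q n" using n m by (intro exI[of _ "max n m"]) auto
  qed
qed

text \<open>Successive extension along the exhaustion: values once assigned on an interval are never
  changed afterwards, so the limit is well defined and locally equals one of the systems.\<close>

lemma dsys_open_connected:
  assumes I: "finite I" and C: "open C" "connected C" and loc: "\<And>t. t \<in> C \<Longrightarrow> locdiff I \<mu> t"
    and sides: "\<And>t. t \<in> C \<Longrightarrow> \<exists>e>0. (\<exists>\<nu>. dsys I \<mu> {t - e..t} \<nu>) \<and> (\<exists>\<nu>. dsys I \<mu> {t..t + e} \<nu>)"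
  shows "\<exists>\<nu>. dsys I \<mu> C \<nu>"
proof (cases "C = {}")
  case True
  then show ?thesis by (simp add: dsys_def)
next
  case False
  then obtain t0 where t0: "t0 \<in> C" by blast
  obtain p q :: "nat \<Rightarrow> real" where pq: "\<And>n. p n < q n" "\<And>n. {p n..q n} \<subseteq> C" "decseq p" "incseq q"
    "\<And>x. x \<in> C \<Longrightarrow> \<exists>n. p n < x \<and> x < q n"
    using open_interval_exhaustion[OF C t0] by metis
  have cpt: "\<exists>\<nu>. dsys I \<mu> {u..v} \<nu>" if "u < v" "{u..v} \<subseteq> C" for u v
    by (rule dsys_compact_interval[OF I that(1)]) (use that loc sides in blast)+
  have step: "\<exists>\<nu>'. dsys I \<mu> {p (Suc n)..q (Suc n)} \<nu>' \<and> (\<forall>s\<in>{p n..q n}. \<forall>i\<in>I. \<nu>' s i = \<nu> s i)"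
    if \<nu>: "dsys I \<mu> {p n..q n} \<nu>" for n \<nu>
  proof -
    have m: "p (Suc n) \<le> p n" "q n \<le> q (Suc n)" using pq(3,4) by (auto simp: decseq_Suc_iff incseq_Suc_iff)
    have PQ: "{p (Suc n)..q (Suc n)} \<subseteq> C" by (rule pq(2))
    have "\<exists>\<nu>1. dsys I \<mu> {p n..q (Suc n)} \<nu>1 \<and> (\<forall>s\<in>{p n..q n}. \<nu>1 s = \<nu> s)"
    proof (cases "q n = q (Suc n)")
      case False
      then have lt: "q n < q (Suc n)" using m by simp
      obtain \<nu>' where "dsys I \<mu> {q n..q (Suc n)} \<nu>'"
        using cpt[OF lt] PQ m pq(1)[of n] by (metis atLeastatMost_subset_iff order_trans order_refl less_imp_le)
      moreover have "locdiff I \<mu> (q n)" using pq(1,2)[of n] by (intro loc) auto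
      ultimately show ?thesis using dsys_extend_right[OF I _ pq(1)[of n] lt \<nu>] by metis
    qed (use \<nu> in auto)
    then obtain \<nu>1 where \<nu>1: "dsys I \<mu> {p n..q (Suc n)} \<nu>1" "\<And>s. s \<in> {p n..q n} \<Longrightarrow> \<nu>1 s = \<nu> s" by blast
    show ?thesis
    proof (cases "p (Suc n) = p n")
      case True
      then show ?thesis using \<nu>1 by (intro exI[of _ \<nu>1]) auto
    next
      case False
      then have lt: "p (Suc n) < p n" using m by simp
      have lt2: "p n < q (Suc n)" using m pq(1)[of n] by simp
      obtain \<nu>' where \<nu>': "dsys I \<mu> {p (Suc n)..p n} \<nu>'"
        using cpt[OF lt] PQ m pq(1)[of n] by (metis atLeastatMost_subset_iff order_trans order_refl less_imp_le)
      have "locdiff I \<mu> (p n)" using pq(1,2)[of n] by (intro loc) auto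
      from dsys_extend_left[OF I this lt lt2 \<nu>' \<nu>1(1)] obtain \<nu>2 where
        \<nu>2: "dsys I \<mu> {p (Suc n)..q (Suc n)} \<nu>2" "\<And>s i. s \<in> {p n..q (Suc n)} \<Longrightarrow> i \<in> I \<Longrightarrow> \<nu>2 s i = \<nu>1 s i" by metis
      show ?thesis
      proof (intro exI[of _ \<nu>2] conjI \<nu>2(1) ballI)
        fix s i assume "s \<in> {p n..q n}" "i \<in> I"
        then show "\<nu>2 s i = \<nu> s i" using \<nu>2(2)[of s i] \<nu>1(2)[of s] m by simp
      qed
    qed
  qed
  have "\<exists>f. \<forall>n. dsys I \<mu> {p n..q n} (f n) \<and> (\<forall>s\<in>{p n..q n}. \<forall>i\<in>I. f (Suc n) s i = f n s i)"
    by (rule dependent_nat_choice[of "\<lambda>n \<nu>. dsys I \<mu> {p n..q n} \<nu>"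
          "\<lambda>n \<nu> \<nu>'. \<forall>s\<in>{p n..q n}. \<forall>i\<in>I. \<nu>' s i = \<nu> s i"]) (rule cpt[OF pq(1,2)], rule step)
  then obtain f where f: "\<And>n. dsys I \<mu> {p n..q n} (f n)"
      "\<And>n s i. s \<in> {p n..q n} \<Longrightarrow> i \<in> I \<Longrightarrow> f (Suc n) s i = f n s i" by blast
  have sub: "{p n..q n} \<subseteq> {p (n + k)..q (n + k)}" for n k
    using decseqD[OF pq(3), of n "n + k"] incseqD[OF pq(4), of n "n + k"] by auto
  have agree: "f (n + k) s i = f n s i" if "s \<in> {p n..q n}" "i \<in> I" for n k s i
  proof (induction k)
    case (Suc k)
    have "s \<in> {p (n + k)..q (n + k)}" using that(1) sub by blast
    then show ?case using f(2)[of s "n + k" i] that(2) Suc by simp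
  qed simp
  \<comment> \<open>The first interval containing \<open>s\<close>; by \<open>agree\<close> every
    later one gives the same values.\<close>
  define N where "N s = (LEAST n. s \<in> {p n..q n})" for s
  have fN: "f (N s) s i = f n s i" if "s \<in> {p n..q n}" "i \<in> I" for n s i
  proof -
    have 1: "s \<in> {p (N s)..q (N s)}" unfolding N_def by (rule LeastI[of "\<lambda>n. s \<in> {p n..q n}", OF that(1)])
    have "N s \<le> n" unfolding N_def by (rule Least_le[of "\<lambda>n. s \<in> {p n..q n}", OF that(1)])
    then have "N s + (n - N s) = n" by simp
    with agree[OF 1 that(2), of "n - N s"] show ?thesis by simp
  qed
  have "dsys I \<mu> C (\<lambda>s. f (N s) s)"
    unfolding dsys_def
  proof (intro ballI conjI)
    fix s assume s: "s \<in> C"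
    then obtain n where n: "p n < s" "s < q n" using pq(5) by blast
    then have sn: "s \<in> {p n..q n}" by simp
    have "rearr I (\<mu> s) (f n s)" by (rule dsys_rearr[OF f(1) sn])
    then show "rearr I (\<mu> s) (f (N s) s)"
      using rearr_cong[of I "f (N s) s" "f n s"] fN[OF sn] I by blast
    fix i assume i: "i \<in> I"
    obtain d where d: "((\<lambda>s. f n s i) has_real_derivative d) (at s within {p n..q n})"
      using dsys_DERIV[OF f(1) sn i] by blast
    have "((\<lambda>s. f n s i) has_real_derivative d) (at s)"
      using d n at_within_interior[of s "{p n..q n}"] by simp
    moreover have "\<forall>\<^sub>F x in nhds s. f n x i = f (N x) x i"
    proof (rule eventually_mono)
      show "\<forall>\<^sub>F x in nhds s. x \<in> {p n<..<q n}" by (rule eventually_nhds_in_open) (use n in auto)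
      fix x assume "x \<in> {p n<..<q n}"
      then have "x \<in> {p n..q n}" by simp
      from fN[OF this i] show "f n x i = f (N x) x i" by simp
    qed
    ultimately have "((\<lambda>s. f (N s) s i) has_real_derivative d) (at s)"
      by (rule DERIV_eventually_eq)
    then show "\<exists>d. ((\<lambda>s. f (N s) s i) has_real_derivative d) (at s within C)"
      using DERIV_subset by blast
  qed
  then show ?thesis by blast
qed

lemma dsys_open:
  assumes I: "finite I" and J: "open J" and loc: "\<And>t. t \<in> J \<Longrightarrow> locdiff I \<mu> t"
    and sides: "\<And>t. t \<in> J \<Longrightarrow> \<exists>e>0. (\<exists>\<nu>. dsys I \<mu> {t - e..t} \<nu>) \<and> (\<exists>\<nu>. dsys I \<mu> {t..t + e} \<nu>)"
  shows "\<exists>\<nu>. dsys I \<mu> J \<nu>"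
proof -
  let ?C = "connected_component_set J"
  have sub: "?C t \<subseteq> J" for t by (rule connected_component_subset)
  have op: "open (?C t)" for t using J by (rule open_connected_component)
  have "\<exists>\<nu>. dsys I \<mu> (?C t) \<nu>" for t
    by (rule dsys_open_connected[OF I op connected_connected_component]) (use loc sides sub in blast)+
  note ex = this
  \<comment> \<open>The system is chosen per component and not per point, so that nearby points use
    the same one.\<close>
  define n where "n C = (SOME \<nu>. dsys I \<mu> C \<nu>)" for C
  have n: "dsys I \<mu> (?C t) (n (?C t))" for t
    unfolding n_def by (rule someI_ex[OF ex])
  have "dsys I \<mu> J (\<lambda>s. n (?C s) s)"
    unfolding dsys_def
  proof (intro ballI conjI)
    fix s assume s: "s \<in> J"
    then have sC: "s \<in> ?C s" by simp
    show "rearr I (\<mu> s) (n (?C s) s)" by (rule dsys_rearr[OF n sC])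
    fix i assume i: "i \<in> I"
    obtain d where "((\<lambda>x. n (?C s) x i) has_real_derivative d) (at s within ?C s)"
      using dsys_DERIV[OF n sC i] by blast
    then have "((\<lambda>x. n (?C s) x i) has_real_derivative d) (at s)"
      using at_within_open[OF sC op] by simp
    moreover have "\<forall>\<^sub>F x in nhds s. n (?C s) x i = n (?C x) x i"
    proof (rule eventually_mono[OF eventually_nhds_in_open[OF op sC]])
      fix x assume "x \<in> ?C s"
      from connected_component_eq[OF this] show "n (?C s) x i = n (?C x) x i" by simp
    qed
    ultimately have "((\<lambda>x. n (?C x) x i) has_real_derivative d) (at s)"
      by (rule DERIV_eventually_eq)
    then show "\<exists>d. ((\<lambda>x. n (?C x) x i) has_real_derivative d) (at s within J)"
      using DERIV_subset by blast
  qed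
  then show ?thesis by blast
qed

section \<open>Times at which all values coincide\<close>

lemma dsys_sides:
  assumes "dsys I \<mu> N \<nu>" "open N" "t \<in> N"
  shows "\<exists>e>0. (\<exists>\<nu>. dsys I \<mu> {t - e..t} \<nu>) \<and> (\<exists>\<nu>. dsys I \<mu> {t..t + e} \<nu>)"
proof -
  obtain e where e: "e > 0" "cball t e \<subseteq> N" using assms open_contains_cball by blast
  have "{t - e..t} \<subseteq> N" "{t..t + e} \<subseteq> N"
    using e by (auto simp: dist_real_def intro!: subsetD[OF e(2)])
  with dsys_subset[OF assms(1)] e(1) show ?thesis by blast
qed

text \<open>Near \<open>t\<close> the values of \<open>q\<close> lie in disjoint balls around the
  points of \<open>D\<close>; the image of a connected set cannot pass from one ball to another, so
  a single point of \<open>D\<close> attracts it.\<close>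

lemma connected_quotient_limit:
  fixes q :: "real \<Rightarrow> real"
  assumes S: "convex S" "t islimpt S" "t \<notin> S" and q: "continuous_on S q" and D: "finite D"
    and near: "\<And>e. e > 0 \<Longrightarrow> \<forall>\<^sub>F s in at t within S. \<exists>d\<in>D. \<bar>q s - d\<bar> < e"
  shows "\<exists>d\<in>D. (q \<longlongrightarrow> d) (at t within S)"
proof -
  have nt: "at t within S \<noteq> bot" using S(2) by (simp add: trivial_limit_within)
  \<comment> \<open>At most half of the smallest distance in \<open>D\<close>, so that the balls of
    radius \<open>e0\<close> are disjoint; the 1 covers a set \<open>D\<close> with at most one
    point.\<close>
  define e0 where "e0 = Min (insert 1 ((\<lambda>(d, d'). \<bar>d - d'\<bar> / 2) ` {(d, d'). d \<in> D \<and> d' \<in> D \<and> d \<noteq> d'}))"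
  have fin: "finite {(d, d'). d \<in> D \<and> d' \<in> D \<and> d \<noteq> d'}"
    by (rule finite_subset[of _ "D \<times> D"]) (use D in auto)
  have e0: "e0 > 0" unfolding e0_def using fin by (subst Min_gr_iff) auto
  have sep: "2 * e0 \<le> \<bar>d - d'\<bar>" if "d \<in> D" "d' \<in> D" "d \<noteq> d'" for d d'
  proof -
    have "e0 \<le> \<bar>d - d'\<bar> / 2" unfolding e0_def using fin that by (intro Min_le) (auto intro!: image_eqI[of _ _ "(d, d')"])
    then show ?thesis by simp
  qed
  from near[OF e0] obtain \<delta> where \<delta>: "\<delta> > 0" "\<And>s. s \<in> S \<Longrightarrow> s \<noteq> t \<Longrightarrow> dist s t < \<delta> \<Longrightarrow> \<exists>d\<in>D. \<bar>q s - d\<bar> < e0"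
    unfolding eventually_at by blast
  define A where "A = q ` (S \<inter> ball t \<delta>)"
  have "connected A"
    unfolding A_def
    by (intro connected_continuous_image continuous_on_subset[OF q] convex_connected convex_Int S convex_ball) auto
  have Acov: "\<exists>d\<in>D. \<bar>y - d\<bar> < e0" if "y \<in> A" for y
  proof -
    from that obtain x where x: "x \<in> S" "dist x t < \<delta>" "y = q x" by (auto simp: A_def dist_commute)
    with S(3) have "x \<noteq> t" by blast
    from \<delta>(2)[OF x(1) this x(2)] x(3) show ?thesis by simp
  qed
  obtain s0 where s0: "s0 \<in> S" "dist s0 t < \<delta>"
    using S(2) \<delta>(1) unfolding islimpt_approachable by blast
  then have s0A: "q s0 \<in> A" by (auto simp: A_def dist_commute)
  then obtain d0 where d0: "d0 \<in> D" "\<bar>q s0 - d0\<bar> < e0" using Acov by blast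
  define V where "V = (\<Union>d\<in>D - {d0}. ball d e0)"
  have "ball d0 e0 \<inter> V = {}"
  proof -
    have False if "y \<in> ball d0 e0" "y \<in> ball d e0" "d \<in> D - {d0}" for y d
      using sep[of d d0] that d0(1) by (auto simp: dist_real_def)
    then show ?thesis unfolding V_def by blast
  qed
  moreover have "A \<subseteq> ball d0 e0 \<union> V"
    using Acov by (fastforce simp: V_def dist_real_def abs_minus_commute)
  moreover have "open V" by (auto simp: V_def)
  ultimately have "ball d0 e0 \<inter> A = {} \<or> V \<inter> A = {}"
    using connectedD[OF \<open>connected A\<close> open_ball[of d0 e0] \<open>open V\<close>] by auto
  moreover have "q s0 \<in> ball d0 e0 \<inter> A" using d0 s0A by (auto simp: dist_real_def abs_minus_commute)
  ultimately have VA: "V \<inter> A = {}" by blast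
  have "(q \<longlongrightarrow> d0) (at t within S)"
  proof (rule tendstoI)
    fix e :: real assume "e > 0"
    then have "min e e0 > 0" using e0 by simp
    from near[OF this] have "\<forall>\<^sub>F s in at t within S. \<exists>d\<in>D. \<bar>q s - d\<bar> < min e e0" .
    moreover have "\<forall>\<^sub>F s in at t within S. s \<in> S \<inter> ball t \<delta>"
      unfolding eventually_at using \<delta>(1) by (intro exI[of _ \<delta>]) (auto simp: dist_commute)
    ultimately show "\<forall>\<^sub>F s in at t within S. dist (q s) d0 < e"
    proof eventually_elim
      case (elim s)
      then obtain d where d: "d \<in> D" "\<bar>q s - d\<bar> < min e e0" by blast
      have "q s \<in> A" using elim by (auto simp: A_def)
      then have "q s \<notin> V" using VA by blast
      then have "d = d0" using d by (auto simp: V_def dist_real_def abs_minus_commute)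
      with d show ?case by (simp add: dist_real_def)
    qed
  qed
  with d0 show ?thesis by blast
qed

lemma rearr_filter:
  assumes "rearr I x y" "finite I" "I1 \<subseteq> I" "I2 \<subseteq> I"
    and "\<And>i. i \<in> I \<Longrightarrow> x i \<in> O1 \<longleftrightarrow> i \<in> I1" "\<And>i. i \<in> I \<Longrightarrow> y i \<in> O1 \<longleftrightarrow> i \<in> I2"
  shows "image_mset x (mset_set I1) = image_mset y (mset_set I2)"
proof -
  have f: "image_mset z (mset_set I') = filter_mset (\<lambda>v. v \<in> O1) (image_mset z (mset_set I))"
    if "I' \<subseteq> I" "\<And>i. i \<in> I \<Longrightarrow> z i \<in> O1 \<longleftrightarrow> i \<in> I'" for z I'
  proof -
    have "filter_mset (\<lambda>v. v \<in> O1) (image_mset z (mset_set I)) = image_mset z (filter_mset (\<lambda>i. z i \<in> O1) (mset_set I))"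
      by (simp add: filter_mset_image_mset)
    also have "filter_mset (\<lambda>i. z i \<in> O1) (mset_set I) = mset_set {i \<in> I. z i \<in> O1}"
      using assms(2) by simp
    also have "{i \<in> I. z i \<in> O1} = I'" using that by blast
    finally show ?thesis by simp
  qed
  show ?thesis
    using f[of I1 x] f[of I2 y] assms(1,3-6) by (simp add: rearr_def)
qed

text \<open>A rearrangement cannot exchange values between two disjoint open sets, so near
  \<open>t\<close> the differentiable family splits accordingly. Its part in \<open>O1\<close> has
  an index set \<open>I2\<close> of the same size as \<open>I1\<close> and is transported to
  \<open>I1\<close> by a bijection.\<close>

lemma locdiff_split:
  assumes I: "finite I" and N: "open N" "t \<in> N" and O: "open O1" "open O2" "O1 \<inter> O2 = {}" and I1: "I1 \<subseteq> I"
    and \<xi>: "\<And>s i. s \<in> N \<Longrightarrow> i \<in> I1 \<Longrightarrow> \<xi> s i \<in> O1" "\<And>s i. s \<in> N \<Longrightarrow> i \<in> I - I1 \<Longrightarrow> \<xi> s i \<in> O2"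
    and \<mu>: "\<And>s. s \<in> N \<Longrightarrow> rearr I (\<mu> s) (\<xi> s)" and loc: "locdiff I \<mu> t"
  shows "locdiff I1 \<xi> t"
proof -
  obtain \<nu> d where \<nu>: "\<forall>\<^sub>F s in nhds t. rearr I (\<mu> s) (\<nu> s)"
    and d: "\<And>i. i \<in> I \<Longrightarrow> ((\<lambda>s. \<nu> s i) has_real_derivative d i) (at t)"
    using loc unfolding locdiff_def by blast
  have evN: "\<forall>\<^sub>F s in nhds t. s \<in> N" by (rule eventually_nhds_in_open[OF N])
  have ev: "\<forall>\<^sub>F s in nhds t. rearr I (\<xi> s) (\<nu> s)"
    using \<nu> evN by eventually_elim (rule rearr_trans[OF rearr_sym[OF \<mu>]])
  have at_t: "rearr I (\<xi> t) (\<nu> t)" by (rule eventually_nhds_x_imp_x[OF ev])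
  define I2 where "I2 = {i \<in> I. \<nu> t i \<in> O1}"
  have I2: "I2 \<subseteq> I" by (auto simp: I2_def)
  have img: "\<nu> t ` I \<subseteq> O1 \<union> O2"
  proof -
    have "\<xi> t i \<in> O1 \<union> O2" if "i \<in> I" for i
      using \<xi>(1)[OF N(2), of i] \<xi>(2)[OF N(2), of i] that by (cases "i \<in> I1") auto
    then show ?thesis unfolding rearr_image[OF at_t I, symmetric] by blast
  qed
  have cont: "((\<lambda>s. \<nu> s i) \<longlongrightarrow> \<nu> t i) (nhds t)" if "i \<in> I" for i
    using DERIV_isCont[OF d[OF that]] by (simp add: isCont_def tendsto_nhds_iff)
  have ev2: "\<forall>\<^sub>F s in nhds t. \<forall>i\<in>I. \<nu> s i \<in> O1 \<longleftrightarrow> i \<in> I2"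
  proof (rule eventually_ball_finite[OF I], intro ballI)
    fix i assume i: "i \<in> I"
    show "\<forall>\<^sub>F s in nhds t. \<nu> s i \<in> O1 \<longleftrightarrow> i \<in> I2"
    proof (cases "i \<in> I2")
      case True
      then have "\<nu> t i \<in> O1" by (simp add: I2_def)
      from topological_tendstoD[OF cont[OF i] O(1) this] show ?thesis by eventually_elim (simp add: True)
    next
      case False
      then have "\<nu> t i \<in> O2" using i img by (auto simp: I2_def)
      from topological_tendstoD[OF cont[OF i] O(2) this] show ?thesis
        by eventually_elim (use O(3) False in auto)
    qed
  qed
  have \<xi>O: "\<xi> s i \<in> O1 \<longleftrightarrow> i \<in> I1" if "s \<in> N" "i \<in> I" for s i
    using \<xi>[OF that(1)] that O(3) by blast
  have ev3: "\<forall>\<^sub>F s in nhds t. image_mset (\<xi> s) (mset_set I1) = image_mset (\<nu> s) (mset_set I2)"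
    using ev ev2 evN by eventually_elim (rule rearr_filter[OF _ I I1 I2, where ?O1.0 = O1]; use \<xi>O in blast)
  have fin: "finite I1" "finite I2" using I I1 I2 finite_subset by auto
  have "size (image_mset (\<xi> t) (mset_set I1)) = size (image_mset (\<nu> t) (mset_set I2))"
    using eventually_nhds_x_imp_x[OF ev3] by simp
  then have "card I1 = card I2" by simp
  then obtain f where f: "bij_betw f I1 I2" using finite_same_card_bij[OF fin] by blast
  have im: "image_mset (\<nu> s) (mset_set I2) = image_mset (\<lambda>i. \<nu> s (f i)) (mset_set I1)" for s
  proof -
    have "mset_set I2 = image_mset f (mset_set I1)"
      using image_mset_mset_set[of f I1] f by (simp add: bij_betw_def)
    then show ?thesis by (simp add: multiset.map_comp o_def)
  qed
  have "\<forall>\<^sub>F s in nhds t. rearr I1 (\<xi> s) (\<lambda>i. \<nu> s (f i))"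
    using ev3 by eventually_elim (simp add: rearr_def im)
  moreover have "((\<lambda>s. \<nu> s (f i)) has_real_derivative d (f i)) (at t)" if "i \<in> I1" for i
    using f that I2 by (intro d) (auto simp: bij_betw_def)
  ultimately show ?thesis
    unfolding locdiff_def by (intro exI[of _ "\<lambda>s i. \<nu> s (f i)"] exI[of _ "d \<circ> f"]) simp
qed

text \<open>At each \<open>s\<close> the values of \<open>\<nu>\<close> are among those of
  \<open>\<xi>\<close>, so their quotients are among the quotients of \<open>\<xi>\<close>, which
  tend to finitely many limits.\<close>

lemma quotient_in_image:
  assumes "finite I" "\<forall>\<^sub>F s in at t within S. rearr I (\<nu> s) (\<xi> s)"
    and d: "\<And>i. i \<in> I \<Longrightarrow> ((\<lambda>s. \<xi> s i) has_real_derivative d i) (at t)"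
    and m: "\<And>i. i \<in> I \<Longrightarrow> \<xi> t i = m" and i: "i \<in> I" and e: "e > 0"
  shows "\<forall>\<^sub>F s in at t within S. \<exists>b\<in>d ` I. \<bar>(\<nu> s i - m) / (s - t) - b\<bar> < e"
proof -
  have "\<forall>\<^sub>F s in at t within S. \<forall>j\<in>I. \<bar>(\<xi> s j - m) / (s - t) - d j\<bar> < e"
  proof (rule eventually_ball_finite[OF assms(1)], intro ballI)
    fix j assume j: "j \<in> I"
    have "((\<lambda>s. (\<xi> s j - \<xi> t j) / (s - t)) \<longlongrightarrow> d j) (at t within S)"
      using DERIV_subset[OF d[OF j]] unfolding has_field_derivative_iff by blast
    from tendstoD[OF this e] show "\<forall>\<^sub>F s in at t within S. \<bar>(\<xi> s j - m) / (s - t) - d j\<bar> < e"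
      by (simp add: m[OF j] dist_real_def)
  qed
  with assms(2) show ?thesis
  proof eventually_elim
    case (elim s)
    have "\<nu> s i \<in> \<xi> s ` I" using rearr_image[OF elim(1) assms(1)] i by blast
    then obtain j where "j \<in> I" "\<nu> s i = \<xi> s j" by blast
    with elim(2) show ?case by auto
  qed
qed

lemma rearr_const:
  assumes "finite I" "\<And>i. i \<in> I \<Longrightarrow> x i = m"
  shows "rearr I x (\<lambda>_. m)"
  using rearr_cong[of I x "\<lambda>_. m" x] assms by auto

text \<open>All values equal \<open>m\<close> at \<open>t\<close>, so the order of the family there
  is immaterial and only the existence of the derivative within \<open>S\<close> is at stake. The
  quotients are continuous on \<open>S\<close> and stay near the finitely many derivatives of
  \<open>\<xi>\<close>, hence they converge by connectedness.\<close>

lemma dsys_close_endpoint: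
  assumes I: "finite I" and \<nu>: "dsys I \<mu> U \<nu>" and S: "convex S" "S \<subseteq> U" "open U" "t islimpt S" "t \<notin> S"
    and \<xi>: "\<forall>\<^sub>F s in nhds t. rearr I (\<mu> s) (\<xi> s)"
    and d: "\<And>i. i \<in> I \<Longrightarrow> ((\<lambda>s. \<xi> s i) has_real_derivative d i) (at t)"
    and m: "\<And>i. i \<in> I \<Longrightarrow> \<xi> t i = m"
  shows "dsys I \<mu> (insert t S) (\<lambda>s. if s = t then (\<lambda>_. m) else \<nu> s)"
  unfolding dsys_def
proof (intro ballI conjI)
  let ?n = "\<lambda>s. if s = t then (\<lambda>_. m) else \<nu> s"
  have \<nu>\<xi>: "\<forall>\<^sub>F s in at t within S. rearr I (\<nu> s) (\<xi> s)"
  proof -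
    have "\<forall>\<^sub>F s in at t within S. rearr I (\<mu> s) (\<xi> s)"
      using \<xi> by (simp add: eventually_at_filter eventually_mono)
    moreover have "\<forall>\<^sub>F s in at t within S. s \<in> U"
      using S(2) unfolding eventually_at_filter by (intro always_eventually) blast
    ultimately show ?thesis
      by eventually_elim (rule rearr_trans[OF rearr_sym[OF dsys_rearr[OF \<nu>]]])
  qed
  fix s assume s: "s \<in> insert t S"
  show "rearr I (\<mu> s) (?n s)"
  proof (cases "s = t")
    case True
    have "rearr I (\<mu> t) (\<xi> t)" by (rule eventually_nhds_x_imp_x[OF \<xi>])
    then show ?thesis using rearr_trans[OF _ rearr_const[OF I m]] True by simp
  next
    case False
    then show ?thesis using s S(2) dsys_rearr[OF \<nu>] by auto
  qed
  fix i assume i: "i \<in> I"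
  show "\<exists>d. ((\<lambda>s. ?n s i) has_real_derivative d) (at s within insert t S)"
  proof (cases "s = t")
    case True
    let ?q = "\<lambda>s. (\<nu> s i - m) / (s - t)"
    have c: "continuous_on S (\<lambda>s. \<nu> s i)"
    proof (rule continuous_on_subset[OF _ S(2)])
      show "continuous_on U (\<lambda>s. \<nu> s i)"
        unfolding continuous_on_eq_continuous_within using dsys_DERIV[OF \<nu> _ i] DERIV_continuous by blast
    qed
    have "continuous_on S ?q" by (intro continuous_intros c) (use S(5) in auto)
    from connected_quotient_limit[OF S(1,4,5) this finite_imageI[OF I] quotient_in_image[OF I \<nu>\<xi> d m i]]
    obtain b where b: "(?q \<longlongrightarrow> b) (at t within S)" by blast
    have f: "at t within insert t S = at t within S" by (rule at_within_nhd[of t UNIV]) auto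
    have "((\<lambda>s. (?n s i - ?n t i) / (s - t)) \<longlongrightarrow> b) (at t within insert t S)"
      unfolding f by (rule Lim_transform_eventually[OF b]) (simp add: eventually_at_filter)
    then show ?thesis unfolding True has_field_derivative_iff by blast
  next
    case False
    then have sU: "s \<in> U" using s S(2) by auto
    obtain e where "((\<lambda>s. \<nu> s i) has_real_derivative e) (at s within U)" using dsys_DERIV[OF \<nu> sU i] by blast
    then have "((\<lambda>s. \<nu> s i) has_real_derivative e) (at s)" using at_within_open[OF sU S(3)] by simp
    then have "((\<lambda>s. ?n s i) has_real_derivative e) (at s)"
    proof (rule DERIV_eventually_eq)
      have "\<forall>\<^sub>F x in nhds s. x \<in> - {t}" by (rule eventually_nhds_in_open) (use False in auto)
      then show "\<forall>\<^sub>F x in nhds s. \<nu> x i = ?n x i" by eventually_elim simp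
    qed
    then show ?thesis using DERIV_subset by blast
  qed
qed

text \<open>Strong induction on \<open>card I\<close>. Near a time outside \<open>Z\<close> the
  family splits into two smaller ones. A time in \<open>Z\<close> at which two derivatives differ is
  isolated in \<open>Z\<close>, so a system on the complement of \<open>Z\<close> extends to it from
  either side. At the times of the remaining set \<open>F\<close> every arrangement is
  differentiable.\<close>

theorem differentiable_rearrangement_exists:
  assumes "finite I" "open J" "\<And>t. t \<in> J \<Longrightarrow> locdiff I \<mu> t"
  shows "\<exists>\<nu>. dsys I \<mu> J \<nu>"
  using assms
proof (induction "card I" arbitrary: I \<mu> J rule: less_induct)
  case less
  note I = less.prems(1) and J = less.prems(2) and loc = less.prems(3)
  have "\<forall>t\<in>J. \<exists>\<xi> d. (\<forall>\<^sub>F s in nhds t. rearr I (\<mu> s) (\<xi> s)) \<and>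
      (\<forall>i\<in>I. ((\<lambda>s. \<xi> s i) has_real_derivative d i) (at t))"
    using loc unfolding locdiff_def by blast
  then obtain X D where X: "\<And>t. t \<in> J \<Longrightarrow> \<forall>\<^sub>F s in nhds t. rearr I (\<mu> s) (X t s)"
    and D: "\<And>t i. t \<in> J \<Longrightarrow> i \<in> I \<Longrightarrow> ((\<lambda>s. X t s i) has_real_derivative D t i) (at t)"
    unfolding bchoice_iff by blast
  define Z where "Z = {t \<in> J. \<forall>i\<in>I. \<forall>j\<in>I. \<mu> t i = \<mu> t j}"
  have allsame: "(\<forall>i\<in>I. \<forall>j\<in>I. x i = x j) \<longleftrightarrow> (\<forall>i\<in>I. \<forall>j\<in>I. y i = y j)" if "rearr I x y" for x y
    using rearr_image[OF that I] by (metis (no_types, opaque_lifting) image_iff)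
  have Xt: "rearr I (\<mu> t) (X t t)" if "t \<in> J" for t by (rule eventually_nhds_x_imp_x[OF X[OF that]])
  have contX: "((\<lambda>s. X t s i) \<longlongrightarrow> X t t i) (nhds t)" if "t \<in> J" "i \<in> I" for t i
    using DERIV_isCont[OF D[OF that]] by (simp add: isCont_def tendsto_nhds_iff)
  have split: "\<exists>N. open N \<and> t \<in> N \<and> N \<subseteq> J - Z \<and> (\<exists>\<nu>. dsys I \<mu> N \<nu>)" if t: "t \<in> J - Z" for t
  proof -
    have tJ: "t \<in> J" using t by blast
    obtain i0 j0 where ij: "i0 \<in> I" "j0 \<in> I" "X t t i0 < X t t j0"
    proof -
      have "\<not> (\<forall>i\<in>I. \<forall>j\<in>I. X t t i = X t t j)"
        using t allsame[OF Xt[OF tJ]] by (simp add: Z_def)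
      then obtain i j where ij: "i \<in> I" "j \<in> I" "X t t i \<noteq> X t t j" by blast
      show thesis
      proof (cases "X t t i < X t t j")
        case False
        then have "X t t j < X t t i" using ij by simp
        then show thesis by (rule that[OF ij(2,1)])
      qed (rule that[OF ij(1,2)])
    qed
    define v where "v = X t t j0"
    define L where "L = X t t ` I \<inter> {..<v}"
    have L: "finite L" "L \<noteq> {}" using I ij by (auto simp: L_def v_def)
    \<comment> \<open>A threshold just below \<open>v\<close> that no value at \<open>t\<close>
      attains; the indices below it form \<open>I1\<close>, with \<open>i0\<close> inside and
      \<open>j0\<close> outside, so both parts are smaller than \<open>I\<close>.\<close>
    define c where "c = (Max L + v) / 2"
    have maxL: "Max L < v" using Max_in[OF L] by (auto simp: L_def)
    have nc: "X t t i < c \<or> c < X t t i" if "i \<in> I" for i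
    proof (cases "X t t i < v")
      case True
      then have "X t t i \<le> Max L" using that L by (intro Max_ge) (auto simp: L_def)
      then show ?thesis using maxL by (auto simp: c_def)
    qed (use maxL in \<open>auto simp: c_def\<close>)
    define I1 where "I1 = {i \<in> I. X t t i < c}"
    have I1: "I1 \<subseteq> I" by (auto simp: I1_def)
    have "X t t i0 \<le> Max L" using ij L by (intro Max_ge) (auto simp: L_def v_def)
    then have i0: "i0 \<in> I1" using ij maxL by (auto simp: I1_def c_def)
    have j0: "j0 \<in> I - I1" using ij maxL by (auto simp: I1_def c_def v_def)
    have "\<forall>\<^sub>F s in nhds t. \<forall>i\<in>I. if i \<in> I1 then X t s i < c else c < X t s i"
    proof (rule eventually_ball_finite[OF I], intro ballI)
      fix i assume i: "i \<in> I"
      show "\<forall>\<^sub>F s in nhds t. if i \<in> I1 then X t s i < c else c < X t s i"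
      proof (cases "i \<in> I1")
        case True
        then have "X t t i < c" by (simp add: I1_def)
        from order_tendstoD(2)[OF contX[OF tJ i] this] show ?thesis using True by simp
      next
        case False
        then have "c < X t t i" using nc[OF i] i by (auto simp: I1_def)
        from order_tendstoD(1)[OF contX[OF tJ i] this] show ?thesis using False by simp
      qed
    qed
    moreover have "\<forall>\<^sub>F s in nhds t. s \<in> J" by (rule eventually_nhds_in_open[OF J tJ])
    ultimately have "\<forall>\<^sub>F s in nhds t. s \<in> J \<and> rearr I (\<mu> s) (X t s) \<and> (\<forall>i\<in>I. if i \<in> I1 then X t s i < c else c < X t s i)"
      using X[OF tJ] by eventually_elim blast
    then obtain N where N: "open N" "t \<in> N"
      and NP: "\<And>s. s \<in> N \<Longrightarrow> s \<in> J" "\<And>s. s \<in> N \<Longrightarrow> rearr I (\<mu> s) (X t s)"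
        "\<And>s i. s \<in> N \<Longrightarrow> i \<in> I \<Longrightarrow> if i \<in> I1 then X t s i < c else c < X t s i"
      unfolding eventually_nhds by blast
    have lo: "X t s i \<in> {..<c}" if "s \<in> N" "i \<in> I1" for s i using NP(3)[of s i] that I1 by auto
    have hi: "X t s i \<in> {c<..}" if "s \<in> N" "i \<in> I - I1" for s i using NP(3)[of s i] that by auto
    have NZ: "N \<subseteq> J - Z"
    proof
      fix s assume s: "s \<in> N"
      have "X t s i0 \<noteq> X t s j0" using lo[OF s i0] hi[OF s j0] by auto
      then have "\<not> (\<forall>i\<in>I. \<forall>j\<in>I. X t s i = X t s j)" using ij by blast
      then show "s \<in> J - Z" using allsame[OF NP(2)[OF s]] NP(1)[OF s] by (auto simp: Z_def)
    qed
    have l1: "locdiff I1 (X t) s" if s: "s \<in> N" for s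
      by (rule locdiff_split[OF I N(1) s open_lessThan[of c] open_greaterThan[of c] _ I1 lo hi NP(2) loc[OF NP(1)[OF s]]]) auto
    have l2: "locdiff (I - I1) (X t) s" if s: "s \<in> N" for s
    proof (rule locdiff_split[OF I N(1) s open_greaterThan[of c] open_lessThan[of c] _ _ hi _ NP(2) loc[OF NP(1)[OF s]]])
      fix s i assume "s \<in> N" "i \<in> I - (I - I1)"
      then show "X t s i \<in> {..<c}" using lo[of s i] by blast
    qed auto
    have "card I1 < card I" using psubset_card_mono[OF I, of I1] I1 j0 by blast
    moreover have "finite I1" using I I1 finite_subset by blast
    ultimately obtain n1 where n1: "dsys I1 (X t) N n1" using less.hyps[OF _ _ N(1) l1] by blast
    have "card (I - I1) < card I" using psubset_card_mono[OF I, of "I - I1"] I1 i0 by blast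
    then obtain n2 where n2: "dsys (I - I1) (X t) N n2" using less.hyps[OF _ _ N(1) l2] I by blast
    have "dsys I \<mu> N (\<lambda>s i. if i \<in> I1 then n1 s i else n2 s i)"
      unfolding dsys_def
    proof (intro ballI conjI)
      fix s assume s: "s \<in> N"
      let ?n = "\<lambda>s i. if i \<in> I1 then n1 s i else n2 s i"
      have u: "mset_set I = mset_set I1 + mset_set (I - I1)"
        using mset_set_Union[of I1 "I - I1"] I I1 finite_subset[OF I1 I] by (simp add: Un_absorb1)
      have fI1: "finite I1" using I I1 finite_subset by blast
      have "image_mset (?n s) (mset_set I1) = image_mset (n1 s) (mset_set I1)"
        by (rule image_mset_cong) (use fI1 in simp)
      moreover have "image_mset (?n s) (mset_set (I - I1)) = image_mset (n2 s) (mset_set (I - I1))"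
        by (rule image_mset_cong) (use I in simp)
      ultimately have "rearr I (X t s) (?n s)"
        using dsys_rearr[OF n1 s] dsys_rearr[OF n2 s] unfolding rearr_def u by simp
      then show "rearr I (\<mu> s) (?n s)" using rearr_trans[OF NP(2)[OF s]] by blast
      fix i assume i: "i \<in> I"
      show "\<exists>d. ((\<lambda>s. ?n s i) has_real_derivative d) (at s within N)"
        using dsys_DERIV[OF n1 s, of i] dsys_DERIV[OF n2 s, of i] i by (cases "i \<in> I1") simp_all
    qed
    with N NZ show ?thesis by blast
  qed
  have Zc: "open (J - Z)"
    unfolding open_subopen[of "J - Z"]
  proof
    fix t assume "t \<in> J - Z"
    from split[OF this] obtain N where "open N" "t \<in> N" "N \<subseteq> J - Z" by blast
    then show "\<exists>T. open T \<and> t \<in> T \<and> T \<subseteq> J - Z" by blast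
  qed
  have sidesJZ: "\<exists>e>0. (\<exists>\<nu>. dsys I \<mu> {t - e..t} \<nu>) \<and> (\<exists>\<nu>. dsys I \<mu> {t..t + e} \<nu>)" if "t \<in> J - Z" for t
  proof -
    from split[OF that] obtain N \<nu> where "open N" "t \<in> N" "dsys I \<mu> N \<nu>" by blast
    then show ?thesis using dsys_sides by metis
  qed
  define F where "F = {t \<in> Z. \<forall>i\<in>I. \<forall>j\<in>I. D t i = D t j}"
  have ZJ: "Z \<subseteq> J" and FZ: "F \<subseteq> Z" by (auto simp: Z_def F_def)
  have Zval: "X t t i = X t t j" if "t \<in> Z" "i \<in> I" "j \<in> I" for t i j
  proof -
    have tJ: "t \<in> J" and eq: "\<forall>i\<in>I. \<forall>j\<in>I. \<mu> t i = \<mu> t j" using that(1) unfolding Z_def by blast+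
    from iffD1[OF allsame[OF Xt[OF tJ]] eq] that(2,3) show ?thesis by blast
  qed
  \<comment> \<open>Two branches with equal values and different derivatives separate at once, so
    near \<open>t\<close> the values do not all coincide.\<close>
  have isolated: "\<exists>e>0. \<forall>s. s \<noteq> t \<and> \<bar>s - t\<bar> < e \<longrightarrow> s \<in> J - Z" if t: "t \<in> Z - F" for t
  proof -
    have tJ: "t \<in> J" using t ZJ by blast
    obtain i j where ij: "i \<in> I" "j \<in> I" "D t i \<noteq> D t j" using t by (auto simp: F_def)
    have "\<not> (\<exists>\<^sub>F s in at t. X t s i - X t s j = 0)"
    proof
      assume "\<exists>\<^sub>F s in at t. X t s i - X t s j = 0"
      from frequently_zero_DERIV(2)[OF DERIV_diff[OF D[OF tJ ij(1)] D[OF tJ ij(2)]] this] ij(3) show False by simp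
    qed
    then have "\<forall>\<^sub>F s in at t. X t s i \<noteq> X t s j" by (simp add: frequently_def)
    moreover have "\<forall>\<^sub>F s in at t. rearr I (\<mu> s) (X t s)" using X[OF tJ] by (simp add: eventually_at_filter eventually_mono)
    moreover have "\<forall>\<^sub>F s in at t. s \<in> J" using eventually_nhds_in_open[OF J tJ] by (simp add: eventually_at_filter eventually_mono)
    ultimately have "\<forall>\<^sub>F s in at t. s \<in> J - Z"
    proof eventually_elim
      case (elim s)
      then show ?case using allsame[OF elim(2)] ij by (auto simp: Z_def)
    qed
    then show ?thesis unfolding eventually_at by (auto simp: dist_real_def)
  qed
  have sidesZF: "\<exists>e>0. (\<exists>\<nu>. dsys I \<mu> {t - e..t} \<nu>) \<and> (\<exists>\<nu>. dsys I \<mu> {t..t + e} \<nu>)" if t: "t \<in> Z - F" for t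
  proof -
    have tJ: "t \<in> J" and tZ: "t \<in> Z" using t ZJ by auto
    obtain e where e: "e > 0" "\<And>s. s \<noteq> t \<Longrightarrow> \<bar>s - t\<bar> < e \<Longrightarrow> s \<in> J - Z" using isolated[OF t] by blast
    obtain \<nu> where \<nu>: "dsys I \<mu> (J - Z) \<nu>"
      using dsys_open[OF I Zc, of \<mu>] loc sidesJZ by blast
    obtain m where m: "\<And>i. i \<in> I \<Longrightarrow> X t t i = m"
      using Zval[OF tZ] by metis
    have "dsys I \<mu> (insert t {t - e / 2..<t}) (\<lambda>s. if s = t then (\<lambda>_. m) else \<nu> s)"
      by (rule dsys_close_endpoint[OF I \<nu> _ _ Zc _ _ X[OF tJ] D[OF tJ] m]) (use e in auto)
    moreover have "insert t {t - e / 2..<t} = {t - e / 2..t}" using e by auto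
    moreover have "dsys I \<mu> (insert t {t<..t + e / 2}) (\<lambda>s. if s = t then (\<lambda>_. m) else \<nu> s)"
      by (rule dsys_close_endpoint[OF I \<nu> _ _ Zc _ _ X[OF tJ] D[OF tJ] m]) (use e in auto)
    moreover have "insert t {t<..t + e / 2} = {t..t + e / 2}" using e by auto
    ultimately show ?thesis using e(1) by (intro exI[of _ "e / 2"]) auto
  qed
  have JF: "open (J - F)"
    unfolding open_subopen[of "J - F"]
  proof
    fix t assume t: "t \<in> J - F"
    show "\<exists>T. open T \<and> t \<in> T \<and> T \<subseteq> J - F"
    proof (cases "t \<in> Z")
      case False
      then show ?thesis using t Zc FZ by (intro exI[of _ "J - Z"]) auto
    next
      case True
      obtain e where e: "e > 0" "\<And>s. s \<noteq> t \<Longrightarrow> \<bar>s - t\<bar> < e \<Longrightarrow> s \<in> J - Z" using isolated[of t] t True by blast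
      have "ball t e \<subseteq> J - F"
      proof
        fix s assume "s \<in> ball t e"
        then show "s \<in> J - F" using e(2)[of s] t FZ by (cases "s = t") (auto simp: dist_real_def abs_minus_commute)
      qed
      then show ?thesis using e(1) by (intro exI[of _ "ball t e"]) auto
    qed
  qed
  obtain \<nu> where \<nu>: "dsys I \<mu> (J - F) \<nu>"
  proof -
    have "\<exists>\<nu>. dsys I \<mu> (J - F) \<nu>"
    proof (rule dsys_open[OF I JF])
      fix t assume t: "t \<in> J - F"
      then show "locdiff I \<mu> t" by (intro loc) auto
      show "\<exists>e>0. (\<exists>\<nu>. dsys I \<mu> {t - e..t} \<nu>) \<and> (\<exists>\<nu>. dsys I \<mu> {t..t + e} \<nu>)"
        using t sidesJZ[of t] sidesZF[of t] by (cases "t \<in> Z") auto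
    qed
    then show thesis using that by blast
  qed
  \<comment> \<open>On \<open>F\<close> all values are equal, and the quotients of any arrangement
    are squeezed towards the common derivative \<open>D s i\<close>; so \<open>n\<close> is
    differentiable there although \<open>\<nu>\<close> was built on the complement.\<close>
  define n where "n s = (if s \<in> F then \<mu> s else \<nu> s)" for s
  have rn: "rearr I (\<mu> s) (n s)" if "s \<in> J" for s
    using that dsys_rearr[OF \<nu>, of s] by (auto simp: n_def)
  have "dsys I \<mu> J n"
    unfolding dsys_def
  proof (intro ballI conjI)
    fix s assume s: "s \<in> J"
    show "rearr I (\<mu> s) (n s)" by (rule rn[OF s])
    fix i assume i: "i \<in> I"
    show "\<exists>d. ((\<lambda>s. n s i) has_real_derivative d) (at s within J)"
    proof (cases "s \<in> F")
      case False
      then have sF: "s \<in> J - F" using s by blast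
      obtain d where "((\<lambda>s. \<nu> s i) has_real_derivative d) (at s within (J - F))"
        using dsys_DERIV[OF \<nu> sF i] by blast
      then have "((\<lambda>s. \<nu> s i) has_real_derivative d) (at s)" using at_within_open[OF sF JF] by simp
      then have "((\<lambda>s. n s i) has_real_derivative d) (at s)"
      proof (rule DERIV_eventually_eq)
        show "\<forall>\<^sub>F x in nhds s. \<nu> x i = n x i"
          using eventually_nhds_in_open[OF JF sF] by eventually_elim (simp add: n_def)
      qed
      then show ?thesis using DERIV_subset by blast
    next
      case True
      have sZ: "s \<in> Z" using True FZ by blast
      have ev: "\<forall>\<^sub>F x in at s within J. rearr I (n x) (X s x)"
      proof -
        have "\<forall>\<^sub>F x in at s within J. rearr I (\<mu> x) (X s x)" using X[OF s] by (simp add: eventually_at_filter eventually_mono)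
        moreover have "\<forall>\<^sub>F x in at s within J. x \<in> J" by (simp add: eventually_at_filter)
        ultimately show ?thesis by eventually_elim (rule rearr_trans[OF rearr_sym[OF rn]])
      qed
      define m where "m = X s s i"
      have m: "X s s j = m" if "j \<in> I" for j using Zval[OF sZ that i] by (simp add: m_def)
      have nm: "n s i = m"
      proof -
        have "n s i \<in> X s s ` I" using rearr_image[OF rearr_trans[OF rearr_sym[OF rn[OF s]] Xt[OF s]] I] i by blast
        then show ?thesis using m by auto
      qed
      have Dc: "D s j = D s i" if "j \<in> I" for j using True that i unfolding F_def by blast
      have "((\<lambda>x. (n x i - n s i) / (x - s)) \<longlongrightarrow> D s i) (at s within J)"
      proof (rule tendstoI)
        fix e :: real assume e: "e > 0"
        have "\<forall>\<^sub>F x in at s within J. \<exists>b\<in>D s ` I. \<bar>(n x i - m) / (x - s) - b\<bar> < e"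
          by (rule quotient_in_image[OF I ev D[OF s] m i e])
        then show "\<forall>\<^sub>F x in at s within J. dist ((n x i - n s i) / (x - s)) (D s i) < e"
        proof eventually_elim
          case (elim x)
          then obtain j where j: "j \<in> I" "\<bar>(n x i - m) / (x - s) - D s j\<bar> < e" by blast
          then show ?case unfolding Dc[OF j(1)] dist_real_def nm by blast
        qed
      qed
      then show ?thesis unfolding has_field_derivative_iff by blast
    qed
  qed
  then show ?case by blast
qed

section \<open>Curves in difference-convex families\<close>

lemma convex_three_points:
  fixes g :: "real \<Rightarrow> real"
  assumes g: "convex_on J g" and J: "x \<in> J" "z \<in> J" and xyz: "x \<le> y" "y \<le> z" "x < z"
  shows "(z - x) * g y \<le> (z - y) * g x + (y - x) * g z"
proof -
  define l where "l = (y - x) / (z - x)"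
  have l: "0 \<le> l" "l \<le> 1" using xyz by (auto simp: l_def divide_simps)
  have l1: "(z - x) * l = y - x" using xyz by (simp add: l_def)
  have "(1 - l) *\<^sub>R x + l *\<^sub>R z = x + (z - x) * l" by (simp add: algebra_simps)
  then have e: "(1 - l) *\<^sub>R x + l *\<^sub>R z = y" unfolding l1 by simp
  have "g y \<le> (1 - l) * g x + l * g z"
    using convex_onD[OF g l J] by (simp only: e)
  then have "(z - x) * g y \<le> (z - x) * ((1 - l) * g x + l * g z)"
    using xyz by (intro mult_left_mono) auto
  also have "\<dots> = ((z - x) - (z - x) * l) * g x + ((z - x) * l) * g z" by (simp add: algebra_simps)
  finally show ?thesis unfolding l1 by (simp add: algebra_simps)
qed

definition dquot :: "(real \<Rightarrow> real) \<Rightarrow> real \<Rightarrow> real \<Rightarrow> real" where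
  "dquot g e x = (g (x + e) - g x) / e"

lemma dquot_mono_step:
  assumes g: "convex_on J g" and J: "x \<in> J" "x + e \<in> J" and e: "0 < e'" "e' \<le> e"
  shows "dquot g e' x \<le> dquot g e x"
proof -
  have "e * g (x + e') \<le> (e - e') * g x + e' * g (x + e)"
    using convex_three_points[OF g J, of "x + e'"] e by (simp add: algebra_simps)
  then show ?thesis using e by (simp add: dquot_def field_simps)
qed

text \<open>Adding the chord inequalities at the two inner points \<open>x + e\<close> and
  \<open>y\<close> gives \<open>g (x + e) + g y \<le> g x + g (y + e)\<close>, whatever the order of
  the inner points.\<close>

lemma dquot_mono:
  assumes g: "convex_on J g" and J: "x \<in> J" "y + e \<in> J" and e: "0 < e" and xy: "x \<le> y"
  shows "dquot g e x \<le> dquot g e y"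
proof -
  let ?L = "y + e - x"
  have "?L * g (x + e) \<le> (y - x) * g x + e * g (y + e)"
    using convex_three_points[OF g J, of "x + e"] e xy by (simp add: algebra_simps)
  moreover have "?L * g y \<le> e * g x + (y - x) * g (y + e)"
    using convex_three_points[OF g J, of y] e xy by (simp add: algebra_simps)
  ultimately have "?L * (g (x + e) + g y) \<le> ?L * (g x + g (y + e))" by (simp add: algebra_simps)
  then have "g (x + e) + g y \<le> g x + g (y + e)" using e xy by (simp add: mult_le_cancel_left)
  then show ?thesis using e by (simp add: dquot_def divide_right_mono)
qed

text \<open>The room \<open>\<delta>\<close> on both sides bounds the quotient by the slopes of the
  chords of length \<open>\<delta>\<close> to the right and to the left of \<open>x\<close>.\<close>

lemma dquot_bounds:
  assumes g: "convex_on {\<alpha> - \<delta>..\<beta> + \<delta>} g" and M: "\<And>y. y \<in> {\<alpha> - \<delta>..\<beta> + \<delta>} \<Longrightarrow> \<bar>g y\<bar> \<le> M"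
    and x: "\<alpha> \<le> x" "x \<le> \<beta>" and e: "0 < e" "e \<le> \<delta>"
  shows "\<bar>dquot g e x\<bar> \<le> 2 * M / \<delta>"
proof -
  have d: "\<delta> > 0" using e by simp
  have "dquot g e x \<le> dquot g \<delta> x"
    by (rule dquot_mono_step[OF g]) (use x e in auto)
  also have "\<dots> \<le> 2 * M / \<delta>"
    using M[of "x + \<delta>"] M[of x] x d unfolding dquot_def by (intro divide_right_mono) (auto simp: abs_le_iff)
  finally have u: "dquot g e x \<le> 2 * M / \<delta>" .
  have "(\<delta> + e) * g x \<le> e * g (x - \<delta>) + \<delta> * g (x + e)"
    using convex_three_points[OF g, of "x - \<delta>" "x + e" x] x e by (simp add: algebra_simps)
  then have "(g x - g (x - \<delta>)) / \<delta> \<le> dquot g e x"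
    using d e by (simp add: dquot_def field_simps)
  moreover have "- (2 * M / \<delta>) \<le> (g x - g (x - \<delta>)) / \<delta>"
  proof -
    have "- (2 * M) / \<delta> \<le> (g x - g (x - \<delta>)) / \<delta>"
      using M[of "x - \<delta>"] M[of x] x d by (intro divide_right_mono) (auto simp: abs_le_iff)
    then show ?thesis by simp
  qed
  ultimately show ?thesis using u by linarith
qed

text \<open>The right derivatives of \<open>g\<close> and \<open>h\<close> are monotone and, by the
  room \<open>\<delta>\<close>, bounded by \<open>2 * M / \<delta>\<close>. Their difference is
  \<open>\<phi>'\<close>, which gives the first bound; the increments of their sum dominate those of
  \<open>\<phi>'\<close>, which gives the second.\<close>

lemma dc_derivative_bounds:
  fixes \<phi> \<phi>' B :: "real \<Rightarrow> real"
  assumes ab: "\<alpha> < \<beta>" and \<delta>: "\<delta> > 0"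
    and g: "convex_on {\<alpha> - \<delta>..\<beta> + \<delta>} g" "\<And>y. y \<in> {\<alpha> - \<delta>..\<beta> + \<delta>} \<Longrightarrow> \<bar>g y\<bar> \<le> M"
    and h: "convex_on {\<alpha> - \<delta>..\<beta> + \<delta>} h" "\<And>y. y \<in> {\<alpha> - \<delta>..\<beta> + \<delta>} \<Longrightarrow> \<bar>h y\<bar> \<le> M"
    and \<phi>: "\<And>y. y \<in> {\<alpha>..\<beta>} \<Longrightarrow> \<phi> y = g y - h y"
    and d: "\<And>x. x \<in> {\<alpha>..\<beta>} \<Longrightarrow> (\<phi> has_vector_derivative \<phi>' x) (at x within {\<alpha>..\<beta>})"
    and c: "continuous_on {\<alpha>..\<beta>} \<phi>'"
    and B: "B absolutely_integrable_on {\<alpha>..\<beta>}"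
      "\<And>s t. \<alpha> \<le> s \<Longrightarrow> s \<le> t \<Longrightarrow> t \<le> \<beta> \<Longrightarrow> integral {s..t} B = \<phi>' t - \<phi>' s"
  shows "x \<in> {\<alpha>..\<beta>} \<Longrightarrow> \<bar>\<phi>' x\<bar> \<le> 4 * M / \<delta>"
    and "integral {\<alpha>..\<beta>} (\<lambda>x. \<bar>B x\<bar>) \<le> 8 * M / \<delta>"
proof -
  \<comment> \<open>Step lengths are at most \<open>\<delta>\<close>, to stay in the domain of
    \<open>g\<close> and \<open>h\<close>, and at most \<open>\<beta> - \<alpha>\<close>, so that
    the points \<open>r n\<close> below stay in the interval.\<close>
  define m where "m = min \<delta> (\<beta> - \<alpha>)"
  define e where "e n = m / real (Suc n)" for n
  have m: "m > 0" using ab \<delta> by (simp add: m_def)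
  have e: "0 < e n" "e n \<le> \<delta>" "e (Suc n) \<le> e n" for n
  proof -
    show "0 < e n" using m by (simp add: e_def)
    have "e n \<le> m / 1" unfolding e_def by (rule divide_left_mono) (use m in auto)
    then show "e n \<le> \<delta>" by (simp add: m_def)
    show "e (Suc n) \<le> e n" unfolding e_def by (rule divide_left_mono) (use m in auto)
  qed
  have e0: "e \<longlonglongrightarrow> 0"
  proof -
    have "(\<lambda>n. m * (1 / real (Suc n))) \<longlonglongrightarrow> m * 0" by (intro tendsto_intros LIMSEQ_Suc lim_1_over_n)
    then show ?thesis by (simp add: e_def[abs_def])
  qed
  let ?J = "{\<alpha> - \<delta>..\<beta> + \<delta>}"
  have inJ: "x \<in> ?J" "x + e n \<in> ?J" if "\<alpha> \<le> x" "x \<le> \<beta>" for x n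
    using that e[of n] \<delta> by auto
  have conv: "\<exists>l. (\<lambda>n. dquot f (e n) x) \<longlonglongrightarrow> l"
    if f: "convex_on ?J f" "\<And>y. y \<in> ?J \<Longrightarrow> \<bar>f y\<bar> \<le> M" and x: "\<alpha> \<le> x" "x \<le> \<beta>" for f x
  proof -
    have "decseq (\<lambda>n. dquot f (e n) x)"
      unfolding decseq_Suc_iff by (intro allI dquot_mono_step[OF f(1)] inJ x e)
    moreover have "- (2 * M / \<delta>) \<le> dquot f (e n) x" for n
      using dquot_bounds[OF f x e(1,2)[of n]] by linarith
    ultimately show ?thesis using decseq_convergent[of "\<lambda>n. dquot f (e n) x"] by metis
  qed
  define \<gamma> where "\<gamma> x = lim (\<lambda>n. dquot g (e n) x)" for x
  define \<eta> where "\<eta> x = lim (\<lambda>n. dquot h (e n) x)" for x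
  have \<gamma>: "(\<lambda>n. dquot g (e n) x) \<longlonglongrightarrow> \<gamma> x" and \<eta>: "(\<lambda>n. dquot h (e n) x) \<longlonglongrightarrow> \<eta> x" if "\<alpha> \<le> x" "x \<le> \<beta>" for x
    unfolding \<gamma>_def \<eta>_def using conv[OF g that] conv[OF h that] by (auto simp: convergent_def intro!: convergent_LIMSEQ_iff[THEN iffD1])
  have mono: "\<gamma> x \<le> \<gamma> y \<and> \<eta> x \<le> \<eta> y" if "\<alpha> \<le> x" "x \<le> y" "y \<le> \<beta>" for x y
  proof
    show "\<gamma> x \<le> \<gamma> y"
      by (rule LIMSEQ_le[OF \<gamma> \<gamma>]) (use that dquot_mono[OF g(1) inJ(1) inJ(2) e(1)] in auto)
    show "\<eta> x \<le> \<eta> y"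
      by (rule LIMSEQ_le[OF \<eta> \<eta>]) (use that dquot_mono[OF h(1) inJ(1) inJ(2) e(1)] in auto)
  qed
  have bnd: "\<bar>\<gamma> x\<bar> \<le> 2 * M / \<delta> \<and> \<bar>\<eta> x\<bar> \<le> 2 * M / \<delta>" if "\<alpha> \<le> x" "x \<le> \<beta>" for x
  proof
    show "\<bar>\<gamma> x\<bar> \<le> 2 * M / \<delta>"
      by (rule LIMSEQ_le_const2[OF tendsto_rabs[OF \<gamma>[OF that]]]) (use dquot_bounds[OF g that e(1,2)] in auto)
    show "\<bar>\<eta> x\<bar> \<le> 2 * M / \<delta>"
      by (rule LIMSEQ_le_const2[OF tendsto_rabs[OF \<eta>[OF that]]]) (use dquot_bounds[OF h that e(1,2)] in auto)
  qed
  have der: "\<phi>' x = \<gamma> x - \<eta> x" if x: "\<alpha> \<le> x" "x < \<beta>" for x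
  proof -
    have xx: "\<alpha> \<le> x" "x \<le> \<beta>" using x by auto
    have ev: "\<forall>\<^sub>F n in sequentially. x + e n \<le> \<beta>"
    proof -
      have "\<forall>\<^sub>F n in sequentially. e n < \<beta> - x" using order_tendstoD(2)[OF e0, of "\<beta> - x"] x by simp
      then show ?thesis by eventually_elim simp
    qed
    have "((\<lambda>s. (1 / (s - x)) *\<^sub>R (\<phi> s - \<phi> x)) \<longlongrightarrow> \<phi>' x) (at x within {\<alpha>..\<beta>})"
      using d[of x] x by (simp only: has_vector_derivative_iff_quotient[symmetric] atLeastAtMost_iff) simp
    moreover have "filterlim (\<lambda>n. x + e n) (at x within {\<alpha>..\<beta>}) sequentially"
      unfolding filterlim_at
    proof (intro conjI)
      show "(\<lambda>n. x + e n) \<longlonglongrightarrow> x" using tendsto_add[OF tendsto_const e0, of x] by simp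
      show "\<forall>\<^sub>F n in sequentially. x + e n \<in> {\<alpha>..\<beta>} \<and> x + e n \<noteq> x"
        using ev by eventually_elim (use x e(1) in \<open>auto simp: add_increasing2 less_imp_le less_imp_neq[symmetric]\<close>)
    qed
    ultimately have "(\<lambda>n. (1 / (x + e n - x)) *\<^sub>R (\<phi> (x + e n) - \<phi> x)) \<longlonglongrightarrow> \<phi>' x"
      by (rule filterlim_compose)
    moreover have "\<forall>\<^sub>F n in sequentially. (1 / (x + e n - x)) *\<^sub>R (\<phi> (x + e n) - \<phi> x) = dquot g (e n) x - dquot h (e n) x"
      using ev
    proof eventually_elim
      case (elim n)
      have "\<phi> (x + e n) = g (x + e n) - h (x + e n)" "\<phi> x = g x - h x"
        using elim x e(1)[of n] by (auto intro!: \<phi>)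
      then show ?case by (simp add: dquot_def diff_divide_distrib)
    qed
    ultimately have "(\<lambda>n. dquot g (e n) x - dquot h (e n) x) \<longlonglongrightarrow> \<phi>' x"
      by (rule Lim_transform_eventually)
    then show ?thesis
      using LIMSEQ_unique[OF _ tendsto_diff[OF \<gamma>[OF xx] \<eta>[OF xx]]] by blast
  qed
  define r where "r n = \<beta> - e n" for n
  have r: "r n < \<beta>" "\<alpha> \<le> r n" for n
  proof -
    show "r n < \<beta>" using e(1)[of n] by (simp add: r_def)
    have "e n \<le> m / 1" unfolding e_def by (rule divide_left_mono) (use m in auto)
    then show "\<alpha> \<le> r n" by (simp add: r_def m_def)
  qed
  \<comment> \<open>\<open>\<phi>\<close> is related to \<open>g\<close> and \<open>h\<close> on
    \<open>{\<alpha>..\<beta>}\<close> only, so no right quotient is available at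
    \<open>\<beta>\<close>; this end is reached by continuity of \<open>\<phi>'\<close>.\<close>
  have rl: "(\<lambda>n. \<phi>' (r n)) \<longlonglongrightarrow> \<phi>' \<beta>"
  proof (rule continuous_on_tendsto_compose[OF c])
    show "r \<longlonglongrightarrow> \<beta>" unfolding r_def using tendsto_diff[OF tendsto_const e0, of \<beta>] by simp
    show "\<forall>\<^sub>F n in sequentially. r n \<in> {\<alpha>..\<beta>}" using r by (intro always_eventually) (auto intro: less_imp_le)
  qed (use ab in auto)
  have b1: "\<bar>\<phi>' x\<bar> \<le> 4 * M / \<delta>" if "\<alpha> \<le> x" "x < \<beta>" for x
    using bnd[of x] der[of x] that by (auto simp: abs_le_iff)
  show "\<bar>\<phi>' x\<bar> \<le> 4 * M / \<delta>" if "x \<in> {\<alpha>..\<beta>}"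
  proof (cases "x = \<beta>")
    case True
    have "\<bar>\<phi>' \<beta>\<bar> \<le> 4 * M / \<delta>"
      by (rule LIMSEQ_le_const2[OF tendsto_rabs[OF rl]]) (use b1 r in auto)
    then show ?thesis using True by simp
  qed (use that b1 in auto)
  \<comment> \<open>At the right end the value is the upper bound of
    \<open>\<gamma> + \<eta>\<close>, which keeps increments up to \<open>\<beta>\<close>
    dominated.\<close>
  define \<Phi> where "\<Phi> x = (if x < \<beta> then \<gamma> x + \<eta> x else 4 * M / \<delta>)" for x
  have \<Phi>le: "\<Phi> x \<le> 4 * M / \<delta>" "- (4 * M / \<delta>) \<le> \<Phi> x" if "\<alpha> \<le> x" "x \<le> \<beta>" for x
  proof -
    have M0: "0 \<le> 2 * M / \<delta>" using bnd[of \<alpha>] ab by linarith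
    show "\<Phi> x \<le> 4 * M / \<delta>" "- (4 * M / \<delta>) \<le> \<Phi> x"
      unfolding \<Phi>_def using bnd[OF that] M0 by (auto simp: abs_le_iff)
  qed
  have inc: "\<bar>\<phi>' t - \<phi>' s\<bar> \<le> \<Phi> t - \<Phi> s" if st: "\<alpha> \<le> s" "s \<le> t" "t < \<beta>" for s t
    using der[of s] der[of t] mono[of s t] st by (auto simp: \<Phi>_def abs_le_iff)
  have inc': "\<bar>\<phi>' t - \<phi>' s\<bar> \<le> \<Phi> t - \<Phi> s" if st: "\<alpha> \<le> s" "s \<le> t" "t \<le> \<beta>" for s t
  proof (cases "t < \<beta>")
    case False
    then have t: "t = \<beta>" using st by simp
    show ?thesis
    proof (cases "s = \<beta>")
      case False
      then have s: "s < \<beta>" using st t by simp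
      have "\<bar>\<phi>' \<beta> - \<phi>' s\<bar> \<le> \<Phi> \<beta> - \<Phi> s"
      proof (rule LIMSEQ_le_const2[OF tendsto_rabs[OF tendsto_diff[OF rl tendsto_const]]])
        have "\<forall>\<^sub>F n in sequentially. e n < \<beta> - s" using order_tendstoD(2)[OF e0, of "\<beta> - s"] s by simp
        then obtain N where N: "\<And>n. n \<ge> N \<Longrightarrow> e n < \<beta> - s" by (auto simp: eventually_sequentially)
        have "\<bar>\<phi>' (r n) - \<phi>' s\<bar> \<le> \<Phi> \<beta> - \<Phi> s" if "n \<ge> N" for n
        proof -
          have "\<bar>\<phi>' (r n) - \<phi>' s\<bar> \<le> \<Phi> (r n) - \<Phi> s"
            using N[OF that] r[of n] st by (intro inc) (auto simp: r_def)
          also have "\<Phi> (r n) \<le> \<Phi> \<beta>" using \<Phi>le(1)[of "r n"] r[of n] by (simp add: \<Phi>_def)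
          finally show ?thesis by simp
        qed
        then show "\<exists>N. \<forall>n\<ge>N. \<bar>\<phi>' (r n) - \<phi>' s\<bar> \<le> \<Phi> \<beta> - \<Phi> s" by blast
      qed
      then show ?thesis using t by simp
    qed (use t in simp)
  qed (use inc st in auto)
  have "integral {\<alpha>..\<beta>} (\<lambda>x. norm (B x)) \<le> \<Phi> \<beta> - \<Phi> \<alpha>"
    by (rule integral_norm_le_variation[OF B(1) less_imp_le[OF ab]]) (use B(2) inc' in auto)
  also have "\<dots> \<le> 8 * M / \<delta>"
    using \<Phi>le(1)[of \<beta>] \<Phi>le(2)[of \<alpha>] ab by simp
  finally show "integral {\<alpha>..\<beta>} (\<lambda>x. \<bar>B x\<bar>) \<le> 8 * M / \<delta>" by simp
qed

section \<open>Sobolev curves and uniform difference-convex bounds\<close>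

lemma W21_open_classical:
  fixes f :: "real \<Rightarrow> 'b::euclidean_space"
  assumes pq: "p < q" and c: "continuous_on {p<..<q} f" and W: "W21 {p<..<q} f"
  obtains f' g where "g absolutely_integrable_on {p..q}"
    "\<And>t. t \<in> {p<..<q} \<Longrightarrow> (f has_vector_derivative f' t) (at t)"
    "continuous_on {p..q} f'"
    "\<And>s t. p \<le> s \<Longrightarrow> s \<le> t \<Longrightarrow> t \<le> q \<Longrightarrow> integral {s..t} g = f' t - f' s"
proof -
  obtain g where g: "g absolutely_integrable_on {p<..<q}" and w: "has_weak_derivative 2 {p<..<q} f g"
    using W unfolding W21_def by blast
  have g': "g absolutely_integrable_on {p..q}"
    using g absolutely_integrable_on_open_interval[where f = g and a = p and b = q] by (simp add: cbox_interval box_real)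
  obtain k where k: "\<And>t. t \<in> {p<..<q} \<Longrightarrow> (f has_vector_derivative (k + integral {p..t} g)) (at t)"
    using weak_imp_classical[OF pq c w g'] by blast
  have gi: "g integrable_on {p..q}" by (rule set_lebesgue_integral_eq_integral(1)[OF g'])
  show ?thesis
  proof (rule that[OF g' k])
    show "continuous_on {p..q} (\<lambda>t. k + integral {p..t} g)"
      by (intro continuous_intros indefinite_integral_continuous_1 gi)
    fix s t assume st: "p \<le> s" "s \<le> t" "t \<le> q"
    have "g integrable_on {p..t}" by (rule integrable_on_subinterval[OF gi]) (use st in auto)
    then have "integral {p..s} g + integral {s..t} g = integral {p..t} g"
      by (rule Henstock_Kurzweil_Integration.integral_combine[rotated 2]) (use st in auto)
    then show "integral {s..t} g = k + integral {p..t} g - (k + integral {p..s} g)"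
      by (simp add: algebra_simps)
  qed
qed

text \<open>The derivative from \<open>W21_open_classical\<close> agrees with the given
  \<open>f'\<close> inside the interval, and by continuity also at the ends.\<close>

lemma C1_W21_increments:
  fixes f f' :: "real \<Rightarrow> 'b::euclidean_space"
  assumes pq: "p < q" and W: "W21 {p<..<q} f"
    and d: "\<And>t. t \<in> {p..q} \<Longrightarrow> (f has_vector_derivative f' t) (at t within {p..q})"
    and c: "continuous_on {p..q} f'"
  obtains g where "g absolutely_integrable_on {p..q}"
    "\<And>s t. p \<le> s \<Longrightarrow> s \<le> t \<Longrightarrow> t \<le> q \<Longrightarrow> integral {s..t} g = f' t - f' s"
proof -
  have "continuous_on {p..q} f"
    using d has_vector_derivative_continuous continuous_on_eq_continuous_within by blast
  then have cf: "continuous_on {p<..<q} f" by (rule continuous_on_subset) auto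
  obtain h g where hg: "g absolutely_integrable_on {p..q}"
    "\<And>t. t \<in> {p<..<q} \<Longrightarrow> (f has_vector_derivative h t) (at t)"
    "continuous_on {p..q} h"
    "\<And>s t. p \<le> s \<Longrightarrow> s \<le> t \<Longrightarrow> t \<le> q \<Longrightarrow> integral {s..t} g = h t - h s"
    by (rule W21_open_classical[OF pq cf W]) (rule that; assumption)
  have i: "h t - f' t = 0" if "t \<in> {p<..<q}" for t
  proof -
    have "t \<in> {p..q}" using that by auto
    then have "(f has_vector_derivative f' t) (at t within {p..q})" by (rule d)
    then have "(f has_vector_derivative f' t) (at t)"
      using that at_within_interior[of t "{p..q}"] by simp
    then show ?thesis using vector_derivative_unique_at[OF hg(2)[OF that]] by simp
  qed
  have cl: "closure {p<..<q} = {p..q}" using pq by simp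
  have eq: "h t = f' t" if "t \<in> {p..q}" for t
  proof -
    have "(\<lambda>t. h t - f' t) t = 0"
      by (rule continuous_constant_on_closure[of "{p<..<q}"])
        (use cl that i in \<open>auto intro: continuous_on_diff[OF hg(3) c]\<close>)
    then show ?thesis by simp
  qed
  show ?thesis
  proof (rule that[OF hg(1)])
    fix s t assume "p \<le> s" "s \<le> t" "t \<le> q"
    then show "integral {s..t} g = f' t - f' s" using hg(4)[of s t] eq[of s] eq[of t] by simp
  qed
qed

text \<open>A Lebesgue number argument. Near each \<open>x\<close> in \<open>K\<close> a
  decomposition is bounded on a ball of twice the radius used for the cover, so a ball of the common
  radius \<open>\<rho>\<close> around a point of \<open>K\<close> stays inside one of the doubled
  balls. The decomposition itself varies with the point.\<close>

lemma locally_dc_uniform: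
  fixes f :: "'a::euclidean_space \<Rightarrow> real"
  assumes U: "open U" and K: "compact K" "K \<subseteq> U" and f: "locally_dc_fun_on U f"
  shows "\<exists>\<rho> M. 0 < \<rho> \<and> (\<forall>p\<in>K. \<exists>g h. convex_on (cball p \<rho>) g \<and> convex_on (cball p \<rho>) h \<and>
           (\<forall>x\<in>cball p \<rho>. f x = g x - h x \<and> \<bar>g x\<bar> \<le> M \<and> \<bar>h x\<bar> \<le> M))"
proof -
  define Q where "Q = (\<lambda>p \<rho> M. \<exists>g h. convex_on (cball p \<rho>) g \<and> convex_on (cball p \<rho>) h \<and>
           (\<forall>x\<in>cball p \<rho>. f x = g x - h x \<and> \<bar>g x\<bar> \<le> M \<and> \<bar>h x\<bar> \<le> M))"
  have Q_mono: "Q p \<rho> M" if "Q x (2 * \<rho>') M'" "dist x p < \<rho>'" "\<rho> \<le> \<rho>'" "M' \<le> M" for p x \<rho> \<rho>' M M'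
  proof -
    obtain g h where gh0: "convex_on (cball x (2 * \<rho>')) g \<and> convex_on (cball x (2 * \<rho>')) h \<and>
      (\<forall>y\<in>cball x (2 * \<rho>'). f y = g y - h y \<and> \<bar>g y\<bar> \<le> M' \<and> \<bar>h y\<bar> \<le> M')"
      using \<open>Q x (2 * \<rho>') M'\<close> unfolding Q_def by - (elim exE, rule that)
    note gh = gh0[THEN conjunct1] gh0[THEN conjunct2, THEN conjunct1] bspec[OF gh0[THEN conjunct2, THEN conjunct2]]
    have sub: "cball p \<rho> \<subseteq> cball x (2 * \<rho>')"
    proof
      fix y assume "y \<in> cball p \<rho>"
      then show "y \<in> cball x (2 * \<rho>')" using dist_triangle[of x y p] that(2,3) by simp
    qed
    show ?thesis unfolding Q_def
    proof (intro exI conjI ballI)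
      show "convex_on (cball p \<rho>) g" "convex_on (cball p \<rho>) h"
        using convex_on_subset[OF gh(1) sub] convex_on_subset[OF gh(2) sub] by simp_all
      fix y assume "y \<in> cball p \<rho>"
      then have "y \<in> cball x (2 * \<rho>')" using sub by blast
      from gh(3)[OF this] that(4) show "f y = g y - h y" "\<bar>g y\<bar> \<le> M" "\<bar>h y\<bar> \<le> M" by auto
    qed
  qed
  have ex: "\<exists>\<rho> M. 0 < \<rho> \<and> Q x (2 * \<rho>) M" if "x \<in> K" for x
  proof -
    have "x \<in> U" using that K by auto
    then obtain V T where V: "V \<subseteq> U" "convex V" "open T" "x \<in> T" "T \<inter> U \<subseteq> V" "dc_fun_on V f"
      using f unfolding locally_dc_fun_on_def by metis
    obtain g h where gh: "continuous_on V g" "convex_on V g" "continuous_on V h" "convex_on V h"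
      "\<And>y. y \<in> V \<Longrightarrow> f y = g y - h y"
      using V(6) unfolding dc_fun_on_def by auto
    have "open (T \<inter> U)" "x \<in> T \<inter> U" using V \<open>x \<in> U\<close> U by auto
    then obtain e where e: "0 < e" "cball x e \<subseteq> T \<inter> U" using open_contains_cball by blast
    then have eV: "cball x e \<subseteq> V" using V(5) by blast
    have bd: "\<exists>M. \<forall>y\<in>cball x e. \<bar>k y\<bar> \<le> M" if "continuous_on V k" for k :: "'a \<Rightarrow> real"
    proof -
      have "compact (k ` cball x e)"
        by (intro compact_continuous_image continuous_on_subset[OF that eV]) auto
      then have "bounded (k ` cball x e)" by (rule compact_imp_bounded)
      then show ?thesis by (auto simp: bounded_iff)
    qed
    obtain M1 M2 where M: "\<And>y. y \<in> cball x e \<Longrightarrow> \<bar>g y\<bar> \<le> M1" "\<And>y. y \<in> cball x e \<Longrightarrow> \<bar>h y\<bar> \<le> M2"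
      using bd[OF gh(1)] bd[OF gh(3)] by blast
    have "Q x (2 * (e / 2)) (max M1 M2)"
      unfolding Q_def
    proof (intro exI conjI ballI)
      show "convex_on (cball x (2 * (e/2))) g" "convex_on (cball x (2 * (e/2))) h"
        using convex_on_subset[OF gh(2) eV] convex_on_subset[OF gh(4) eV] by simp_all
      fix y assume "y \<in> cball x (2 * (e/2))"
      then have y: "y \<in> cball x e" by simp
      show "f y = g y - h y" using gh(5) y eV by blast
      show "\<bar>g y\<bar> \<le> max M1 M2" "\<bar>h y\<bar> \<le> max M1 M2" using M(1)[OF y] M(2)[OF y] by auto
    qed
    then show ?thesis using e(1) by (intro exI[of _ "e/2"] exI[of _ "max M1 M2"]) auto
  qed
  then obtain R N where RN: "\<And>x. x \<in> K \<Longrightarrow> 0 < R x \<and> Q x (2 * R x) (N x)" by metis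
  have "K \<subseteq> (\<Union>x\<in>K. ball x (R x))"
  proof
    fix x assume "x \<in> K"
    then show "x \<in> (\<Union>x\<in>K. ball x (R x))" using RN[of x] by (intro UN_I[of x]) auto
  qed
  then obtain C where C: "C \<subseteq> K" "finite C" "K \<subseteq> (\<Union>x\<in>C. ball x (R x))"
    using compactE_image[OF K(1), of K "\<lambda>x. ball x (R x)"] by (metis open_ball)
  define \<rho> where "\<rho> = Min (insert 1 (R ` C))"
  define M where "M = Max (insert 0 (N ` C))"
  have "0 < \<rho>" unfolding \<rho>_def using C RN by (subst Min_gr_iff) auto
  moreover have "Q p \<rho> M" if pK: "p \<in> K" for p
  proof -
    obtain x where x: "x \<in> C" "p \<in> ball x (R x)" using subsetD[OF C(3) pK] by blast
    show ?thesis
    proof (rule Q_mono)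
      show "Q x (2 * R x) (N x)" using RN x C by blast
      show "dist x p < R x" using x by simp
      show "\<rho> \<le> R x" unfolding \<rho>_def using C(2) x by (intro Min_le) auto
      show "N x \<le> M" unfolding M_def using C(2) x by (intro Max_ge) auto
    qed
  qed
  ultimately have "0 < \<rho> \<and> (\<forall>p\<in>K. Q p \<rho> M)" by simp
  then show ?thesis unfolding Q_def by (intro exI)
qed

lemma locally_DC_uniform:
  fixes A :: "'a::euclidean_space \<Rightarrow> 'b::euclidean_space"
  assumes U: "open U" and K: "compact K" "K \<subseteq> U" and A: "locally_DC_on U A"
  shows "\<exists>\<rho> M. 0 < \<rho> \<and> 0 \<le> M \<and> (\<forall>b\<in>Basis. \<forall>p\<in>K. \<exists>g h. convex_on (cball p \<rho>) g \<and> convex_on (cball p \<rho>) h \<and>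
           (\<forall>x\<in>cball p \<rho>. A x \<bullet> b = g x - h x \<and> \<bar>g x\<bar> \<le> M \<and> \<bar>h x\<bar> \<le> M))"
proof -
  have "\<exists>\<rho> M. 0 < \<rho> \<and> (\<forall>p\<in>K. \<exists>g h. convex_on (cball p \<rho>) g \<and> convex_on (cball p \<rho>) h \<and>
           (\<forall>x\<in>cball p \<rho>. A x \<bullet> b = g x - h x \<and> \<bar>g x\<bar> \<le> M \<and> \<bar>h x\<bar> \<le> M))" if "b \<in> Basis" for b
    using A that unfolding locally_DC_on_def by (intro locally_dc_uniform[OF U K]) blast
  then obtain R N where RN: "\<And>b. b \<in> Basis \<Longrightarrow> 0 < R b \<and> (\<forall>p\<in>K. \<exists>g h. convex_on (cball p (R b)) g \<and> convex_on (cball p (R b)) h \<and>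
           (\<forall>x\<in>cball p (R b). A x \<bullet> b = g x - h x \<and> \<bar>g x\<bar> \<le> N b \<and> \<bar>h x\<bar> \<le> N b))" by metis
  define \<rho> where "\<rho> = Min (insert 1 (R ` Basis))"
  define M where "M = Max (insert 0 (N ` Basis))"
  show ?thesis
  proof (rule exI[of _ \<rho>], rule exI[of _ M], intro conjI ballI)
    show "0 < \<rho>" unfolding \<rho>_def using RN by (subst Min_gr_iff) auto
    show "0 \<le> M" unfolding M_def by (intro Max_ge) auto
    fix b :: 'b and p assume b: "b \<in> Basis" and p: "p \<in> K"
    have \<rho>: "\<rho> \<le> R b" unfolding \<rho>_def using b by (intro Min_le) auto
    have M: "N b \<le> M" unfolding M_def using b by (intro Max_ge) auto
    obtain g h where gh0: "convex_on (cball p (R b)) g \<and> convex_on (cball p (R b)) h \<and>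
      (\<forall>x\<in>cball p (R b). A x \<bullet> b = g x - h x \<and> \<bar>g x\<bar> \<le> N b \<and> \<bar>h x\<bar> \<le> N b)"
      using bspec[OF conjunct2[OF RN[OF b]] p] by - (elim exE, rule that)
    note gh = gh0[THEN conjunct1] gh0[THEN conjunct2, THEN conjunct1] bspec[OF gh0[THEN conjunct2, THEN conjunct2]]
    have sub: "cball p \<rho> \<subseteq> cball p (R b)" using \<rho> by auto
    show "\<exists>g h. convex_on (cball p \<rho>) g \<and> convex_on (cball p \<rho>) h \<and>
           (\<forall>x\<in>cball p \<rho>. A x \<bullet> b = g x - h x \<and> \<bar>g x\<bar> \<le> M \<and> \<bar>h x\<bar> \<le> M)"
    proof (intro exI conjI ballI)
      show "convex_on (cball p \<rho>) g" "convex_on (cball p \<rho>) h"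
        using convex_on_subset[OF gh(1) sub] convex_on_subset[OF gh(2) sub] by simp_all
      fix y assume "y \<in> cball p \<rho>"
      then have "y \<in> cball p (R b)" using sub by blast
      from gh(3)[OF this] M show "A y \<bullet> b = g y - h y" "\<bar>g y\<bar> \<le> M" "\<bar>h y\<bar> \<le> M" by auto
    qed
  qed
qed

lemma convex_on_slice:
  fixes g :: "real \<times> 'r::euclidean_space \<Rightarrow> real"
  assumes g: "convex_on S g" and T: "convex T" and sub: "\<And>t. t \<in> T \<Longrightarrow> (t, r) \<in> S"
  shows "convex_on T (\<lambda>t. g (t, r))"
proof (rule convex_onI[OF _ T])
  fix l x y :: real assume l: "0 < l" "l < 1" and xy: "x \<in> T" "y \<in> T"
  have "((1 - l) *\<^sub>R x + l *\<^sub>R y, r) = (1 - l) *\<^sub>R (x, r) + l *\<^sub>R (y, r)"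
    by (simp add: algebra_simps)
  then show "g ((1 - l) *\<^sub>R x + l *\<^sub>R y, r) \<le> (1 - l) * g (x, r) + l * g (y, r)"
    using convex_onD[OF g _ _ sub[OF xy(1)] sub[OF xy(2)], of l] l by simp
qed

lemma integral_le_pieces:
  fixes f :: "real \<Rightarrow> real"
  assumes f: "f integrable_on {a..b}" and c: "0 \<le> c" and d: "0 < d"
    and p: "\<And>\<alpha> \<beta>. a \<le> \<alpha> \<Longrightarrow> \<alpha> < \<beta> \<Longrightarrow> \<beta> \<le> b \<Longrightarrow> \<beta> - \<alpha> \<le> d \<Longrightarrow> integral {\<alpha>..\<beta>} f \<le> c"
    and \<beta>: "a \<le> \<beta>" "\<beta> \<le> b" "\<beta> - a \<le> real n * d"
  shows "integral {a..\<beta>} f \<le> real n * c"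
  using \<beta>
proof (induction n arbitrary: \<beta>)
  case 0
  then show ?case by simp
next
  case (Suc n)
  show ?case
  proof (cases "\<beta> = a")
    case True
    then show ?thesis using c by simp
  next
    case False
    define \<alpha> where "\<alpha> = max a (\<beta> - d)"
    have \<alpha>: "a \<le> \<alpha>" "\<alpha> < \<beta>" "\<beta> - \<alpha> \<le> d" using False Suc.prems d by (auto simp: \<alpha>_def)
    have "\<alpha> - a \<le> real n * d"
    proof (cases "a \<le> \<beta> - d")
      case True
      then show ?thesis using Suc.prems(3) by (simp add: \<alpha>_def algebra_simps)
    next
      case False
      then show ?thesis using d by (simp add: \<alpha>_def)
    qed
    then have 1: "integral {a..\<alpha>} f \<le> real n * c" using \<alpha> Suc.prems by (intro Suc.IH) auto
    have 2: "integral {\<alpha>..\<beta>} f \<le> c" using \<alpha> Suc.prems by (intro p) auto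
    have "f integrable_on {a..\<beta>}" by (rule integrable_on_subinterval[OF f]) (use Suc.prems in auto)
    then have "integral {a..\<alpha>} f + integral {\<alpha>..\<beta>} f = integral {a..\<beta>} f"
      by (rule Henstock_Kurzweil_Integration.integral_combine[rotated 2]) (use \<alpha> in auto)
    then show ?thesis using 1 2 by (simp add: algebra_simps)
  qed
qed

text \<open>The constants are obtained before \<open>r\<close>, \<open>f'\<close> and
  \<open>B\<close>, hence the quantified form of the second conclusion: it bounds all slices at
  once. Each slice is treated on pieces of length at most \<open>\<delta>\<close>, on which a single
  decomposition of \<open>locally_DC_uniform\<close> is valid.\<close>

lemma locally_DC_curve_bounds:
  fixes A :: "real \<times> 'r::euclidean_space \<Rightarrow> 'b::euclidean_space"
  assumes U: "open U" and K: "compact ({a..b} \<times> R)" "{a..b} \<times> R \<subseteq> U" and A: "locally_DC_on U A"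
    and ab: "a < b"
  obtains N L V where "\<And>t r. t \<in> {a..b} \<Longrightarrow> r \<in> R \<Longrightarrow> norm (A (t, r)) \<le> N"
    "\<forall>f' B r. r \<in> R \<longrightarrow> (\<forall>t\<in>{a..b}. ((\<lambda>t. A (t, r)) has_vector_derivative f' t) (at t within {a..b}))
       \<longrightarrow> continuous_on {a..b} f' \<longrightarrow> B absolutely_integrable_on {a..b}
       \<longrightarrow> (\<forall>s t. a \<le> s \<longrightarrow> s \<le> t \<longrightarrow> t \<le> b \<longrightarrow> integral {s..t} B = f' t - f' s)
       \<longrightarrow> (\<forall>t\<in>{a..b}. norm (f' t) \<le> L) \<and> integral {a..b} (\<lambda>t. norm (B t)) \<le> V"
proof -
  let ?D = "real (card (Basis :: 'b set))"
  obtain \<rho> M where \<rho>: "0 < \<rho>" and M0: "0 \<le> M"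
    and DC: "\<forall>i\<in>Basis. \<forall>p\<in>{a..b} \<times> R. \<exists>g h. convex_on (cball p \<rho>) g \<and> convex_on (cball p \<rho>) h \<and>
           (\<forall>x\<in>cball p \<rho>. A x \<bullet> i = g x - h x \<and> \<bar>g x\<bar> \<le> M \<and> \<bar>h x\<bar> \<le> M)"
    using locally_DC_uniform[OF U K A] by blast
  \<comment> \<open>A piece of length at most \<open>\<delta>\<close>, enlarged by
    \<open>\<delta>\<close> on both sides, stays within distance
    \<open>2 * \<delta> = \<rho>\<close> of its left end \<open>(\<alpha>, r)\<close>.\<close>
  define \<delta> where "\<delta> = \<rho> / 2"
  have \<delta>: "\<delta> > 0" using \<rho> by (simp add: \<delta>_def)
  obtain n :: nat where n: "b - a \<le> real n * \<delta>"
    using reals_Archimedean3[OF \<delta>, of ] by (metis less_imp_le)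
  have N: "norm (A (t, r)) \<le> ?D * (2 * M)" if "t \<in> {a..b}" "r \<in> R" for t r
  proof -
    have "\<bar>A (t, r) \<bullet> i\<bar> \<le> 2 * M" if i: "i \<in> Basis" for i
    proof -
      obtain g h where "\<forall>x\<in>cball (t, r) \<rho>. A x \<bullet> i = g x - h x \<and> \<bar>g x\<bar> \<le> M \<and> \<bar>h x\<bar> \<le> M"
        using bspec[OF bspec[OF DC i] SigmaI[OF \<open>t \<in> {a..b}\<close> \<open>r \<in> R\<close>]] by - (elim exE conjE, rule that)
      from bspec[OF this, of "(t, r)"] \<rho> show ?thesis by auto
    qed
    then have "(\<Sum>i\<in>Basis. \<bar>A (t, r) \<bullet> i\<bar>) \<le> of_nat (card (Basis :: 'b set)) * (2 * M)"
      by (intro sum_bounded_above) auto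
    then show ?thesis using norm_le_l1[of "A (t, r)"] by simp
  qed
  show ?thesis
  proof (rule that[of "?D * (2 * M)" "?D * (4 * M / \<delta>)" "?D * (real n * (8 * M / \<delta>))"], fact N, intro allI impI)
    fix f' B r
    assume r: "r \<in> R" and d: "\<forall>t\<in>{a..b}. ((\<lambda>t. A (t, r)) has_vector_derivative f' t) (at t within {a..b})"
      and c: "continuous_on {a..b} f'" and B: "B absolutely_integrable_on {a..b}"
      and inc: "\<forall>s t. a \<le> s \<longrightarrow> s \<le> t \<longrightarrow> t \<le> b \<longrightarrow> integral {s..t} B = f' t - f' s"
    have Bi: "B integrable_on {a..b}" by (rule set_lebesgue_integral_eq_integral(1)[OF B])
    have piece: "(\<forall>x\<in>{\<alpha>..\<beta>}. \<bar>f' x \<bullet> i\<bar> \<le> 4 * M / \<delta>) \<and> integral {\<alpha>..\<beta>} (\<lambda>x. \<bar>B x \<bullet> i\<bar>) \<le> 8 * M / \<delta>"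
      if i: "i \<in> Basis" and \<alpha>: "a \<le> \<alpha>" "\<alpha> < \<beta>" "\<beta> \<le> b" "\<beta> - \<alpha> \<le> \<delta>" for i \<alpha> \<beta>
    proof -
      have "(\<alpha>, r) \<in> {a..b} \<times> R" using \<alpha> r by auto
      then obtain g h where g: "convex_on (cball (\<alpha>, r) \<rho>) g" and h: "convex_on (cball (\<alpha>, r) \<rho>) h"
        and gh: "\<forall>x\<in>cball (\<alpha>, r) \<rho>. A x \<bullet> i = g x - h x \<and> \<bar>g x\<bar> \<le> M \<and> \<bar>h x\<bar> \<le> M"
        by - (drule bspec[OF bspec[OF DC i]], elim exE conjE, rule that)
      let ?J = "{\<alpha> - \<delta>..\<beta> + \<delta>}"
      have J: "(t, r) \<in> cball (\<alpha>, r) \<rho>" if "t \<in> ?J" for t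
        using that \<alpha> by (auto simp: dist_Pair_Pair dist_real_def \<delta>_def)
      have sub: "{\<alpha>..\<beta>} \<subseteq> {a..b}" using \<alpha> by auto
      have a1: "((\<lambda>t. A (t, r) \<bullet> i) has_vector_derivative f' x \<bullet> i) (at x within {\<alpha>..\<beta>})" if "x \<in> {\<alpha>..\<beta>}" for x
        by (rule bounded_linear.has_vector_derivative[OF bounded_linear_inner_left])
          (rule has_vector_derivative_within_subset[OF bspec[OF d] sub], use that sub in blast)
      have a2: "continuous_on {\<alpha>..\<beta>} (\<lambda>x. f' x \<bullet> i)"
        by (intro continuous_intros continuous_on_subset[OF c sub])
      have a3: "(\<lambda>x. B x \<bullet> i) absolutely_integrable_on {\<alpha>..\<beta>}"
        by (rule absolutely_integrable_component[OF absolutely_integrable_on_subinterval[OF B sub]])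
      have a4: "integral {s..t} (\<lambda>x. B x \<bullet> i) = f' t \<bullet> i - f' s \<bullet> i" if "\<alpha> \<le> s" "s \<le> t" "t \<le> \<beta>" for s t
      proof -
        have "B integrable_on {s..t}" by (rule integrable_on_subinterval[OF Bi]) (use that \<alpha> in auto)
        then have "integral {s..t} (\<lambda>x. B x \<bullet> i) = integral {s..t} B \<bullet> i" by (rule integral_component_eq)
        then show ?thesis using inc[rule_format, of s t] that \<alpha> by (simp add: inner_diff_left)
      qed
      have ch: "convex_on ?J (\<lambda>t. g (t, r))" "convex_on ?J (\<lambda>t. h (t, r))"
        by (rule convex_on_slice[OF g _ J] convex_on_slice[OF h _ J]; simp)+
      have bd: "\<bar>g (t, r)\<bar> \<le> M" "\<bar>h (t, r)\<bar> \<le> M" if "t \<in> ?J" for t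
        using gh J[OF that] by blast+
      have eq: "A (t, r) \<bullet> i = g (t, r) - h (t, r)" if "t \<in> {\<alpha>..\<beta>}" for t
        using gh J[of t] that \<delta> by auto
      show ?thesis
        using dc_derivative_bounds[OF \<alpha>(2) \<delta> ch(1) bd(1) ch(2) bd(2) eq a1 a2 a3 a4] by blast
    qed
    have L: "norm (f' t) \<le> ?D * (4 * M / \<delta>)" if t: "t \<in> {a..b}" for t
    proof -
      have "\<exists>\<alpha> \<beta>. a \<le> \<alpha> \<and> \<alpha> < \<beta> \<and> \<beta> \<le> b \<and> \<beta> - \<alpha> \<le> \<delta> \<and> t \<in> {\<alpha>..\<beta>}"
      proof (cases "t < b")
        case True
        then show ?thesis using t \<delta> by (intro exI[of _ t] exI[of _ "min b (t + \<delta>)"]) auto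
      next
        case False
        then show ?thesis using t \<delta> ab by (intro exI[of _ "max a (b - \<delta>)"] exI[of _ b]) auto
      qed
      then obtain \<alpha> \<beta> where \<alpha>: "a \<le> \<alpha>" "\<alpha> < \<beta>" "\<beta> \<le> b" "\<beta> - \<alpha> \<le> \<delta>" "t \<in> {\<alpha>..\<beta>}" by blast
      have "(\<Sum>i\<in>Basis. \<bar>f' t \<bullet> i\<bar>) \<le> of_nat (card (Basis :: 'b set)) * (4 * M / \<delta>)"
        using piece[OF _ \<alpha>(1-4)] \<alpha>(5) by (intro sum_bounded_above) auto
      then show ?thesis using norm_le_l1[of "f' t"] by simp
    qed
    have Bc: "(\<lambda>x. \<bar>B x \<bullet> i\<bar>) integrable_on {a..b}" for i
      using absolutely_integrable_on_def[THEN iffD1, OF absolutely_integrable_component[OF B, of i]] by simp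
    have "integral {a..b} (\<lambda>x. \<bar>B x \<bullet> i\<bar>) \<le> real n * (8 * M / \<delta>)" if "i \<in> Basis" for i
      by (rule integral_le_pieces[OF Bc _ \<delta>]) (use piece[OF that] M0 \<delta> n ab in auto)
    then have "(\<Sum>i\<in>Basis. integral {a..b} (\<lambda>x. \<bar>B x \<bullet> i\<bar>)) \<le> of_nat (card (Basis :: 'b set)) * (real n * (8 * M / \<delta>))"
      by (intro sum_bounded_above) auto
    moreover have "integral {a..b} (\<lambda>t. norm (B t)) \<le> (\<Sum>i\<in>Basis. integral {a..b} (\<lambda>x. \<bar>B x \<bullet> i\<bar>))"
    proof -
      have "integral {a..b} (\<lambda>t. norm (B t)) \<le> integral {a..b} (\<lambda>x. \<Sum>i\<in>Basis. \<bar>B x \<bullet> i\<bar>)"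
        using absolutely_integrable_on_def[THEN iffD1, OF B]
        by (intro integral_le integrable_sum Bc norm_le_l1) auto
      also have "\<dots> = (\<Sum>i\<in>Basis. integral {a..b} (\<lambda>x. \<bar>B x \<bullet> i\<bar>))"
        by (rule integral_sum) (simp_all add: Bc)
      finally show ?thesis .
    qed
    ultimately show "(\<forall>t\<in>{a..b}. norm (f' t) \<le> ?D * (4 * M / \<delta>)) \<and>
        integral {a..b} (\<lambda>t. norm (B t)) \<le> ?D * (real n * (8 * M / \<delta>))"
      using L by auto
  qed
qed

section \<open>Eigenvalues of difference-convex curves\<close>

lemma cube_Icc: "cube {a..b} = cbox (\<chi> i. a) (\<chi> i. b)"
  and cube_Ioo: "cube {a<..<b} = box (\<chi> i. a) (\<chi> i. b)"
  by (auto simp: cube_def mem_box_cart)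

lemma norm_le_card:
  fixes x :: "real ^ 'n"
  assumes "\<And>i. \<bar>x $ i\<bar> \<le> c"
  shows "norm x \<le> real CARD('n) * c"
proof -
  have "(\<Sum>i\<in>UNIV. \<bar>x $ i\<bar>) \<le> of_nat (card (UNIV :: 'n set)) * c"
    by (intro sum_bounded_above assms)
  then show ?thesis using norm_le_l1_cart[of x] by simp
qed

lemma abs_eigenvalue_le: "diagonalizes E l M \<Longrightarrow> \<bar>l $ i\<bar> \<le> norm M"
  using Cauchy_Schwarz_ineq2[of M "E i"] diagonalizes_inner[of E l M i] resolution_norm[of E i]
  by (simp add: diagonalizes_def)

lemma integral_norm_le_const:
  fixes f :: "real \<Rightarrow> 'b::euclidean_space"
  assumes "continuous_on {a..b} f" "\<And>t. t \<in> {a..b} \<Longrightarrow> norm (f t) \<le> c" "a \<le> b"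
  shows "integral {a..b} (\<lambda>t. norm (f t)) \<le> c * (b - a)"
proof -
  have "integral {a..b} (\<lambda>t. norm (f t)) \<le> integral {a..b} (\<lambda>t. c)"
    using assms by (intro integral_le integrable_continuous_interval continuous_intros) auto
  then show ?thesis using assms(3) by (simp add: mult.commute)
qed

text \<open>The quantities \<open>N\<close>, \<open>L\<close> and \<open>V\<close> that enter the
  bounds are uniform over the compact cube, so every slice satisfies the estimates of
  \<open>eigenvalue_curve\<close> with the same constants.\<close>

theorem eigenvalue_family_bounded:
  fixes A :: "real \<times> (real ^ 'k) \<Rightarrow> complex ^ 'n ^ 'n" and lam :: "real \<Rightarrow> real ^ 'k \<Rightarrow> real ^ 'n"
  assumes ab: "a < b" and U: "open U" "closure ({a<..<b} \<times> cube {a<..<b}) \<subseteq> U"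
    and herm: "A ` U \<subseteq> Herm" and dc: "locally_DC_on U A"
    and reg: "\<And>r. r \<in> cube {a..b} \<Longrightarrow> C1_on {a..b} (\<lambda>t. A (t, r)) \<and> W21 {a<..<b} (\<lambda>t. A (t, r))"
    and sys: "\<And>r. r \<in> cube {a..b} \<Longrightarrow> eigenvalue_system_on {a..b} (\<lambda>t. A (t, r)) (\<lambda>t. lam t r) \<and>
                              C1_on {a..b} (\<lambda>t. lam t r)"
  shows "bounded_in_C1 {a..b} ((\<lambda>r t. lam t r) ` cube {a..b})"
    and "\<exists>c\<ge>0. \<forall>r\<in>cube {a..b}. W21 {a<..<b} (\<lambda>t. lam t r) \<and> W21_norm {a<..<b} (\<lambda>t. lam t r) \<le> c"
proof -
  let ?R = "cube {a..b} :: (real ^ 'k) set"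
  have "(\<chi> i. (a + b) / 2) \<in> box (\<chi> i::'k. a) (\<chi> i. b)" using ab by (simp add: mem_box_cart)
  then have "closure (cube {a<..<b} :: (real ^ 'k) set) = ?R"
    unfolding cube_Icc cube_Ioo by (intro closure_box) blast
  then have KU: "{a..b} \<times> ?R \<subseteq> U" using U(2) ab by (simp add: closure_Times)
  have K: "compact ({a..b} \<times> ?R)" unfolding cube_Icc by (intro compact_Times) auto
  obtain N L V where N: "\<And>t r. t \<in> {a..b} \<Longrightarrow> r \<in> ?R \<Longrightarrow> norm (A (t, r)) \<le> N"
    and LV: "\<forall>f' B r. r \<in> ?R \<longrightarrow> (\<forall>t\<in>{a..b}. ((\<lambda>t. A (t, r)) has_vector_derivative f' t) (at t within {a..b}))
       \<longrightarrow> continuous_on {a..b} f' \<longrightarrow> B absolutely_integrable_on {a..b}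
       \<longrightarrow> (\<forall>s t. a \<le> s \<longrightarrow> s \<le> t \<longrightarrow> t \<le> b \<longrightarrow> integral {s..t} B = f' t - f' s)
       \<longrightarrow> (\<forall>t\<in>{a..b}. norm (f' t) \<le> L) \<and> integral {a..b} (\<lambda>t. norm (B t)) \<le> V"
    by (rule locally_DC_curve_bounds[OF U(1) K KU dc ab]) (rule that; assumption)
  let ?d = "real CARD('n)"
  \<comment> \<open>The bound of \<open>eigenvalue_derivative_density\<close>, with \<open>V\<close>
    in place of the integral of the norm of \<open>B\<close>.\<close>
  define c2 where "c2 = ?d * (real CARD('n set \<times> 'n set) * (real (Suc CARD('n)) * (2 * ?d * (L + V))))"
  define c where "c = ?d * N * (b - a) + ?d * L * (b - a) + c2"
  have main: "(\<forall>t\<in>{a..b}. norm (lam t r) \<le> ?d * N \<and> norm (vector_derivative (\<lambda>t. lam t r) (at t within {a..b})) \<le> ?d * L)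
    \<and> W21 {a<..<b} (\<lambda>t. lam t r) \<and> W21_norm {a<..<b} (\<lambda>t. lam t r) \<le> c"
    if r: "r \<in> ?R" for r
  proof -
    obtain A' where A': "\<forall>t\<in>{a..b}. ((\<lambda>t. A (t, r)) has_vector_derivative A' t) (at t within {a..b})"
      and cA': "continuous_on {a..b} A'" using reg[OF r] unfolding C1_on_def by blast
    obtain l' where l': "\<forall>t\<in>{a..b}. ((\<lambda>t. lam t r) has_vector_derivative l' t) (at t within {a..b})"
      and cl': "continuous_on {a..b} l'" using sys[OF r] unfolding C1_on_def by blast
    obtain B where B: "B absolutely_integrable_on {a..b}"
      and inc: "\<And>s t. a \<le> s \<Longrightarrow> s \<le> t \<Longrightarrow> t \<le> b \<Longrightarrow> integral {s..t} B = A' t - A' s"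
      by (rule C1_W21_increments[OF ab conjunct2[OF reg[OF r]] bspec[OF A'] cA'], assumption) (rule that; assumption)
    have bounds: "(\<forall>t\<in>{a..b}. norm (A' t) \<le> L) \<and> integral {a..b} (\<lambda>t. norm (B t)) \<le> V"
      by (rule LV[rule_format, OF r bspec[OF A'] cA' B inc])
    have dg: "\<exists>E. diagonalizes E (lam t r) (A (t, r))" if t: "t \<in> {a..b}" for t
    proof -
      have "(t, r) \<in> U" using KU t r by blast
      then have "A (t, r) \<in> Herm" using herm by blast
      then show ?thesis by (rule eigenvalue_system_on_diagonalizes[OF conjunct1[OF sys[OF r]] t])
    qed
    interpret eigenvalue_curve "\<lambda>t. A (t, r)" A' B a b L "\<lambda>t. lam t r" l'
    proof
      show "a < b" "B absolutely_integrable_on {a..b}" by fact+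
      show "integral {s..t} B = A' t - A' s" if "a \<le> s" "s \<le> t" "t \<le> b" for s t
        using that by (rule inc)
      show "\<exists>E. diagonalizes E (lam t r) (A (t, r))" if "t \<in> {a..b}" for t using that by (rule dg)
    qed (use A' l' bounds in blast)+
    obtain u where u: "u absolutely_integrable_on {a..b}"
      and uinc: "\<And>s t. a \<le> s \<Longrightarrow> s \<le> t \<Longrightarrow> t \<le> b \<Longrightarrow> integral {s..t} u = l' t - l' s"
      and ubd: "integral {a..b} (\<lambda>x. norm (u x)) \<le> ?d * (real CARD('n set \<times> 'n set) *
       (real (Suc CARD('n)) * (2 * ?d * (L + integral {a..b} (\<lambda>x. norm (B x))))))"
      by (rule eigenvalue_derivative_density) (rule that; assumption)
    have ubd': "integral {a..b} (\<lambda>x. norm (u x)) \<le> c2"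
      unfolding c2_def using bounds by (intro order_trans[OF ubd] mult_left_mono add_left_mono) auto
    have n1: "norm (lam t r) \<le> ?d * N" if t: "t \<in> {a..b}" for t
    proof (rule norm_le_card)
      fix i
      obtain E where "diagonalizes E (lam t r) (A (t, r))" using dg[OF t] by blast
      then show "\<bar>lam t r $ i\<bar> \<le> N" using abs_eigenvalue_le N[OF t r] order_trans by blast
    qed
    have n2: "norm (l' t) \<le> ?d * L" if t: "t \<in> {a..b}" for t
      by (rule norm_le_card) (rule eigenvalue_derivative_le[OF t])
    have vd: "vector_derivative (\<lambda>t. lam t r) (at t within {a..b}) = l' t" if "t \<in> {a..b}" for t
      using vector_derivative_within_closed_interval[OF ab that bspec[OF l' that]] .
    have cl: "continuous_on {a..b} (\<lambda>t. lam t r)"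
      using l' has_vector_derivative_continuous continuous_on_eq_continuous_within by blast
    have "W21_norm {a<..<b} (\<lambda>t. lam t r) \<le> integral {a..b} (\<lambda>t. norm (lam t r)) +
        integral {a..b} (\<lambda>t. norm (l' t)) + integral {a..b} (\<lambda>t. norm (u t))"
      by (rule W21_norm_le[OF ab u uinc bspec[OF l']])
    also have "\<dots> \<le> c" unfolding c_def
      by (intro add_mono integral_norm_le_const cl cl' n1 n2 ubd' less_imp_le[OF ab])
    finally have "W21_norm {a<..<b} (\<lambda>t. lam t r) \<le> c" .
    moreover have "W21 {a<..<b} (\<lambda>t. lam t r)"
      by (rule W21_classical[OF less_imp_le[OF ab] u uinc bspec[OF l']]) auto
    ultimately show ?thesis using n1 n2 vd by simp
  qed
  show "bounded_in_C1 {a..b} ((\<lambda>r t. lam t r) ` ?R)"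
    unfolding bounded_in_C1_def
  proof (intro conjI exI[of _ "max (?d * N) (?d * L)"] ballI)
    fix f assume "f \<in> (\<lambda>r t. lam t r) ` ?R"
    then obtain r where r: "r \<in> ?R" "f = (\<lambda>t. lam t r)" by blast
    show "C1_on {a..b} f" unfolding r(2) by (rule conjunct2[OF sys[OF r(1)]])
    fix t assume t: "t \<in> {a..b}"
    show "norm (f t) \<le> max (?d * N) (?d * L)" "norm (vector_derivative f (at t within {a..b})) \<le> max (?d * N) (?d * L)"
      using bspec[OF conjunct1[OF main[OF r(1)]] t] unfolding r(2) by auto
  qed
  show "\<exists>c\<ge>0. \<forall>r\<in>?R. W21 {a<..<b} (\<lambda>t. lam t r) \<and> W21_norm {a<..<b} (\<lambda>t. lam t r) \<le> c"
  proof (intro exI[of _ "max 0 c"] conjI ballI)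
    fix r assume r: "r \<in> ?R"
    show "W21 {a<..<b} (\<lambda>t. lam t r)" "W21_norm {a<..<b} (\<lambda>t. lam t r) \<le> max 0 c"
      using conjunct2[OF main[OF r]] by auto
  qed simp
qed

text \<open>A function \<open>P\<close> whose derivative \<open>\<Phi>\<close> accumulates the
  variation of \<open>f'\<close> is convex, and so is \<open>P\<close> minus a component of
  \<open>f\<close>, because the increments of \<open>\<Phi>\<close> dominate those of
  \<open>f'\<close>; the component is the difference of these two convex functions.\<close>

theorem regular_if_derivative_density:
  fixes f :: "real \<Rightarrow> 'b::euclidean_space"
  assumes f: "\<And>t. (f has_vector_derivative f' t) (at t)"
    and dens: "\<And>a b. a < b \<Longrightarrow> \<exists>u. u absolutely_integrable_on {a..b} \<and>
       (\<forall>s t. a \<le> s \<longrightarrow> s \<le> t \<longrightarrow> t \<le> b \<longrightarrow> integral {s..t} u = f' t - f' s)"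
  shows "C1_on UNIV f" and "DC_on UNIV f" and "W21_loc UNIV f"
proof -
  have "\<forall>c. \<exists>u. 0 < c \<longrightarrow> u absolutely_integrable_on {-c..c} \<and>
       (\<forall>s t. -c \<le> s \<longrightarrow> s \<le> t \<longrightarrow> t \<le> c \<longrightarrow> integral {s..t} u = f' t - f' s)"
    using dens by simp
  then obtain v where v0: "\<forall>c. 0 < c \<longrightarrow> v c absolutely_integrable_on {-c..c} \<and>
       (\<forall>s t. -c \<le> s \<longrightarrow> s \<le> t \<longrightarrow> t \<le> c \<longrightarrow> integral {s..t} (v c) = f' t - f' s)"
    unfolding choice_iff by (elim exE) (rule that)
  have v: "v c absolutely_integrable_on {-c..c}" if "0 < c" for c
    using v0 that by simp
  have vi: "integral {s..t} (v c) = f' t - f' s" if "0 < c" "-c \<le> s" "s \<le> t" "t \<le> c" for c s t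
    using v0 that by simp
  have f_within: "(f has_vector_derivative f' t) (at t within S)" for t S
    by (rule has_vector_derivative_at_within[OF f])
  have cf': "isCont f' t" for t
  proof -
    define c where "c = \<bar>t\<bar> + 1"
    have c: "0 < c" "-c < t" "t < c" by (auto simp: c_def)
    have "continuous_on {-c..c} (\<lambda>x. f' (-c) + integral {-c..x} (v c))"
      by (intro continuous_intros indefinite_integral_continuous_1 set_lebesgue_integral_eq_integral(1)[OF v[OF c(1)]])
    then have "continuous_on {-c..c} f'"
      by (rule continuous_on_cong[THEN iffD1, rotated -1]) (use vi[OF c(1)] in auto)
    then show ?thesis by (rule continuous_on_interior) (use c in simp)
  qed
  show "C1_on UNIV f" unfolding C1_on_def
    using f cf' by (intro exI[of _ f'] conjI ballI continuous_at_imp_continuous_on) auto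
  show "W21_loc UNIV f" unfolding W21_loc_def
  proof (intro allI impI)
    fix V :: "real set" assume V: "open V \<and> compact (closure V) \<and> closure V \<subseteq> UNIV"
    then have "bounded V" using bounded_subset[OF compact_imp_bounded closure_subset] by blast
    then obtain c where c: "0 < c" "\<forall>x\<in>V. norm x < c" using bounded_pos_less by blast
    show "W21 V f"
      by (rule W21_classical[OF _ v[OF c(1)] vi[OF c(1)] f_within]) (use V c in \<open>auto simp: abs_less_iff\<close>)
  qed
  have nv: "(\<lambda>x. norm (v c x)) integrable_on {x..y}" if "0 < c" "-c \<le> x" "y \<le> c" for c x y
    using absolutely_integrable_on_subinterval[OF v[OF that(1)], of x y] that
    by (simp add: absolutely_integrable_on_def)
  \<comment> \<open>The densities chosen for different intervals are not known to coincide, but the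
    integrals of their norms do, being determined by the increments of \<open>f'\<close>.\<close>
  have var: "integral {x..y} (\<lambda>z. norm (v c z)) \<le> integral {x..y} (\<lambda>z. norm (v k z))"
    if c: "0 < c" "-c \<le> x" "y \<le> c" and k: "0 < k" "-k \<le> x" "y \<le> k" and xy: "x \<le> y" for c k x y
  proof -
    have "integral {x..y} (\<lambda>z. norm (v c z)) \<le>
        integral {x..y} (\<lambda>z. norm (v k z)) - integral {x..x} (\<lambda>z. norm (v k z))"
    proof (rule integral_norm_le_variation[OF _ xy, where \<Phi> = "\<lambda>y. integral {x..y} (\<lambda>z. norm (v k z))"])
      show "v c absolutely_integrable_on {x..y}"
        using absolutely_integrable_on_subinterval[OF v[OF c(1)], of x y] c by simp
      fix s t assume st: "x \<le> s" "s \<le> t" "t \<le> y"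
      have "integral {x..s} (\<lambda>z. norm (v k z)) + integral {s..t} (\<lambda>z. norm (v k z)) = integral {x..t} (\<lambda>z. norm (v k z))"
        by (rule Henstock_Kurzweil_Integration.integral_combine) (use st nv k in auto)
      moreover have "norm (integral {s..t} (v k)) \<le> integral {s..t} (\<lambda>z. norm (v k z))"
      proof (rule integral_norm_bound_integral)
        show "v k integrable_on {s..t}"
          by (rule integrable_on_subinterval[OF set_lebesgue_integral_eq_integral(1)[OF v[OF k(1)]]]) (use st k in auto)
        show "(\<lambda>z. norm (v k z)) integrable_on {s..t}" by (rule nv) (use st k in auto)
      qed simp
      moreover have "integral {s..t} (v c) = integral {s..t} (v k)"
        using vi[of c s t] vi[of k s t] st c k by simp
      ultimately show "norm (integral {s..t} (v c)) \<le>
          integral {x..t} (\<lambda>z. norm (v k z)) - integral {x..s} (\<lambda>z. norm (v k z))" by simp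
    qed
    then show ?thesis by simp
  qed
  define H where "H c x y = integral {x..y} (\<lambda>z. norm (v c z))" for c x y
  \<comment> \<open>The signed variation from 0 to \<open>t\<close>, computed in a symmetric
    interval that depends on \<open>t\<close>; by \<open>H_eq\<close> any other symmetric interval
    containing \<open>t\<close> may be used instead.\<close>
  define \<Phi> where "\<Phi> t = H (\<bar>t\<bar> + 1) (- (\<bar>t\<bar> + 1)) t - H (\<bar>t\<bar> + 1) (- (\<bar>t\<bar> + 1)) 0" for t
  have H_add: "H c x y + H c y z = H c x z" if "0 < c" "-c \<le> x" "x \<le> y" "y \<le> z" "z \<le> c" for c x y z
    unfolding H_def by (rule Henstock_Kurzweil_Integration.integral_combine) (use that nv in auto)
  have H_eq: "H c x y = H k x y"
    if "0 < c" "-c \<le> x" "y \<le> c" "0 < k" "-k \<le> x" "y \<le> k" "x \<le> y" for c k x y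
    unfolding H_def using that by (intro antisym var) auto
  have \<Phi>: "\<Phi> t = H c (-c) t - H c (-c) 0" if c: "0 < c" "-c \<le> t" "t \<le> c" for c t
  proof (cases "0 \<le> t")
    case True
    then show ?thesis
      using H_add[of c "-c" 0 t] H_add[of "\<bar>t\<bar> + 1" "- (\<bar>t\<bar> + 1)" 0 t] H_eq[of c 0 t "\<bar>t\<bar> + 1"] c
      by (simp add: \<Phi>_def)
  next
    case False
    then show ?thesis
      using H_add[of c "-c" t 0] H_add[of "\<bar>t\<bar> + 1" "- (\<bar>t\<bar> + 1)" t 0] H_eq[of c t 0 "\<bar>t\<bar> + 1"] c
      by (simp add: \<Phi>_def)
  qed
  have c\<Phi>: "isCont \<Phi> t" for t
  proof -
    define c where "c = \<bar>t\<bar> + 1"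
    have c: "0 < c" "-c < t" "t < c" by (auto simp: c_def)
    have "continuous_on {-c..c} (\<lambda>x. H c (-c) x - H c (-c) 0)"
      unfolding H_def by (intro continuous_intros indefinite_integral_continuous_1 nv) (use c in auto)
    then have "continuous_on {-c..c} \<Phi>"
      by (rule continuous_on_cong[THEN iffD1, rotated -1]) (use \<Phi>[OF c(1)] in auto)
    then show ?thesis by (rule continuous_on_interior) (use c in simp)
  qed
  have inc: "norm (f' t - f' s) \<le> \<Phi> t - \<Phi> s" if "s \<le> t" for s t
  proof -
    define c where "c = max \<bar>s\<bar> \<bar>t\<bar> + 1"
    have c: "0 < c" "-c \<le> s" "-c \<le> t" "s \<le> c" "t \<le> c" by (auto simp: c_def)
    have "norm (integral {s..t} (v c)) \<le> integral {s..t} (\<lambda>z. norm (v c z))"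
    proof (rule integral_norm_bound_integral)
      show "v c integrable_on {s..t}"
        by (rule integrable_on_subinterval[OF set_lebesgue_integral_eq_integral(1)[OF v[OF c(1)]]]) (use c in auto)
      show "(\<lambda>z. norm (v c z)) integrable_on {s..t}" by (rule nv) (use c in auto)
    qed simp
    also have "\<dots> = \<Phi> t - \<Phi> s"
      using \<Phi>[of c t] \<Phi>[of c s] H_add[of c "-c" s t] c that by (simp add: H_def)
    finally show ?thesis using vi[of c s t] c that by simp
  qed
  obtain P where P: "\<And>x. (P has_real_derivative \<Phi> x) (at x)"
    using einterval_antiderivative[of "-\<infinity>" "\<infinity>" \<Phi>] c\<Phi> by (auto simp: has_real_derivative_iff_has_vector_derivative)
  show "DC_on UNIV f" unfolding DC_on_def
  proof (intro ballI)
    fix i :: 'b assume i: "i \<in> Basis"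
    have fi: "((\<lambda>x. f x \<bullet> i) has_real_derivative f' x \<bullet> i) (at x)" for x
      unfolding has_real_derivative_iff_has_vector_derivative
      by (rule bounded_linear.has_vector_derivative[OF bounded_linear_inner_left f])
    have Q: "((\<lambda>x. P x - f x \<bullet> i) has_real_derivative \<Phi> x - f' x \<bullet> i) (at x)" for x
      by (rule DERIV_diff[OF P fi])
    have m: "\<Phi> s \<le> \<Phi> t" "\<Phi> s - f' s \<bullet> i \<le> \<Phi> t - f' t \<bullet> i" if "s \<le> t" for s t
      using inc[OF that] Basis_le_norm[OF i, of "f' t - f' s"] norm_ge_zero[of "f' t - f' s"]
      by (auto simp: inner_diff_left)
    show "dc_fun_on UNIV (\<lambda>x. f x \<bullet> i)" unfolding dc_fun_on_def
    proof (intro exI conjI ballI)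
      show "continuous_on UNIV P" "continuous_on UNIV (\<lambda>x. P x - f x \<bullet> i)"
        using DERIV_isCont[OF P] DERIV_isCont[OF Q] by (auto intro!: continuous_at_imp_continuous_on)
      show "convex_on UNIV P" by (rule convex_on_realI[OF _ P]) (use m(1) in auto)
      show "convex_on UNIV (\<lambda>x. P x - f x \<bullet> i)" by (rule convex_on_realI[OF _ Q]) (use m(2) in auto)
    qed simp
  qed
qed

lemma DC_on_imp_continuous_on:
  fixes f :: "'a::real_normed_vector \<Rightarrow> 'b::euclidean_space"
  assumes "DC_on S f"
  shows "continuous_on S f"
proof (subst continuous_on_componentwise, intro ballI)
  fix i :: 'b assume "i \<in> Basis"
  then obtain g h where gh: "continuous_on S g" "continuous_on S h" "\<forall>x\<in>S. f x \<bullet> i = g x - h x"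
    using assms unfolding DC_on_def dc_fun_on_def by blast
  then show "continuous_on S (\<lambda>x. f x \<bullet> i)"
    using continuous_on_diff[OF gh(1,2)] by (simp cong: continuous_on_cong)
qed

theorem eigenvalue_system_regular:
  fixes A :: "real \<Rightarrow> complex ^ 'n ^ 'n" and lam :: "real \<Rightarrow> real ^ 'n"
  assumes A: "range A \<subseteq> Herm" "DC_on UNIV A" "W21_loc UNIV A"
    and lam: "eigenvalue_system_on UNIV A lam" "lam differentiable_on UNIV"
  shows "C1_on UNIV lam" and "DC_on UNIV lam" and "W21_loc UNIV lam"
proof -
  define l' where "l' t = vector_derivative lam (at t)" for t
  have l': "(lam has_vector_derivative l' t) (at t)" for t
    using lam(2) unfolding l'_def differentiable_on_def
    by (simp add: vector_derivative_works[symmetric])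
  have dens: "\<exists>u. u absolutely_integrable_on {a..b} \<and>
       (\<forall>s t. a \<le> s \<longrightarrow> s \<le> t \<longrightarrow> t \<le> b \<longrightarrow> integral {s..t} u = l' t - l' s)" if ab: "a < b" for a b
  proof -
    \<comment> \<open>The interval is enlarged because the classical derivative is obtained on the
      open interval only, while the estimate needs it on all of \<open>{a..b}\<close>.\<close>
    have "W21 {a - 1<..<b + 1} A"
      using A(3) ab unfolding W21_loc_def by simp
    moreover have "continuous_on {a - 1<..<b + 1} A"
      by (rule continuous_on_subset[OF DC_on_imp_continuous_on[OF A(2)]]) simp
    moreover have "a - 1 < b + 1" using ab by simp
    ultimately obtain A' B where B: "B absolutely_integrable_on {a - 1..b + 1}"
      and A': "\<And>t. t \<in> {a - 1<..<b + 1} \<Longrightarrow> (A has_vector_derivative A' t) (at t)"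
      and cA': "continuous_on {a - 1..b + 1} A'"
      and inc: "\<And>s t. a - 1 \<le> s \<Longrightarrow> s \<le> t \<Longrightarrow> t \<le> b + 1 \<Longrightarrow> integral {s..t} B = A' t - A' s"
      using W21_open_classical[of "a - 1" "b + 1" A] by metis
    have "bounded (A' ` {a - 1..b + 1})"
      by (intro compact_imp_bounded compact_continuous_image cA') simp
    then obtain L where L: "\<forall>t\<in>{a - 1..b + 1}. norm (A' t) \<le> L" by (auto simp: bounded_iff)
    interpret eigenvalue_curve A A' B a b L lam l'
    proof
      show "a < b" by fact
      show "(A has_vector_derivative A' t) (at t within {a..b})" if "t \<in> {a..b}" for t
        by (rule has_vector_derivative_at_within[OF A']) (use that in auto)
      show "B absolutely_integrable_on {a..b}"
        by (rule absolutely_integrable_on_subinterval[OF B]) auto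
      show "integral {s..t} B = A' t - A' s" if "a \<le> s" "s \<le> t" "t \<le> b" for s t
        using that by (intro inc) auto
      show "norm (A' t) \<le> L" if "t \<in> {a..b}" for t
        using L that by auto
      show "\<exists>E. diagonalizes E (lam t) (A t)" for t
        by (rule eigenvalue_system_on_diagonalizes[OF lam(1)]) (use A(1) in auto)
      show "(lam has_vector_derivative l' t) (at t within {a..b})" for t
        by (rule has_vector_derivative_at_within[OF l'])
    qed
    show ?thesis by (rule eigenvalue_derivative_density) blast
  qed
  show "C1_on UNIV lam" "DC_on UNIV lam" "W21_loc UNIV lam"
    by (rule regular_if_derivative_density[OF l' dens]; assumption)+
qed

theorem differentiable_eigenvalue_system_exists:
  fixes A :: "real \<Rightarrow> complex ^ 'n ^ 'n"
  assumes A: "range A \<subseteq> Herm" "C1_on UNIV A"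
  shows "\<exists>lam :: real \<Rightarrow> real ^ 'n. eigenvalue_system_on UNIV A lam \<and> lam differentiable_on UNIV"
proof -
  obtain A' where A': "\<forall>t. (A has_vector_derivative A' t) (at t)"
    using A(2) unfolding C1_on_def by auto
  have "\<forall>t. \<exists>l. (\<exists>E. diagonalizes E l (A t)) \<and>
      image_mset (\<lambda>i. complex_of_real (l $ i)) (mset_set UNIV) = proots (charpoly (A t))"
  proof
    fix t
    have "A t \<in> Herm" using A(1) by auto
    from Herm_diagonalizes[OF this] show "\<exists>l. (\<exists>E. diagonalizes E l (A t)) \<and>
      image_mset (\<lambda>i. complex_of_real (l $ i)) (mset_set UNIV) = proots (charpoly (A t))" by blast
  qed
  then obtain l where l: "\<And>t. \<exists>E. diagonalizes E (l t) (A t)"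
    and ms: "\<And>t. image_mset (\<lambda>i. complex_of_real (l t $ i)) (mset_set UNIV) = proots (charpoly (A t))"
    unfolding choice_iff by auto
  have "locdiff UNIV (\<lambda>t i. l t $ i) t" for t
  proof -
    obtain p nu' where p: "\<forall>s. p s permutes UNIV"
      and d: "((\<lambda>s. \<chi> i. l s $ p s i) has_vector_derivative nu') (at t)"
      using pointwise_differentiable_rearrangement[OF l spec[OF A']] by blast
    show ?thesis unfolding locdiff_def
    proof (intro exI conjI ballI always_eventually allI)
      show "rearr UNIV (\<lambda>i. l s $ i) (\<lambda>i. l s $ p s i)" for s
        using permutes_rearr[OF spec[OF p], of "\<lambda>i. l s $ i"] by (simp add: comp_def)
      show "((\<lambda>s. l s $ p s i) has_real_derivative nu' $ i) (at t)" for i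
        using bounded_linear.has_vector_derivative[OF bounded_linear_vec_nth d, of i]
        by (simp add: has_real_derivative_iff_has_vector_derivative)
    qed
  qed
  then obtain \<nu> where \<nu>: "dsys UNIV (\<lambda>t i. l t $ i) UNIV \<nu>"
    using differentiable_rearrangement_exists[of UNIV UNIV "\<lambda>t i. l t $ i"] by auto
  define lam where "lam t = (\<chi> i. \<nu> t i)" for t
  have "image_mset (\<lambda>i. complex_of_real (lam t $ i)) (mset_set UNIV) = proots (charpoly (A t))" for t
  proof -
    have "image_mset (\<lambda>i. complex_of_real (lam t $ i)) (mset_set UNIV) =
        image_mset complex_of_real (image_mset (\<nu> t) (mset_set UNIV))"
      by (simp add: lam_def multiset.map_comp comp_def)
    also have "\<dots> = image_mset complex_of_real (image_mset (\<lambda>i. l t $ i) (mset_set UNIV))"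
      using dsys_rearr[OF \<nu>, of t] by (simp only: rearr_def UNIV_I)
    finally show ?thesis by (simp add: multiset.map_comp comp_def ms)
  qed
  moreover have "lam differentiable (at t)" for t
  proof (subst differentiable_componentwise_within, intro ballI)
    fix b :: "real ^ 'n" assume "b \<in> Basis"
    then obtain i where b: "b = axis i 1" by (auto simp: Basis_vec_def)
    have "(\<lambda>s. \<nu> s i) differentiable (at t)"
      using dsys_DERIV[OF \<nu>, of t i] by (auto simp: real_differentiable_def)
    then show "(\<lambda>s. lam s \<bullet> b) differentiable (at t)"
      by (simp add: b inner_axis lam_def)
  qed
  ultimately show ?thesis
    by (intro exI[of _ lam]) (auto simp: eigenvalue_system_on_def differentiable_on_def)
qed

theorem theorem0p6p2:
  shows "(\<forall>A :: real \<Rightarrow> complex ^ 'n ^ 'n.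
            range A \<subseteq> Herm \<and> DC_on UNIV A \<and> W21_loc UNIV A \<longrightarrow>
              (\<forall>lam :: real \<Rightarrow> real ^ 'n.
                 eigenvalue_system_on UNIV A lam \<and> lam differentiable_on UNIV \<longrightarrow>
                 C1_on UNIV lam \<and> DC_on UNIV lam \<and> W21_loc UNIV lam) \<and>
              (C1_on UNIV A \<longrightarrow>
                 (\<exists>lam :: real \<Rightarrow> real ^ 'n.
                    eigenvalue_system_on UNIV A lam \<and>
                    lam differentiable_on UNIV \<and> C1_on UNIV lam)))
       \<and>
         (\<forall>(a::real) b (U :: (real \<times> (real ^ 'k)) set)
            (A :: real \<times> (real ^ 'k) \<Rightarrow> complex ^ 'n ^ 'n)
            (lam :: real \<Rightarrow> real ^ 'k \<Rightarrow> real ^ 'n).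
            a < b \<and>
            open U \<and> closure ({a<..<b} \<times> cube {a<..<b}) \<subseteq> U \<and>
            A ` U \<subseteq> Herm \<and>
            locally_DC_on U A \<and>
            (\<forall>r\<in>cube {a..b}. C1_on {a..b} (\<lambda>t. A (t, r)) \<and> W21 {a<..<b} (\<lambda>t. A (t, r))) \<and>
            (\<forall>r\<in>cube {a..b}. eigenvalue_system_on {a..b} (\<lambda>t. A (t, r)) (\<lambda>t. lam t r) \<and>
                              C1_on {a..b} (\<lambda>t. lam t r))
            \<longrightarrow>
            bounded_in_C1 {a..b} ((\<lambda>r t. lam t r) ` cube {a..b}) \<and>
            (\<exists>m :: real ^ 'k \<Rightarrow> real.
               (\<forall>r\<in>cube {a<..<b}. 0 \<le> m r) \<and>
               m absolutely_integrable_on cube {a<..<b} \<and>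
               (AE r in lebesgue. r \<in> cube {a<..<b} \<longrightarrow>
                  W21 {a<..<b} (\<lambda>t. lam t r) \<and> W21_norm {a<..<b} (\<lambda>t. lam t r) \<le> m r)))"
    (is "?curves \<and> ?families")
proof
  show ?curves
  proof (intro allI impI, elim conjE, intro conjI allI impI)
    fix A :: "real \<Rightarrow> complex ^ 'n ^ 'n"
    assume A: "range A \<subseteq> Herm" "DC_on UNIV A" "W21_loc UNIV A"
    show "C1_on UNIV lam" "DC_on UNIV lam" "W21_loc UNIV lam"
      if "eigenvalue_system_on UNIV A lam \<and> lam differentiable_on UNIV" for lam :: "real \<Rightarrow> real ^ 'n"
      using eigenvalue_system_regular[OF A conjunct1[OF that] conjunct2[OF that]] by auto
    assume "C1_on UNIV A"
    then obtain lam :: "real \<Rightarrow> real ^ 'n" where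
      "eigenvalue_system_on UNIV A lam" "lam differentiable_on UNIV"
      using differentiable_eigenvalue_system_exists[OF A(1)] by blast
    with eigenvalue_system_regular(1)[OF A this]
    show "\<exists>lam :: real \<Rightarrow> real ^ 'n. eigenvalue_system_on UNIV A lam \<and> lam differentiable_on UNIV \<and> C1_on UNIV lam"
      by blast
  qed
  show ?families
  proof (intro allI impI, elim conjE)
    fix a b :: real and U :: "(real \<times> (real ^ 'k)) set" and A :: "real \<times> (real ^ 'k) \<Rightarrow> complex ^ 'n ^ 'n"
      and lam :: "real \<Rightarrow> real ^ 'k \<Rightarrow> real ^ 'n"
    assume hyps: "a < b" "open U" "closure ({a<..<b} \<times> cube {a<..<b}) \<subseteq> U" "A ` U \<subseteq> Herm" "locally_DC_on U A"
      and reg: "\<forall>r\<in>cube {a..b}. C1_on {a..b} (\<lambda>t. A (t, r)) \<and> W21 {a<..<b} (\<lambda>t. A (t, r))"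
      and sys: "\<forall>r\<in>cube {a..b}. eigenvalue_system_on {a..b} (\<lambda>t. A (t, r)) (\<lambda>t. lam t r) \<and>
                              C1_on {a..b} (\<lambda>t. lam t r)"
    note fam = eigenvalue_family_bounded[OF hyps bspec[OF reg] bspec[OF sys]]
    obtain c where c: "0 \<le> c"
      "\<forall>r\<in>cube {a..b}. W21 {a<..<b} (\<lambda>t. lam t r) \<and> W21_norm {a<..<b} (\<lambda>t. lam t r) \<le> c"
      using fam(2) by blast
    have sub: "r \<in> cube {a..b}" if "r \<in> cube {a<..<b}" for r :: "real ^ 'k"
      using that by (auto simp: cube_def less_imp_le)
    have "(\<lambda>r. c) absolutely_integrable_on (cube {a<..<b} :: (real ^ 'k) set)"
      unfolding cube_Ioo by (intro absolutely_integrable_on_const lmeasurable_box)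
    moreover have "AE r in lebesgue. r \<in> cube {a<..<b} \<longrightarrow>
        W21 {a<..<b} (\<lambda>t. lam t r) \<and> W21_norm {a<..<b} (\<lambda>t. lam t r) \<le> c"
      using c(2) sub by (intro AE_I2) blast
    ultimately show "bounded_in_C1 {a..b} ((\<lambda>r t. lam t r) ` cube {a..b}) \<and>
            (\<exists>m :: real ^ 'k \<Rightarrow> real.
               (\<forall>r\<in>cube {a<..<b}. 0 \<le> m r) \<and>
               m absolutely_integrable_on cube {a<..<b} \<and>
               (AE r in lebesgue. r \<in> cube {a<..<b} \<longrightarrow>
                  W21 {a<..<b} (\<lambda>t. lam t r) \<and> W21_norm {a<..<b} (\<lambda>t. lam t r) \<le> m r))"
      using fam(1) c(1) by (intro conjI exI[of _ "\<lambda>r. c"] ballI)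
  qed
qed

end
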